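(* Let $\nu\ge0$. There exist constants $C=C(\nu)>0$ and $\theta=\theta(\nu)\in(0,1)$, depending only on $\nu$, such that the following holds. Let $A=[a_1,a_2]$ and $B=[b_1,b_2]$ with $0\le a_1<a_2$ and $0\le b_1<b_2$, put $a=a_2-a_1$, $b=b_2-b_1$, let $x_0,x_1$ be the centers of $A$ and $B$ respectively, and let $\lambda,T>0$. Then for all $u_0\in C_0^\infty(\mathbb{R}^+)$, $$\int_A|u(x,T;u_0)|^2dx\le C\left(a_2^{2\nu+2}-a_1^{2\nu+2}\right)\big((\lambda T)\wedge b\big)^{-(2\nu+2)}\left(\int_B|u(x,T;u_0)|^2dx\right)^{\theta^p}\left(\int_{\mathbb{R}^+}e^{\lambda x}|u_0(x)|^2dx\right)^{1-\theta^p},$$ where $$p:=1+\frac{|x_0-x_1|+\frac a2+\frac b2}{(\lambda T)\wedge\frac b2}.$$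
   Context: $\mathbb{R}^+=(0,\infty)$, $L^2(\mathbb{R}^+)=L^2(\mathbb{R}^+;\mathbb{C})$, $C_0^\infty(\mathbb{R}^+)$ denotes complex-valued smooth functions with compact support in $(0,\infty)$, and $s\wedge t=\min\{s,t\}$. For $\nu\ge0$, $H_\nu$ is the Friedrichs extension in $L^2(\mathbb{R}^+)$ of the operator $-\partial_x^2+(\nu^2-\frac14)\frac1{x^2}$ with domain $C_0^\infty(\mathbb{R}^+)$. For $u_0\in L^2(\mathbb{R}^+)$, $u(x,t;u_0)=(e^{-itH_\nu}u_0)(x)$ denotes the solution of $i\partial_tu=H_\nu u$, $u(\cdot,0)=u_0$. *)

theory Defs
  imports "HOL-Analysis.Analysis"
begin

section \<open>The space \<open>L\<^sup>2\<close> on the half-line\<close>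

text \<open>
  Elements of \<open>L\<^sup>2((0,\<infinity>); \<complex>)\<close> are represented by functions on the whole real line; two functions
  represent the same element iff they agree almost everywhere on \<open>(0,\<infinity>)\<close>, and values outside
  \<open>(0,\<infinity>)\<close> are irrelevant.  All notions below are invariant under this identification.
\<close>

abbreviation half_line :: "real measure" where
  "half_line \<equiv> lebesgue_on {0<..}"

definition L2 :: "(real \<Rightarrow> complex) set" where
  "L2 = {f. f \<in> borel_measurable half_line \<and> integrable half_line (\<lambda>x. (cmod (f x))\<^sup>2)}"

definition L2_inner :: "(real \<Rightarrow> complex) \<Rightarrow> (real \<Rightarrow> complex) \<Rightarrow> complex" where
  "L2_inner f g = (LINT x|half_line. f x * cnj (g x))"

definition L2_norm :: "(real \<Rightarrow> complex) \<Rightarrow> real" where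
  "L2_norm f = sqrt (LINT x|half_line. (cmod (f x))\<^sup>2)"

definition L2_eq :: "(real \<Rightarrow> complex) \<Rightarrow> (real \<Rightarrow> complex) \<Rightarrow> bool" where
  "L2_eq f g \<longleftrightarrow> (AE x in half_line. f x = g x)"

section \<open>Test functions and the Friedrichs extension\<close>

abbreviation deriv1 :: "(real \<Rightarrow> complex) \<Rightarrow> real \<Rightarrow> complex" where
  "deriv1 f \<equiv> (\<lambda>x. vector_derivative f (at x))"

text \<open>Smooth functions with compact support in \<open>(0,\<infinity>)\<close>, extended by zero to the real line.\<close>

definition Cc_inf :: "(real \<Rightarrow> complex) set" where
  "Cc_inf = {f. (\<forall>k x. (deriv1 ^^ k) f differentiable (at x)) \<and>
                (\<exists>K. compact K \<and> K \<subseteq> {0<..} \<and> (\<forall>x. x \<notin> K \<longrightarrow> f x = 0))}"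

definition bessel_op :: "real \<Rightarrow> (real \<Rightarrow> complex) \<Rightarrow> real \<Rightarrow> complex" where
  "bessel_op \<nu> f x = - deriv1 (deriv1 f) x + of_real ((\<nu>\<^sup>2 - 1/4) * (1 / x\<^sup>2)) * f x"

text \<open>
  Let \<open>S\<close> be a symmetric operator in \<open>L\<^sup>2\<close> with dense domain \<open>D\<close>, bounded from below.  The domain
  of the closure of its quadratic form \<open>q(\<phi>) = \<langle>S \<phi>, \<phi>\<rangle>\<close> consists of the \<open>L\<^sup>2\<close>-limits of
  \<open>q\<close>-Cauchy sequences in \<open>D\<close>.  The Friedrichs extension is the restriction of the adjoint \<open>S\<^sup>*\<close>
  to those elements of its domain that lie in this form domain.  Operators are represented by
  their graphs.
\<close>

definition form_domain ::
  "(real \<Rightarrow> complex) set \<Rightarrow> ((real \<Rightarrow> complex) \<Rightarrow> real \<Rightarrow> complex) \<Rightarrow> (real \<Rightarrow> complex) set" where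
  "form_domain D S = {u \<in> L2. \<exists>\<phi> :: nat \<Rightarrow> real \<Rightarrow> complex.
     (\<forall>n. \<phi> n \<in> D) \<and>
     (\<lambda>n. L2_norm (\<lambda>x. \<phi> n x - u x)) \<longlonglongrightarrow> 0 \<and>
     (\<forall>e>0. \<exists>N. \<forall>m\<ge>N. \<forall>n\<ge>N.
        cmod (L2_inner (S (\<lambda>x. \<phi> m x - \<phi> n x)) (\<lambda>x. \<phi> m x - \<phi> n x)) < e)}"

definition adjoint_graph ::
  "(real \<Rightarrow> complex) set \<Rightarrow> ((real \<Rightarrow> complex) \<Rightarrow> real \<Rightarrow> complex)
    \<Rightarrow> ((real \<Rightarrow> complex) \<times> (real \<Rightarrow> complex)) set" where
  "adjoint_graph D S =
     {(u, f). u \<in> L2 \<and> f \<in> L2 \<and> (\<forall>\<phi>\<in>D. L2_inner (S \<phi>) u = L2_inner \<phi> f)}"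

definition friedrichs_extension ::
  "(real \<Rightarrow> complex) set \<Rightarrow> ((real \<Rightarrow> complex) \<Rightarrow> real \<Rightarrow> complex)
    \<Rightarrow> ((real \<Rightarrow> complex) \<times> (real \<Rightarrow> complex)) set" where
  "friedrichs_extension D S = {(u, f) \<in> adjoint_graph D S. u \<in> form_domain D S}"

definition H_op :: "real \<Rightarrow> ((real \<Rightarrow> complex) \<times> (real \<Rightarrow> complex)) set" where
  "H_op \<nu> = friedrichs_extension Cc_inf (bessel_op \<nu>)"

section \<open>The unitary group \<open>exp(-itH)\<close>\<close>

text \<open>
  Strongly continuous one-parameter unitary groups on \<open>L\<^sup>2\<close>.  Linearity together with the isometry
  property makes \<open>U t\<close> well defined on almost-everywhere classes; surjectivity follows from the
  group law.
\<close>

definition unitary_group :: "(real \<Rightarrow> (real \<Rightarrow> complex) \<Rightarrow> real \<Rightarrow> complex) \<Rightarrow> bool" where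
  "unitary_group U \<longleftrightarrow>
     (\<forall>t. \<forall>f\<in>L2. U t f \<in> L2 \<and> L2_norm (U t f) = L2_norm f) \<and>
     (\<forall>t c. \<forall>f\<in>L2. \<forall>g\<in>L2. L2_eq (U t (\<lambda>x. c * f x + g x)) (\<lambda>x. c * U t f x + U t g x)) \<and>
     (\<forall>f\<in>L2. L2_eq (U 0 f) f) \<and>
     (\<forall>s t. \<forall>f\<in>L2. L2_eq (U (s + t) f) (U s (U t f))) \<and>
     (\<forall>f\<in>L2. ((\<lambda>t. L2_norm (\<lambda>x. U t f x - f x)) \<longlongrightarrow> 0) (at 0))"

definition generator ::
  "(real \<Rightarrow> (real \<Rightarrow> complex) \<Rightarrow> real \<Rightarrow> complex)
    \<Rightarrow> ((real \<Rightarrow> complex) \<times> (real \<Rightarrow> complex)) set" where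
  "generator U = {(f, g). f \<in> L2 \<and> g \<in> L2 \<and>
     ((\<lambda>t. L2_norm (\<lambda>x. (U t f x - f x) / of_real t - g x)) \<longlongrightarrow> 0) (at 0)}"

text \<open>
  \<open>exp(-itH)\<close> is the strongly continuous unitary group with infinitesimal generator \<open>-iH\<close>.  For
  self-adjoint \<open>H\<close> it exists by Stone's theorem and is unique as a family of operators on \<open>L\<^sup>2\<close>;
  the choice operator only selects representatives of almost-everywhere classes.
\<close>

definition exp_minus_i ::
  "((real \<Rightarrow> complex) \<times> (real \<Rightarrow> complex)) set
    \<Rightarrow> real \<Rightarrow> (real \<Rightarrow> complex) \<Rightarrow> real \<Rightarrow> complex" where
  "exp_minus_i H = (SOME U. unitary_group U \<and>
     (\<forall>f g. (f, g) \<in> H \<longleftrightarrow> (f, \<lambda>x. - \<i> * g x) \<in> generator U))"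

definition schroedinger_solution ::
  "real \<Rightarrow> real \<Rightarrow> real \<Rightarrow> (real \<Rightarrow> complex) \<Rightarrow> complex" where
  "schroedinger_solution \<nu> x t u\<^sub>0 = exp_minus_i (H_op \<nu>) t u\<^sub>0 x"

end

(*
  The Hankel transform diagonalises H_nu, and its action on Gaussians gives the propagator in closed
  form: up to the unimodular factor exp(i x^2/(4T)) and a constant, u(x,T) is x^(nu+1/2) times
  f(x) = int k(x y/(2T)) w(y) dy, where k(r) = r^(-nu) J_nu(r) is entire of exponential type 1 and
  |w(y)| = y^(nu+1/2) |u_0(y)|. That the spectrally defined operator is the Friedrichs extension
  follows by factorising the form through the ground state x^(nu+1/2) and approximating Gaussians in
  form norm by logarithmic cutoffs, which also works for nu = 0. The exponential weight bounds the
  Taylor coefficients of f: on a disc of radius comparable to min(lambda T, b/2), uniformly in the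
  centre, f is controlled by a multiple of the weighted norm of u_0. Lagrange interpolation on an
  interval where f is small in L^2 gives a bound on the neighbouring intervals by the geometric mean of
  the small and the large quantity. Iterating along a chain of about p intervals from B to A yields
  the exponent theta^p.
*)

theory Submission
  imports Defs
begin

section \<open>The Hilbert space of square integrable functions\<close>

text \<open>The group is given by a choice operator that sees only its generator, and for \<nu> < 1
  the formal operator on test functions has several self-adjoint extensions. Hence both inclusions
  between the Friedrichs extension and the spectrally defined operator are required. Every identity
  of this kind is tested against the real Gaussians
  \<open>x powr (\<nu> + 1/2) * exp (- a * x^2)\<close>, which are total by Stone-Weierstrass.
  Constants: interpolation with n nodes costs \<open>48 ^ n\<close>, while the Taylor remainder at
  scale l gains \<open>(2 * l / R) ^ n\<close>; with \<open>l = R / (2 * 48^2)\<close> the gain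
  exceeds the cost by \<open>48 ^ n\<close>. For m = min(\<lambda> T, b/2) the radius is R = m/2, so
  the chain advances by m/9216 and halves the exponent each time, whence \<theta> = 2^(-9216). The
  bound m \<le> \<lambda> T is what the exponential weight can pay for; the bound m \<le> b/2 leaves
  room for a starting interval at the right end of B on which x \<ge> m, so that the weight
  \<open>x powr (2 * \<nu> + 1)\<close> can be divided out there.\<close>

lemma L2I:
  assumes "f \<in> borel_measurable half_line" "integrable half_line (\<lambda>x. (cmod (f x))\<^sup>2)"
  shows "f \<in> L2"
  using assms by (simp add: L2_def)

lemma L2_measurable: "f \<in> L2 \<Longrightarrow> f \<in> borel_measurable half_line"
  and L2_integrable: "f \<in> L2 \<Longrightarrow> integrable half_line (\<lambda>x. (cmod (f x))\<^sup>2)"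
  by (auto simp: L2_def)

lemma L2_bound:
  assumes "f \<in> L2" and [measurable]: "g \<in> borel_measurable half_line"
    and "AE x in half_line. cmod (g x) \<le> B * cmod (f x)"
  shows "g \<in> L2"
proof (rule L2I[OF assms(2)])
  have "integrable half_line (\<lambda>x. B\<^sup>2 * (cmod (f x))\<^sup>2)"
    using L2_integrable[OF assms(1)] by simp
  then show "integrable half_line (\<lambda>x. (cmod (g x))\<^sup>2)"
  proof (rule Bochner_Integration.integrable_bound)
    show "AE x in half_line. norm ((cmod (g x))\<^sup>2) \<le> norm (B\<^sup>2 * (cmod (f x))\<^sup>2)"
      using assms(3)
    proof eventually_elim
      case (elim x)
      have "(cmod (g x))\<^sup>2 \<le> (B * cmod (f x))\<^sup>2"
        using elim by (intro power_mono) auto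
      then show ?case by (simp add: power_mult_distrib)
    qed
  qed measurable
qed

lemma borel_measurable_cnj [measurable]: "cnj \<in> borel_measurable borel"
  by (intro borel_measurable_continuous_onI continuous_intros)

lemma L2_zero: "(\<lambda>x. 0) \<in> L2"
  by (intro L2I) auto

lemma L2_mult_bounded:
  assumes "f \<in> L2" and m: "m \<in> borel_measurable half_line" "\<And>x. x > 0 \<Longrightarrow> cmod (m x) \<le> B"
  shows "(\<lambda>x. m x * f x) \<in> L2"
proof -
  have [measurable]: "m \<in> borel_measurable half_line" "f \<in> borel_measurable half_line"
    using assms L2_measurable by auto
  show ?thesis
    by (rule L2_bound[OF assms(1), where B = B])
      (auto simp: norm_mult intro!: AE_I2 mult_right_mono m)
qed

lemma L2_cmult: "f \<in> L2 \<Longrightarrow> (\<lambda>x. c * f x) \<in> L2"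
  by (rule L2_mult_bounded[where B = "cmod c"]) auto

lemma L2_add:
  assumes "f \<in> L2" "g \<in> L2"
  shows "(\<lambda>x. f x + g x) \<in> L2"
proof -
  have [measurable]: "f \<in> borel_measurable half_line" "g \<in> borel_measurable half_line"
    using assms L2_measurable by auto
  have "integrable half_line (\<lambda>x. 2 * (cmod (f x))\<^sup>2 + 2 * (cmod (g x))\<^sup>2)"
    using assms L2_integrable by auto
  then have "integrable half_line (\<lambda>x. (cmod (f x + g x))\<^sup>2)"
  proof (rule Bochner_Integration.integrable_bound)
    show "AE x in half_line. norm ((cmod (f x + g x))\<^sup>2)
        \<le> norm (2 * (cmod (f x))\<^sup>2 + 2 * (cmod (g x))\<^sup>2)"
    proof (rule AE_I2)
      fix x
      have "(cmod (f x + g x))\<^sup>2 \<le> (cmod (f x) + cmod (g x))\<^sup>2"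
        by (intro power_mono norm_triangle_ineq) auto
      also have "\<dots> \<le> 2 * (cmod (f x))\<^sup>2 + 2 * (cmod (g x))\<^sup>2"
        using sum_squares_bound[of "cmod (f x)" "cmod (g x)"] by (simp add: power2_sum)
      finally show "norm ((cmod (f x + g x))\<^sup>2) \<le> norm (2 * (cmod (f x))\<^sup>2 + 2 * (cmod (g x))\<^sup>2)"
        by simp
    qed
  qed measurable
  then show ?thesis by (intro L2I) auto
qed

lemma L2_uminus: "f \<in> L2 \<Longrightarrow> (\<lambda>x. - f x) \<in> L2"
  using L2_cmult[of f "-1"] by simp

lemma L2_diff: "f \<in> L2 \<Longrightarrow> g \<in> L2 \<Longrightarrow> (\<lambda>x. f x - g x) \<in> L2"
  using L2_add[of f "\<lambda>x. - g x"] L2_uminus[of g] by simp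

lemma L2_inner_integrable:
  assumes "f \<in> L2" "g \<in> L2"
  shows "integrable half_line (\<lambda>x. f x * cnj (g x))"
proof -
  have [measurable]: "f \<in> borel_measurable half_line" "g \<in> borel_measurable half_line"
    using assms L2_measurable by auto
  have "integrable half_line (\<lambda>x. (cmod (f x))\<^sup>2 + (cmod (g x))\<^sup>2)"
    using assms L2_integrable by auto
  then show ?thesis
  proof (rule Bochner_Integration.integrable_bound)
    show "AE x in half_line. norm (f x * cnj (g x)) \<le> norm ((cmod (f x))\<^sup>2 + (cmod (g x))\<^sup>2)"
    proof (rule AE_I2)
      fix x
      have "2 * cmod (f x) * cmod (g x) \<le> (cmod (f x))\<^sup>2 + (cmod (g x))\<^sup>2"
        by (rule sum_squares_bound)
      moreover have "0 \<le> cmod (f x) * cmod (g x)" by simp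
      ultimately have "cmod (f x) * cmod (g x) \<le> (cmod (f x))\<^sup>2 + (cmod (g x))\<^sup>2"
        by linarith
      then show "norm (f x * cnj (g x)) \<le> norm ((cmod (f x))\<^sup>2 + (cmod (g x))\<^sup>2)"
        by (simp add: norm_mult)
    qed
  qed measurable
qed

lemma L2_eq_refl: "L2_eq f f"
  and L2_eq_sym: "L2_eq f g \<Longrightarrow> L2_eq g f"
  and L2_eq_trans: "L2_eq f g \<Longrightarrow> L2_eq g h \<Longrightarrow> L2_eq f h"
proof -
  show "L2_eq f f" by (simp add: L2_eq_def)
  show "L2_eq f g \<Longrightarrow> L2_eq g f" unfolding L2_eq_def by (erule eventually_mono) simp
  show "L2_eq f h" if "L2_eq f g" "L2_eq g h"
    using that unfolding L2_eq_def by eventually_elim simp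
qed

lemma
  assumes "L2_eq f f'" "L2_eq g g'"
  shows L2_eq_add: "L2_eq (\<lambda>x. f x + g x) (\<lambda>x. f' x + g' x)"
    and L2_eq_diff: "L2_eq (\<lambda>x. f x - g x) (\<lambda>x. f' x - g' x)"
    and L2_eq_mult: "L2_eq (\<lambda>x. m x * f x) (\<lambda>x. m x * f' x)"
    and L2_eq_uminus: "L2_eq (\<lambda>x. - f x) (\<lambda>x. - f' x)"
  using assms unfolding L2_eq_def by (eventually_elim, simp)+

\<comment> \<open>Classes make the inner product definite, so the space becomes an instance of
  \<open>real_inner\<close> and \<open>complete_space\<close>, and closures, limits and bounded
  linear maps apply to functions known only almost everywhere. The quotient is partial: a function
  that is not square integrable belongs to no class.\<close>
quotient_type hl2 = "real \<Rightarrow> complex" / partial: "\<lambda>f g. f \<in> L2 \<and> g \<in> L2 \<and> L2_eq f g"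
proof (rule part_equivpI)
  show "\<exists>f. f \<in> L2 \<and> f \<in> L2 \<and> L2_eq f f"
    using L2_zero L2_eq_refl by blast
qed (auto intro: sympI transpI L2_eq_sym L2_eq_trans)

abbreviation cls :: "(real \<Rightarrow> complex) \<Rightarrow> hl2" where "cls \<equiv> abs_hl2"
abbreviation rep :: "hl2 \<Rightarrow> real \<Rightarrow> complex" where "rep \<equiv> rep_hl2"

lemma rep_L2: "rep F \<in> L2"
  using Quotient_rep_reflp[OF Quotient_hl2] by simp

lemma rep_measurable [measurable]: "rep F \<in> borel_measurable half_line"
  by (rule L2_measurable[OF rep_L2])

lemma cls_rep [simp]: "cls (rep F) = F"
  by (rule Quotient_abs_rep[OF Quotient_hl2])

lemma cls_eq_iff: "f \<in> L2 \<Longrightarrow> g \<in> L2 \<Longrightarrow> cls f = cls g \<longleftrightarrow> L2_eq f g"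
  using Quotient_rel[OF Quotient_hl2, of f g] L2_eq_refl by auto

lemma rep_cls: "f \<in> L2 \<Longrightarrow> L2_eq (rep (cls f)) f"
  using cls_eq_iff[of "rep (cls f)" f] rep_L2 by simp

lemma AE_rep_cls: "f \<in> L2 \<Longrightarrow> AE x in half_line. rep (cls f) x = f x"
  using rep_cls by (simp add: L2_eq_def)

lemma hl2_eqI: "AE x in half_line. rep F x = rep G x \<Longrightarrow> F = G"
  using cls_eq_iff[OF rep_L2 rep_L2, of F G] by (simp add: L2_eq_def)

lemma L2_inner_cong:
  assumes "f \<in> L2" "g \<in> L2" "f' \<in> L2" "g' \<in> L2" "L2_eq f f'" "L2_eq g g'"
  shows "L2_inner f g = L2_inner f' g'"
  unfolding L2_inner_def
proof (rule integral_cong_AE)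
  have [measurable]: "f \<in> borel_measurable half_line" "g \<in> borel_measurable half_line"
    "f' \<in> borel_measurable half_line" "g' \<in> borel_measurable half_line"
    using assms L2_measurable by auto
  show "(\<lambda>x. f x * cnj (g x)) \<in> borel_measurable half_line"
    "(\<lambda>x. f' x * cnj (g' x)) \<in> borel_measurable half_line"
    by measurable
  show "AE x in half_line. f x * cnj (g x) = f' x * cnj (g' x)"
    using assms(5,6) unfolding L2_eq_def by eventually_elim simp
qed

instantiation hl2 :: real_vector
begin

lift_definition zero_hl2 :: hl2 is "\<lambda>x. 0"
  by (simp add: L2_zero L2_eq_refl)

lift_definition plus_hl2 :: "hl2 \<Rightarrow> hl2 \<Rightarrow> hl2" is "\<lambda>f g x. f x + g x"
  by (simp add: L2_add L2_eq_add)

lift_definition uminus_hl2 :: "hl2 \<Rightarrow> hl2" is "\<lambda>f x. - f x"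
  by (simp add: L2_uminus L2_eq_uminus[OF _ L2_eq_refl])

lift_definition minus_hl2 :: "hl2 \<Rightarrow> hl2 \<Rightarrow> hl2" is "\<lambda>f g x. f x - g x"
  by (simp add: L2_diff L2_eq_diff)

lift_definition scaleR_hl2 :: "real \<Rightarrow> hl2 \<Rightarrow> hl2" is "\<lambda>c f x. of_real c * f x"
  by (simp add: L2_cmult L2_eq_mult[OF _ L2_eq_refl])

instance
proof
  fix F G K :: hl2 and a b :: real
  obtain f g k where F: "f \<in> L2" "F = cls f" and G: "g \<in> L2" "G = cls g" and K: "k \<in> L2" "K = cls k"
    by (metis cls_rep rep_L2)
  note * = plus_hl2.abs_eq uminus_hl2.abs_eq minus_hl2.abs_eq scaleR_hl2.abs_eq zero_hl2_def
    L2_eq_refl L2_add L2_diff L2_cmult L2_uminus L2_zero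
  show "F + G + K = F + (G + K)" "F + G = G + F" "0 + F = F" "- F + F = 0" "F - G = F + - G"
    "a *\<^sub>R b *\<^sub>R F = (a * b) *\<^sub>R F" "1 *\<^sub>R F = F"
    using F G K by (simp_all add: * add_ac mult.assoc)
  show "a *\<^sub>R (F + G) = a *\<^sub>R F + a *\<^sub>R G" "(a + b) *\<^sub>R F = a *\<^sub>R F + b *\<^sub>R F"
    using F G by (simp_all add: * distrib_left distrib_right)
qed

end

instantiation hl2 :: real_inner
begin

lift_definition inner_hl2 :: "hl2 \<Rightarrow> hl2 \<Rightarrow> real" is "\<lambda>f g. Re (L2_inner f g)"
  by (metis L2_inner_cong)

definition norm_hl2 :: "hl2 \<Rightarrow> real" where "norm_hl2 F = sqrt (inner F F)"
definition dist_hl2 :: "hl2 \<Rightarrow> hl2 \<Rightarrow> real" where "dist_hl2 F G = norm (F - G)"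
definition sgn_hl2 :: "hl2 \<Rightarrow> hl2" where "sgn_hl2 F = F /\<^sub>R norm F"
definition uniformity_hl2 :: "(hl2 \<times> hl2) filter" where
  "uniformity_hl2 = (INF e\<in>{0 <..}. principal {(x, y). dist x y < e})"
definition open_hl2 :: "hl2 set \<Rightarrow> bool" where
  "open_hl2 U = (\<forall>x\<in>U. \<forall>\<^sub>F (x', y) in uniformity. x' = x \<longrightarrow> y \<in> U)"

instance
proof
  fix F G K :: hl2 and a b :: real
  show "dist F G = norm (F - G)" "sgn F = F /\<^sub>R norm F" "norm F = sqrt (inner F F)"
    by (simp_all add: dist_hl2_def sgn_hl2_def norm_hl2_def)
  show "uniformity = (INF e\<in>{0 <..}. principal {(x::hl2, y). dist x y < e})"
    by (simp add: uniformity_hl2_def)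
  show "open U = (\<forall>x\<in>U. \<forall>\<^sub>F (x', y) in uniformity. x' = x \<longrightarrow> y \<in> U)" for U :: "hl2 set"
    by (simp add: open_hl2_def)
  show "inner F G = inner G F"
  proof transfer
    fix f g assume "f \<in> L2 \<and> f \<in> L2 \<and> L2_eq f f" "g \<in> L2 \<and> g \<in> L2 \<and> L2_eq g g"
    have "L2_inner g f = cnj (L2_inner f g)"
      unfolding L2_inner_def by (simp add: mult.commute flip: Bochner_Integration.integral_cnj)
    then show "Re (L2_inner f g) = Re (L2_inner g f)" by simp
  qed
  show "inner (F + G) K = inner F K + inner G K"
    by transfer (simp add: L2_inner_def distrib_right L2_inner_integrable)
  show "inner (a *\<^sub>R F) G = a * inner F G"
    by transfer (simp add: L2_inner_def mult.assoc)
  have *: "Re (L2_inner f f) = (LINT x|half_line. (cmod (f x))\<^sup>2)" for f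
    unfolding L2_inner_def complex_norm_square[symmetric] of_real_power[symmetric]
    by (subst integral_complex_of_real) simp
  show "0 \<le> inner F F"
    by transfer (simp add: *)
  show "(inner F F = 0) = (F = 0)"
    by transfer (auto simp: * integral_nonneg_eq_0_iff_AE[OF L2_integrable] L2_zero L2_eq_def)
qed

end

text \<open>The type classes provide a real Hilbert space only. The complex structure is carried by
  \<open>cscale\<close> and by \<open>cinner\<close>, which is linear in its first argument and
  whose real part is the class operation \<open>inner\<close>.\<close>

lift_definition cscale :: "complex \<Rightarrow> hl2 \<Rightarrow> hl2" (infixr \<open>*\<^sub>c\<close> 75) is "\<lambda>c f x. c * f x"
  by (simp add: L2_cmult L2_eq_mult[OF _ L2_eq_refl])

lift_definition cinner :: "hl2 \<Rightarrow> hl2 \<Rightarrow> complex" is L2_inner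
  by (metis L2_inner_cong)

lemma L2_inner_self: "L2_inner f f = of_real (LINT x|half_line. (cmod (f x))\<^sup>2)"
  unfolding L2_inner_def complex_norm_square[symmetric] of_real_power[symmetric]
  by (rule integral_complex_of_real)

lemma
  assumes "f \<in> L2" "g \<in> L2"
  shows cls_add: "cls f + cls g = cls (\<lambda>x. f x + g x)"
    and cls_diff: "cls f - cls g = cls (\<lambda>x. f x - g x)"
    and cls_cscale: "c *\<^sub>c cls f = cls (\<lambda>x. c * f x)"
    and cls_scaleR: "r *\<^sub>R cls f = cls (\<lambda>x. of_real r * f x)"
    and cinner_cls: "cinner (cls f) (cls g) = L2_inner f g"
    and norm_cls: "norm (cls f) = L2_norm f"
  using assms
  by (simp_all add: plus_hl2.abs_eq minus_hl2.abs_eq cscale.abs_eq scaleR_hl2.abs_eq cinner.abs_eq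
      norm_hl2_def inner_hl2.abs_eq L2_eq_refl L2_inner_self L2_norm_def)

lemma cls_zero: "cls (\<lambda>x. 0) = 0"
  by (simp add: zero_hl2_def)

lemma inner_eq_Re: "inner F G = Re (cinner F G)"
  by transfer simp

lemma cinner_eq: "cinner F G = (LINT x|half_line. rep F x * cnj (rep G x))"
  by (metis L2_inner_def cinner_cls cls_rep rep_L2)

lemma norm_sq_eq: "(norm F)\<^sup>2 = (LINT x|half_line. (cmod (rep F x))\<^sup>2)"
  using norm_cls[OF rep_L2 rep_L2, of F] by (simp add: L2_norm_def)

lemma
  shows AE_rep_add: "AE x in half_line. rep (F + G) x = rep F x + rep G x"
    and AE_rep_diff: "AE x in half_line. rep (F - G) x = rep F x - rep G x"
    and AE_rep_cscale: "AE x in half_line. rep (c *\<^sub>c F) x = c * rep F x"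
    and AE_rep_zero: "AE x in half_line. rep 0 x = 0"
  using AE_rep_cls[OF L2_add[OF rep_L2 rep_L2, of F G]] AE_rep_cls[OF L2_diff[OF rep_L2 rep_L2, of F G]]
    AE_rep_cls[OF L2_cmult[OF rep_L2[of F], where c = c]] AE_rep_cls[OF L2_zero]
    cls_add[OF rep_L2 rep_L2, of F G] cls_diff[OF rep_L2 rep_L2, of F G]
    cls_cscale[OF rep_L2[of F] rep_L2, where c = c] cls_zero
  by simp_all

lemma cinner_commute: "cinner F G = cnj (cinner G F)"
  unfolding cinner_eq by (simp add: mult.commute flip: Bochner_Integration.integral_cnj)

lemma
  shows cinner_add_left: "cinner (F + G) K = cinner F K + cinner G K"
    and cinner_diff_left: "cinner (F - G) K = cinner F K - cinner G K"
    and cinner_cscale_left: "cinner (c *\<^sub>c F) K = c * cinner F K"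
proof -
  obtain f g k where F: "f \<in> L2" "F = cls f" and G: "g \<in> L2" "G = cls g" and K: "k \<in> L2" "K = cls k"
    by (metis cls_rep rep_L2)
  note * = cls_add cls_diff cls_cscale cinner_cls L2_add L2_diff L2_cmult L2_inner_def
    L2_inner_integrable
  show "cinner (F + G) K = cinner F K + cinner G K" "cinner (F - G) K = cinner F K - cinner G K"
    using F G K by (simp_all add: * distrib_right left_diff_distrib)
  show "cinner (c *\<^sub>c F) K = c * cinner F K"
    using F K by (simp add: * cls_cscale[OF F(1) F(1)] mult.assoc)
qed

lemma
  shows cinner_add_right: "cinner K (F + G) = cinner K F + cinner K G"
    and cinner_diff_right: "cinner K (F - G) = cinner K F - cinner K G"
    and cinner_cscale_right: "cinner K (c *\<^sub>c F) = cnj c * cinner K F"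
  by (metis cinner_add_left cinner_commute complex_cnj_add)
    (metis cinner_diff_left cinner_commute complex_cnj_diff,
      metis cinner_cscale_left cinner_commute complex_cnj_mult)

lemma cinner_self: "cinner F F = of_real ((norm F)\<^sup>2)"
  unfolding norm_sq_eq by (metis L2_inner_self cinner_cls cls_rep rep_L2)

lemma cscale_add: "c *\<^sub>c (F + G) = c *\<^sub>c F + c *\<^sub>c G"
  and cscale_diff: "c *\<^sub>c (F - G) = c *\<^sub>c F - c *\<^sub>c G"
  and cscale_cscale: "c *\<^sub>c d *\<^sub>c F = (c * d) *\<^sub>c F"
  and cscale_one [simp]: "1 *\<^sub>c F = F"
  and scaleR_eq_cscale: "r *\<^sub>R F = of_real r *\<^sub>c F"
  and cscale_scaleR: "c *\<^sub>c r *\<^sub>R F = r *\<^sub>R c *\<^sub>c F"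
proof -
  obtain f g where F: "f \<in> L2" "F = cls f" and G: "g \<in> L2" "G = cls g"
    by (metis cls_rep rep_L2)
  note * = cls_add cls_diff cscale.abs_eq scaleR_hl2.abs_eq L2_eq_refl L2_add L2_diff L2_cmult
  show "c *\<^sub>c (F + G) = c *\<^sub>c F + c *\<^sub>c G" "c *\<^sub>c (F - G) = c *\<^sub>c F - c *\<^sub>c G"
    using F G by (simp_all add: * distrib_left right_diff_distrib)
  show "c *\<^sub>c d *\<^sub>c F = (c * d) *\<^sub>c F" "1 *\<^sub>c F = F" "r *\<^sub>R F = of_real r *\<^sub>c F"
    "c *\<^sub>c r *\<^sub>R F = r *\<^sub>R c *\<^sub>c F"
    using F by (simp_all add: * mult.assoc mult.left_commute)
qed

lemma norm_cscale: "norm (c *\<^sub>c F) = cmod c * norm F"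
proof -
  have "complex_of_real ((norm (c *\<^sub>c F))\<^sup>2) = of_real ((cmod c * norm F)\<^sup>2)"
    unfolding cinner_self[symmetric] cinner_cscale_left cinner_cscale_right
    using complex_norm_square[of c] by (simp add: cinner_self power_mult_distrib mult.assoc[symmetric])
  then have "(norm (c *\<^sub>c F))\<^sup>2 = (cmod c * norm F)\<^sup>2"
    using of_real_eq_iff by blast
  then show ?thesis by (simp add: power2_eq_iff_nonneg)
qed

lemma bounded_linear_cscale: "bounded_linear (\<lambda>F. c *\<^sub>c F)"
  by (rule bounded_linear_intro[where K = "cmod c"])
    (simp_all add: cscale_add cscale_scaleR norm_cscale mult.commute)

text \<open>Conjugate linearity in the second argument turns the imaginary part into a real inner
  product with \<open>\<i> *\<^sub>c G\<close>. Continuity of \<open>cinner\<close>, and its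
  vanishing on complex subspaces, are read off from the real product this way.\<close>

lemma cinner_eq_inner: "cinner F G = Complex (inner F G) (inner F (\<i> *\<^sub>c G))"
  by (simp add: inner_eq_Re cinner_cscale_right complex_eq_iff)

lemma norm_cinner_le: "cmod (cinner F G) \<le> norm F * norm G"
proof (cases "cinner F G = 0")
  case False
  \<comment> \<open>The unimodular factor rotates \<open>cinner F G\<close> onto the positive real
    axis, which reduces the claim to the real Cauchy-Schwarz inequality.\<close>
  define c where "c = cnj (cinner F G) / cmod (cinner F G)"
  have c: "cmod c = 1" using False by (simp add: c_def norm_divide)
  have "c * cinner F G = complex_of_real (cmod (cinner F G))"
    using complex_norm_square[of "cinner F G"] False
    by (simp add: c_def field_simps power2_eq_square)
  then have "cmod (cinner F G) = inner (c *\<^sub>c F) G"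
    by (simp add: inner_eq_Re cinner_cscale_left)
  also have "\<dots> \<le> norm (c *\<^sub>c F) * norm G" by (rule norm_cauchy_schwarz)
  finally show ?thesis by (simp add: norm_cscale c)
qed simp

lemma tendsto_cinner [tendsto_intros]:
  assumes "(F \<longlongrightarrow> F') A" "(G \<longlongrightarrow> G') A"
  shows "((\<lambda>x. cinner (F x) (G x)) \<longlongrightarrow> cinner F' G') A"
  unfolding cinner_eq_inner
  by (intro tendsto_Complex tendsto_inner assms bounded_linear.tendsto[OF bounded_linear_cscale])

lemma tendsto_cscale [tendsto_intros]:
  "(F \<longlongrightarrow> F') A \<Longrightarrow> ((\<lambda>x. c *\<^sub>c F x) \<longlongrightarrow> c *\<^sub>c F') A"
  by (rule bounded_linear.tendsto[OF bounded_linear_cscale])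

text \<open>Fatou's lemma for the squared moduli. In the completeness proof it is applied to the
  differences \<open>X (r j) - X n\<close> as j grows, and yields both square integrability of the
  limit and the rate of convergence.\<close>

lemma L2_Fatou:
  assumes f: "\<And>n. f n \<in> L2" "\<And>n. n \<ge> N \<Longrightarrow> L2_norm (f n) \<le> B"
    and [measurable]: "g \<in> borel_measurable half_line"
    and lim: "AE x in half_line. (\<lambda>n. f n x) \<longlonglongrightarrow> g x"
  shows "g \<in> L2" "L2_norm g \<le> B"
proof -
  have [measurable]: "f n \<in> borel_measurable half_line" for n
    using f L2_measurable by auto
  have "0 \<le> L2_norm (f N)" by (simp add: L2_norm_def)
  with f(2)[of N] have B: "0 \<le> B" by simp
  have bd: "(\<integral>\<^sup>+x. ennreal ((cmod (f n x))\<^sup>2) \<partial>half_line) \<le> ennreal (B\<^sup>2)" if "n \<ge> N" for n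
  proof -
    have "(LINT x|half_line. (cmod (f n x))\<^sup>2) = (L2_norm (f n))\<^sup>2"
      by (simp add: L2_norm_def)
    also have "\<dots> \<le> B\<^sup>2"
      using f(2)[OF that] by (intro power_mono) (auto simp: L2_norm_def)
    finally show ?thesis
      by (subst nn_integral_eq_integral[OF L2_integrable[OF f(1)]]) (auto intro: ennreal_leI)
  qed
  have "(\<integral>\<^sup>+x. ennreal ((cmod (g x))\<^sup>2) \<partial>half_line)
      = (\<integral>\<^sup>+x. liminf (\<lambda>n. ennreal ((cmod (f n x))\<^sup>2)) \<partial>half_line)"
  proof (rule nn_integral_cong_AE)
    show "AE x in half_line. ennreal ((cmod (g x))\<^sup>2) = liminf (\<lambda>n. ennreal ((cmod (f n x))\<^sup>2))"
      using lim
    proof eventually_elim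
      case (elim x)
      then have "(\<lambda>n. ennreal ((cmod (f n x))\<^sup>2)) \<longlonglongrightarrow> ennreal ((cmod (g x))\<^sup>2)"
        by (intro tendsto_intros)
      then show ?case by (rule lim_imp_Liminf[OF sequentially_bot, symmetric])
    qed
  qed
  also have "\<dots> \<le> liminf (\<lambda>n. \<integral>\<^sup>+x. ennreal ((cmod (f n x))\<^sup>2) \<partial>half_line)"
    by (rule nn_integral_liminf) measurable
  also have "\<dots> \<le> ennreal (B\<^sup>2)"
  proof (rule Liminf_le)
    show "\<forall>\<^sub>F n in sequentially. (\<integral>\<^sup>+x. ennreal ((cmod (f n x))\<^sup>2) \<partial>half_line) \<le> ennreal (B\<^sup>2)"
      using bd by (auto simp: eventually_sequentially)
  qed simp
  finally have fin: "(\<integral>\<^sup>+x. ennreal ((cmod (g x))\<^sup>2) \<partial>half_line) \<le> ennreal (B\<^sup>2)" .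
  have int: "integrable half_line (\<lambda>x. (cmod (g x))\<^sup>2)"
    using fin by (intro integrableI_bounded) (auto simp: less_top[symmetric] top_unique)
  then show "g \<in> L2" by (intro L2I) auto
  have "(LINT x|half_line. (cmod (g x))\<^sup>2) \<le> B\<^sup>2"
    using fin by (subst (asm) nn_integral_eq_integral[OF int]) auto
  then show "L2_norm g \<le> B"
    using B unfolding L2_norm_def by (intro real_le_lsqrt) auto
qed

lemma L2_norm_diff_rep: "L2_norm (\<lambda>x. rep F x - rep G x) = norm (F - G)"
  using norm_cls[OF L2_diff[OF rep_L2[of F] rep_L2[of G]] rep_L2] cls_diff[OF rep_L2[of F] rep_L2[of G]]
  by simp

text \<open>Riesz--Fischer: weighting the squared increments of a rapidly converging subsequence by
  \<open>2 ^ k\<close> keeps their sum integrable and forces pointwise convergence.\<close>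

lemma hl2_Cauchy_AE_convergent:
  fixes X :: "nat \<Rightarrow> hl2"
  assumes "\<And>k. norm (X (Suc k) - X k) \<le> (1/2) ^ k"
  shows "AE x in half_line. convergent (\<lambda>k. rep (X k) x)"
proof -
  define g where "g k x = (cmod (rep (X (Suc k)) x - rep (X k) x))\<^sup>2" for k x
  have [measurable]: "g k \<in> borel_measurable half_line" for k
    unfolding g_def by measurable
  have int: "integrable half_line (g k)" for k
    unfolding g_def by (intro L2_integrable L2_diff rep_L2)
  have gle: "(LINT x|half_line. g k x) \<le> (1/4) ^ k" for k
  proof -
    have "(LINT x|half_line. g k x) = (norm (X (Suc k) - X k))\<^sup>2"
      unfolding L2_norm_diff_rep[symmetric] by (simp add: L2_norm_def g_def)
    also have "\<dots> \<le> ((1/2) ^ k)\<^sup>2" by (intro power_mono assms) auto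
    also have "\<dots> = (1/4) ^ k"
      by (simp add: power2_eq_square flip: power_mult_distrib)
    finally show ?thesis .
  qed
  have "(\<integral>\<^sup>+x. (\<Sum>k. ennreal (2 ^ k * g k x)) \<partial>half_line)
      = (\<Sum>k. \<integral>\<^sup>+x. ennreal (2 ^ k * g k x) \<partial>half_line)"
    by (rule nn_integral_suminf) measurable
  also have "\<dots> \<le> (\<Sum>k. ennreal ((1/2) ^ k))"
  proof (rule suminf_le)
    fix k
    have "(\<integral>\<^sup>+x. ennreal (2 ^ k * g k x) \<partial>half_line) = ennreal (LINT x|half_line. 2 ^ k * g k x)"
      by (rule nn_integral_eq_integral) (auto simp: int, simp add: g_def)
    also have "\<dots> = ennreal (2 ^ k * (LINT x|half_line. g k x))"
      by simp
    also have "\<dots> \<le> ennreal (2 ^ k * (1/4) ^ k)"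
      by (intro ennreal_leI mult_left_mono gle) auto
    also have "\<dots> = ennreal ((1/2) ^ k)" by (simp flip: power_mult_distrib)
    finally show "(\<integral>\<^sup>+x. ennreal (2 ^ k * g k x) \<partial>half_line) \<le> ennreal ((1/2) ^ k)" .
  qed auto
  also have "\<dots> = ennreal (\<Sum>k. (1/2) ^ k)"
    by (rule suminf_ennreal_eq[symmetric, OF _ summable_sums, THEN sym]) auto
  finally have "(\<integral>\<^sup>+x. (\<Sum>k. ennreal (2 ^ k * g k x)) \<partial>half_line) \<noteq> \<infinity>"
    by (auto simp: top_unique)
  then have "AE x in half_line. (\<Sum>k. ennreal (2 ^ k * g k x)) \<noteq> \<infinity>"
    by (intro nn_integral_PInf_AE) measurable
  then show ?thesis
  proof eventually_elim
    case (elim x)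
    have "summable (\<lambda>k. 2 ^ k * g k x)"
      by (rule summable_suminf_not_top) (use elim in \<open>auto simp: g_def\<close>)
    then have "Bseq (\<lambda>k. 2 ^ k * g k x)"
      by (intro convergent_imp_Bseq summable_LIMSEQ_zero[THEN convergentI])
    then obtain K where K: "K > 0" "\<And>k. norm (2 ^ k * g k x) \<le> K"
      unfolding Bseq_def by auto
    have "norm (rep (X (Suc k)) x - rep (X k) x) \<le> sqrt K * (sqrt (1/2)) ^ k" for k
    proof (rule power2_le_imp_le)
      have "(norm (rep (X (Suc k)) x - rep (X k) x))\<^sup>2 \<le> K / 2 ^ k"
        using K(2)[of k] by (simp add: g_def field_simps)
      also have "\<dots> = (sqrt K * (sqrt (1/2)) ^ k)\<^sup>2"
        using K(1) by (simp add: power_mult_distrib power_divide real_sqrt_divide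
            power_mult[symmetric] mult.commute[of k] power_mult[of "sqrt 2" 2])
      finally show "(norm (rep (X (Suc k)) x - rep (X k) x))\<^sup>2 \<le> (sqrt K * (sqrt (1/2)) ^ k)\<^sup>2" .
    qed (use K in auto)
    note bd = this
    have "summable (\<lambda>k. sqrt K * (sqrt (1/2)) ^ k)"
      by (intro summable_mult summable_geometric) (simp add: real_sqrt_divide)
    then have "summable (\<lambda>k. norm (rep (X (Suc k)) x - rep (X k) x))"
      by (rule summable_comparison_test'[where N = 0]) (simp only: real_norm_def abs_norm_cancel bd)
    then have "summable (\<lambda>k. rep (X (Suc k)) x - rep (X k) x)"
      by (rule summable_norm_cancel)
    then have "convergent (\<lambda>n. \<Sum>k<n. rep (X (Suc k)) x - rep (X k) x)"
      by (simp add: summable_iff_convergent)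
    then have "convergent (\<lambda>n. rep (X n) x - rep (X 0) x)"
      using sum_lessThan_telescope[of "\<lambda>k. rep (X k) x"] by simp
    then show ?case by (simp add: convergent_diff_const_right_iff)
  qed
qed

instance hl2 :: complete_space
proof
  fix X :: "nat \<Rightarrow> hl2"
  assume "Cauchy X"
  then have "\<exists>N. \<forall>m\<ge>N. \<forall>n\<ge>N. dist (X m) (X n) < (1/2) ^ k" for k
    by (intro metric_CauchyD) auto
  then obtain N where N: "\<And>k m n. m \<ge> N k \<Longrightarrow> n \<ge> N k \<Longrightarrow> dist (X m) (X n) < (1/2) ^ k"
    by metis
  \<comment> \<open>The partial sum dominates \<open>N j\<close> for all \<open>j \<le> k\<close> at
    once, so consecutive terms of the subsequence differ by at most
    \<open>(1/2) ^ k\<close>.\<close>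
  define r where "r k = (\<Sum>i\<le>k. N i)" for k
  have r: "N j \<le> r k" if "j \<le> k" for j k
    unfolding r_def using that by (intro member_le_sum) auto
  have "norm (X (r (Suc k)) - X (r k)) \<le> (1/2) ^ k" for k
    using N[where k = k, of "r (Suc k)" "r k"] r[of k k] r[of k "Suc k"] by (simp add: dist_norm)
  then have conv: "AE x in half_line. convergent (\<lambda>k. rep (X (r k)) x)"
    by (rule hl2_Cauchy_AE_convergent)
  define g where "g x = lim (\<lambda>k. rep (X (r k)) x)" for x
  have [measurable]: "g \<in> borel_measurable half_line"
    unfolding g_def by measurable
  have lim: "AE x in half_line. (\<lambda>k. rep (X (r k)) x) \<longlonglongrightarrow> g x"
    using conv by eventually_elim (simp add: g_def convergent_LIMSEQ_iff)
  have est: "(\<lambda>x. g x - rep (X n) x) \<in> L2" "L2_norm (\<lambda>x. g x - rep (X n) x) \<le> (1/2) ^ k"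
    if "n \<ge> N k" for n k
  proof -
    have L: "L2_norm (\<lambda>x. rep (X (r j)) x - rep (X n) x) \<le> (1/2) ^ k" if "j \<ge> k" for j
      using N[where k = k, of "r j" n] r[OF that] \<open>n \<ge> N k\<close>
      by (simp add: L2_norm_diff_rep dist_norm)
    show "(\<lambda>x. g x - rep (X n) x) \<in> L2" "L2_norm (\<lambda>x. g x - rep (X n) x) \<le> (1/2) ^ k"
      by (rule L2_Fatou[where f = "\<lambda>j x. rep (X (r j)) x - rep (X n) x" and N = k];
        use lim in \<open>auto intro!: L2_diff rep_L2 L tendsto_intros\<close>)+
  qed
  have g: "g \<in> L2"
    using L2_add[OF est(1)[of 0 "N 0"] rep_L2[of "X (N 0)"]] by simp
  have "X \<longlonglongrightarrow> cls g"
  proof (rule metric_LIMSEQ_I)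
    fix e :: real assume "e > 0"
    then obtain k where k: "(1/2) ^ k < e"
      using real_arch_pow_inv[of e "1/2"] by auto
    have "dist (X n) (cls g) < e" if "n \<ge> N k" for n
    proof -
      have "dist (X n) (cls g) = norm (cls g - cls (rep (X n)))"
        by (simp add: dist_norm norm_minus_commute)
      also have "\<dots> = L2_norm (\<lambda>x. g x - rep (X n) x)"
        using cls_diff[OF g rep_L2] norm_cls[OF est(1)[OF that] est(1)[OF that]] by simp
      finally show ?thesis using est(2)[OF that] k by simp
    qed
    then show "\<exists>no. \<forall>n\<ge>no. dist (X n) (cls g) < e" by blast
  qed
  then show "convergent X" by (rule convergentI)
qed

text \<open>The parallelogram law makes a minimising sequence for the distance Cauchy; comparing the
  minimiser \<open>p\<close> with \<open>p + t s\<close> gives orthogonality. All density statements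
  below are obtained by showing that \<open>x - p\<close> vanishes.\<close>

lemma closed_subspace_projection:
  fixes S :: "'a::{real_inner, complete_space} set"
  assumes S: "subspace S" "closed S"
  obtains p where "p \<in> S" "\<And>s. s \<in> S \<Longrightarrow> inner (x - p) s = 0"
proof -
  define d where "d = infdist x S"
  have ne: "S \<noteq> {}" using subspace_0[OF S(1)] by auto
  have d0: "d \<ge> 0" by (simp add: d_def infdist_nonneg)
  have dle: "d \<le> norm (x - s)" if "s \<in> S" for s
    using infdist_le[OF that, of x] by (simp add: d_def dist_norm)
  have "\<exists>s\<in>S. norm (x - s) < d + 1 / (Suc n)" for n
  proof -
    have "Inf ((dist x) ` S) < d + 1 / (Suc n)"
      using ne by (simp add: d_def infdist_notempty)
    then show ?thesis
      using ne by (subst (asm) cInf_less_iff) (auto simp: dist_norm intro!: bdd_belowI[of _ 0])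
  qed
  then obtain y where y: "\<And>n. y n \<in> S" "\<And>n. norm (x - y n) < d + 1 / (Suc n)"
    by metis
  have lim: "(\<lambda>n. norm (x - y n)) \<longlonglongrightarrow> d"
  proof (rule real_tendsto_sandwich[where f = "\<lambda>_. d" and h = "\<lambda>n. d + 1 / (Suc n)"])
    have "(\<lambda>n. d + 1 / real (Suc n)) \<longlonglongrightarrow> d + 0"
      by (intro tendsto_intros LIMSEQ_inverse_real_of_nat[unfolded inverse_eq_divide])
    then show "(\<lambda>n. d + 1 / real (Suc n)) \<longlonglongrightarrow> d" by simp
  qed (use dle y in \<open>auto intro!: always_eventually less_imp_le\<close>)
  have par: "(norm (y m - y n))\<^sup>2 \<le> 2 * (norm (x - y m))\<^sup>2 + 2 * (norm (x - y n))\<^sup>2 - 4 * d\<^sup>2" for m n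
  proof -
    have "(1/2) *\<^sub>R (y m + y n) \<in> S"
      using y S by (intro subspace_scale subspace_add) auto
    then have "d\<^sup>2 \<le> (norm (x - (1/2) *\<^sub>R (y m + y n)))\<^sup>2"
      using d0 by (intro power_mono dle)
    moreover have "(norm (y m - y n))\<^sup>2 + 4 * (norm (x - (1/2) *\<^sub>R (y m + y n)))\<^sup>2
        = 2 * (norm (x - y m))\<^sup>2 + 2 * (norm (x - y n))\<^sup>2"
      unfolding power2_norm_eq_inner
      by (simp add: inner_diff_left inner_diff_right inner_add_left inner_add_right inner_commute)
        (simp add: algebra_simps)
    ultimately show ?thesis by simp
  qed
  have "Cauchy y"
  proof (rule metric_CauchyI)
    fix e :: real assume e: "e > 0"
    have "(\<lambda>n. (norm (x - y n))\<^sup>2) \<longlonglongrightarrow> d\<^sup>2" by (intro tendsto_intros lim)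
    then have "\<forall>\<^sub>F n in sequentially. (norm (x - y n))\<^sup>2 < d\<^sup>2 + e\<^sup>2 / 4"
      using e by (intro order_tendstoD) auto
    then obtain M where M: "\<And>n. n \<ge> M \<Longrightarrow> (norm (x - y n))\<^sup>2 < d\<^sup>2 + e\<^sup>2 / 4"
      by (auto simp: eventually_sequentially)
    have "dist (y m) (y n) < e" if "m \<ge> M" "n \<ge> M" for m n
    proof -
      have "(norm (y m - y n))\<^sup>2 < e\<^sup>2" using par[of m n] M[OF that(1)] M[OF that(2)] by linarith
      then show ?thesis using e by (simp add: dist_norm power2_less_imp_less)
    qed
    then show "\<exists>M. \<forall>m\<ge>M. \<forall>n\<ge>M. dist (y m) (y n) < e" by blast
  qed
  then obtain p where p: "y \<longlonglongrightarrow> p"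
    using Cauchy_convergent_iff convergent_def by blast
  have pS: "p \<in> S" using S(2) y(1) p by (auto simp: closed_sequential_limits)
  have pd: "norm (x - p) = d"
    by (rule LIMSEQ_unique[OF _ lim]) (intro tendsto_intros p)
  have "inner (x - p) s = 0" if s: "s \<in> S" for s
  proof (cases "s = 0")
    case False
    \<comment> \<open>The minimiser of the quadratic polynomial in t that compares the two
      distances.\<close>
    define t where "t = inner (x - p) s / inner s s"
    have "p + t *\<^sub>R s \<in> S" using pS s S by (intro subspace_add subspace_scale)
    then have "(norm (x - p))\<^sup>2 \<le> (norm (x - (p + t *\<^sub>R s)))\<^sup>2"
      unfolding pd using d0 by (intro power_mono dle)
    also have "\<dots> = (norm (x - p))\<^sup>2 - 2 * t * inner (x - p) s + t\<^sup>2 * inner s s"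
      unfolding power2_norm_eq_inner
      by (simp add: inner_diff_left inner_diff_right inner_add_left inner_add_right inner_commute power2_eq_square algebra_simps)
    also have "\<dots> = (norm (x - p))\<^sup>2 - (inner (x - p) s)\<^sup>2 / inner s s"
      using False by (simp add: t_def power2_eq_square field_simps)
    finally have "(inner (x - p) s)\<^sup>2 / inner s s \<le> 0" by simp
    then show ?thesis using False
      by (smt (verit) divide_pos_pos inner_gt_zero_iff zero_less_power2)
  qed simp
  with pS show ?thesis by (rule that)
qed

section \<open>Multiplication operators, bounded and unbounded\<close>

definition bounded_mult :: "(real \<Rightarrow> complex) \<Rightarrow> bool" where
  "bounded_mult m \<longleftrightarrow> m \<in> borel_measurable half_line \<and> (\<exists>B. \<forall>x>0. cmod (m x) \<le> B)"

lemma bounded_multI: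
  "m \<in> borel_measurable half_line \<Longrightarrow> (\<And>x. x > 0 \<Longrightarrow> cmod (m x) \<le> B) \<Longrightarrow> bounded_mult m"
  by (auto simp: bounded_mult_def)

definition mult_op :: "(real \<Rightarrow> complex) \<Rightarrow> hl2 \<Rightarrow> hl2" where
  "mult_op m F = cls (\<lambda>x. m x * rep F x)"

lemma mult_op_L2: "bounded_mult m \<Longrightarrow> f \<in> L2 \<Longrightarrow> (\<lambda>x. m x * f x) \<in> L2"
  unfolding bounded_mult_def using L2_mult_bounded by blast

lemma mult_op_cls: "bounded_mult m \<Longrightarrow> f \<in> L2 \<Longrightarrow> mult_op m (cls f) = cls (\<lambda>x. m x * f x)"
  unfolding mult_op_def
  by (subst cls_eq_iff) (auto intro!: mult_op_L2 rep_L2 L2_eq_mult[OF _ L2_eq_refl] rep_cls)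

lemma AE_rep_mult_op: "bounded_mult m \<Longrightarrow> AE x in half_line. rep (mult_op m F) x = m x * rep F x"
  unfolding mult_op_def by (intro AE_rep_cls mult_op_L2 rep_L2)

lemma norm_mult_op_le:
  assumes "bounded_mult m" "\<And>x. x > 0 \<Longrightarrow> cmod (m x) \<le> B"
  shows "norm (mult_op m F) \<le> B * norm F"
proof -
  have "0 \<le> cmod (m 1)" by simp
  with assms(2)[of 1] have B: "B \<ge> 0" by (simp del: norm_ge_zero)
  have "(norm (mult_op m F))\<^sup>2 = (LINT x|half_line. (cmod (m x * rep F x))\<^sup>2)"
    unfolding norm_sq_eq
  proof (rule integral_cong_AE)
    have [measurable]: "m \<in> borel_measurable half_line" using assms(1) by (simp add: bounded_mult_def)
    show "(\<lambda>x. (cmod (m x * rep F x))\<^sup>2) \<in> borel_measurable half_line" by measurable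
    show "AE x in half_line. (cmod (rep (mult_op m F) x))\<^sup>2 = (cmod (m x * rep F x))\<^sup>2"
      using AE_rep_mult_op[OF assms(1), of F] by eventually_elim simp
  qed measurable
  also have "\<dots> \<le> (LINT x|half_line. B\<^sup>2 * (cmod (rep F x))\<^sup>2)"
  proof (rule integral_mono)
    show "integrable half_line (\<lambda>x. (cmod (m x * rep F x))\<^sup>2)"
      by (intro L2_integrable mult_op_L2 assms rep_L2)
    show "integrable half_line (\<lambda>x. B\<^sup>2 * (cmod (rep F x))\<^sup>2)"
      by (intro integrable_mult_right L2_integrable rep_L2)
  qed (auto simp: norm_mult power_mult_distrib intro!: mult_right_mono power_mono assms)
  also have "\<dots> = (B * norm F)\<^sup>2" by (simp add: norm_sq_eq power_mult_distrib)
  finally show ?thesis using B by (intro power2_le_imp_le[of "norm (mult_op m F)"]) auto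
qed

lemma mult_op_eqI:
  assumes "bounded_mult m" "AE x in half_line. rep G x = m x * rep F x"
  shows "mult_op m F = G"
proof (rule hl2_eqI)
  show "AE x in half_line. rep (mult_op m F) x = rep G x"
    using AE_rep_mult_op[OF assms(1), of F] assms(2) by eventually_elim simp
qed

lemma
  assumes "bounded_mult m"
  shows mult_op_add: "mult_op m (F + G) = mult_op m F + mult_op m G"
    and mult_op_diff: "mult_op m (F - G) = mult_op m F - mult_op m G"
    and mult_op_cscale: "mult_op m (c *\<^sub>c F) = c *\<^sub>c mult_op m F"
proof -
  note * = AE_rep_mult_op[OF assms, of F] AE_rep_mult_op[OF assms, of G]
  have "AE x in half_line. rep (mult_op m F + mult_op m G) x = m x * rep (F + G) x"
    using * AE_rep_add[of F G] AE_rep_add[of "mult_op m F" "mult_op m G"]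
    by eventually_elim (simp add: algebra_simps)
  then show "mult_op m (F + G) = mult_op m F + mult_op m G" by (rule mult_op_eqI[OF assms])
  have "AE x in half_line. rep (mult_op m F - mult_op m G) x = m x * rep (F - G) x"
    using * AE_rep_diff[of F G] AE_rep_diff[of "mult_op m F" "mult_op m G"]
    by eventually_elim (simp add: right_diff_distrib)
  then show "mult_op m (F - G) = mult_op m F - mult_op m G" by (rule mult_op_eqI[OF assms])
  have "AE x in half_line. rep (c *\<^sub>c mult_op m F) x = m x * rep (c *\<^sub>c F) x"
    using * AE_rep_cscale[of c F] AE_rep_cscale[of c "mult_op m F"]
    by eventually_elim (simp add: algebra_simps)
  then show "mult_op m (c *\<^sub>c F) = c *\<^sub>c mult_op m F" by (rule mult_op_eqI[OF assms])
qed

lemma bounded_linear_mult_op: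
  assumes "bounded_mult m"
  shows "bounded_linear (mult_op m)"
proof -
  obtain B where B: "\<And>x. x > 0 \<Longrightarrow> cmod (m x) \<le> B"
    using assms by (auto simp: bounded_mult_def)
  show ?thesis
    by (rule bounded_linear_intro[where K = B])
      (use norm_mult_op_le[OF assms B] in
        \<open>auto simp: mult_op_add[OF assms] mult_op_cscale[OF assms] scaleR_eq_cscale mult.commute\<close>)
qed

lemma cinner_mult_op:
  assumes "bounded_mult m"
  shows "cinner (mult_op m F) G = cinner F (mult_op (\<lambda>x. cnj (m x)) G)"
proof -
  have m: "bounded_mult (\<lambda>x. cnj (m x))"
    using assms by (auto simp: bounded_mult_def)
  show ?thesis
    unfolding cinner_eq
  proof (rule integral_cong_AE)
    show "AE x in half_line. rep (mult_op m F) x * cnj (rep G x)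
        = rep F x * cnj (rep (mult_op (\<lambda>x. cnj (m x)) G) x)"
      using AE_rep_mult_op[OF assms, of F] AE_rep_mult_op[OF m, of G] by eventually_elim simp
  qed measurable
qed

text \<open>An unbounded multiplication operator is represented by its graph on classes: the
  relation says that \<open>F\<close> is in the domain of multiplication by \<open>w\<close> and
  that \<open>G\<close> is its image.\<close>

definition mult_rel :: "(real \<Rightarrow> real) \<Rightarrow> hl2 \<Rightarrow> hl2 \<Rightarrow> bool" where
  "mult_rel w F G \<longleftrightarrow> (AE x in half_line. rep G x = of_real (w x) * rep F x)"

lemma bounded_mult_resolvent:
  fixes w :: "real \<Rightarrow> real"
  assumes [measurable]: "w \<in> borel_measurable half_line"
  shows "bounded_mult (\<lambda>x. of_real (1 / (1 + \<bar>w x\<bar>)))"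
    and "bounded_mult (\<lambda>x. of_real (w x / (1 + \<bar>w x\<bar>)))"
proof -
  show "bounded_mult (\<lambda>x. of_real (1 / (1 + \<bar>w x\<bar>)))"
    by (rule bounded_multI[where B = 1]) (measurable, simp add: norm_divide flip: of_real_add)
  show "bounded_mult (\<lambda>x. of_real (w x / (1 + \<bar>w x\<bar>)))"
    by (rule bounded_multI[where B = 1]) (measurable, simp add: norm_divide flip: of_real_add)
qed

text \<open>Dividing the defining equation by \<open>1 + \<bar>w x\<bar>\<close> leaves bounded
  multipliers on both sides. As bounded operators are continuous, this equivalence is what makes the
  graph closed.\<close>

lemma mult_rel_iff:
  assumes w: "w \<in> borel_measurable half_line"
  shows "mult_rel w F G \<longleftrightarrow>
    mult_op (\<lambda>x. of_real (1 / (1 + \<bar>w x\<bar>))) G = mult_op (\<lambda>x. of_real (w x / (1 + \<bar>w x\<bar>))) F"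
    (is "_ \<longleftrightarrow> mult_op ?m G = mult_op ?n F")
proof
  note m = bounded_mult_resolvent(1)[OF w] and n = bounded_mult_resolvent(2)[OF w]
  have pos: "complex_of_real (1 + \<bar>w x\<bar>) \<noteq> 0" for x
    using abs_ge_zero[of "w x"] by (simp only: of_real_eq_0_iff)
  show "mult_op ?m G = mult_op ?n F" if "mult_rel w F G"
  proof (rule mult_op_eqI[OF m])
    show "AE x in half_line. rep (mult_op ?n F) x = ?m x * rep G x"
      using that AE_rep_mult_op[OF n, of F] unfolding mult_rel_def by eventually_elim simp
  qed
  assume eq: "mult_op ?m G = mult_op ?n F"
  from AE_rep_mult_op[OF m, of G] AE_rep_mult_op[OF n, of F] show "mult_rel w F G"
    unfolding mult_rel_def
  proof eventually_elim
    case (elim x)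
    then have "of_real (1 / (1 + \<bar>w x\<bar>)) * rep G x = of_real (w x / (1 + \<bar>w x\<bar>)) * rep F x"
      using eq by (metis (no_types))
    then show ?case
      using pos[of x] by (auto simp: nonzero_divide_eq_eq simp del: of_real_add)
  qed
qed

lemma mult_rel_closed:
  assumes w: "w \<in> borel_measurable half_line"
    and "\<And>n. mult_rel w (F n) (G n)" "F \<longlonglongrightarrow> F'" "G \<longlonglongrightarrow> G'"
  shows "mult_rel w F' G'"
proof -
  note m = bounded_mult_resolvent(1)[OF w] and n = bounded_mult_resolvent(2)[OF w]
  have "(\<lambda>k. mult_op (\<lambda>x. of_real (1 / (1 + \<bar>w x\<bar>))) (G k))
      \<longlonglongrightarrow> mult_op (\<lambda>x. of_real (1 / (1 + \<bar>w x\<bar>))) G'"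
    by (rule bounded_linear.tendsto[OF bounded_linear_mult_op[OF m] assms(4)])
  moreover have "(\<lambda>k. mult_op (\<lambda>x. of_real (w x / (1 + \<bar>w x\<bar>))) (F k))
      \<longlonglongrightarrow> mult_op (\<lambda>x. of_real (w x / (1 + \<bar>w x\<bar>))) F'"
    by (rule bounded_linear.tendsto[OF bounded_linear_mult_op[OF n] assms(3)])
  ultimately show ?thesis
    using assms(2) unfolding mult_rel_iff[OF w] by (auto dest: LIMSEQ_unique)
qed

section \<open>Uniqueness of the Gaussian transform\<close>

lemma sigma_finite_half_line: "sigma_finite_measure half_line"
proof
  show "\<exists>A. countable A \<and> A \<subseteq> sets half_line \<and> \<Union> A = space half_line \<and> (\<forall>a\<in>A. emeasure half_line a \<noteq> \<infinity>)"
  proof (intro exI conjI ballI)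
    show "countable (range (\<lambda>n::nat. {0<..<real n}))" by simp
    show "range (\<lambda>n::nat. {0<..<real n}) \<subseteq> sets half_line"
      by (auto simp: sets_restrict_space image_iff intro!: bexI[of _ "{0<..<real _}"])
    show "\<Union> (range (\<lambda>n::nat. {0<..<real n})) = space half_line"
      using reals_Archimedean2 by auto
    fix a assume "a \<in> range (\<lambda>n::nat. {0<..<real n})"
    then obtain n :: nat where a: "a = {0<..<real n}" by auto
    have "emeasure half_line a = emeasure lebesgue a"
      unfolding a by (subst emeasure_restrict_space) auto
    then show "emeasure half_line a \<noteq> \<infinity>"
      unfolding a by (cases "n = 0") (auto simp: emeasure_lborel_Ioo)
  qed
qed

lemma borel_measurable_half_line [measurable]:
  "(\<lambda>x. x) \<in> borel_measurable half_line"
  using id_borel_measurable_lebesgue_on[of "{0<..}"] by (simp add: id_def)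

lemma measurable_half_line_comp: "f \<in> borel_measurable borel \<Longrightarrow> f \<in> borel_measurable half_line"
  using measurable_compose[OF borel_measurable_half_line] by auto

lemma AE_half_line_null:
  assumes "N \<in> null_sets lborel"
  shows "AE x in half_line. x \<notin> N"
proof -
  have "AE x in lebesgue. x \<notin> N"
    using assms AE_not_in null_sets_completionI by blast
  then show ?thesis by (subst AE_restrict_space_iff) (auto elim: eventually_mono)
qed

text \<open>The half-lines \<open>{..<b}\<close> are stable under intersection and generate the
  Borel sets, so by Dynkin's argument the integral of \<open>h\<close> over every Borel set
  vanishes; the total integral serves the complements. Half-lines with \<open>b \<le> 0\<close> do
  not meet the domain.\<close>

lemma AE_zero_if_initial_integrals_zero:
  fixes h :: "real \<Rightarrow> complex"
  assumes h: "integrable half_line h"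
    and tot: "(LINT x|half_line. h x) = 0"
    and zero: "\<And>b. b > 0 \<Longrightarrow> (LINT x|half_line. indicator {..<b} x *\<^sub>R h x) = 0"
  shows "AE x in half_line. h x = 0"
proof -
  interpret sigma_finite_measure half_line by (rule sigma_finite_half_line)
  have int: "integrable half_line (\<lambda>x. indicat_real A x *\<^sub>R h x)" if "A \<in> sets borel" for A
  proof (rule Bochner_Integration.integrable_bound[OF h])
    have [measurable]: "h \<in> borel_measurable half_line" using h by auto
    have "indicat_real A \<in> borel_measurable half_line"
      by (rule measurable_half_line_comp) (use that in simp)
    then show "(\<lambda>x. indicat_real A x *\<^sub>R h x) \<in> borel_measurable half_line" by measurable
  qed (auto simp: indicator_def)
  have borel: "(LINT x|half_line. indicat_real A x *\<^sub>R h x) = 0" if "A \<in> sets borel" for A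
  proof -
    have "Int_stable (range lessThan :: real set set)"
    proof -
      have "{..<a} \<inter> {..<b} = {..<min a b}" for a b :: real by auto
      then show ?thesis by (auto simp: Int_stable_def)
    qed
    moreover have "range lessThan \<subseteq> Pow (UNIV :: real set)" by auto
    moreover have "A \<in> sigma_sets UNIV (range lessThan)"
      using that unfolding borel_Iio by simp
    ultimately show ?thesis
    proof (induct A rule: sigma_sets_induct_disjoint)
      case (basic A)
      then obtain b where A: "A = {..<b}" by auto
      show ?case
      proof (cases "b > 0")
        case False
        then have "(LINT x|half_line. indicat_real A x *\<^sub>R h x) = (LINT x|half_line. 0)"
          by (intro Bochner_Integration.integral_cong) (auto simp: A indicator_def)
        then show ?thesis by simp
      qed (use zero A in auto)
    next
      case empty then show ?case by simp
    next
      case (compl A)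
      then have A: "A \<in> sets borel" unfolding borel_Iio by simp
      have "(LINT x|half_line. indicat_real (UNIV - A) x *\<^sub>R h x)
          = (LINT x|half_line. h x - indicat_real A x *\<^sub>R h x)"
        by (intro Bochner_Integration.integral_cong) (auto simp: indicator_def)
      also have "\<dots> = 0" using h int[OF A] compl tot by simp
      finally show ?case .
    next
      case (union A)
      then have A: "A i \<in> sets borel" for i unfolding borel_Iio by auto
      have "(\<lambda>n. LINT x|half_line. (\<Sum>i<n. indicat_real (A i) x *\<^sub>R h x))
          \<longlonglongrightarrow> (LINT x|half_line. indicat_real (\<Union>i. A i) x *\<^sub>R h x)"
      proof (rule integral_dominated_convergence[where w = "\<lambda>x. norm (h x)"])
        have [measurable]: "(\<lambda>x. indicat_real (A i) x *\<^sub>R h x) \<in> borel_measurable half_line" for i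
          using int[OF A[of i]] by auto
        show "(\<lambda>x. \<Sum>i<n. indicat_real (A i) x *\<^sub>R h x) \<in> borel_measurable half_line" for n by measurable
        show "(\<lambda>x. indicat_real (\<Union>i. A i) x *\<^sub>R h x) \<in> borel_measurable half_line"
          by (intro borel_measurable_integrable int) (use A in auto)
        show "integrable half_line (\<lambda>x. norm (h x))" using h by simp
        have eq: "(\<Sum>i<n. indicat_real (A i) x *\<^sub>R h x) = indicat_real (\<Union>i<n. A i) x *\<^sub>R h x" for n x
          using union(1) by (subst indicator_UN_disjoint)
            (auto simp: scaleR_sum_left disjoint_family_on_def)
        show "AE x in half_line. norm (\<Sum>i<n. indicat_real (A i) x *\<^sub>R h x) \<le> norm (h x)" for n
          unfolding eq by (auto simp: indicator_def)
        have "(\<lambda>n. indicat_real (\<Union>i<n. A i) x) \<longlonglongrightarrow> indicat_real (\<Union>i. A i) x" for x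
          by (rule LIMSEQ_indicator_UN)
        then show "AE x in half_line. (\<lambda>n. \<Sum>i<n. indicat_real (A i) x *\<^sub>R h x)
            \<longlonglongrightarrow> indicat_real (\<Union>i. A i) x *\<^sub>R h x"
          unfolding eq by (intro always_eventually allI tendsto_scaleR tendsto_const)
      qed
      moreover have "(LINT x|half_line. (\<Sum>i<n. indicat_real (A i) x *\<^sub>R h x)) = 0" for n
        using union(3) by (subst Bochner_Integration.integral_sum) (auto intro!: int A)
      ultimately have "(\<lambda>n. 0) \<longlonglongrightarrow> (LINT x|half_line. indicat_real (\<Union>i. A i) x *\<^sub>R h x)"
        by simp
      then show ?case using LIMSEQ_unique tendsto_const by blast
    qed
  qed
  show ?thesis
  proof (rule density_zero[OF h])
    fix A assume A: "A \<in> sets half_line"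
    then have "A \<in> sets lebesgue" by (auto simp: sets_restrict_space)
    \<comment> \<open>Measurable sets of the half-line are Lebesgue sets; each differs from a Borel
      set by a subset of a Borel null set, to which the integral is blind.\<close>
    then obtain S N N' where S: "A = S \<union> N" "N \<subseteq> N'" "N' \<in> null_sets lborel" "S \<in> sets lborel"
      by (rule sets_completionE)
    have "(LINT x|half_line. indicat_real A x *\<^sub>R h x) = (LINT x|half_line. indicat_real S x *\<^sub>R h x)"
    proof (rule integral_cong_AE)
      show "(\<lambda>x. indicat_real A x *\<^sub>R h x) \<in> borel_measurable half_line"
        using A h by (intro borel_measurable_scaleR borel_measurable_indicator) auto
      show "(\<lambda>x. indicat_real S x *\<^sub>R h x) \<in> borel_measurable half_line"
        using S by (intro borel_measurable_integrable int) auto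
      show "AE x in half_line. indicat_real A x *\<^sub>R h x = indicat_real S x *\<^sub>R h x"
        using AE_half_line_null[OF S(3)] by eventually_elim (use S in \<open>auto simp: indicator_def\<close>)
    qed
    then show "set_lebesgue_integral half_line A h = 0"
      using borel S by (simp add: set_lebesgue_integral_def)
  qed
qed

text \<open>Polynomials in \<open>exp (- x\<^sup>2)\<close> approximate all continuous functions of \<open>exp (- x\<^sup>2)\<close>,
  hence indicators of intervals.\<close>

lemma gaussian_transform_unique:
  fixes D :: "real \<Rightarrow> complex"
  assumes int: "\<And>\<alpha>::real. \<alpha> > 0 \<Longrightarrow> integrable half_line (\<lambda>x. D x * of_real (exp (- \<alpha> * x\<^sup>2)))"
    and zero: "\<And>\<alpha>::real. \<alpha> > 0 \<Longrightarrow> (LINT x|half_line. D x * of_real (exp (- \<alpha> * x\<^sup>2))) = 0"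
  shows "AE x in half_line. D x = 0"
proof -
  \<comment> \<open>Integrability is assumed only against a Gaussian, so one factor
    \<open>exp (- (x^2))\<close> is absorbed into \<open>h\<close>. The power \<open>e x ^ k\<close>
    then corresponds to the parameter \<open>k + 1\<close>, and even the constant polynomial is
    admissible.\<close>
  define h where "h x = D x * of_real (exp (- (x\<^sup>2)))" for x
  have h: "integrable half_line h"
    using int[of 1] by (simp add: h_def[abs_def])
  then have [measurable]: "h \<in> borel_measurable half_line" by auto
  define e :: "real \<Rightarrow> real" where "e x = exp (- (x\<^sup>2))" for x
  have e: "e x \<in> {0..1}" for x by (auto simp: e_def)
  have [measurable]: "e \<in> borel_measurable borel"
    unfolding e_def by (intro borel_measurable_continuous_onI continuous_intros)
  have hp: "h x * of_real (e x ^ k) = D x * of_real (exp (- (real k + 1) * x\<^sup>2))" for k x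
  proof -
    have "exp (- (real k + 1) * x\<^sup>2) = exp (- (x\<^sup>2)) * exp (- (x\<^sup>2)) ^ k"
      by (simp add: algebra_simps flip: exp_of_nat_mult exp_add)
    then show ?thesis by (simp add: h_def e_def)
  qed
  have pint: "integrable half_line (\<lambda>x. h x * of_real (c (e x)))"
    if "continuous_on {0..1} c" for c :: "real \<Rightarrow> real"
  proof -
    have "compact (c ` {0..1})" using that by (intro compact_continuous_image) auto
    then obtain B where B: "\<And>y. y \<in> {0..1} \<Longrightarrow> \<bar>c y\<bar> \<le> B"
      using compact_imp_bounded bounded_iff by (metis image_eqI real_norm_def)
    have m: "(\<lambda>x. indicator {0..1} x *\<^sub>R c x) \<in> borel_measurable borel"
      by (intro borel_measurable_continuous_on_indicator that) auto
    have [measurable]: "(\<lambda>x. indicator {0..1} (e x) *\<^sub>R c (e x)) \<in> borel_measurable half_line"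
      by (rule measurable_half_line_comp[OF measurable_compose[OF _ m]]) measurable
    have "(\<lambda>x. h x * of_real (indicator {0..1} (e x) *\<^sub>R c (e x))) \<in> borel_measurable half_line"
      by measurable
    moreover have "indicator {0..1} (e x) *\<^sub>R c (e x) = c (e x)" for x
      using e[of x] by (simp add: indicator_def)
    ultimately have meas: "(\<lambda>x. h x * of_real (c (e x))) \<in> borel_measurable half_line"
      by (simp only:)
    show ?thesis
    proof (rule Bochner_Integration.integrable_bound)
      show "integrable half_line (\<lambda>x. B * norm (h x))" using h by simp
      show "AE x in half_line. norm (h x * of_real (c (e x))) \<le> norm (B * norm (h x))"
      proof (rule AE_I2)
        fix x
        have "\<bar>c (e x)\<bar> * norm (h x) \<le> B * norm (h x)"
          by (intro mult_right_mono B e) auto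
        then show "norm (h x * of_real (c (e x))) \<le> norm (B * norm (h x))"
          by (simp add: norm_mult mult.commute)
      qed
    qed (rule meas)
  qed
  have cont: "(LINT x|half_line. h x * of_real (c (e x))) = 0"
    if c: "continuous_on {0..1} c" for c :: "real \<Rightarrow> real"
  proof -
    define I where "I = (LINT x|half_line. norm (h x))"
    have I: "I \<ge> 0" by (simp add: I_def)
    have "norm (LINT x|half_line. h x * of_real (c (e x))) \<le> d * I" if "d > 0" for d
    proof -
      obtain g where g: "real_polynomial_function g" "\<And>y. y \<in> {0..1} \<Longrightarrow> \<bar>c y - g y\<bar> < d"
        using Stone_Weierstrass_real_polynomial_function[OF _ c \<open>d > 0\<close>] by auto
      obtain a n where ga: "g = (\<lambda>y. \<Sum>i\<le>n. a i * y ^ i)"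
        using g(1) real_polynomial_function_iff_sum by auto
      have gint: "integrable half_line (\<lambda>x. h x * of_real (g (e x)))"
        by (intro pint) (auto simp: ga intro!: continuous_intros)
      have "(LINT x|half_line. h x * of_real (g (e x)))
          = (LINT x|half_line. (\<Sum>i\<le>n. of_real (a i) * (D x * of_real (exp (- (real i + 1) * x\<^sup>2)))))"
        unfolding hp[symmetric] by (simp add: ga sum_distrib_left mult.left_commute)
      also have "\<dots> = (\<Sum>i\<le>n. of_real (a i) * (LINT x|half_line. D x * of_real (exp (- (real i + 1) * x\<^sup>2))))"
      proof (subst Bochner_Integration.integral_sum)
        show "integrable half_line (\<lambda>x. of_real (a i) * (D x * of_real (exp (- (real i + 1) * x\<^sup>2))))" for i
          by (intro integrable_mult_right int) simp
      qed (rule sum.cong[OF refl], rule integral_mult_right_zero)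
      also have "\<dots> = 0" by (intro sum.neutral ballI) (subst zero; simp)
      finally have "(LINT x|half_line. h x * of_real (c (e x)))
          = (LINT x|half_line. h x * of_real (c (e x)) - h x * of_real (g (e x)))"
        using gint pint[OF c] by simp
      also have "norm \<dots> \<le> (LINT x|half_line. d * norm (h x))"
      proof (rule order.trans[OF integral_norm_bound integral_mono])
        fix x
        have "norm (h x * of_real (c (e x)) - h x * of_real (g (e x))) = norm (h x) * \<bar>c (e x) - g (e x)\<bar>"
          by (simp flip: right_diff_distrib of_real_diff add: norm_mult)
        also have "\<dots> \<le> norm (h x) * d"
          using g(2)[OF e[of x]] by (intro mult_left_mono) auto
        finally show "norm (h x * of_real (c (e x)) - h x * of_real (g (e x))) \<le> d * norm (h x)"
          by (simp add: mult.commute)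
      qed (use gint pint[OF c] h in auto)
      finally show ?thesis by (simp add: I_def)
    qed
    note bnd = this
    have "norm (LINT x|half_line. h x * of_real (c (e x))) \<le> 0"
    proof (rule field_le_epsilon)
      fix d :: real assume "d > 0"
      have "norm (LINT x|half_line. h x * of_real (c (e x))) \<le> d / (I + 1) * I"
        using \<open>d > 0\<close> I by (intro bnd) auto
      also have "\<dots> \<le> d" using \<open>d > 0\<close> I by (simp add: field_simps)
      finally show "norm (LINT x|half_line. h x * of_real (c (e x))) \<le> 0 + d" by simp
    qed
    then show ?thesis by simp
  qed
  have "AE x in half_line. h x = 0"
  proof (rule AE_zero_if_initial_integrals_zero[OF h])
    show "(LINT x|half_line. h x) = 0"
      using cont[of "\<lambda>_. 1"] by simp
    fix b :: real assume b: "b > 0"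
    \<comment> \<open>Piecewise linear ramps starting at \<open>e b\<close>. Since \<open>e\<close>
      is decreasing on the half-line, \<open>e x > e b\<close> means \<open>x < b\<close>, and the
      ramps evaluated at \<open>e x\<close> converge to the indicator of \<open>{..<b}\<close>,
      including the value 0 at \<open>x = b\<close>.\<close>
    define c where "c n y = max 0 (min 1 (real n * (y - e b)))" for n y
    have c: "continuous_on {0..1} (c n)" for n
      unfolding c_def by (intro continuous_intros)
    have lim: "(\<lambda>n. c n (e x)) \<longlonglongrightarrow> indicator {..<b} x" if "x > 0" for x
    proof (cases "x < b")
      case True
      then have "e b < e x" using b that by (simp add: e_def power_strict_mono)
      then have "\<forall>\<^sub>F n in sequentially. 1 \<le> real n * (e x - e b)"
        using real_arch_simple[of "1 / (e x - e b)"]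
        by (intro eventually_sequentiallyI[of "nat \<lceil>1 / (e x - e b)\<rceil>"])
           (simp add: field_simps nat_le_iff ceiling_le_iff)
      then have "\<forall>\<^sub>F n in sequentially. c n (e x) = indicator {..<b} x"
        by eventually_elim (use True in \<open>auto simp: c_def\<close>)
      then show ?thesis by (rule tendsto_eventually)
    next
      case False
      then have "e x \<le> e b" using b that by (simp add: e_def)
      then have "real n * (e x - e b) \<le> 0" for n by (intro mult_nonneg_nonpos) auto
      then have "c n (e x) = indicator {..<b} x" for n
        using False by (simp add: c_def min.coboundedI2 max_absorb1)
      then show ?thesis by simp
    qed
    have "(\<lambda>n. LINT x|half_line. h x * of_real (c n (e x)))
        \<longlonglongrightarrow> (LINT x|half_line. indicat_real {..<b} x *\<^sub>R h x)"
    proof (rule integral_dominated_convergence[where w = "\<lambda>x. norm (h x)"])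
      show "(\<lambda>x. h x * of_real (c n (e x))) \<in> borel_measurable half_line" for n
        by (rule borel_measurable_integrable[OF pint[OF c]])
      have "indicat_real {..<b} \<in> borel_measurable half_line"
        by (rule measurable_half_line_comp) simp
      then show "(\<lambda>x. indicat_real {..<b} x *\<^sub>R h x) \<in> borel_measurable half_line" by measurable
      show "AE x in half_line. (\<lambda>n. h x * of_real (c n (e x))) \<longlonglongrightarrow> indicat_real {..<b} x *\<^sub>R h x"
      proof (rule AE_I2)
        fix x assume "x \<in> space half_line"
        then have "(\<lambda>n. h x * of_real (c n (e x))) \<longlonglongrightarrow> h x * of_real (indicat_real {..<b} x)"
          by (intro tendsto_intros lim) auto
        then show "(\<lambda>n. h x * of_real (c n (e x))) \<longlonglongrightarrow> indicat_real {..<b} x *\<^sub>R h x"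
          by (simp add: scaleR_conv_of_real mult.commute)
      qed
      show "AE x in half_line. norm (h x * of_real (c n (e x))) \<le> norm (h x)" for n
        by (auto simp: norm_mult c_def intro!: mult_left_le)
    qed (use h in auto)
    then show "(LINT x|half_line. indicat_real {..<b} x *\<^sub>R h x) = 0"
      unfolding cont[OF c] using LIMSEQ_unique tendsto_const by blast
  qed
  then show ?thesis
    by eventually_elim (simp add: h_def)
qed

section \<open>Gaussian moments\<close>

text \<open>The substitution \<open>t = a x^2\<close> in Euler's integral for the Gamma function;
  the exponent \<open>2 * \<mu> + 1\<close> is the one produced by \<open>t powr \<mu>\<close>
  together with the Jacobian \<open>2 a x\<close>.\<close>

lemma
  fixes a \<mu> :: real
  assumes \<mu>: "\<mu> > -1" and a: "a > 0"
  shows integrable_gaussian_moment: "integrable half_line (\<lambda>x. x powr (2 * \<mu> + 1) * exp (- a * x\<^sup>2))"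
    and gaussian_moment: "(LINT x|half_line. x powr (2 * \<mu> + 1) * exp (- a * x\<^sup>2))
      = Gamma (\<mu> + 1) / 2 * a powr (- (\<mu> + 1))"
proof -
  define f :: "real \<Rightarrow> real" where "f t = t powr \<mu> / exp t" for t
  have "(f has_integral Gamma (\<mu> + 1)) {0..}"
    using Gamma_integral_real[of "\<mu> + 1"] \<mu> by (simp add: f_def[abs_def])
  moreover have "(f has_integral Gamma (\<mu> + 1)) {0..} \<longleftrightarrow> (f has_integral Gamma (\<mu> + 1)) {0<..}"
    by (intro has_integral_spike_set_eq; rule negligible_subset[of "{0}"]) auto
  ultimately have hi: "(f has_integral Gamma (\<mu> + 1)) {0<..}" by simp
  have "(f absolutely_integrable_on {0<..})"
    by (rule nonnegative_absolutely_integrable_1) (use hi in \<open>auto simp: f_def has_integral_iff\<close>)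
  moreover have "(\<lambda>x. a * x\<^sup>2) ` {0<..} = {0<..}"
  proof (intro equalityI subsetI)
    fix y :: real assume "y \<in> {0<..}"
    then show "y \<in> (\<lambda>x. a * x\<^sup>2) ` {0<..}"
      using a by (intro image_eqI[of _ _ "sqrt (y / a)"]) auto
  qed (use a in auto)
  ultimately have fint: "f absolutely_integrable_on (\<lambda>x. a * x\<^sup>2) ` {0<..} \<and>
      integral ((\<lambda>x. a * x\<^sup>2) ` {0<..}) f = Gamma (\<mu> + 1)"
    using hi by (simp add: integral_unique)
  have "(\<lambda>x. \<bar>2 * a * x\<bar> * f (a * x\<^sup>2)) absolutely_integrable_on {0<..} \<and>
      integral {0<..} (\<lambda>x. \<bar>2 * a * x\<bar> * f (a * x\<^sup>2)) = Gamma (\<mu> + 1)"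
  proof (subst has_absolute_integral_change_of_variables_1'[where g = "\<lambda>x. a * x\<^sup>2"])
    show "((\<lambda>x. a * x\<^sup>2) has_real_derivative 2 * a * x) (at x within {0<..})" for x
      by (auto intro!: derivative_eq_intros)
    show "inj_on (\<lambda>x. a * x\<^sup>2) {0<..}"
      using a by (auto intro!: inj_onI simp: power2_eq_iff)
  qed (use fint in auto)
  then have 1: "integrable half_line (\<lambda>x. \<bar>2 * a * x\<bar> * f (a * x\<^sup>2))"
      and 2: "(LINT x|half_line. \<bar>2 * a * x\<bar> * f (a * x\<^sup>2)) = Gamma (\<mu> + 1)"
    using lebesgue_integral_eq_integral[OF absolutely_integrable_imp_integrable, of "{0<..}" "\<lambda>x. \<bar>2 * a * x\<bar> * f (a * x\<^sup>2)"]
    by (auto intro: absolutely_integrable_imp_integrable)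
  have eq: "\<bar>2 * a * x\<bar> * f (a * x\<^sup>2) = 2 * a powr (\<mu> + 1) * (x powr (2 * \<mu> + 1) * exp (- a * x\<^sup>2))"
    if "x > 0" for x
  proof -
    have "(x\<^sup>2) powr \<mu> = x powr (2 * \<mu>)"
      using that by (simp add: powr_powr flip: powr_numeral)
    then show ?thesis
      using that a by (simp add: f_def powr_mult powr_add exp_minus divide_inverse abs_mult)
  qed
  have "integrable half_line (\<lambda>x. 2 * a powr (\<mu> + 1) * (x powr (2 * \<mu> + 1) * exp (- a * x\<^sup>2)))"
    using 1 by (rule Bochner_Integration.integrable_cong[THEN iffD1, rotated -1]) (auto simp: eq)
  then show "integrable half_line (\<lambda>x. x powr (2 * \<mu> + 1) * exp (- a * x\<^sup>2))"
    using a by simp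
  have "2 * a powr (\<mu> + 1) * (LINT x|half_line. x powr (2 * \<mu> + 1) * exp (- a * x\<^sup>2)) = Gamma (\<mu> + 1)"
    unfolding 2[symmetric] integral_mult_right_zero[symmetric]
    by (rule Bochner_Integration.integral_cong) (auto simp: eq)
  then show "(LINT x|half_line. x powr (2 * \<mu> + 1) * exp (- a * x\<^sup>2)) = Gamma (\<mu> + 1) / 2 * a powr (- (\<mu> + 1))"
    using a by (simp add: powr_minus field_simps del: minus_add_distrib)
qed

lemma Gamma_add_nat:
  fixes x :: real
  assumes "x > 0"
  shows "Gamma (x + real m) = pochhammer x m * Gamma x"
  using pochhammer_Gamma[of x m] assms Gamma_real_pos[OF assms] nonpos_Ints_nonpos[of x]
  by (force simp: field_simps)

lemma powr_of_real_mult_complex: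
  fixes r :: real and z s :: complex
  assumes "r > 0"
  shows "(of_real r * z) powr s = of_real r powr s * z powr s"
  using powr_times_real_left[of "of_real r" z s] assms by simp

lemma of_real_gbinomial: "of_real a gchoose n = complex_of_real (a gchoose n)"
  by (simp add: gbinomial_prod_rev)

text \<open>The inequality \<open>cmod (z - a) < a\<close> is equivalent to |z|^2 < 2 a Re z, so
  every large \<open>a\<close> will do. It places \<open>(z - a) / a\<close> inside the disc of
  convergence of the binomial series.\<close>

lemma shift_in_disc:
  assumes "Re z > 0"
  obtains a :: real where "a > 0" "cmod (z - of_real a) < a"
proof
  define a where "a = ((cmod z)\<^sup>2 / Re z) + 1"
  show a: "a > 0" using assms by (simp add: a_def add_nonneg_pos)
  have "a * Re z = (cmod z)\<^sup>2 + Re z" using assms by (simp add: a_def field_simps)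
  then have "(cmod z)\<^sup>2 < 2 * (a * Re z)" using assms zero_le_power2[of "cmod z"] by linarith
  then have "(cmod z)\<^sup>2 + a * (a - 2 * Re z) < a\<^sup>2"
    by (simp add: algebra_simps power2_eq_square)
  moreover have "(cmod (z - of_real a))\<^sup>2 = (cmod z)\<^sup>2 + a * (a - 2 * Re z)"
    unfolding cmod_power2 by (simp add: power2_eq_square algebra_simps)
  ultimately show "cmod (z - of_real a) < a"
    using a by (intro power2_less_imp_less[of "cmod (z - of_real a)" a]) auto
qed

text \<open>The complex case follows from the real one by expanding \<open>exp (- (z - a) x\<^sup>2)\<close> for a
  sufficiently large real \<open>a\<close>; the result is a binomial series.\<close>

lemma gaussian_moment_complex:
  fixes z :: complex and \<mu> :: real
  assumes \<mu>: "\<mu> > -1" and z: "Re z > 0"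
  shows "(LINT x|half_line. of_real (x powr (2 * \<mu> + 1)) * exp (- z * of_real (x\<^sup>2)))
      = of_real (Gamma (\<mu> + 1) / 2) * z powr (- of_real (\<mu> + 1))"
proof -
  obtain a where a: "a > 0" "cmod (z - of_real a) < a" using shift_in_disc[OF z] .
  define w where "w = z - of_real a"
  define c where "c = Gamma (\<mu> + 1) / 2 * a powr (- (\<mu> + 1))"
  define F where "F m x = of_real (x powr (2 * \<mu> + 1) * exp (- a * x\<^sup>2)) * ((- w * of_real (x\<^sup>2)) ^ m /\<^sub>R fact m)"
    for m x
  have F_eq: "F m x = ((- w) ^ m /\<^sub>R fact m) * of_real (x powr (2 * (\<mu> + real m) + 1) * exp (- a * x\<^sup>2))"
    if "x > 0" for m x
  proof -
    have "x powr (2 * (\<mu> + real m) + 1) = x powr (2 * \<mu> + 1) * x powr (real (2 * m))"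
      by (simp add: powr_add[symmetric] algebra_simps)
    also have "x powr (real (2 * m)) = (x\<^sup>2) ^ m"
      using that by (subst powr_realpow) (auto simp: power_mult)
    finally show ?thesis
      unfolding F_def by (subst power_mult_distrib) (simp add: scaleR_conv_of_real)
  qed
  have mom: "(LINT x|half_line. x powr (2 * (\<mu> + real m) + 1) * exp (- a * x\<^sup>2))
      = c * (pochhammer (\<mu> + 1) m / a ^ m)" for m
  proof -
    have "a powr (- (\<mu> + real m + 1)) = a powr (- (\<mu> + 1)) / a ^ m"
      using a by (simp add: powr_diff powr_minus powr_add powr_realpow field_simps)
    moreover have "\<mu> + 1 + real m = \<mu> + real m + 1" by simp
    then have "Gamma (\<mu> + real m + 1) = pochhammer (\<mu> + 1) m * Gamma (\<mu> + 1)"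
      using Gamma_add_nat[of "\<mu> + 1" m] \<mu> by (simp only:)
    moreover have "(LINT x|half_line. x powr (2 * (\<mu> + real m) + 1) * exp (- a * x\<^sup>2))
        = Gamma (\<mu> + real m + 1) / 2 * a powr (- (\<mu> + real m + 1))"
      using \<mu> by (intro gaussian_moment a) auto
    ultimately have "(LINT x|half_line. x powr (2 * (\<mu> + real m) + 1) * exp (- a * x\<^sup>2))
        = pochhammer (\<mu> + 1) m * Gamma (\<mu> + 1) / 2 * (a powr (- (\<mu> + 1)) / a ^ m)"
      by (simp only:)
    then show ?thesis unfolding c_def by (simp only: times_divide_eq_left times_divide_eq_right mult_ac)
  qed
  have int: "integrable half_line (F m)" for m
  proof -
    have "integrable half_line (\<lambda>x. ((- w) ^ m /\<^sub>R fact m) *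
        complex_of_real (x powr (2 * (\<mu> + real m) + 1) * exp (- a * x\<^sup>2)))"
      using \<mu> a by (intro integrable_mult_right integrable_of_real integrable_gaussian_moment) auto
    then show ?thesis
      by (rule Bochner_Integration.integrable_cong[THEN iffD1, rotated -1]) (auto simp: F_eq)
  qed
  have q: "cmod w / a < 1" using a by (simp add: w_def)
  have binom: "((- (\<mu> + 1)) gchoose m) = (-1) ^ m * pochhammer (\<mu> + 1) m / fact m" for m
    by (simp only: gbinomial_pochhammer minus_minus)
  have nint: "(LINT x|half_line. norm (F m x)) = c * (pochhammer (\<mu> + 1) m / fact m * (cmod w / a) ^ m)" for m
  proof -
    have "(LINT x|half_line. norm (F m x))
        = (LINT x|half_line. (cmod w ^ m / fact m) * (x powr (2 * (\<mu> + real m) + 1) * exp (- a * x\<^sup>2)))"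
      by (rule Bochner_Integration.integral_cong)
        (auto simp: F_eq norm_mult norm_power divide_inverse)
    also have "\<dots> = (cmod w ^ m / fact m) * (c * (pochhammer (\<mu> + 1) m / a ^ m))"
      unfolding integral_mult_right_zero mom ..
    finally show ?thesis by (simp add: field_simps power_divide)
  qed
  \<comment> \<open>At the negative point \<open>- (cmod w / a)\<close> the signs of the binomial
    coefficients are cancelled, so convergence of the binomial series there is convergence of the
    series of norms.\<close>
  have "summable (\<lambda>m. (complex_of_real (- (\<mu> + 1)) gchoose m) * (of_real (- (cmod w / a))) ^ m)"
    by (rule sums_summable[OF gen_binomial_complex]) (use q a in \<open>simp add: norm_divide\<close>)
  also have "(\<lambda>m. (complex_of_real (- (\<mu> + 1)) gchoose m) * (of_real (- (cmod w / a))) ^ m)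
      = (\<lambda>m. of_real (pochhammer (\<mu> + 1) m / fact m * (cmod w / a) ^ m))"
  proof
    fix m
    have "complex_of_real (((- (\<mu> + 1)) gchoose m) * (- (cmod w / a)) ^ m)
        = of_real (pochhammer (\<mu> + 1) m / fact m * (cmod w / a) ^ m)"
      unfolding binom by (subst power_minus) simp
    then show "(complex_of_real (- (\<mu> + 1)) gchoose m) * (of_real (- (cmod w / a))) ^ m
        = of_real (pochhammer (\<mu> + 1) m / fact m * (cmod w / a) ^ m)"
      by (simp only: of_real_mult of_real_power of_real_gbinomial)
  qed
  finally have sm: "summable (\<lambda>m. pochhammer (\<mu> + 1) m / fact m * (cmod w / a) ^ m)"
    by (simp only: summable_of_real_iff)
  have sums: "(\<lambda>m. integral\<^sup>L half_line (F m)) sums (LINT x|half_line. (\<Sum>m. F m x))"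
  proof (rule sums_integral[OF int])
    show "summable (\<lambda>m. LINT x|half_line. norm (F m x))"
      unfolding nint by (intro summable_mult sm)
    show "AE x in half_line. summable (\<lambda>m. norm (F m x))"
      unfolding F_def norm_mult by (intro AE_I2 summable_mult summable_norm_exp)
  qed
  have "(\<Sum>m. F m x) = of_real (x powr (2 * \<mu> + 1)) * exp (- z * of_real (x\<^sup>2))" for x
  proof -
    have "(\<Sum>m. F m x) = of_real (x powr (2 * \<mu> + 1) * exp (- a * x\<^sup>2)) * exp (- w * of_real (x\<^sup>2))"
      unfolding F_def exp_def by (rule suminf_mult[symmetric, THEN sym]) (rule summable_exp_generic)
    also have "\<dots> = of_real (x powr (2 * \<mu> + 1)) * exp (- z * of_real (x\<^sup>2))"
      by (simp add: w_def exp_of_real[symmetric] exp_add[symmetric] algebra_simps)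
    finally show ?thesis .
  qed
  with sums have 1: "(\<lambda>m. integral\<^sup>L half_line (F m)) sums
      (LINT x|half_line. of_real (x powr (2 * \<mu> + 1)) * exp (- z * of_real (x\<^sup>2)))"
    by simp
  have Fint: "integral\<^sup>L half_line (F m) = of_real c * ((complex_of_real (- (\<mu> + 1)) gchoose m) * (w / of_real a) ^ m)" for m
  proof -
    have "integral\<^sup>L half_line (F m) = (LINT x|half_line. ((- w) ^ m /\<^sub>R fact m) *
        complex_of_real (x powr (2 * (\<mu> + real m) + 1) * exp (- a * x\<^sup>2)))"
      by (rule Bochner_Integration.integral_cong) (auto simp: F_eq)
    also have "\<dots> = ((- w) ^ m /\<^sub>R fact m) * of_real (c * (pochhammer (\<mu> + 1) m / a ^ m))"
      unfolding integral_mult_right_zero integral_complex_of_real mom ..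
    also have "\<dots> = of_real c * (of_real ((- (\<mu> + 1)) gchoose m) * (w / of_real a) ^ m)"
      unfolding binom using power_minus[of w m]
      by (simp add: scaleR_conv_of_real field_simps power_divide)
    finally show ?thesis by (simp only: of_real_gbinomial)
  qed
  have "(\<lambda>m. integral\<^sup>L half_line (F m)) sums (of_real c * (1 + w / of_real a) powr (of_real (- (\<mu> + 1))))"
    unfolding Fint using q a by (intro sums_mult gen_binomial_complex) (simp add: norm_divide)
  from sums_unique2[OF 1 this]
  have "(LINT x|half_line. of_real (x powr (2 * \<mu> + 1)) * exp (- z * of_real (x\<^sup>2)))
      = of_real c * (1 + w / of_real a) powr (of_real (- (\<mu> + 1)))" .
  also have "\<dots> = of_real (Gamma (\<mu> + 1) / 2) * (of_real a * (1 + w / of_real a)) powr (of_real (- (\<mu> + 1)))"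
    using a by (subst powr_of_real_mult_complex) (simp_all add: c_def powr_of_real[symmetric])
  also have "of_real a * (1 + w / of_real a) = z"
    using a by (simp add: w_def field_simps)
  finally show ?thesis by simp
qed

lemma integrable_gaussian_moment_complex:
  fixes z :: complex and \<mu> :: real
  assumes "\<mu> > -1" "Re z > 0"
  shows "integrable half_line (\<lambda>x. of_real (x powr (2 * \<mu> + 1)) * exp (- z * of_real (x\<^sup>2)))"
proof (rule Bochner_Integration.integrable_bound[OF integrable_gaussian_moment[OF assms]])
  show "(\<lambda>x. of_real (x powr (2 * \<mu> + 1)) * exp (- z * of_real (x\<^sup>2))) \<in> borel_measurable half_line"
  proof -
    have [measurable]: "(\<lambda>x. exp (- z * complex_of_real (x\<^sup>2))) \<in> borel_measurable half_line"
      by (intro measurable_half_line_comp borel_measurable_continuous_onI continuous_intros)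
    show ?thesis by measurable
  qed
qed (auto simp: norm_mult)

text \<open>Dominated convergence with the majorant \<open>(B + B0)^2\<close> times the squared
  modulus of \<open>F\<close>; as that theorem speaks of sequences, the limit at 0 is tested along
  sequences avoiding 0. It gives strong continuity of groups and of cutoffs alike.\<close>

lemma mult_op_tendsto:
  fixes m :: "real \<Rightarrow> real \<Rightarrow> complex"
  assumes m: "\<And>t. t \<noteq> 0 \<Longrightarrow> m t \<in> borel_measurable half_line"
      "\<And>t x. t \<noteq> 0 \<Longrightarrow> x > 0 \<Longrightarrow> cmod (m t x) \<le> B"
    and m0: "bounded_mult m0"
    and lim: "\<And>x. x > 0 \<Longrightarrow> ((\<lambda>t. m t x) \<longlongrightarrow> m0 x) (at 0)"
  shows "((\<lambda>t. mult_op (m t) F) \<longlongrightarrow> mult_op m0 F) (at 0)"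
  unfolding tendsto_at_iff_sequentially comp_def
proof (intro allI impI)
  fix X :: "nat \<Rightarrow> real"
  assume X: "\<forall>i. X i \<in> UNIV - {0}" "X \<longlonglongrightarrow> 0"
  have X0: "X n \<noteq> 0" for n using X(1) by auto
  have bm: "bounded_mult (m (X n))" for n
    using m X0 by (intro bounded_multI[where B = B]) auto
  obtain B0 where B0: "\<And>x. x > 0 \<Longrightarrow> cmod (m0 x) \<le> B0"
    using m0 by (auto simp: bounded_mult_def)
  have meas [measurable]: "m0 \<in> borel_measurable half_line" "m (X n) \<in> borel_measurable half_line" for n
    using m0 bm by (auto simp: bounded_mult_def)
  have eq: "(norm (mult_op (m (X n)) F - mult_op m0 F))\<^sup>2
      = (LINT x|half_line. (cmod (m (X n) x - m0 x))\<^sup>2 * (cmod (rep F x))\<^sup>2)" for n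
    unfolding norm_sq_eq
  proof (rule integral_cong_AE)
    show "AE x in half_line. (cmod (rep (mult_op (m (X n)) F - mult_op m0 F) x))\<^sup>2
        = (cmod (m (X n) x - m0 x))\<^sup>2 * (cmod (rep F x))\<^sup>2"
      using AE_rep_diff[of "mult_op (m (X n)) F" "mult_op m0 F"] AE_rep_mult_op[OF bm, of n F]
        AE_rep_mult_op[OF m0, of F]
    proof eventually_elim
      case (elim x)
      have "rep (mult_op (m (X n)) F - mult_op m0 F) x = (m (X n) x - m0 x) * rep F x"
        unfolding elim by (simp add: algebra_simps)
      then show ?case by (simp add: norm_mult power_mult_distrib)
    qed
  qed measurable
  have "(\<lambda>n. LINT x|half_line. (cmod (m (X n) x - m0 x))\<^sup>2 * (cmod (rep F x))\<^sup>2)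
      \<longlonglongrightarrow> (LINT x|half_line. 0)"
  proof (rule integral_dominated_convergence[where w = "\<lambda>x. (B + B0)\<^sup>2 * (cmod (rep F x))\<^sup>2"])
    show "integrable half_line (\<lambda>x. (B + B0)\<^sup>2 * (cmod (rep F x))\<^sup>2)"
      by (intro integrable_mult_right L2_integrable rep_L2)
    show "AE x in half_line. (\<lambda>n. (cmod (m (X n) x - m0 x))\<^sup>2 * (cmod (rep F x))\<^sup>2) \<longlonglongrightarrow> 0"
    proof (rule AE_I2)
      fix x assume "x \<in> space half_line"
      then have "((\<lambda>t. m t x) \<longlongrightarrow> m0 x) (at 0)" by (intro lim) auto
      then have "(\<lambda>n. m (X n) x) \<longlonglongrightarrow> m0 x"
        using X unfolding tendsto_at_iff_sequentially by (auto simp: comp_def)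
      then have "(\<lambda>n. (cmod (m (X n) x - m0 x))\<^sup>2 * (cmod (rep F x))\<^sup>2)
          \<longlonglongrightarrow> (cmod (m0 x - m0 x))\<^sup>2 * (cmod (rep F x))\<^sup>2"
        by (intro tendsto_intros)
      then show "(\<lambda>n. (cmod (m (X n) x - m0 x))\<^sup>2 * (cmod (rep F x))\<^sup>2) \<longlonglongrightarrow> 0"
        by simp
    qed
    show "AE x in half_line. norm ((cmod (m (X n) x - m0 x))\<^sup>2 * (cmod (rep F x))\<^sup>2)
        \<le> (B + B0)\<^sup>2 * (cmod (rep F x))\<^sup>2" for n
    proof (rule AE_I2)
      fix x assume "x \<in> space half_line"
      then have "cmod (m (X n) x) \<le> B" "cmod (m0 x) \<le> B0" using m B0 X0 by auto
      then have "cmod (m (X n) x - m0 x) \<le> B + B0"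
        using norm_triangle_ineq4[of "m (X n) x" "m0 x"] by linarith
      then show "norm ((cmod (m (X n) x - m0 x))\<^sup>2 * (cmod (rep F x))\<^sup>2)
          \<le> (B + B0)\<^sup>2 * (cmod (rep F x))\<^sup>2"
        by (auto intro!: mult_right_mono power_mono)
    qed
  qed measurable
  then have "(\<lambda>n. (norm (mult_op (m (X n)) F - mult_op m0 F))\<^sup>2) \<longlonglongrightarrow> 0"
    unfolding eq by simp
  then have "(\<lambda>n. sqrt ((norm (mult_op (m (X n)) F - mult_op m0 F))\<^sup>2)) \<longlonglongrightarrow> sqrt 0"
    by (rule tendsto_real_sqrt)
  then have "(\<lambda>n. norm (mult_op (m (X n)) F - mult_op m0 F)) \<longlonglongrightarrow> 0" by simp
  then show "(\<lambda>n. mult_op (m (X n)) F) \<longlonglongrightarrow> mult_op m0 F"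
    by (rule LIM_zero_cancel[OF tendsto_norm_zero_cancel])
qed

text \<open>The arguments are below pi/2 and at most pi/2 in modulus, so their sum stays strictly
  inside the principal strip. The second factor is allowed on the imaginary axis because the
  propagator constant involves the power of \<open>4 * \<i> * T\<close>.\<close>

lemma Ln_mult_right_half_plane:
  assumes "Re z > 0" "Re w \<ge> 0" "w \<noteq> 0"
  shows "Ln (z * w) = Ln z + Ln w"
proof -
  have z: "z \<noteq> 0" using assms by auto
  have "\<bar>Im (Ln z)\<bar> < pi / 2" "\<bar>Im (Ln w)\<bar> \<le> pi / 2"
    using assms Re_Ln_pos_lt[OF z] Re_Ln_pos_le[of w] by auto
  then show ?thesis using z assms by (intro Ln_times_simple) auto
qed

lemma powr_mult_right_half_plane:
  assumes "Re z > 0" "Re w \<ge> 0" "w \<noteq> 0"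
  shows "(z * w) powr s = z powr s * w powr s"
  using Ln_mult_right_half_plane[OF assms] assms
  by (auto simp: powr_def ring_distribs exp_add)

lemma Re_inverse_pos: "Re z > 0 \<Longrightarrow> Re (1 / (4 * z)) > 0"
  by (simp add: Re_divide power2_eq_square) (auto intro!: divide_pos_pos add_pos_nonneg)

lemma subspace_closure:
  fixes S :: "'a::real_normed_vector set"
  assumes "subspace S"
  shows "subspace (closure S)"
proof (unfold subspace_def, intro conjI ballI allI)
  show "0 \<in> closure S" using subspace_0[OF assms] closure_subset by auto
  fix x y c assume "x \<in> closure S" "y \<in> closure S"
  then obtain f g where fg: "\<And>n. f n \<in> S" "f \<longlonglongrightarrow> x" "\<And>n. g n \<in> S" "g \<longlonglongrightarrow> y"
    unfolding closure_sequential by auto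
  have "(\<lambda>n. f n + g n) \<longlonglongrightarrow> x + y" "f n + g n \<in> S" for n
    using fg assms by (auto intro!: tendsto_intros intro: subspace_add)
  then show "x + y \<in> closure S"
    unfolding closure_sequential by (intro exI[of _ "\<lambda>n. f n + g n"]) simp
  have "(\<lambda>n. c *\<^sub>R f n) \<longlonglongrightarrow> c *\<^sub>R x" "c *\<^sub>R f n \<in> S" for n
    using fg assms by (auto intro!: tendsto_intros intro: subspace_scale)
  then show "c *\<^sub>R x \<in> closure S"
    unfolding closure_sequential by (intro exI[of _ "\<lambda>n. c *\<^sub>R f n"]) simp
qed

locale bessel =
  fixes \<nu> :: real
  assumes nu_nonneg: "\<nu> \<ge> 0"
begin

section \<open>Gaussians\<close>

definition gs :: "complex \<Rightarrow> real \<Rightarrow> complex" where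
  "gs z x = of_real (x powr (\<nu> + 1/2)) * exp (- z * of_real (x\<^sup>2))"

abbreviation G :: "complex \<Rightarrow> hl2" where "G z \<equiv> cls (gs z)"

abbreviation \<kappa> :: real where "\<kappa> \<equiv> Gamma (\<nu> + 1) / 2"

lemma gs_measurable [measurable]: "gs z \<in> borel_measurable half_line"
proof -
  have [measurable]: "(\<lambda>x. exp (- z * complex_of_real (x\<^sup>2))) \<in> borel_measurable half_line"
    by (intro measurable_half_line_comp borel_measurable_continuous_onI continuous_intros)
  show ?thesis unfolding gs_def by measurable
qed

lemma gs_mult_cnj: "gs z x * cnj (gs w x) = of_real (x powr (2 * \<nu> + 1)) * exp (- (z + cnj w) * of_real (x\<^sup>2))"
proof -
  have "x powr (2 * \<nu> + 1) = x powr (\<nu> + 1/2) * x powr (\<nu> + 1/2)"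
    by (simp flip: powr_add)
  then show ?thesis
    by (simp add: gs_def exp_cnj exp_add[symmetric] algebra_simps)
qed

lemma gs_moment_L2:
  assumes "Re z > 0"
  shows "(\<lambda>x. of_real (x ^ k) * gs z x) \<in> L2"
proof (rule L2I)
  have "integrable half_line (\<lambda>x. x powr (2 * (\<nu> + real k) + 1) * exp (- (2 * Re z) * x\<^sup>2))"
    using assms nu_nonneg by (intro integrable_gaussian_moment) auto
  then show "integrable half_line (\<lambda>x. (cmod (of_real (x ^ k) * gs z x))\<^sup>2)"
  proof (rule Bochner_Integration.integrable_cong[THEN iffD1, rotated -1])
    fix x assume "x \<in> space half_line"
    then have x: "x > 0" by simp
    have 1: "x powr (2 * (\<nu> + real k) + 1) = (x ^ k)\<^sup>2 * (x powr (\<nu> + 1/2))\<^sup>2"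
    proof -
      have "2 * (\<nu> + real k) + 1 = (\<nu> + 1/2) + (\<nu> + 1/2) + real k + real k" by simp
      then show ?thesis
        using x by (simp only: powr_add powr_realpow power2_eq_square) simp
    qed
    have 2: "exp (- (2 * Re z) * x\<^sup>2) = (exp (- (Re z * x\<^sup>2)))\<^sup>2"
      by (simp add: power2_eq_square flip: exp_add)
    have 3: "cmod (of_real (x ^ k) * gs z x) = x ^ k * x powr (\<nu> + 1/2) * exp (- (Re z * x\<^sup>2))"
      using x by (simp add: gs_def norm_mult norm_power)
    show "x powr (2 * (\<nu> + real k) + 1) * exp (- (2 * Re z) * x\<^sup>2) = (cmod (of_real (x ^ k) * gs z x))\<^sup>2"
      unfolding 1 2 3 by (simp add: power_mult_distrib)
  qed simp
qed measurable

lemma gs_L2: "Re z > 0 \<Longrightarrow> gs z \<in> L2"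
  using gs_moment_L2[of z 0] by simp

lemma gs_sq_L2: "Re z > 0 \<Longrightarrow> (\<lambda>x. of_real (x\<^sup>2) * gs z x) \<in> L2"
  using gs_moment_L2[of z 2] by simp

lemma cinner_G:
  assumes "Re z > 0" "Re w > 0"
  shows "cinner (G z) (G w) = \<kappa> * (z + cnj w) powr (- of_real (\<nu> + 1))"
proof -
  have "L2_inner (gs z) (gs w) = \<kappa> * (z + cnj w) powr (- of_real (\<nu> + 1))"
    unfolding L2_inner_def gs_mult_cnj
    using assms nu_nonneg by (intro gaussian_moment_complex) auto
  then show ?thesis using assms by (simp add: cinner_cls gs_L2)
qed

lemma cinner_G_sq:
  assumes "Re z > 0" "Re w > 0"
  shows "cinner (cls (\<lambda>x. of_real (x\<^sup>2) * gs z x)) (G w)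
    = \<kappa> * (\<nu> + 1) * (z + cnj w) powr (- of_real (\<nu> + 2))"
proof -
  have "L2_inner (\<lambda>x. of_real (x\<^sup>2) * gs z x) (gs w)
      = (LINT x|half_line. of_real (x powr (2 * (\<nu> + 1) + 1)) * exp (- (z + cnj w) * of_real (x\<^sup>2)))"
    unfolding L2_inner_def mult.assoc gs_mult_cnj
  proof (rule Bochner_Integration.integral_cong)
    fix x assume "x \<in> space half_line"
    then have x: "x > 0" by simp
    have "x powr (2 * (\<nu> + 1) + 1) = x powr (2 * \<nu> + 1) * x powr 2"
      by (simp flip: powr_add)
    also have "x powr 2 = x\<^sup>2" using x by simp
    finally show "of_real (x\<^sup>2) * (of_real (x powr (2 * \<nu> + 1)) * exp (- (z + cnj w) * of_real (x\<^sup>2)))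
        = of_real (x powr (2 * (\<nu> + 1) + 1)) * exp (- (z + cnj w) * of_real (x\<^sup>2))"
      by simp
  qed simp
  also have "\<dots> = of_real (Gamma (\<nu> + 1 + 1) / 2) * (z + cnj w) powr (- of_real (\<nu> + 1 + 1))"
    using assms nu_nonneg by (intro gaussian_moment_complex) auto
  also have "Gamma (\<nu> + 1 + 1) = (\<nu> + 1) * Gamma (\<nu> + 1)"
    using nu_nonneg by (intro Gamma_plus1) (auto dest: nonpos_Ints_nonpos)
  finally show ?thesis
    unfolding cinner_cls[OF gs_sq_L2[OF assms(1)] gs_L2[OF assms(2)]] by (simp add: add_ac mult_ac)
qed

lemma gs_real_cnj: "cnj (gs (of_real a) x) = gs (of_real a) x"
  by (simp add: gs_def exp_cnj)

lemma gs_real_times: "D x * gs (of_real \<alpha>) x = (D x * of_real (x powr (\<nu> + 1/2))) * of_real (exp (- \<alpha> * x\<^sup>2))"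
  by (simp add: gs_def exp_of_real[symmetric] mult_ac)

text \<open>The uniqueness device of the whole development: identities are tested against real
  Gaussians. \<open>D\<close> itself need not be square integrable, and below it contains terms such
  as \<open>k^2\<close> times a transform.\<close>

lemma gs_total:
  assumes int: "\<And>a. a > 0 \<Longrightarrow> integrable half_line (\<lambda>x. D x * gs (of_real a) x)"
    and zero: "\<And>a. a > 0 \<Longrightarrow> (LINT x|half_line. D x * gs (of_real a) x) = 0"
  shows "AE x in half_line. D x = 0"
proof -
  have "AE x in half_line. D x * of_real (x powr (\<nu> + 1/2)) = 0"
    using int zero unfolding gs_real_times by (intro gaussian_transform_unique)
  moreover have "AE x in half_line. x > 0" by (rule AE_I2) simp
  ultimately show ?thesis by eventually_elim auto
qed

lemma gs_mult_integrable: "f \<in> L2 \<Longrightarrow> a > 0 \<Longrightarrow> integrable half_line (\<lambda>x. f x * gs (of_real a) x)"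
  using L2_inner_integrable[of f "gs (of_real a)"] by (simp add: gs_L2 gs_real_cnj)

lemma cinner_G_real: "cinner F (G (of_real a)) = (LINT x|half_line. rep F x * gs (of_real a) x)" if "a > 0"
  using cinner_cls[OF rep_L2[of F] gs_L2[of "of_real a"]] that by (simp add: L2_inner_def gs_real_cnj)

lemma hl2_eq_0I:
  assumes "\<And>a. a > 0 \<Longrightarrow> cinner F (G (of_real a)) = 0"
  shows "F = 0"
proof (rule hl2_eqI)
  have "AE x in half_line. rep F x = 0"
    using assms by (intro gs_total) (auto simp: cinner_G_real intro!: gs_mult_integrable rep_L2)
  then show "AE x in half_line. rep F x = rep 0 x"
    using AE_rep_zero by eventually_elim simp
qed

section \<open>The Hankel transform\<close>

text \<open>The Hankel transform is not defined by its integral but through its values \<open>HG\<close> on Gaussians,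
  which span a dense subspace: there it is isometric, and \<open>hankel\<close> is the closure of its graph.\<close>

definition hpow :: "complex \<Rightarrow> complex" where
  "hpow z = (2 * z) powr (- of_real (\<nu> + 1))"

text \<open>The value that Weber's integral assigns to the Hankel transform of
  \<open>gs z\<close>.\<close>

definition HG :: "complex \<Rightarrow> hl2" where
  "HG z = hpow z *\<^sub>c G (1 / (4 * z))"

lemma hpow_nonzero: "Re z > 0 \<Longrightarrow> hpow z \<noteq> 0"
  by (auto simp: hpow_def)

lemma hpow_real: "b > 0 \<Longrightarrow> hpow (of_real b) = of_real ((2 * b) powr (- (\<nu> + 1)))"
  unfolding hpow_def by (subst powr_of_real[symmetric]) auto

text \<open>The algebraic core is that \<open>(2 z) (2 b) (1 / (4 z) + 1 / (4 b))\<close> equals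
  \<open>z + b\<close>. Keeping one parameter real allows the powers to be merged: first with a
  positive factor, then with two factors in the right half-plane.\<close>

lemma cinner_HG:
  assumes z: "Re z > 0" and b: "b > 0"
  shows "cinner (HG z) (HG (of_real b)) = cinner (G z) (G (of_real b))"
proof -
  define s where "s = - complex_of_real (\<nu> + 1)"
  have z0: "z \<noteq> 0" using z by auto
  have hb: "cnj (hpow (of_real b)) = hpow (of_real b)"
    using b by (simp add: hpow_real)
  have R: "Re (of_real b / (2 * z) + 1/2) > 0"
  proof -
    have "of_real b / (2 * z) = of_real (2 * b) * (1 / (4 * z))" using z0 by (simp add: field_simps)
    then have "Re (of_real b / (2 * z)) = 2 * b * Re (1 / (4 * z))" by (metis Re_complex_of_real Im_complex_of_real times_complex.sel(1) mult_zero_left diff_zero)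
    then have "Re (of_real b / (2 * z) + 1/2) = 2 * b * Re (1 / (4 * z)) + 1 / 2" by simp
    moreover have "2 * b * Re (1 / (4 * z)) > 0" using Re_inverse_pos[OF z] b by (intro mult_pos_pos) auto
    ultimately show ?thesis by linarith
  qed
  have "cinner (HG z) (HG (of_real b)) = \<kappa> * ((2 * z) powr s * (of_real (2 * b) powr s * (1 / (4 * z) + 1 / (4 * of_real b)) powr s))"
    using cinner_G[of "1 / (4 * z)" "1 / (4 * of_real b)"] Re_inverse_pos[OF z] b
    by (simp add: HG_def cinner_cscale_left cinner_cscale_right hb) (simp add: hpow_def s_def mult_ac)
  also have "of_real (2 * b) powr s * (1 / (4 * z) + 1 / (4 * of_real b)) powr s
      = (of_real b / (2 * z) + 1/2) powr s"
  proof -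
    have "of_real (2 * b) * (1 / (4 * z) + 1 / (4 * of_real b)) = of_real b / (2 * z) + 1/2"
      using b z0 by (simp add: field_simps)
    then show ?thesis
      using b powr_of_real_mult_complex[of "2 * b" "1 / (4 * z) + 1 / (4 * of_real b)" s] by simp
  qed
  also have "(2 * z) powr s * (of_real b / (2 * z) + 1/2) powr s = (2 * z * (of_real b / (2 * z) + 1/2)) powr s"
  proof -
    have "of_real b / (2 * z) + 1/2 \<noteq> 0" using R by (metis less_irrefl zero_complex.sel(1))
    then show ?thesis using z R by (intro powr_mult_right_half_plane[symmetric]) auto
  qed
  also have "2 * z * (of_real b / (2 * z) + 1/2) = z + cnj (of_real b)"
    using z0 by (simp add: field_simps)
  also have "\<kappa> * (z + cnj (of_real b)) powr s = cinner (G z) (G (of_real b))"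
    using z b by (simp add: cinner_G s_def)
  finally show ?thesis .
qed

text \<open>\<open>span\<close> is the real span; including all complex multiples \<open>c\<close>
  makes it a complex subspace of the product space.\<close>

definition hgen :: "(hl2 \<times> hl2) set" where
  "hgen = {(c *\<^sub>c G (of_real a), c *\<^sub>c HG (of_real a)) |c a. a > 0}"

lemma hgen_isometric:
  assumes "p \<in> span hgen" "q \<in> span hgen"
  shows "inner (fst p) (fst q) = inner (snd p) (snd q)"
proof -
  have gg: "inner (fst p) (fst q) = inner (snd p) (snd q)" if "p \<in> hgen" "q \<in> hgen" for p q
    using that cinner_HG[of "of_real _"]
    by (auto simp: hgen_def inner_eq_Re cinner_cscale_left cinner_cscale_right)
  have sub: "subspace {p. inner (fst p) (fst q) = inner (snd p) (snd q)}" for q :: "hl2 \<times> hl2"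
    by (auto simp: subspace_def inner_add_left)
  have sg: "inner (fst p) (fst q) = inner (snd p) (snd q)" if "p \<in> span hgen" "q \<in> hgen" for p q
  proof -
    have "hgen \<subseteq> {p. inner (fst p) (fst q) = inner (snd p) (snd q)}" using gg that(2) by blast
    from span_minimal[OF this sub] show ?thesis using that(1) by blast
  qed
  have "hgen \<subseteq> {q. inner (fst q) (fst p) = inner (snd q) (snd p)}"
    using sg[OF assms(1)] by (auto simp: inner_commute)
  from span_minimal[OF this sub] show ?thesis using assms(2) by (auto simp: inner_commute)
qed

lemma hgen_closure_isometric:
  assumes "p \<in> closure (span hgen)"
  shows "norm (snd p) = norm (fst p)"
proof -
  have "span hgen \<subseteq> {p. norm (snd p) = norm (fst p)}"
    using hgen_isometric by (auto simp: norm_eq_sqrt_inner)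
  moreover have "closed {p :: hl2 \<times> hl2. norm (snd p) = norm (fst p)}"
    by (intro closed_Collect_eq continuous_intros)
  ultimately show ?thesis using assms closure_minimal by blast
qed

lemma HG_inverse:
  assumes "a > 0"
  shows "G (of_real a) = (1 / hpow (of_real (1 / (4 * a)))) *\<^sub>c HG (of_real (1 / (4 * a)))"
proof -
  have "Re (of_real (1 / (4 * a))) > 0" using assms by simp
  from hpow_nonzero[OF this] show ?thesis
    using assms by (simp add: HG_def cscale_cscale)
qed

text \<open>The map from \<open>a\<close> to \<open>1 / (4 a)\<close> is an involution and the two
  factors \<open>hpow\<close> are reciprocal, so swapping a generator gives a generator.
  Consequently the transform is its own inverse.\<close>

lemma hgen_swap:
  assumes "p \<in> span hgen"
  shows "prod.swap p \<in> span hgen"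
proof -
  have "subspace {p. prod.swap p \<in> span hgen}"
    by (auto simp: subspace_def prod.swap_def zero_prod_def[symmetric] span_zero
        simp flip: add_Pair scaleR_Pair intro: span_add span_scale)
  moreover have "prod.swap p \<in> hgen" if "p \<in> hgen" for p
  proof -
    obtain c a where a: "a > 0" and p: "p = (c *\<^sub>c G (of_real a), c *\<^sub>c HG (of_real a))"
      using \<open>p \<in> hgen\<close> unfolding hgen_def by blast
    define b where "b = 1 / (4 * a)"
    have b: "b > 0" "1 / (4 * b) = a" using a by (auto simp: b_def)
    have hb: "hpow (of_real b) * hpow (of_real a) = 1"
    proof -
      have "hpow (of_real b) * hpow (of_real a) = (of_real (2 * b) * of_real (2 * a)) powr (- of_real (\<nu> + 1))"
        unfolding hpow_def using b by (subst powr_of_real_mult_complex) auto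
      also have "of_real (2 * b) * of_real (2 * a) = (1 :: complex)"
        using a by (simp add: b_def)
      finally show ?thesis by simp
    qed
    have "HG (of_real a) = hpow (of_real a) *\<^sub>c G (of_real b)"
      by (simp add: HG_def b_def)
    moreover have "G (of_real a) = hpow (of_real a) *\<^sub>c HG (of_real b)"
    proof -
      have "1 / (4 * complex_of_real b) = of_real a"
        using b(2) by (metis of_real_1 of_real_divide of_real_mult of_real_numeral)
      then show ?thesis using hb by (simp add: HG_def cscale_cscale mult.commute)
    qed
    ultimately have "prod.swap p = ((c * hpow (of_real a)) *\<^sub>c G (of_real b), (c * hpow (of_real a)) *\<^sub>c HG (of_real b))"
      by (simp add: p cscale_cscale)
    then show ?thesis using b unfolding hgen_def by blast
  qed
  ultimately have "span hgen \<subseteq> {p. prod.swap p \<in> span hgen}"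
    by (intro span_minimal) (auto intro: span_base)
  then show ?thesis using assms by auto
qed

lemma hgen_cscale:
  assumes "p \<in> span hgen"
  shows "(c *\<^sub>c fst p, c *\<^sub>c snd p) \<in> span hgen"
proof -
  have "subspace {p. (c *\<^sub>c fst p, c *\<^sub>c snd p) \<in> span hgen}"
  proof (unfold subspace_def, intro conjI ballI allI)
    have "c *\<^sub>c (0 :: hl2) = 0" using scaleR_eq_cscale[of 0 0] bounded_linear_cscale linear_simps(3) by blast
    then show "0 \<in> {p. (c *\<^sub>c fst p, c *\<^sub>c snd p) \<in> span hgen}"
      using span_zero[of hgen] by (simp add: zero_prod_def)
  qed (auto simp: cscale_add cscale_scaleR simp flip: add_Pair scaleR_Pair intro: span_add span_scale)
  moreover have "hgen \<subseteq> {p. (c *\<^sub>c fst p, c *\<^sub>c snd p) \<in> span hgen}"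
  proof
    fix p assume "p \<in> hgen"
    then obtain d a where "a > 0" "p = (d *\<^sub>c G (of_real a), d *\<^sub>c HG (of_real a))"
      unfolding hgen_def by blast
    then have "(c *\<^sub>c fst p, c *\<^sub>c snd p) \<in> hgen"
      by (auto simp: cscale_cscale hgen_def)
    then show "p \<in> {p. (c *\<^sub>c fst p, c *\<^sub>c snd p) \<in> span hgen}" by (simp add: span_base)
  qed
  ultimately show ?thesis using assms span_minimal by blast
qed

lemma closure_imageI:
  fixes f :: "'a::topological_space \<Rightarrow> 'b::topological_space"
  assumes "continuous_on UNIV f" "\<And>p. p \<in> S \<Longrightarrow> f p \<in> S'" "p \<in> closure S"
  shows "f p \<in> closure S'"
proof -
  have "f ` closure S \<subseteq> closure (f ` S)"
    by (rule image_closure_subset[OF continuous_on_subset[OF assms(1)]]) (auto simp: closure_subset)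
  also have "\<dots> \<subseteq> closure S'" using assms(2) by (intro closure_mono) auto
  finally show ?thesis using assms(3) by auto
qed

text \<open>What the projection onto the closed span of Gaussians leaves over is orthogonal to all
  Gaussians, hence zero. Isometry then makes the images of an approximating sequence Cauchy, and
  completeness supplies the second component.\<close>

lemma hgen_closure_total: "\<exists>y. (F, y) \<in> closure (span hgen)"
proof -
  define W where "W = closure (fst ` span hgen)"
  have "subspace (fst ` span hgen)"
    by (intro linear_subspace_image bounded_linear.linear[OF bounded_linear_fst] subspace_span)
  then have "subspace W" unfolding W_def by (rule subspace_closure)
  moreover have "closed W" by (simp add: W_def)
  ultimately obtain p where p: "p \<in> W" "\<And>s. s \<in> W \<Longrightarrow> inner (F - p) s = 0"
    using closed_subspace_projection by blast
  have "F - p = 0"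
  proof (rule hl2_eq_0I)
    fix a :: real assume a: "a > 0"
    have "c *\<^sub>c G (of_real a) \<in> W" for c
    proof -
      have "(c *\<^sub>c G (of_real a), c *\<^sub>c HG (of_real a)) \<in> hgen" using a by (auto simp: hgen_def)
      then have "fst (c *\<^sub>c G (of_real a), c *\<^sub>c HG (of_real a)) \<in> fst ` span hgen"
        by (intro imageI span_base)
      then have "c *\<^sub>c G (of_real a) \<in> fst ` span hgen" by (simp only: fst_conv)
      then show ?thesis unfolding W_def by (rule closure_subset[THEN subsetD])
    qed
    then have "inner (F - p) (1 *\<^sub>c G (of_real a)) = 0" "inner (F - p) (\<i> *\<^sub>c G (of_real a)) = 0"
      using p(2) by blast+
    then show "cinner (F - p) (G (of_real a)) = 0"
      by (simp add: cinner_eq_inner complex_eq_iff)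
  qed
  then have "F \<in> W" using p(1) by simp
  then obtain f where f: "\<And>n. f n \<in> fst ` span hgen" "f \<longlonglongrightarrow> F"
    unfolding W_def closure_sequential by auto
  then have "\<forall>n. \<exists>y. (f n, y) \<in> span hgen" by force
  then obtain y where y: "\<And>n. (f n, y n) \<in> span hgen" by metis
  have "norm (y m - y n) = norm (f m - f n)" for m n
  proof -
    have "(f m, y m) - (f n, y n) \<in> span hgen" using y by (intro span_diff)
    then have "(f m - f n, y m - y n) \<in> closure (span hgen)"
      using closure_subset by (auto simp: diff_Pair)
    from hgen_closure_isometric[OF this] show ?thesis by simp
  qed
  then have "Cauchy y"
    using LIMSEQ_imp_Cauchy[OF f(2)] unfolding Cauchy_def by (simp add: dist_norm)
  then obtain Y where "y \<longlonglongrightarrow> Y" using Cauchy_convergent_iff convergent_def by blast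
  then have "(\<lambda>n. (f n, y n)) \<longlonglongrightarrow> (F, Y)" using f(2) by (intro tendsto_Pair)
  then have "(F, Y) \<in> closure (span hgen)"
    using y unfolding closure_sequential by (intro exI[of _ "\<lambda>n. (f n, y n)"]) simp
  then show ?thesis by blast
qed

lemma subspace_closure_hgen: "subspace (closure (span hgen))"
  by (rule subspace_closure[OF subspace_span])

lemma hgen_closure_unique:
  assumes "(F, y) \<in> closure (span hgen)" "(F, y') \<in> closure (span hgen)"
  shows "y = y'"
proof -
  have "(F, y) - (F, y') \<in> closure (span hgen)"
    using assms subspace_closure_hgen by (intro subspace_diff)
  from hgen_closure_isometric[OF this] show ?thesis by (simp add: diff_Pair)
qed

definition hankel :: "hl2 \<Rightarrow> hl2" where
  "hankel F = (THE y. (F, y) \<in> closure (span hgen))"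

lemma hankel_graph: "(F, hankel F) \<in> closure (span hgen)"
  unfolding hankel_def using hgen_closure_total[of F] by (metis hgen_closure_unique theI)

lemma hankel_eqI: "(F, y) \<in> closure (span hgen) \<Longrightarrow> hankel F = y"
  using hgen_closure_unique hankel_graph by blast

lemma hankel_hankel [simp]: "hankel (hankel F) = F"
proof (rule hankel_eqI)
  have "prod.swap (F, hankel F) \<in> closure (span hgen)"
    by (rule closure_imageI[OF continuous_on_swap hgen_swap hankel_graph])
  then show "(hankel F, F) \<in> closure (span hgen)" by simp
qed

lemma hankel_add: "hankel (F + K) = hankel F + hankel K"
  using subspace_add[OF subspace_closure_hgen hankel_graph hankel_graph, of F K]
  by (intro hankel_eqI) simp

lemma hankel_diff: "hankel (F - K) = hankel F - hankel K"
  using subspace_diff[OF subspace_closure_hgen hankel_graph hankel_graph, of F K]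
  by (intro hankel_eqI) (simp add: diff_Pair)

lemma hankel_cscale: "hankel (c *\<^sub>c F) = c *\<^sub>c hankel F"
proof (rule hankel_eqI)
  have "(c *\<^sub>c fst (F, hankel F), c *\<^sub>c snd (F, hankel F)) \<in> closure (span hgen)"
  proof (rule closure_imageI[where S = "span hgen" and S' = "span hgen" and
      f = "\<lambda>p. (c *\<^sub>c fst p, c *\<^sub>c snd p)", OF _ hgen_cscale hankel_graph])
    have "continuous_on UNIV (\<lambda>F. c *\<^sub>c F)"
      using linear_continuous_on[OF bounded_linear_cscale] .
    then show "continuous_on UNIV (\<lambda>p. (c *\<^sub>c fst p, c *\<^sub>c snd p))"
      by (auto intro!: continuous_intros continuous_on_compose2[of UNIV "\<lambda>F. c *\<^sub>c F"])
  qed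
  then show "(c *\<^sub>c F, c *\<^sub>c hankel F) \<in> closure (span hgen)" by simp
qed

lemma norm_hankel [simp]: "norm (hankel F) = norm F"
  using hgen_closure_isometric[OF hankel_graph[of F]] by simp

lemma bounded_linear_hankel: "bounded_linear hankel"
  by (rule bounded_linear_intro[where K = 1]) (simp_all add: hankel_add hankel_cscale scaleR_eq_cscale)

lemma inner_hankel: "inner (hankel F) (hankel K) = inner F K"
proof -
  have "(norm (hankel F + hankel K))\<^sup>2 = (norm (F + K))\<^sup>2"
    by (metis hankel_add norm_hankel)
  then have "2 * inner (hankel F) (hankel K) + ((norm (hankel F))\<^sup>2 + (norm (hankel K))\<^sup>2)
      = 2 * inner F K + ((norm F)\<^sup>2 + (norm K)\<^sup>2)"
    unfolding power2_norm_eq_inner by (simp add: inner_add_left inner_add_right inner_commute algebra_simps)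
  then show ?thesis by simp
qed

lemma cinner_hankel: "cinner (hankel F) (hankel K) = cinner F K"
  by (simp add: cinner_eq_inner inner_hankel flip: hankel_cscale)

lemma cinner_hankel_left: "cinner (hankel F) K = cinner F (hankel K)"
  using cinner_hankel[of F "hankel K"] by simp

lemma hankel_G_real: "a > 0 \<Longrightarrow> hankel (G (of_real a)) = HG (of_real a)"
proof (rule hankel_eqI)
  assume "a > 0"
  then have "(1 *\<^sub>c G (of_real a), 1 *\<^sub>c HG (of_real a)) \<in> hgen" unfolding hgen_def by blast
  then show "(G (of_real a), HG (of_real a)) \<in> closure (span hgen)"
    using closure_subset span_base by fastforce
qed

lemma hl2_eqI_HG:
  assumes "\<And>a. a > 0 \<Longrightarrow> cinner F (HG (of_real a)) = cinner K (HG (of_real a))"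
  shows "F = K"
proof -
  have "F - K = 0"
  proof (rule hl2_eq_0I)
    fix a :: real assume a: "a > 0"
    show "cinner (F - K) (G (of_real a)) = 0"
      unfolding HG_inverse[OF a] using assms[of "1 / (4 * a)"] a
      by (simp add: cinner_cscale_right cinner_diff_left)
  qed
  then show ?thesis by simp
qed

text \<open>By construction the formula holds for real parameters only. Testing against the
  transforms of real Gaussians extends it, because \<open>cinner_HG\<close> admits one complex
  parameter; the time evolution of a Gaussian needs this.\<close>

lemma hankel_G:
  assumes "Re z > 0"
  shows "hankel (G z) = HG z"
proof (rule hl2_eqI_HG)
  fix a :: real assume a: "a > 0"
  have "cinner (hankel (G z)) (HG (of_real a)) = cinner (hankel (G z)) (hankel (G (of_real a)))"
    by (simp only: hankel_G_real[OF a])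
  then show "cinner (hankel (G z)) (HG (of_real a)) = cinner (HG z) (HG (of_real a))"
    by (simp add: cinner_hankel cinner_HG[OF assms a])
qed

end

section \<open>Unitary groups on classes\<close>

definition ugroup :: "(real \<Rightarrow> hl2 \<Rightarrow> hl2) \<Rightarrow> bool" where
  "ugroup V \<longleftrightarrow> (\<forall>t F. norm (V t F) = norm F) \<and>
     (\<forall>t c F K. V t (c *\<^sub>c F + K) = c *\<^sub>c V t F + V t K) \<and>
     (\<forall>F. V 0 F = F) \<and> (\<forall>s t F. V (s + t) F = V s (V t F)) \<and>
     (\<forall>F. ((\<lambda>t. V t F) \<longlongrightarrow> F) (at 0))"

definition has_generator :: "(real \<Rightarrow> hl2 \<Rightarrow> hl2) \<Rightarrow> hl2 \<Rightarrow> hl2 \<Rightarrow> bool" where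
  "has_generator V F K \<longleftrightarrow> ((\<lambda>t. (1 / t) *\<^sub>R (V t F - F)) \<longlongrightarrow> K) (at 0)"

lemma cscale_zero [simp]: "c *\<^sub>c 0 = 0" "0 *\<^sub>c F = 0"
  using norm_cscale[of c 0] norm_cscale[of 0 F] by simp_all

lemma cscale_minus_one: "(-1) *\<^sub>c F = - F"
  using scaleR_eq_cscale[of "-1" F] by simp

lemma L2_norm_tendsto_iff:
  assumes "\<And>t. t \<noteq> 0 \<Longrightarrow> h t \<in> L2" "\<And>t. t \<noteq> 0 \<Longrightarrow> cls (h t) = F t - K"
  shows "((\<lambda>t. L2_norm (h t)) \<longlongrightarrow> 0) (at (0::real)) \<longleftrightarrow> (F \<longlongrightarrow> K) (at 0)"
proof -
  have "L2_norm (h t) = norm (F t - K)" if "t \<noteq> 0" for t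
    using assms(2)[OF that] norm_cls[OF assms(1)[OF that] assms(1)[OF that]] by simp
  then have "((\<lambda>t. L2_norm (h t)) \<longlongrightarrow> 0) (at (0::real)) \<longleftrightarrow> ((\<lambda>t. norm (F t - K)) \<longlongrightarrow> 0) (at 0)"
    by (intro filterlim_cong refl) (auto simp: eventually_at_filter)
  also have "\<dots> \<longleftrightarrow> (F \<longlongrightarrow> K) (at 0)"
    unfolding tendsto_norm_zero_iff LIM_zero_iff ..
  finally show ?thesis .
qed

lemma cls_cong: "f \<in> L2 \<Longrightarrow> g \<in> L2 \<Longrightarrow> L2_eq f g \<Longrightarrow> cls f = cls g"
  using cls_eq_iff by blast

context
  fixes U :: "real \<Rightarrow> (real \<Rightarrow> complex) \<Rightarrow> real \<Rightarrow> complex" and V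
  assumes U: "unitary_group U"
  defines "V \<equiv> \<lambda>t F. cls (U t (rep F))"
begin

lemma unitary_group_L2: "f \<in> L2 \<Longrightarrow> U t f \<in> L2"
  using U by (simp add: unitary_group_def)

lemma unitary_group_linear:
  assumes "f \<in> L2" "g \<in> L2"
  shows "cls (U t (\<lambda>x. c * f x + g x)) = c *\<^sub>c cls (U t f) + cls (U t g)"
proof -
  have "L2_eq (U t (\<lambda>x. c * f x + g x)) (\<lambda>x. c * U t f x + U t g x)"
    using U assms by (auto simp: unitary_group_def)
  then have "cls (U t (\<lambda>x. c * f x + g x)) = cls (\<lambda>x. c * U t f x + U t g x)"
    using assms by (intro cls_cong) (auto intro!: unitary_group_L2 L2_add L2_cmult)
  also have "\<dots> = c *\<^sub>c cls (U t f) + cls (U t g)"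
    using assms unitary_group_L2 L2_cmult
    by (simp add: cls_cscale cls_add)
  finally show ?thesis .
qed

lemma norm_unitary_group: "f \<in> L2 \<Longrightarrow> norm (cls (U t f)) = norm (cls f)"
  using U unitary_group_L2[of f t] by (simp add: unitary_group_def norm_cls)

text \<open>\<open>U\<close> is not assumed to respect equality almost everywhere. Linearity and
  isometry force it: the difference of \<open>rep (cls f)\<close> and \<open>f\<close> has norm
  zero, hence so has its image.\<close>

lemma unitary_group_cls:
  assumes "f \<in> L2"
  shows "V t (cls f) = cls (U t f)"
proof -
  have "cls (U t (\<lambda>x. (-1) * f x + rep (cls f) x)) = (-1) *\<^sub>c cls (U t f) + cls (U t (rep (cls f)))"
    by (intro unitary_group_linear assms rep_L2)
  moreover have "norm (cls (U t (\<lambda>x. (-1) * f x + rep (cls f) x))) = 0"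
  proof (subst norm_unitary_group)
    show "(\<lambda>x. - 1 * f x + rep (cls f) x) \<in> L2" by (intro L2_add L2_cmult assms rep_L2)
    have "cls (\<lambda>x. - 1 * f x + rep (cls f) x) = (-1) *\<^sub>c cls f + cls (rep (cls f))"
      using assms rep_L2 L2_cmult by (simp only: cls_cscale cls_add)
    then show "norm (cls (\<lambda>x. - 1 * f x + rep (cls f) x)) = 0" by (simp add: cscale_minus_one)
  qed
  ultimately show ?thesis by (simp add: V_def cscale_minus_one)
qed

lemma unitary_group_ugroup: "ugroup V"
  unfolding ugroup_def
proof (intro conjI allI)
  fix s t c and F K :: hl2
  show "norm (V t F) = norm F"
    unfolding V_def by (subst norm_unitary_group) (simp_all add: rep_L2)
  have "V t (c *\<^sub>c F + K) = V t (cls (\<lambda>x. c * rep F x + rep K x))"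
    using cls_add[OF L2_cmult[OF rep_L2[of F], of c] rep_L2[of K]] cls_cscale[OF rep_L2[of F] rep_L2[of F], of c]
    by simp
  also have "\<dots> = cls (U t (\<lambda>x. c * rep F x + rep K x))"
    by (intro unitary_group_cls L2_add L2_cmult rep_L2)
  also have "\<dots> = c *\<^sub>c V t F + V t K"
    unfolding V_def by (intro unitary_group_linear rep_L2)
  finally show "V t (c *\<^sub>c F + K) = c *\<^sub>c V t F + V t K" .
  have "cls (U 0 (rep F)) = cls (rep F)"
    using U rep_L2 by (intro cls_cong unitary_group_L2) (auto simp: unitary_group_def)
  then show "V 0 F = F" by (simp add: V_def)
  have "cls (U (s + t) (rep F)) = cls (U s (U t (rep F)))"
    using U rep_L2 by (intro cls_cong unitary_group_L2) (auto simp: unitary_group_def)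
  then show "V (s + t) F = V s (V t F)"
    using unitary_group_cls[OF unitary_group_L2[OF rep_L2]] by (simp add: V_def)
  have "((\<lambda>t. L2_norm (\<lambda>x. U t (rep F) x - rep F x)) \<longlongrightarrow> 0) (at 0)"
    using U rep_L2 by (auto simp: unitary_group_def)
  then show "((\<lambda>t. V t F) \<longlongrightarrow> F) (at 0)"
    by (rule L2_norm_tendsto_iff[THEN iffD1, rotated -1])
      (auto simp: V_def cls_diff[symmetric] unitary_group_L2 rep_L2 intro!: L2_diff)
qed

lemma generator_iff:
  "(f, g) \<in> generator U \<longleftrightarrow> f \<in> L2 \<and> g \<in> L2 \<and> has_generator V (cls f) (cls g)"
proof (cases "f \<in> L2 \<and> g \<in> L2")
  case True
  then have fg: "f \<in> L2" "g \<in> L2" by auto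
  have h: "(\<lambda>x. (U t f x - f x) / of_real t) \<in> L2" for t
    using L2_cmult[OF L2_diff[OF unitary_group_L2[OF fg(1)] fg(1)], of "1 / of_real t" t] by simp
  have "cls (\<lambda>x. (U t f x - f x) / of_real t) = (1 / t) *\<^sub>R (V t (cls f) - cls f)" for t
    using cls_scaleR[OF L2_diff[OF unitary_group_L2[OF fg(1)] fg(1)] fg(1), of "1 / t" t]
    by (simp add: unitary_group_cls fg cls_diff unitary_group_L2)
  then have "((\<lambda>t. L2_norm (\<lambda>x. (U t f x - f x) / of_real t - g x)) \<longlongrightarrow> 0) (at 0) \<longleftrightarrow>
      ((\<lambda>t. (1 / t) *\<^sub>R (V t (cls f) - cls f)) \<longlongrightarrow> cls g) (at 0)"
    using h fg by (intro L2_norm_tendsto_iff) (auto simp: cls_diff[symmetric] intro!: L2_diff)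
  then show ?thesis using fg by (simp add: generator_def has_generator_def)
qed (auto simp: generator_def)

end

lemma ugroup_unitary_group:
  assumes V: "ugroup V"
  shows "unitary_group (\<lambda>t f. rep (V t (cls f)))"
  unfolding unitary_group_def
proof (intro conjI allI ballI)
  fix t s c f g assume f: "f \<in> L2"
  show "rep (V t (cls f)) \<in> L2" by (rule rep_L2)
  show "L2_norm (rep (V t (cls f))) = L2_norm f"
    using V f norm_cls[OF rep_L2 rep_L2, of "V t (cls f)"] by (simp add: ugroup_def norm_cls)
  show "L2_eq (rep (V 0 (cls f))) f"
    using V f rep_cls by (simp add: ugroup_def)
  show "L2_eq (rep (V (s + t) (cls f))) (rep (V s (cls (rep (V t (cls f))))))"
    using V by (simp add: ugroup_def L2_eq_refl)
  have "((\<lambda>t. V t (cls f)) \<longlongrightarrow> cls f) (at 0)" using V by (simp add: ugroup_def)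
  then show "((\<lambda>t. L2_norm (\<lambda>x. rep (V t (cls f)) x - f x)) \<longlongrightarrow> 0) (at 0)"
    by (rule L2_norm_tendsto_iff[THEN iffD2, rotated -1])
      (auto simp: cls_diff[symmetric] rep_L2 f intro!: L2_diff)
next
  fix t c f g assume fg: "f \<in> L2" "g \<in> L2"
  have "cls (\<lambda>x. c * f x + g x) = c *\<^sub>c cls f + cls g"
    using fg L2_cmult by (simp only: cls_cscale cls_add)
  then have "V t (cls (\<lambda>x. c * f x + g x)) = c *\<^sub>c V t (cls f) + V t (cls g)"
    using V by (simp add: ugroup_def)
  also have "\<dots> = cls (\<lambda>x. c * rep (V t (cls f)) x + rep (V t (cls g)) x)"
    using cls_add[OF L2_cmult[OF rep_L2] rep_L2, of c "V t (cls f)" "V t (cls g)"]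
      cls_cscale[OF rep_L2[of "V t (cls f)"] rep_L2[of "V t (cls f)"], of c] by simp
  finally show "L2_eq (rep (V t (cls (\<lambda>x. c * f x + g x))))
      (\<lambda>x. c * rep (V t (cls f)) x + rep (V t (cls g)) x)"
    using rep_cls[OF L2_add[OF L2_cmult[OF rep_L2] rep_L2]] by simp
qed

lemma bounded_linear_ugroup:
  assumes "ugroup V"
  shows "bounded_linear (V t)"
proof -
  have 0: "V t (c *\<^sub>c F + K) = c *\<^sub>c V t F + V t K" "norm (V t F) = norm F" for c F K
    using assms by (auto simp: ugroup_def)
  have z: "V t 0 = 0" using 0(2)[of 0] by simp
  show ?thesis
    using 0(1)[of 1] 0(1)[where K = 0] z
    by (intro bounded_linear_intro[where K = 1]) (auto simp: 0(2) scaleR_eq_cscale)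
qed

text \<open>\<open>V t\<close> is bounded, linear and commutes with \<open>V h\<close>, so applying
  it to the difference quotients at \<open>F\<close> produces those at \<open>V t F\<close>.\<close>

lemma has_generator_orbit:
  assumes V: "ugroup V" and F: "has_generator V F K"
  shows "has_generator V (V t F) (V t K)"
    and "((\<lambda>t. V t F) has_vector_derivative V t K) (at t)"
proof -
  interpret bounded_linear "V t" by (rule bounded_linear_ugroup[OF V])
  have com: "V h (V t F) = V t (V h F)" for h
    using V unfolding ugroup_def by (metis add.commute)
  have "((\<lambda>h. V t ((1 / h) *\<^sub>R (V h F - F))) \<longlongrightarrow> V t K) (at 0)"
    using F unfolding has_generator_def by (rule tendsto)
  then have lim: "((\<lambda>h. (1 / h) *\<^sub>R (V h (V t F) - V t F)) \<longlongrightarrow> V t K) (at 0)"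
    by (simp add: scaleR diff com)
  then show "has_generator V (V t F) (V t K)" by (simp add: has_generator_def)
  have "V (t + h) F = V h (V t F)" for h
    using V unfolding ugroup_def by (metis add.commute)
  with lim have "((\<lambda>h. (1 / h) *\<^sub>R (V (t + h) F - V t F)) \<longlongrightarrow> V t K) (at 0)" by simp
  then have "((\<lambda>h. norm ((1 / h) *\<^sub>R (V (t + h) F - V t F) - V t K)) \<longlongrightarrow> 0) (at 0)"
    by (intro tendsto_norm_zero LIM_zero)
  then have "((\<lambda>h. norm (V (t + h) F - V t F - h *\<^sub>R V t K) / norm h) \<longlongrightarrow> 0) (at 0)"
  proof (rule Lim_transform_eventually)
    have "norm ((1 / h) *\<^sub>R (V (t + h) F - V t F) - V t K) = norm (V (t + h) F - V t F - h *\<^sub>R V t K) / norm h"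
      if "h \<noteq> 0" for h
    proof -
      have "(1 / h) *\<^sub>R (V (t + h) F - V t F) - V t K = (1 / h) *\<^sub>R (V (t + h) F - V t F - h *\<^sub>R V t K)"
        using that by (simp add: scaleR_diff_right)
      then show ?thesis by simp
    qed
    then show "\<forall>\<^sub>F h in at 0. norm ((1 / h) *\<^sub>R (V (t + h) F - V t F) - V t K)
        = norm (V (t + h) F - V t F - h *\<^sub>R V t K) / norm h"
      by (simp add: eventually_at_filter)
  qed
  then show "((\<lambda>t. V t F) has_vector_derivative V t K) (at t)"
    by (simp add: has_vector_derivative_def has_derivative_at bounded_linear_scaleR_left)
qed

text \<open>The squared distance between two orbits with the same initial value is constant because the
  common generator is skew-symmetric.\<close>

lemma ugroup_unique:
  assumes V: "ugroup V" and W: "ugroup W"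
    and F: "has_generator V F K" "has_generator W F K"
    and gen: "\<And>F K. has_generator V F K \<Longrightarrow> R F K" "\<And>F K. has_generator W F K \<Longrightarrow> R F K"
    and diff: "\<And>F K F' K'. R F K \<Longrightarrow> R F' K' \<Longrightarrow> R (F - F') (K - K')"
    and skew: "\<And>F K. R F K \<Longrightarrow> inner F K = 0"
  shows "V t F = W t F"
proof -
  define D where "D t = V t F - W t F" for t
  define E where "E t = V t K - W t K" for t
  have DE: "R (D t) (E t)" for t
    unfolding D_def E_def
    by (intro diff gen has_generator_orbit V W F)
  have der: "(D has_vector_derivative E t) (at t)" for t
    unfolding D_def[abs_def] E_def
    by (intro derivative_intros has_generator_orbit V W F)
  have "((\<lambda>t. inner (D t) (D t)) has_real_derivative 0) (at t)" for t
  proof -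
    have "((\<lambda>t. inner (D t) (D t)) has_derivative
        (\<lambda>h. inner (D t) (h *\<^sub>R E t) + inner (h *\<^sub>R E t) (D t))) (at t)"
      using der[of t] unfolding has_vector_derivative_def by (intro has_derivative_inner)
    then show ?thesis
      using skew[OF DE, of t] by (simp add: has_field_derivative_def inner_commute flip: lambda_zero)
  qed
  then have "inner (D t) (D t) = inner (D 0) (D 0)"
    by (intro DERIV_isconst_all) auto
  also have "D 0 = 0" using V W by (simp add: D_def ugroup_def)
  finally show ?thesis by (simp add: D_def)
qed

section \<open>The spectral construction of the group\<close>

lemma exp_quotient_limit:
  fixes c :: real
  assumes "c \<noteq> 0"
  shows "((\<lambda>t::real. (exp (- \<i> * of_real (t * c)) - 1) / of_real t) \<longlongrightarrow> - \<i> * of_real c) (at 0)"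
proof -
  have "filterlim (\<lambda>t::real. - \<i> * of_real (t * c)) (at 0) (at 0)"
  proof (rule filterlim_atI)
    have "((\<lambda>t::real. - \<i> * of_real (t * c)) \<longlongrightarrow> - \<i> * of_real (0 * c)) (at 0)"
      by (intro tendsto_intros)
    then show "((\<lambda>t::real. - \<i> * of_real (t * c)) \<longlongrightarrow> 0) (at 0)" by simp
    show "\<forall>\<^sub>F t in at 0. - \<i> * complex_of_real (t * c) \<noteq> 0"
      using assms by (auto simp: eventually_at_filter)
  qed
  then have "((\<lambda>t::real. (exp (- \<i> * of_real (t * c)) - 1) / (- \<i> * of_real (t * c))) \<longlongrightarrow> 1) (at 0)"
    by (rule filterlim_compose[OF lim_exp_minus_1])
  then have "((\<lambda>t::real. (exp (- \<i> * of_real (t * c)) - 1) / (- \<i> * of_real (t * c)) * (- \<i> * of_real c)) \<longlongrightarrow> 1 * (- \<i> * of_real c)) (at 0)"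
    by (intro tendsto_intros)
  then show ?thesis using assms by simp
qed

lemma cmod_exp_minus_one_le: "cmod (exp (- \<i> * of_real s) - 1) \<le> \<bar>s\<bar>"
proof -
  have "cmod (exp (\<i> * of_real (- s)) - 1) = 2 * \<bar>sin (- s / 2)\<bar>" by (rule dist_exp_i_1)
  also have "\<dots> \<le> 2 * \<bar>- s / 2\<bar>" by (intro mult_left_mono abs_sin_x_le_abs_x) auto
  finally show ?thesis by simp
qed

definition phase :: "real \<Rightarrow> real \<Rightarrow> complex" where
  "phase t k = exp (- \<i> * of_real (t * k\<^sup>2))"

lemma phase_measurable [measurable]: "phase t \<in> borel_measurable half_line"
  unfolding phase_def[abs_def]
  by (intro measurable_half_line_comp borel_measurable_continuous_onI continuous_intros)

lemma cmod_phase [simp]: "cmod (phase t k) = 1"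
  by (simp add: phase_def)

lemma bounded_mult_phase: "bounded_mult (phase t)"
  by (rule bounded_multI[where B = 1]) auto

lemma norm_mult_op_phase: "norm (mult_op (phase t) F) = norm F"
proof -
  have "(norm (mult_op (phase t) F))\<^sup>2 = (norm F)\<^sup>2"
    unfolding norm_sq_eq
  proof (rule integral_cong_AE)
    show "AE x in half_line. (cmod (rep (mult_op (phase t) F) x))\<^sup>2 = (cmod (rep F x))\<^sup>2"
      using AE_rep_mult_op[OF bounded_mult_phase, of t F] by eventually_elim (simp add: norm_mult)
  qed measurable
  then show ?thesis by (simp add: power2_eq_iff_nonneg)
qed

lemma mult_op_mult_op:
  assumes "bounded_mult m" "bounded_mult n" "bounded_mult (\<lambda>x. m x * n x)"
  shows "mult_op m (mult_op n F) = mult_op (\<lambda>x. m x * n x) F"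
proof (rule mult_op_eqI[OF assms(1)])
  show "AE x in half_line. rep (mult_op (\<lambda>x. m x * n x) F) x = m x * rep (mult_op n F) x"
    using AE_rep_mult_op[OF assms(2), of F] AE_rep_mult_op[OF assms(3), of F]
    by eventually_elim simp
qed

lemma mult_op_one [simp]: "mult_op (\<lambda>_. 1) F = F"
  by (simp add: mult_op_def)

lemma mult_op_phase_add: "mult_op (phase (s + t)) F = mult_op (phase s) (mult_op (phase t) F)"
proof -
  have "(\<lambda>k. phase s k * phase t k) = phase (s + t)"
    by (simp add: phase_def[abs_def] exp_add[symmetric] algebra_simps)
  then show ?thesis
    using mult_op_mult_op[OF bounded_mult_phase bounded_mult_phase, of s t F] bounded_mult_phase by simp
qed

lemma mult_op_phase_tendsto: "((\<lambda>t. mult_op (phase t) F) \<longlongrightarrow> F) (at 0)"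
proof -
  have "((\<lambda>t. mult_op (phase t) F) \<longlongrightarrow> mult_op (\<lambda>_. 1) F) (at 0)"
  proof (rule mult_op_tendsto[where B = 1])
    fix x :: real
    have "((\<lambda>t. phase t x) \<longlongrightarrow> exp (- \<i> * of_real (0 * x\<^sup>2))) (at 0)"
      unfolding phase_def by (intro tendsto_intros)
    then show "((\<lambda>t. phase t x) \<longlongrightarrow> 1) (at 0)" by simp
  qed (auto intro!: bounded_multI[where B = 1])
  then show ?thesis by simp
qed

text \<open>This identifies the generator of the multiplication group together with its exact
  domain. Both directions reduce to strong convergence of uniformly bounded multipliers.\<close>

lemma phase_quotient_iff:
  "((\<lambda>t. (1 / t) *\<^sub>R (mult_op (phase t) F - F)) \<longlongrightarrow> K) (at 0) \<longleftrightarrow> mult_rel (\<lambda>k. k\<^sup>2) F (\<i> *\<^sub>c K)"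
proof
  have w [measurable]: "(\<lambda>k::real. k\<^sup>2) \<in> borel_measurable half_line" by measurable
  define r :: "real \<Rightarrow> complex" where "r k = of_real (1 / (1 + \<bar>k\<^sup>2\<bar>))" for k
  have r: "bounded_mult r" unfolding r_def[abs_def] by (rule bounded_mult_resolvent(1)[OF w])
  define n :: "real \<Rightarrow> complex" where "n k = of_real (k\<^sup>2 / (1 + \<bar>k\<^sup>2\<bar>))" for k
  have n: "bounded_mult n" unfolding n_def[abs_def] by (rule bounded_mult_resolvent(2)[OF w])
  have AEq: "AE k in half_line. rep ((1 / t) *\<^sub>R (mult_op (phase t) F - F)) k = (phase t k - 1) / of_real t * rep F k" for t
    using AE_rep_cscale[of "1 / of_real t" "mult_op (phase t) F - F"]
      AE_rep_diff[of "mult_op (phase t) F" F] AE_rep_mult_op[OF bounded_mult_phase, of t F]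
    by eventually_elim (simp add: scaleR_eq_cscale left_diff_distrib diff_divide_distrib)
  have bd: "cmod ((phase t k - 1) / of_real t) \<le> k\<^sup>2" for t k
  proof (cases "t = 0")
    case False
    have "cmod (phase t k - 1) \<le> \<bar>t * k\<^sup>2\<bar>"
      unfolding phase_def by (rule cmod_exp_minus_one_le)
    then show ?thesis using False by (simp add: norm_divide abs_mult field_simps)
  qed simp
  have lim: "((\<lambda>t. (phase t k - 1) / of_real t) \<longlongrightarrow> - \<i> * of_real (k\<^sup>2)) (at 0)" if "k > 0" for k
    unfolding phase_def using that by (intro exp_quotient_limit) auto
  {
    assume K: "((\<lambda>t. (1 / t) *\<^sub>R (mult_op (phase t) F - F)) \<longlongrightarrow> K) (at 0)"
    \<comment> \<open>Here only the limit \<open>K\<close> is given. The factor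
      \<open>r k = 1 / (1 + k^2)\<close> tames the quotient, which is bounded by \<open>k^2\<close>,
      and the domain information is recovered from the bounded form of the relation.\<close>
    define m where "m t k = r k * ((phase t k - 1) / of_real t)" for t k
    have [measurable]: "m t \<in> borel_measurable half_line" for t
    proof -
      have [measurable]: "r \<in> borel_measurable half_line" using r by (simp add: bounded_mult_def)
      show ?thesis unfolding m_def by measurable
    qed
    have mb: "cmod (m t k) \<le> 1" for t k
    proof -
      have "cmod (r k) = 1 / (1 + k\<^sup>2)" unfolding r_def norm_of_real by simp
      then have "cmod (m t k) \<le> 1 / (1 + k\<^sup>2) * k\<^sup>2"
        unfolding m_def norm_mult using bd[of t k] by (intro mult_mono) auto
      also have "\<dots> \<le> 1" by (simp add: divide_le_eq_1_pos add_pos_nonneg)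
      finally show ?thesis .
    qed
    have eq: "mult_op r ((1 / t) *\<^sub>R (mult_op (phase t) F - F)) = mult_op (m t) F" for t
    proof (rule mult_op_eqI[OF r])
      show "AE x in half_line. rep (mult_op (m t) F) x = r x * rep ((1 / t) *\<^sub>R (mult_op (phase t) F - F)) x"
        using AEq[of t] AE_rep_mult_op[OF bounded_multI[of "m t" 1], of F] mb
        by (auto elim: eventually_elim2 simp: m_def)
    qed
    have "((\<lambda>t. mult_op r ((1 / t) *\<^sub>R (mult_op (phase t) F - F))) \<longlongrightarrow> mult_op r K) (at 0)"
      by (rule bounded_linear.tendsto[OF bounded_linear_mult_op[OF r] K])
    moreover have "((\<lambda>t. mult_op (m t) F) \<longlongrightarrow> mult_op (\<lambda>k. - \<i> * n k) F) (at 0)"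
    proof (rule mult_op_tendsto[where B = 1])
      show "bounded_mult (\<lambda>k. - \<i> * n k)"
        using n by (auto simp: bounded_mult_def norm_mult)
      fix k :: real assume "k > 0"
      then have "((\<lambda>t. m t k) \<longlongrightarrow> r k * (- \<i> * of_real (k\<^sup>2))) (at 0)"
        unfolding m_def by (intro tendsto_intros lim)
      also have "r k * (- \<i> * of_real (k\<^sup>2)) = - \<i> * n k" by (simp add: r_def n_def)
      finally show "((\<lambda>t. m t k) \<longlongrightarrow> - \<i> * n k) (at 0)" .
    qed (use mb in auto)
    ultimately have e: "mult_op r K = mult_op (\<lambda>k. - \<i> * n k) F"
      unfolding eq using tendsto_unique[OF trivial_limit_at] by blast
    have "mult_op r (\<i> *\<^sub>c K) = \<i> *\<^sub>c mult_op (\<lambda>k. - \<i> * n k) F"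
      by (simp add: mult_op_cscale[OF r] e)
    also have "\<dots> = mult_op n F"
    proof (rule mult_op_eqI[OF n, symmetric])
      have *: "bounded_mult (\<lambda>k. - \<i> * n k)" using n by (auto simp: bounded_mult_def norm_mult)
      show "AE x in half_line. rep (\<i> *\<^sub>c mult_op (\<lambda>k. - \<i> * n k) F) x = n x * rep F x"
        using AE_rep_mult_op[OF *, of F] AE_rep_cscale[of \<i> "mult_op (\<lambda>k. - \<i> * n k) F"]
        by eventually_elim (simp add: mult.assoc[symmetric])
    qed
    finally show "mult_rel (\<lambda>k. k\<^sup>2) F (\<i> *\<^sub>c K)"
      unfolding mult_rel_iff[OF w] r_def[abs_def] n_def[abs_def] .
  next
    assume rel: "mult_rel (\<lambda>k. k\<^sup>2) F (\<i> *\<^sub>c K)"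
    \<comment> \<open>Here \<open>F\<close> equals \<open>\<i> K / k^2\<close>, so the quotient
      applied to \<open>F\<close> is a multiplier applied to \<open>K\<close>; it is bounded by 1
      and tends to 1.\<close>
    define m where "m t k = \<i> * ((phase t k - 1) / of_real t / of_real (k\<^sup>2))" for t k
    have [measurable]: "m t \<in> borel_measurable half_line" for t
      unfolding m_def by measurable
    have mb: "cmod (m t k) \<le> 1" if "k > 0" for t k
    proof -
      have "cmod (m t k) = cmod ((phase t k - 1) / of_real t) / k\<^sup>2"
        unfolding m_def norm_mult norm_divide norm_of_real by simp
      then show ?thesis using bd[of t k] that by simp
    qed
    have eq: "(1 / t) *\<^sub>R (mult_op (phase t) F - F) = mult_op (m t) K" for t
    proof (rule mult_op_eqI[symmetric])
      show "bounded_mult (m t)" by (rule bounded_multI[OF _ mb]) auto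
      have "AE k in half_line. k > 0" by (rule AE_I2) simp
      then show "AE k in half_line. rep ((1 / t) *\<^sub>R (mult_op (phase t) F - F)) k = m t k * rep K k"
        using AEq[of t] rel[unfolded mult_rel_def] AE_rep_cscale[of \<i> K]
      proof eventually_elim
        case (elim k)
        then have "of_real (k\<^sup>2) * rep F k = \<i> * rep K k" by simp
        then have "rep F k = \<i> * rep K k / of_real (k\<^sup>2)" using elim(1) by (simp add: field_simps)
        with elim(2) show ?case by (simp add: m_def)
      qed
    qed
    have "((\<lambda>t. mult_op (m t) K) \<longlongrightarrow> mult_op (\<lambda>_. 1) K) (at 0)"
    proof (rule mult_op_tendsto[where B = 1])
      show "bounded_mult (\<lambda>_. 1)" by (rule bounded_multI[where B = 1]) auto
      fix k :: real assume k: "k > 0"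
      then have "((\<lambda>t. m t k) \<longlongrightarrow> \<i> * (- \<i> * of_real (k\<^sup>2) / of_real (k\<^sup>2))) (at 0)"
        unfolding m_def by (intro tendsto_intros lim) auto
      then show "((\<lambda>t. m t k) \<longlongrightarrow> 1) (at 0)" using k by simp
    qed (use mb in auto)
    then show "((\<lambda>t. (1 / t) *\<^sub>R (mult_op (phase t) F - F)) \<longlongrightarrow> K) (at 0)"
      unfolding eq by simp
  }
qed

section \<open>The propagator and the spectrally defined operator\<close>

context bessel
begin

definition propagator :: "real \<Rightarrow> hl2 \<Rightarrow> hl2" where
  "propagator t F = hankel (mult_op (phase t) (hankel F))"

text \<open>The graph of H in its spectral representation: \<open>F\<close> lies in the domain and
  \<open>K\<close> is H applied to \<open>F\<close>. Since the generator of the group is -iH, a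
  derivative \<open>K\<close> of the group enters as \<open>\<i> *\<^sub>c K\<close>.\<close>

definition H_rel :: "hl2 \<Rightarrow> hl2 \<Rightarrow> bool" where
  "H_rel F K \<longleftrightarrow> mult_rel (\<lambda>k. k\<^sup>2) (hankel F) (hankel K)"

lemma ugroup_propagator: "ugroup propagator"
  unfolding ugroup_def
proof (intro conjI allI)
  fix s t c F K
  show "norm (propagator t F) = norm F" by (simp add: propagator_def norm_mult_op_phase)
  show "propagator t (c *\<^sub>c F + K) = c *\<^sub>c propagator t F + propagator t K"
    by (simp add: propagator_def hankel_add hankel_cscale mult_op_add[OF bounded_mult_phase]
        mult_op_cscale[OF bounded_mult_phase])
  show "propagator 0 F = F" by (simp add: propagator_def phase_def[abs_def])
  show "propagator (s + t) F = propagator s (propagator t F)"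
    by (simp add: propagator_def mult_op_phase_add)
  have "((\<lambda>t. hankel (mult_op (phase t) (hankel F))) \<longlongrightarrow> hankel (hankel F)) (at 0)"
    by (intro bounded_linear.tendsto[OF bounded_linear_hankel] mult_op_phase_tendsto)
  then show "((\<lambda>t. propagator t F) \<longlongrightarrow> F) (at 0)" by (simp add: propagator_def)
qed

lemma has_generator_propagator: "has_generator propagator F K \<longleftrightarrow> H_rel F (\<i> *\<^sub>c K)"
proof -
  interpret bounded_linear hankel by (rule bounded_linear_hankel)
  have eq: "(1 / t) *\<^sub>R (propagator t F - F) = hankel ((1 / t) *\<^sub>R (mult_op (phase t) (hankel F) - hankel F))" for t
    by (simp add: propagator_def scaleR diff)
  have "has_generator propagator F K \<longleftrightarrow>
      ((\<lambda>t. (1 / t) *\<^sub>R (mult_op (phase t) (hankel F) - hankel F)) \<longlongrightarrow> hankel K) (at 0)"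
  proof
    assume "has_generator propagator F K"
    then have "((\<lambda>t. hankel ((1 / t) *\<^sub>R (propagator t F - F))) \<longlongrightarrow> hankel K) (at 0)"
      unfolding has_generator_def by (rule tendsto)
    then show "((\<lambda>t. (1 / t) *\<^sub>R (mult_op (phase t) (hankel F) - hankel F)) \<longlongrightarrow> hankel K) (at 0)"
      unfolding eq by simp
  next
    assume "((\<lambda>t. (1 / t) *\<^sub>R (mult_op (phase t) (hankel F) - hankel F)) \<longlongrightarrow> hankel K) (at 0)"
    then have "((\<lambda>t. hankel ((1 / t) *\<^sub>R (mult_op (phase t) (hankel F) - hankel F))) \<longlongrightarrow> hankel (hankel K)) (at 0)"
      by (rule tendsto)
    then show "has_generator propagator F K"
      unfolding has_generator_def eq by simp
  qed
  then show ?thesis by (simp add: phase_quotient_iff H_rel_def hankel_cscale)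
qed

lemma H_rel_diff:
  assumes "H_rel F K" "H_rel F' K'"
  shows "H_rel (F - F') (K - K')"
  unfolding H_rel_def mult_rel_def hankel_diff
  using assms[unfolded H_rel_def mult_rel_def]
    AE_rep_diff[of "hankel F" "hankel F'"] AE_rep_diff[of "hankel K" "hankel K'"]
  by eventually_elim (simp add: right_diff_distrib)

text \<open>On the transform side the pairing of \<open>K\<close> with \<open>F\<close> is the
  integral of \<open>k^2\<close> times a squared modulus, hence real. This is the skew-symmetry
  required by the uniqueness of the group.\<close>

lemma H_rel_symmetric:
  assumes "H_rel F K"
  shows "inner F (\<i> *\<^sub>c K) = 0"
proof -
  have "cinner K F = (LINT k|half_line. rep (hankel K) k * cnj (rep (hankel F) k))"
    by (simp add: cinner_hankel flip: cinner_eq)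
  also have "\<dots> = (LINT k|half_line. of_real (k\<^sup>2 * (cmod (rep (hankel F) k))\<^sup>2))"
  proof (rule integral_cong_AE)
    show "AE k in half_line. rep (hankel K) k * cnj (rep (hankel F) k) = of_real (k\<^sup>2 * (cmod (rep (hankel F) k))\<^sup>2)"
      using assms unfolding H_rel_def mult_rel_def
      by eventually_elim (simp add: complex_norm_square mult_ac flip: of_real_power)
  qed measurable
  also have "\<dots> = of_real (LINT k|half_line. k\<^sup>2 * (cmod (rep (hankel F) k))\<^sup>2)"
    by (rule integral_complex_of_real)
  finally have "Im (cinner K F) = 0" by simp
  then have "Re (cinner (\<i> *\<^sub>c K) F) = 0" by (simp add: cinner_cscale_left)
  then show ?thesis by (simp add: inner_eq_Re[symmetric] inner_commute)
qed

text \<open>Uniqueness by differentiation applies to data in the domain of the generator, which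
  suffices because test functions lie there.\<close>

lemma unitary_group_eq_propagator:
  assumes U: "unitary_group U"
    and gen: "\<And>f g. (f, g) \<in> generator U \<longleftrightarrow> f \<in> L2 \<and> g \<in> L2 \<and> H_rel (cls f) (\<i> *\<^sub>c cls g)"
    and f: "f \<in> L2" "H_rel (cls f) K"
  shows "L2_eq (U t f) (rep (propagator t (cls f)))"
proof -
  define V where "V t F = cls (U t (rep F))" for t F
  note gi = generator_iff[OF U, folded V_def]
  have V: "has_generator V F K \<longleftrightarrow> H_rel F (\<i> *\<^sub>c K)" for F K
    using gi[of "rep F" "rep K"] gen[of "rep F" "rep K"] rep_L2 by simp
  have K: "\<i> *\<^sub>c (- \<i>) *\<^sub>c K = K" by (simp add: cscale_cscale)
  define R where "R F K \<longleftrightarrow> H_rel F (\<i> *\<^sub>c K)" for F K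
  have "ugroup V" using unitary_group_ugroup[OF U] by (simp add: V_def[abs_def])
  moreover have "has_generator V (cls f) ((- \<i>) *\<^sub>c K)" "has_generator propagator (cls f) ((- \<i>) *\<^sub>c K)"
    using f(2) K by (simp_all only: V has_generator_propagator)
  moreover have "R F K" if "has_generator V F K" for F K using that by (simp add: R_def V)
  moreover have "R F K" if "has_generator propagator F K" for F K
    using that by (simp add: R_def has_generator_propagator)
  moreover have "R (F - F') (K - K')" if "R F K" "R F' K'" for F K F' K'
    using that by (simp add: R_def cscale_diff H_rel_diff)
  moreover have "inner F K = 0" if "R F K" for F K
    using H_rel_symmetric[of F "\<i> *\<^sub>c K"] that by (simp add: R_def cscale_cscale cscale_minus_one)
  ultimately have "V t (cls f) = propagator t (cls f)"
    using ugroup_unique[OF _ ugroup_propagator, of V "cls f" "(- \<i>) *\<^sub>c K" R t] by blast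
  moreover have "V t (cls f) = cls (U t f)"
    using unitary_group_cls[OF U f(1)] by (simp add: V_def)
  ultimately have "cls (U t f) = cls (rep (propagator t (cls f)))" by simp
  then show ?thesis using cls_eq_iff[OF unitary_group_L2[OF U f(1)] rep_L2] by blast
qed

lemma generator_propagator:
  "(f, g) \<in> generator (\<lambda>t f. rep (propagator t (cls f))) \<longleftrightarrow> f \<in> L2 \<and> g \<in> L2 \<and> H_rel (cls f) (\<i> *\<^sub>c cls g)"
  using generator_iff[OF ugroup_unitary_group[OF ugroup_propagator]] by (simp add: has_generator_propagator)

text \<open>The second function is the formal Bessel operator applied to the Gaussian. Its transform
  is found by pairing with the \<open>HG b\<close>: both this and \<open>k^2\<close> times the
  transformed Gaussian give \<open>\<kappa> s P (4 a b)\<close> with \<open>s = \<nu> + 1\<close>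
  and \<open>P = (a + b) powr (- (s + 1))\<close>.\<close>

lemma hankel_bessel_gaussian:
  assumes a: "a > 0"
  shows "H_rel (G (of_real a)) (cls (\<lambda>x. of_real (4 * a * (\<nu> + 1) - 4 * a\<^sup>2 * x\<^sup>2) * gs (of_real a) x))"
proof -
  define s where "s = \<nu> + 1"
  have s: "s > 0" using nu_nonneg by (simp add: s_def)
  define Q where "Q a = cls (\<lambda>x. of_real (x\<^sup>2) * gs (of_real a) x)" for a
  define X where "X = cls (\<lambda>x. of_real (4 * a * (\<nu> + 1) - 4 * a\<^sup>2 * x\<^sup>2) * gs (of_real a) x)"
  have ga: "gs (of_real a) \<in> L2" "(\<lambda>x. of_real (x\<^sup>2) * gs (of_real a) x) \<in> L2"
    using a gs_L2 gs_sq_L2 by auto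
  have X: "X = of_real (4 * a * s) *\<^sub>c G (of_real a) - of_real (4 * a\<^sup>2) *\<^sub>c Q a"
  proof -
    have "of_real (4 * a * s) *\<^sub>c G (of_real a) - of_real (4 * a\<^sup>2) *\<^sub>c Q a
        = cls (\<lambda>x. of_real (4 * a * s) * gs (of_real a) x - of_real (4 * a\<^sup>2) * (of_real (x\<^sup>2) * gs (of_real a) x))"
      unfolding Q_def using ga L2_cmult by (simp only: cls_cscale cls_diff)
    then show ?thesis by (simp add: X_def s_def left_diff_distrib mult.assoc)
  qed
  have Re4: "Re (1 / (4 * of_real b)) > 0" if "b > 0" for b
    using Re_inverse_pos[of "of_real b"] that by simp
  have "hankel X = hpow (of_real a) *\<^sub>c Q (1 / (4 * a))"
  proof (rule hl2_eqI_HG)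
    fix b :: real assume b: "b > 0"
    \<comment> \<open>The higher of the two powers of \<open>a + b\<close> that occur; the lower one
      is \<open>(a + b) * P\<close>, after which the identity is polynomial.\<close>
    define P where "P = (a + b) powr (- (s + 1))"
    have P: "(a + b) powr (- s) = (a + b) * P"
    proof -
      have "(a + b) powr (- s) = (a + b) powr (1 + (- (s + 1)))" by simp
      also have "\<dots> = (a + b) * P" using a b by (simp only: powr_add P_def) simp
      finally show ?thesis .
    qed
    have cpow: "(of_real x :: complex) powr (- of_real y) = of_real (x powr (- y))" if "x > 0" for x y
      using that by (subst powr_of_real[symmetric]) auto
    have "cinner (hankel X) (HG (of_real b)) = cinner X (G (of_real b))"
      using b by (simp add: cinner_hankel flip: hankel_G_real)
    also have "\<dots> = of_real (4 * a * s * (\<kappa> * (a + b) powr (- s)) - 4 * a\<^sup>2 * (\<kappa> * s * (a + b) powr (- (s + 1))))"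
    proof -
      have "cinner (G (of_real a)) (G (of_real b)) = of_real (\<kappa> * (a + b) powr (- s))"
        using a b cinner_G[of "of_real a" "of_real b"] cpow[of "a + b" s] by (simp add: s_def)
      moreover have "cinner (Q a) (G (of_real b)) = of_real (\<kappa> * s * (a + b) powr (- (s + 1)))"
        using a b cinner_G_sq[of "of_real a" "of_real b"] cpow[of "a + b" "s + 1"]
        by (simp add: Q_def s_def add_ac)
      ultimately show ?thesis
        unfolding X cinner_diff_left cinner_cscale_left by (simp only: of_real_diff of_real_mult)
    qed
    also have "4 * a * s * (\<kappa> * (a + b) powr (- s)) - 4 * a\<^sup>2 * (\<kappa> * s * (a + b) powr (- (s + 1)))
        = (2 * a) powr (- s) * ((2 * b) powr (- s) * (\<kappa> * s * (1 / (4 * a) + 1 / (4 * b)) powr (- (s + 1))))"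
    proof -
      have "1 / (4 * a) + 1 / (4 * b) = (a + b) / (4 * a * b)"
        using a b by (simp add: field_simps)
      then have "(1 / (4 * a) + 1 / (4 * b)) powr (- (s + 1)) = P / (4 * a * b) powr (- (s + 1))"
        using a b by (simp add: P_def powr_divide)
      also have "\<dots> = P * (4 * a * b) powr (s + 1)"
        unfolding powr_minus_divide[of "4 * a * b" "s + 1"] by simp
      also have "(4 * a * b) powr (s + 1) = (4 * a * b) * ((2 * a) powr s * (2 * b) powr s)"
        using a b by (simp add: powr_add mult.assoc flip: powr_mult)
      finally have "(1 / (4 * a) + 1 / (4 * b)) powr (- (s + 1)) = P * ((4 * a * b) * ((2 * a) powr s * (2 * b) powr s))" .
      moreover have "(2 * a) powr (- s) * (2 * a) powr s = 1" "(2 * b) powr (- s) * (2 * b) powr s = 1"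
        using a b by (simp_all flip: powr_add)
      ultimately have e: "(2 * a) powr (- s) * ((2 * b) powr (- s) * (\<kappa> * s * (1 / (4 * a) + 1 / (4 * b)) powr (- (s + 1))))
          = \<kappa> * s * P * (4 * a * b)"
        by (simp add: mult.assoc mult.left_commute)
      have "4 * a * s * (\<kappa> * ((a + b) * P)) - 4 * a\<^sup>2 * (\<kappa> * s * P) = \<kappa> * s * P * (4 * a * b)"
        by (simp add: algebra_simps power2_eq_square)
      then show ?thesis unfolding P P_def[symmetric] e .
    qed
    also have "of_real \<dots> = cinner (hpow (of_real a) *\<^sub>c Q (1 / (4 * a))) (HG (of_real b))"
    proof -
      have "cinner (Q (1 / (4 * a))) (G (1 / (4 * of_real b))) = of_real (\<kappa> * s * (1 / (4 * a) + 1 / (4 * b)) powr (- (s + 1)))"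
        using a b cinner_G_sq[of "of_real (1 / (4 * a))" "1 / (4 * of_real b)"] Re4[OF b]
          cpow[of "1 / (4 * a) + 1 / (4 * b)" "s + 1"]
        by (simp add: Q_def s_def add_ac add_pos_pos)
      then show ?thesis
        unfolding HG_def using a b
        by (simp add: cinner_cscale_left cinner_cscale_right hpow_real s_def)
    qed
    finally show "cinner (hankel X) (HG (of_real b)) = cinner (hpow (of_real a) *\<^sub>c Q (1 / (4 * a))) (HG (of_real b))" .
  qed
  moreover have "mult_rel (\<lambda>k. k\<^sup>2) (hankel (G (of_real a))) (hpow (of_real a) *\<^sub>c Q (1 / (4 * a)))"
    unfolding mult_rel_def hankel_G_real[OF a] HG_def
  proof -
    have b: "Re (of_real (1 / (4 * a))) > 0" using a by simp
    show "AE x in half_line. rep (hpow (of_real a) *\<^sub>c Q (1 / (4 * a))) x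
        = of_real (x\<^sup>2) * rep (hpow (of_real a) *\<^sub>c G (1 / (4 * of_real a))) x"
      using AE_rep_cscale[of "hpow (of_real a)" "Q (1 / (4 * a))"] AE_rep_cscale[of "hpow (of_real a)" "G (1 / (4 * of_real a))"]
        AE_rep_cls[OF gs_sq_L2[OF b], folded Q_def] AE_rep_cls[OF gs_L2[OF b]]
      by eventually_elim simp
  qed
  ultimately show ?thesis by (simp add: H_rel_def X_def)
qed

end

section \<open>Test functions\<close>

lemma
  fixes f :: "real \<Rightarrow> 'a::euclidean_space"
  assumes "0 < a" "\<And>x. x > 0 \<Longrightarrow> x \<notin> {a..b} \<Longrightarrow> f x = 0"
  shows integral_half_line_Icc: "integral\<^sup>L half_line f = integral\<^sup>L (lebesgue_on {a..b}) f"
    and integrable_half_line_Icc: "integrable (lebesgue_on {a..b}) f \<Longrightarrow> integrable half_line f"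
proof -
  have eq: "{a..b} \<inter> {0<..} = {a..b}" using assms(1) by auto
  have "integral\<^sup>L half_line f = integral\<^sup>L half_line (\<lambda>x. if x \<in> {a..b} then f x else 0)"
    by (intro Bochner_Integration.integral_cong) (use assms in auto)
  also have "\<dots> = integral\<^sup>L (lebesgue_on {a..b}) f"
    using Lebesgue_Measure.integral_restrict_Int[of "{a..b}" "{0<..}" f] by (simp add: eq)
  finally show "integral\<^sup>L half_line f = integral\<^sup>L (lebesgue_on {a..b}) f" .
  assume f: "integrable (lebesgue_on {a..b}) f"
  have "integrable half_line f \<longleftrightarrow> integrable half_line (\<lambda>x. if x \<in> {a..b} then f x else 0)"
    by (intro Bochner_Integration.integrable_cong) (use assms in auto)
  also have "\<dots> \<longleftrightarrow> integrable lebesgue (\<lambda>x. if x \<in> {0<..} then (if x \<in> {a..b} then f x else 0) else 0)"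
    by (rule Lebesgue_Measure.integrable_restrict_UNIV[symmetric]) auto
  also have "(\<lambda>x. if x \<in> {0<..} then (if x \<in> {a..b} then f x else 0) else 0) = (\<lambda>x. if x \<in> {a..b} then f x else 0)"
    using assms(1) by auto
  also have "integrable lebesgue (\<lambda>x. if x \<in> {a..b} then f x else 0) \<longleftrightarrow> integrable (lebesgue_on {a..b}) f"
    by (rule Lebesgue_Measure.integrable_restrict_UNIV) auto
  finally show "integrable half_line f" using f by simp
qed

lemma integral_derivative_compact_support:
  fixes W :: "real \<Rightarrow> complex"
  assumes a: "0 < a" "a \<le> b"
    and W: "\<And>x. x \<in> {a..b} \<Longrightarrow> (W has_vector_derivative w x) (at x)" "continuous_on {a..b} w"
    and w: "\<And>x. x > 0 \<Longrightarrow> x \<notin> {a..b} \<Longrightarrow> w x = 0" and ends: "W a = 0" "W b = 0"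
  shows "(LINT x|half_line. w x) = 0"
proof -
  have int: "integrable (lebesgue_on {a..b}) w"
    by (rule continuous_imp_integrable_real[OF W(2)])
  have "(LINT x|half_line. w x) = integral {a..b} w"
    using integral_half_line_Icc[OF a(1) w] lebesgue_integral_eq_integral[OF int] by simp
  also have "(w has_integral (W b - W a)) {a..b}"
    using a W(1) by (intro fundamental_theorem_of_calculus) (auto intro: has_vector_derivative_at_within)
  then have "integral {a..b} w = 0" using ends by (simp add: integral_unique)
  finally show ?thesis .
qed

lemma L2_compact_support:
  fixes f :: "real \<Rightarrow> complex"
  assumes "0 < a" "continuous_on {0<..} f" "\<And>x. x > 0 \<Longrightarrow> x \<notin> {a..b} \<Longrightarrow> f x = 0"
  shows "f \<in> L2"
proof (rule L2I)
  show "f \<in> borel_measurable half_line"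
    using assms(2) by (intro continuous_imp_measurable_on_sets_lebesgue) auto
  have "continuous_on {a..b} f"
    using assms(1) by (intro continuous_on_subset[OF assms(2)]) auto
  then show "integrable half_line (\<lambda>x. (cmod (f x))\<^sup>2)"
    using assms by (intro integrable_half_line_Icc[of a b] continuous_imp_integrable_real continuous_intros) auto
qed

lemma Cc_inf_support:
  assumes "f \<in> Cc_inf"
  obtains a b where "0 < a" "a < b" "\<And>x. x \<notin> {a<..<b} \<Longrightarrow> f x = 0"
proof -
  obtain K where K: "compact K" "K \<subseteq> {0<..}" "\<And>x. x \<notin> K \<Longrightarrow> f x = 0"
    using assms by (auto simp: Cc_inf_def)
  show ?thesis
  proof (cases "K = {}")
    case True then show ?thesis using that[of 1 2] K by auto
  next
    case False
    obtain m where m: "m \<in> K" "\<And>x. x \<in> K \<Longrightarrow> m \<le> x"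
      using compact_attains_inf[OF K(1) False] by auto
    obtain M where M: "M \<in> K" "\<And>x. x \<in> K \<Longrightarrow> x \<le> M"
      using compact_attains_sup[OF K(1) False] by auto
    have m0: "m > 0" using m(1) K(2) by auto
    have mM: "m \<le> M" using m M by auto
    show ?thesis
    \<comment> \<open>The hull of the support is enlarged strictly on both sides but stays in the
      half-line, so \<open>f\<close> also vanishes at the end points.\<close>
    proof (rule that[of "m / 2" "M + 1"])
      fix x assume "x \<notin> {m / 2<..<M + 1}"
      then have "x \<notin> K" using m(2)[of x] M(2)[of x] m0 by auto
      then show "f x = 0" by (rule K(3))
    qed (use m0 mM in auto)
  qed
qed

lemma Cc_infI:
  assumes "\<And>k x. (deriv1 ^^ k) f differentiable (at x)" "0 < a" "\<And>x. x \<notin> {a..b} \<Longrightarrow> f x = 0"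
  shows "f \<in> Cc_inf"
  unfolding Cc_inf_def using assms by (auto intro!: exI[of _ "{a..b}"])

lemma Cc_inf_has_derivative:
  assumes "f \<in> Cc_inf"
  shows "(f has_vector_derivative deriv1 f x) (at x)"
proof -
  have "(deriv1 ^^ 0) f differentiable (at x)" using assms unfolding Cc_inf_def by blast
  then show ?thesis by (simp add: vector_derivative_works)
qed

lemma Cc_inf_deriv:
  assumes "f \<in> Cc_inf"
  shows "deriv1 f \<in> Cc_inf" "\<And>x. x \<notin> {a..b} \<Longrightarrow> (\<And>x. x \<notin> {a..b} \<Longrightarrow> f x = 0) \<Longrightarrow> deriv1 f x = 0"
proof -
  show *: "deriv1 f x = 0" if x: "x \<notin> {a..b}" and z: "\<And>x. x \<notin> {a..b} \<Longrightarrow> f x = 0" for a b x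
  proof -
    have "(f has_vector_derivative 0) (at x)"
    proof (rule has_vector_derivative_transform_within_open[where f = "\<lambda>_. 0" and S = "- {a..b}"])
      show "open (- {a..b})" by (intro open_Compl closed_atLeastAtMost)
    qed (use x z in \<open>auto intro!: derivative_eq_intros\<close>)
    then show ?thesis by (rule vector_derivative_at)
  qed
  obtain a b where ab: "0 < a" "a < b" "\<And>x. x \<notin> {a<..<b} \<Longrightarrow> f x = 0"
    using Cc_inf_support[OF assms] by blast
  show "deriv1 f \<in> Cc_inf"
  proof (rule Cc_infI[OF _ ab(1)])
    fix k x
    have "(deriv1 ^^ Suc k) f differentiable (at x)" using assms unfolding Cc_inf_def by blast
    then show "(deriv1 ^^ k) (deriv1 f) differentiable (at x)"
      by (simp only: funpow_Suc_right o_apply)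
  next
    show "x \<notin> {a..b} \<Longrightarrow> deriv1 f x = 0" for x
      using ab by (intro *[of x a b]) auto
  qed
qed

lemma Cc_inf_continuous: "f \<in> Cc_inf \<Longrightarrow> continuous_on S f"
  using Cc_inf_has_derivative[of f]
  by (intro continuous_at_imp_continuous_on ballI) (auto dest: has_vector_derivative_continuous)

lemma Cc_inf_linear:
  assumes "f \<in> Cc_inf" "g \<in> Cc_inf"
  shows "(\<lambda>x. c * f x + g x) \<in> Cc_inf"
    and "deriv1 (\<lambda>x. c * f x + g x) = (\<lambda>x. c * deriv1 f x + deriv1 g x)"
proof -
  have d: "deriv1 (\<lambda>x. c * F x + K x) = (\<lambda>x. c * deriv1 F x + deriv1 K x)"
    if "\<And>x. F differentiable (at x)" "\<And>x. K differentiable (at x)" for F K :: "real \<Rightarrow> complex"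
  proof
    fix x
    have "(F has_vector_derivative deriv1 F x) (at x)" "(K has_vector_derivative deriv1 K x) (at x)"
      using that by (simp_all add: vector_derivative_works)
    then have "((\<lambda>x. c * F x + K x) has_vector_derivative (c * deriv1 F x + deriv1 K x)) (at x)"
      by (auto intro!: derivative_eq_intros)
    then show "deriv1 (\<lambda>x. c * F x + K x) x = c * deriv1 F x + deriv1 K x"
      by (rule vector_derivative_at)
  qed
  have df: "(deriv1 ^^ k) f differentiable (at x)" "(deriv1 ^^ k) g differentiable (at x)" for k x
    using assms unfolding Cc_inf_def by blast+
  have k: "(deriv1 ^^ k) (\<lambda>x. c * f x + g x) = (\<lambda>x. c * (deriv1 ^^ k) f x + (deriv1 ^^ k) g x)" for k
    by (induction k) (simp_all add: d df)
  show "deriv1 (\<lambda>x. c * f x + g x) = (\<lambda>x. c * deriv1 f x + deriv1 g x)"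
    using k[of 1] by simp
  obtain a b where ab: "0 < a" "a < b" "\<And>x. x \<notin> {a<..<b} \<Longrightarrow> f x = 0"
    using Cc_inf_support[OF assms(1)] by blast
  obtain a' b' where ab': "0 < a'" "a' < b'" "\<And>x. x \<notin> {a'<..<b'} \<Longrightarrow> g x = 0"
    using Cc_inf_support[OF assms(2)] by blast
  show "(\<lambda>x. c * f x + g x) \<in> Cc_inf"
  proof (rule Cc_infI[where a = "min a a'" and b = "max b b'"])
    show "(deriv1 ^^ k) (\<lambda>x. c * f x + g x) differentiable (at x)" for k x
      unfolding k using df[of k x]
      by (auto intro!: differentiable_add differentiable_mult)
    show "c * f x + g x = 0" if "x \<notin> {min a a'..max b b'}" for x
    proof -
      have "x \<notin> {a<..<b}" "x \<notin> {a'<..<b'}" using that by auto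
      then show ?thesis using ab(3) ab'(3) by simp
    qed
  qed (use ab ab' in auto)
qed

lemma Cc_inf_zero: "(\<lambda>x. 0) \<in> Cc_inf"
proof (rule Cc_infI[where a = 1 and b = 1])
  have "(deriv1 ^^ k) (\<lambda>x. 0) = (\<lambda>x. 0)" for k
    by (induction k) auto
  then show "(deriv1 ^^ k) (\<lambda>x. 0) differentiable (at x)" for k x by simp
qed auto

lemma Cc_inf_diff: "f \<in> Cc_inf \<Longrightarrow> g \<in> Cc_inf \<Longrightarrow> (\<lambda>x. f x - g x) \<in> Cc_inf"
  and deriv1_diff: "f \<in> Cc_inf \<Longrightarrow> g \<in> Cc_inf \<Longrightarrow> deriv1 (\<lambda>x. f x - g x) = (\<lambda>x. deriv1 f x - deriv1 g x)"
  using Cc_inf_linear[of g f "-1"] by simp_all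

lemma Cc_inf_L2: "f \<in> Cc_inf \<Longrightarrow> f \<in> L2"
proof -
  assume f: "f \<in> Cc_inf"
  then obtain a b where "0 < a" "a < b" "\<And>x. x \<notin> {a<..<b} \<Longrightarrow> f x = 0"
    using Cc_inf_support by blast
  then show ?thesis by (intro L2_compact_support[of a f b] Cc_inf_continuous f) auto
qed

section \<open>The Bessel operator on test functions and its quadratic form\<close>

context bessel
begin

lemma bessel_op_L2:
  assumes "f \<in> Cc_inf"
  shows "bessel_op \<nu> f \<in> L2"
proof -
  obtain a b where ab: "0 < a" "a < b" "\<And>x. x \<notin> {a<..<b} \<Longrightarrow> f x = 0"
    using Cc_inf_support[OF assms] by blast
  note d = Cc_inf_deriv[OF assms] Cc_inf_deriv[OF Cc_inf_deriv(1)[OF assms]]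
  show ?thesis
  proof (rule L2_compact_support[OF ab(1)])
    show "continuous_on {0<..} (bessel_op \<nu> f)"
      unfolding bessel_op_def using d assms
      by (intro continuous_intros Cc_inf_continuous) auto
    show "bessel_op \<nu> f x = 0" if "x \<notin> {a..b}" for x
    proof -
      have f0: "f x = 0" if "x \<notin> {a..b}" for x using ab(3)[of x] that by auto
      have f1: "deriv1 f x = 0" if "x \<notin> {a..b}" for x using d(2)[OF that f0] .
      have f2: "deriv1 (deriv1 f) x = 0" using d(4)[OF that f1] .
      show ?thesis using f0[OF that] f2 by (simp add: bessel_op_def)
    qed
  qed
qed

lemma deriv_powr_gauss:
  fixes x a c :: real
  assumes "x > 0"
  shows "((\<lambda>x. x powr c * exp (- a * x\<^sup>2)) has_real_derivative
      (c / x - 2 * a * x) * (x powr c * exp (- a * x\<^sup>2))) (at x)"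
  using assms by (auto intro!: derivative_eq_intros simp: powr_diff field_simps power2_eq_square)

text \<open>Lagrange's identity: the Gaussian solves \<open>- g'' + (\<nu>\<^sup>2 - 1/4) g / x\<^sup>2 = (4 a (\<nu> + 1) - 4 a\<^sup>2 x\<^sup>2) g\<close>.\<close>

lemma bessel_op_gaussian:
  assumes f: "f \<in> Cc_inf" and a: "a > 0"
  shows "L2_inner (bessel_op \<nu> f) (gs (of_real a))
    = L2_inner f (\<lambda>x. of_real (4 * a * (\<nu> + 1) - 4 * a\<^sup>2 * x\<^sup>2) * gs (of_real a) x)"
proof -
  define c where "c = \<nu> + 1/2"
  define g where "g x = x powr c * exp (- a * x\<^sup>2)" for x
  define g1 where "g1 x = (c / x - 2 * a * x) * g x" for x
  define g2 where "g2 x = ((c / x - 2 * a * x)\<^sup>2 - c / x\<^sup>2 - 2 * a) * g x" for x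
  have gs: "gs (of_real a) x = of_real (g x)" for x
    by (simp add: gs_def g_def c_def exp_of_real[symmetric])
  have dg: "(g has_real_derivative g1 x) (at x)" if "x > 0" for x
    using deriv_powr_gauss[OF that, of c a] by (simp add: g_def[abs_def] g1_def)
  have dg1: "(g1 has_real_derivative g2 x) (at x)" if "x > 0" for x
    unfolding g1_def[abs_def] using that
    by (auto intro!: derivative_eq_intros dg simp: g2_def g1_def field_simps power2_eq_square)
  obtain l r where lr: "0 < l" "l < r" "\<And>x. x \<notin> {l<..<r} \<Longrightarrow> f x = 0"
    using Cc_inf_support[OF f] by blast
  note d = Cc_inf_deriv[OF f] Cc_inf_deriv[OF Cc_inf_deriv(1)[OF f]]
  have f0: "f x = 0" if "x \<notin> {l..r}" for x using lr(3)[of x] that by auto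
  have f1: "deriv1 f x = 0" if "x \<notin> {l..r}" for x using d(2)[OF that f0] .
  have f2: "deriv1 (deriv1 f) x = 0" if "x \<notin> {l..r}" for x using d(4)[OF that f1] .
  \<comment> \<open>The Wronskian of \<open>f\<close> and \<open>g\<close>: in its derivative
    \<open>w\<close> the first-order products cancel. It is integrated over a larger interval than
    the support, so both boundary terms are zero.\<close>
  define W where "W x = f x * of_real (g1 x) - deriv1 f x * of_real (g x)" for x
  define w where "w x = f x * of_real (g2 x) - deriv1 (deriv1 f) x * of_real (g x)" for x
  have gx: "continuous_on {l / 2..r + 1} g" "continuous_on {l / 2..r + 1} g1"
    using lr by (auto intro!: continuous_at_imp_continuous_on DERIV_isCont[OF dg] DERIV_isCont[OF dg1])
  have "(LINT x|half_line. w x) = 0"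
  proof (rule integral_derivative_compact_support[where a = "l / 2" and b = "r + 1" and W = W])
    show "(W has_vector_derivative w x) (at x)" if "x \<in> {l / 2..r + 1}" for x
    proof -
      have x: "x > 0" using that lr by auto
      note D = bounded_linear.has_vector_derivative[OF bounded_linear_of_real]
        has_real_derivative_iff_has_vector_derivative[THEN iffD1]
      have "((\<lambda>x. complex_of_real (g x)) has_vector_derivative of_real (g1 x)) (at x)"
        "((\<lambda>x. complex_of_real (g1 x)) has_vector_derivative of_real (g2 x)) (at x)"
        by (intro D dg dg1 x)+
      then have "(W has_vector_derivative (f x * of_real (g2 x) + deriv1 f x * of_real (g1 x)
          - (deriv1 f x * of_real (g1 x) + deriv1 (deriv1 f) x * of_real (g x)))) (at x)"
        unfolding W_def[abs_def]
        by (intro has_vector_derivative_diff has_vector_derivative_mult Cc_inf_has_derivative f d(1))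
      then show ?thesis by (simp add: w_def)
    qed
    have "continuous_on {l / 2..r + 1} g2"
      unfolding g2_def using lr gx by (intro continuous_intros) auto
    then show "continuous_on {l / 2..r + 1} w"
      unfolding w_def using gx f d by (intro continuous_intros Cc_inf_continuous) auto
    show "w x = 0" if "x > 0" "x \<notin> {l / 2..r + 1}" for x
      using f0[of x] f2[of x] that lr by (auto simp: w_def)
    show "W (l / 2) = 0" "W (r + 1) = 0"
      using f0[of "l / 2"] f1[of "l / 2"] f0[of "r + 1"] f1[of "r + 1"] lr by (auto simp: W_def)
  qed (use lr in auto)
  also have "(LINT x|half_line. w x) = (LINT x|half_line. bessel_op \<nu> f x * cnj (gs (of_real a) x)
      - f x * cnj (of_real (4 * a * (\<nu> + 1) - 4 * a\<^sup>2 * x\<^sup>2) * gs (of_real a) x))"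
  proof (rule Bochner_Integration.integral_cong)
    fix x assume "x \<in> space half_line"
    then have x: "x > 0" by simp
    have "(4 * a * (\<nu> + 1) - 4 * a\<^sup>2 * x\<^sup>2) * g x = - g2 x + ((\<nu>\<^sup>2 - 1/4) * (1 / x\<^sup>2)) * g x"
      using x by (simp add: g2_def c_def field_simps power2_eq_square)
    then have e: "of_real (4 * a * (\<nu> + 1) - 4 * a\<^sup>2 * x\<^sup>2) * complex_of_real (g x)
        = - of_real (g2 x) + of_real ((\<nu>\<^sup>2 - 1/4) * (1 / x\<^sup>2)) * of_real (g x)"
      by (metis of_real_add of_real_minus of_real_mult)
    show "w x = bessel_op \<nu> f x * cnj (gs (of_real a) x)
      - f x * cnj (of_real (4 * a * (\<nu> + 1) - 4 * a\<^sup>2 * x\<^sup>2) * gs (of_real a) x)"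
      unfolding gs e by (simp add: w_def bessel_op_def algebra_simps)
  qed simp
  also have "\<dots> = L2_inner (bessel_op \<nu> f) (gs (of_real a))
      - L2_inner f (\<lambda>x. of_real (4 * a * (\<nu> + 1) - 4 * a\<^sup>2 * x\<^sup>2) * gs (of_real a) x)"
    unfolding L2_inner_def
  proof (rule Bochner_Integration.integral_diff)
    have z: "Re (of_real a) > 0" using a by simp
    show "integrable half_line (\<lambda>x. bessel_op \<nu> f x * cnj (gs (of_real a) x))"
      by (intro L2_inner_integrable bessel_op_L2 f gs_L2 z)
    have "(\<lambda>x. of_real (4 * a * (\<nu> + 1)) * gs (of_real a) x - of_real (4 * a\<^sup>2) * (of_real (x\<^sup>2) * gs (of_real a) x)) \<in> L2"
      by (intro L2_diff L2_cmult gs_L2 gs_sq_L2 z)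
    then have "(\<lambda>x. of_real (4 * a * (\<nu> + 1) - 4 * a\<^sup>2 * x\<^sup>2) * gs (of_real a) x) \<in> L2"
      by (simp add: left_diff_distrib mult.assoc)
    then show "integrable half_line (\<lambda>x. f x * cnj (of_real (4 * a * (\<nu> + 1) - 4 * a\<^sup>2 * x\<^sup>2) * gs (of_real a) x))"
      by (rule L2_inner_integrable[OF Cc_inf_L2[OF f]])
  qed
  finally show ?thesis by simp
qed

text \<open>With phi = \<open>x powr (\<nu> + 1/2)\<close> this is phi times the derivative of
  \<open>f\<close> / phi: the first-order factor of the Bessel operator, which annihilates the
  ground state.\<close>

definition ground_deriv :: "(real \<Rightarrow> complex) \<Rightarrow> real \<Rightarrow> complex" where
  "ground_deriv f x = deriv1 f x - of_real ((\<nu> + 1/2) / x) * f x"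

lemma ground_deriv_L2:
  assumes "f \<in> Cc_inf"
  shows "ground_deriv f \<in> L2"
proof -
  obtain a b where ab: "0 < a" "a < b" "\<And>x. x \<notin> {a<..<b} \<Longrightarrow> f x = 0"
    using Cc_inf_support[OF assms] by blast
  note d = Cc_inf_deriv[OF assms]
  show ?thesis
  proof (rule L2_compact_support[OF ab(1)])
    show "continuous_on {0<..} (ground_deriv f)"
      unfolding ground_deriv_def using d assms
      by (intro continuous_intros Cc_inf_continuous) auto
    show "ground_deriv f x = 0" if "x \<notin> {a..b}" for x
    proof -
      have f0: "f x = 0" if "x \<notin> {a..b}" for x using ab(3)[of x] that by auto
      then show ?thesis using f0[OF that] d(2)[OF that f0] by (simp add: ground_deriv_def)
    qed
  qed
qed

lemma ground_deriv_diff: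
  assumes "f \<in> Cc_inf" "g \<in> Cc_inf"
  shows "ground_deriv (\<lambda>x. f x - g x) = (\<lambda>x. ground_deriv f x - ground_deriv g x)"
  using fun_cong[OF deriv1_diff[OF assms]] by (simp add: ground_deriv_def fun_eq_iff right_diff_distrib)

text \<open>Factorisation of the form through the ground state \<open>x powr (\<nu> + 1/2)\<close>; this is Hardy's
  inequality for \<open>\<nu> = 0\<close>.\<close>

lemma bessel_form:
  assumes f: "f \<in> Cc_inf"
  shows "L2_inner (bessel_op \<nu> f) f = of_real ((L2_norm (ground_deriv f))\<^sup>2)"
proof -
  define c where "c = \<nu> + 1/2"
  obtain l r where lr: "0 < l" "l < r" "\<And>x. x \<notin> {l<..<r} \<Longrightarrow> f x = 0"
    using Cc_inf_support[OF f] by blast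
  note d = Cc_inf_deriv[OF f] Cc_inf_deriv[OF Cc_inf_deriv(1)[OF f]]
  have f0: "f x = 0" if "x \<notin> {l..r}" for x using lr(3)[of x] that by auto
  have f1: "deriv1 f x = 0" if "x \<notin> {l..r}" for x using d(2)[OF that f0] .
  have f2: "deriv1 (deriv1 f) x = 0" if "x \<notin> {l..r}" for x using d(4)[OF that f1] .
  define v where "v x = ground_deriv f x" for x
  define v1 where "v1 x = deriv1 (deriv1 f) x - (of_real (c / x) * deriv1 f x - of_real (c / x\<^sup>2) * f x)" for x
  \<comment> \<open>The derivative of \<open>v * cnj f\<close>; its vanishing integral is the
    integration by parts.\<close>
  define w where "w x = v x * cnj (deriv1 f x) + v1 x * cnj (f x)" for x
  have dv: "(v has_vector_derivative v1 x) (at x)" if x: "x > 0" for x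
  proof -
    have "((\<lambda>x. c / x) has_real_derivative - (c / x\<^sup>2)) (at x)"
      using x by (auto intro!: derivative_eq_intros simp: power2_eq_square)
    then have "((\<lambda>x. complex_of_real (c / x)) has_vector_derivative of_real (- (c / x\<^sup>2))) (at x)"
      by (intro bounded_linear.has_vector_derivative[OF bounded_linear_of_real]
          has_real_derivative_iff_has_vector_derivative[THEN iffD1])
    then have "(v has_vector_derivative deriv1 (deriv1 f) x - (of_real (c / x) * deriv1 f x + of_real (- (c / x\<^sup>2)) * f x)) (at x)"
      unfolding v_def[abs_def] ground_deriv_def c_def[symmetric]
      by (intro has_vector_derivative_diff has_vector_derivative_mult Cc_inf_has_derivative f d(1))
    then show ?thesis by (simp add: v1_def)
  qed
  have "(LINT x|half_line. w x) = 0"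
  proof (rule integral_derivative_compact_support[where a = "l / 2" and b = "r + 1" and W = "\<lambda>x. v x * cnj (f x)"])
    show "((\<lambda>x. v x * cnj (f x)) has_vector_derivative w x) (at x)" if "x \<in> {l / 2..r + 1}" for x
    proof -
      have x: "x > 0" using that lr by auto
      show ?thesis
        unfolding w_def
        by (intro has_vector_derivative_mult dv x bounded_linear.has_vector_derivative[OF bounded_linear_cnj]
            Cc_inf_has_derivative f)
    qed
    show "continuous_on {l / 2..r + 1} w"
      unfolding w_def v_def ground_deriv_def v1_def using f d lr
      by (intro continuous_intros Cc_inf_continuous) auto
    show "w x = 0" if "x > 0" "x \<notin> {l / 2..r + 1}" for x
      using f0[of x] f1[of x] that lr by (auto simp: w_def)
    show "v (l / 2) * cnj (f (l / 2)) = 0" "v (r + 1) * cnj (f (r + 1)) = 0"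
      using f0[of "l / 2"] f0[of "r + 1"] lr by auto
  qed (use lr in auto)
  also have "(LINT x|half_line. w x) = (LINT x|half_line. ground_deriv f x * cnj (ground_deriv f x) - bessel_op \<nu> f x * cnj (f x))"
  proof (rule Bochner_Integration.integral_cong)
    fix x assume "x \<in> space half_line"
    then have x: "x > 0" by simp
    \<comment> \<open>The Riccati equation behind the factorisation: the potential is the square of
      \<open>c / x\<close> plus its derivative, since \<open>c^2 - c = \<nu>^2 - 1/4\<close> for
      \<open>c = \<nu> + 1/2\<close>.\<close>
    have "(\<nu>\<^sup>2 - 1/4) * (1 / x\<^sup>2) = (c / x)\<^sup>2 - c / x\<^sup>2"
      using x by (simp add: c_def field_simps power2_eq_square)
    moreover define A B where "A = complex_of_real (c / x)" "B = complex_of_real (c / x\<^sup>2)"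
    ultimately have e: "of_real ((\<nu>\<^sup>2 - 1/4) * (1 / x\<^sup>2)) = A * A - B"
      by (simp only: of_real_diff of_real_power power2_eq_square[of "complex_of_real _"])
    have "cnj A = A" by (simp add: A_B_def)
    then show "w x = ground_deriv f x * cnj (ground_deriv f x) - bessel_op \<nu> f x * cnj (f x)"
      unfolding w_def v_def v1_def ground_deriv_def bessel_op_def c_def[symmetric] e A_B_def[symmetric]
      by (simp add: algebra_simps)
  qed simp
  also have "\<dots> = L2_inner (ground_deriv f) (ground_deriv f) - L2_inner (bessel_op \<nu> f) f"
    unfolding L2_inner_def
    by (intro Bochner_Integration.integral_diff L2_inner_integrable ground_deriv_L2 bessel_op_L2 Cc_inf_L2 f)
  finally show ?thesis by (simp add: L2_inner_self L2_norm_def)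
qed

text \<open>A weak criterion: pairing with H applied to Gaussians is enough. On the transform side
  the hypothesis says that \<open>hankel K - k^2 hankel F\<close> is annihilated by every real
  Gaussian, and \<open>gs_total\<close> applies without knowing beforehand that the product is
  square integrable.\<close>

lemma H_rel_testI:
  assumes "\<And>a. a > 0 \<Longrightarrow> cinner K (G (of_real a))
      = cinner F (cls (\<lambda>x. of_real (4 * a * (\<nu> + 1) - 4 * a\<^sup>2 * x\<^sup>2) * gs (of_real a) x))"
  shows "H_rel F K"
proof -
  define D where "D k = rep (hankel K) k - of_real (k\<^sup>2) * rep (hankel F) k" for k
  have "AE k in half_line. D k = 0"
  proof (rule gs_total)
    fix b :: real assume b: "b > 0"
    \<comment> \<open>A test Gaussian of parameter \<open>b\<close> on the transform side comes from
      the Gaussian of parameter \<open>1 / (4 b)\<close>.\<close>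
    define a where "a = 1 / (4 * b)"
    have a: "a > 0" "b = 1 / (4 * a)" using b by (auto simp: a_def)
    define X where "X = cls (\<lambda>x. of_real (4 * a * (\<nu> + 1) - 4 * a\<^sup>2 * x\<^sup>2) * gs (of_real a) x)"
    define Q where "Q = cls (\<lambda>x. of_real (x\<^sup>2) * gs (of_real b) x)"
    have gb: "gs (of_real b) \<in> L2" "(\<lambda>x. of_real (x\<^sup>2) * gs (of_real b) x) \<in> L2"
      using b gs_L2 gs_sq_L2 by auto
    have HGa: "HG (of_real a) = hpow (of_real a) *\<^sub>c G (of_real b)"
      by (simp add: HG_def a(2))
    have hX: "hankel X = hpow (of_real a) *\<^sub>c Q"
    proof (rule hl2_eqI)
      have "AE x in half_line. rep (hankel X) x = of_real (x\<^sup>2) * rep (hankel (G (of_real a))) x"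
        using hankel_bessel_gaussian[OF a(1)] by (simp add: H_rel_def mult_rel_def X_def)
      then show "AE x in half_line. rep (hankel X) x = rep (hpow (of_real a) *\<^sub>c Q) x"
        unfolding hankel_G_real[OF a(1)] HGa
        using AE_rep_cscale[of "hpow (of_real a)" Q] AE_rep_cscale[of "hpow (of_real a)" "G (of_real b)"]
          AE_rep_cls[OF gb(1)] AE_rep_cls[OF gb(2), folded Q_def]
        by eventually_elim simp
    qed
    have i1: "integrable half_line (\<lambda>k. rep (hankel K) k * gs (of_real b) k)"
      by (intro gs_mult_integrable rep_L2 b)
    have cq: "rep (hankel F) k * cnj (of_real (k\<^sup>2) * gs (of_real b) k)
        = (of_real (k\<^sup>2) * rep (hankel F) k) * gs (of_real b) k" for k
      by (simp add: gs_real_cnj mult_ac)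
    have i2: "integrable half_line (\<lambda>k. (of_real (k\<^sup>2) * rep (hankel F) k) * gs (of_real b) k)"
      using L2_inner_integrable[OF rep_L2 gb(2), of "hankel F"] unfolding cq .
    show "integrable half_line (\<lambda>k. D k * gs (of_real b) k)"
      unfolding D_def left_diff_distrib by (intro Bochner_Integration.integrable_diff i1 i2)
    have "(LINT k|half_line. D k * gs (of_real b) k)
        = cinner (hankel K) (G (of_real b)) - cinner (hankel F) Q"
    proof -
      have "cinner (hankel F) Q = (LINT k|half_line. (of_real (k\<^sup>2) * rep (hankel F) k) * gs (of_real b) k)"
        using cinner_cls[OF rep_L2 gb(2), of "hankel F"] unfolding L2_inner_def cq by (simp add: Q_def)
      then show ?thesis
        unfolding D_def left_diff_distrib
        by (subst Bochner_Integration.integral_diff[OF i1 i2]) (simp add: cinner_G_real[OF b])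
    qed
    moreover have "cinner (hankel K) (hpow (of_real a) *\<^sub>c G (of_real b)) = cinner (hankel F) (hpow (of_real a) *\<^sub>c Q)"
      using assms[OF a(1)] unfolding hX[symmetric] HGa[symmetric] hankel_G_real[OF a(1), symmetric] cinner_hankel
      by (simp add: X_def)
    ultimately show "(LINT k|half_line. D k * gs (of_real b) k) = 0"
      using hpow_nonzero[of "of_real a"] a by (simp add: cinner_cscale_right)
  qed
  then show ?thesis
    unfolding H_rel_def mult_rel_def by eventually_elim (simp add: D_def)
qed

lemma gs_poly_L2: "a > 0 \<Longrightarrow> (\<lambda>x. of_real (4 * a * (\<nu> + 1) - 4 * a\<^sup>2 * x\<^sup>2) * gs (of_real a) x) \<in> L2"
proof -
  assume "a > 0"
  then have "(\<lambda>x. of_real (4 * a * (\<nu> + 1)) * gs (of_real a) x - of_real (4 * a\<^sup>2) * (of_real (x\<^sup>2) * gs (of_real a) x)) \<in> L2"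
    by (intro L2_diff L2_cmult gs_L2 gs_sq_L2) auto
  then show ?thesis by (simp add: left_diff_distrib mult.assoc)
qed

lemma H_rel_bessel_op:
  assumes "f \<in> Cc_inf"
  shows "H_rel (cls f) (cls (bessel_op \<nu> f))"
proof (rule H_rel_testI)
  fix a :: real assume a: "a > 0"
  then have z: "Re (of_real a) > 0" by simp
  show "cinner (cls (bessel_op \<nu> f)) (G (of_real a))
      = cinner (cls f) (cls (\<lambda>x. of_real (4 * a * (\<nu> + 1) - 4 * a\<^sup>2 * x\<^sup>2) * gs (of_real a) x))"
    unfolding cinner_cls[OF bessel_op_L2[OF assms] gs_L2[OF z]] cinner_cls[OF Cc_inf_L2[OF assms] gs_poly_L2[OF a]]
    by (rule bessel_op_gaussian[OF assms a])
qed

end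

section \<open>Smooth cutoffs\<close>

text \<open>The derivative of \<open>bump m p\<close> is \<open>bump (m + 2) (bump_poly m p)\<close>, so the family is closed under
  differentiation and its members are smooth.\<close>

definition bump :: "nat \<Rightarrow> real poly \<Rightarrow> real \<Rightarrow> real" where
  "bump m p y = (if \<bar>y\<bar> < 1 then poly p y / (1 - y\<^sup>2) ^ m * exp (- (1 / (1 - y\<^sup>2))) else 0)"

definition bump_poly :: "nat \<Rightarrow> real poly \<Rightarrow> real poly" where
  "bump_poly m p = pderiv p * [:1, 0, -1:]\<^sup>2 + [:0, 2 * of_nat m:] * p * [:1, 0, -1:] - [:0, 2:] * p"

text \<open>A single term of the exponential series. It yields the flatness of the bump, the
  absorption of powers into the exponential weight and the interpolation constant.\<close>

lemma power_div_fact_le_exp: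
  fixes x :: real
  assumes "x \<ge> 0"
  shows "x ^ n / fact n \<le> exp x"
proof -
  have s: "(\<lambda>n. x ^ n /\<^sub>R fact n) sums exp x" by (rule exp_converges)
  have "(\<Sum>k\<in>{n}. x ^ k /\<^sub>R fact k) \<le> (\<Sum>k. x ^ k /\<^sub>R fact k)"
    using assms by (intro sum_le_suminf sums_summable[OF s]) auto
  then show ?thesis using sums_unique[OF s] by (simp add: divide_inverse mult.commute)
qed

lemma DERIV_zero_if_quadratic:
  fixes F :: "real \<Rightarrow> real"
  assumes "\<And>z. \<bar>F z - F y\<bar> \<le> C * (z - y)\<^sup>2"
  shows "(F has_real_derivative 0) (at y)"
  unfolding has_field_derivative_iff
proof (rule Lim_null_comparison)
  show "\<forall>\<^sub>F z in at y. norm ((F z - F y) / (z - y)) \<le> C * \<bar>z - y\<bar>"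
  proof (rule eventually_at_filter[THEN iffD2], rule always_eventually, intro allI impI)
    fix z assume "z \<noteq> y"
    then show "norm ((F z - F y) / (z - y)) \<le> C * \<bar>z - y\<bar>"
      using assms[of z] by (simp add: abs_divide divide_le_eq mult.assoc power2_eq_square abs_mult[symmetric])
  qed
  have "((\<lambda>z. C * \<bar>z - y\<bar>) \<longlongrightarrow> C * \<bar>y - y\<bar>) (at y)" by (intro tendsto_intros)
  then show "((\<lambda>z. C * \<bar>z - y\<bar>) \<longlongrightarrow> 0) (at y)" by simp
qed

text \<open>Inside the interval this is the quotient rule. At and beyond the end points the term of
  index \<open>m + 2\<close> of the exponential series bounds the bump by a multiple of
  \<open>u^2\<close>, where \<open>u = 1 - z^2\<close> is at most twice the distance to
  \<open>y\<close>; a quadratic bound makes the derivative vanish.\<close>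

lemma bump_has_derivative: "(bump m p has_real_derivative bump (m + 2) (bump_poly m p) y) (at y)"
proof (cases "\<bar>y\<bar> < 1")
  case True
  have u: "1 - y\<^sup>2 > 0" using True by (simp add: abs_square_less_1)
  define u where "u = 1 - y\<^sup>2"
  have u0: "u \<noteq> 0" using u by (simp add: u_def)
  have "((\<lambda>y. poly p y / (1 - y\<^sup>2) ^ m * exp (- (1 / (1 - y\<^sup>2)))) has_real_derivative
      ((poly (pderiv p) y * u ^ m - poly p y * (of_nat m * u ^ (m - 1) * (- (2 * y)))) / (u ^ m * u ^ m)) * exp (- (1 / u))
      + poly p y / u ^ m * (exp (- (1 / u)) * (- (2 * y / (u * u))))) (at y)"
  proof -
    have Du: "((\<lambda>y. 1 - y\<^sup>2) has_real_derivative - (2 * y)) (at y)"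
      by (auto intro!: derivative_eq_intros)
    have De: "((\<lambda>y. exp (- (1 / (1 - y\<^sup>2)))) has_real_derivative exp (- (1 / u)) * (- (2 * y / (u * u)))) (at y)"
      unfolding u_def using u by (auto intro!: derivative_eq_intros simp: power2_eq_square)
    have "(1 - y\<^sup>2) ^ m \<noteq> 0" using u by simp
    from DERIV_mult[OF DERIV_divide[OF poly_DERIV DERIV_power[OF Du] this] De] show ?thesis
      by (simp add: u_def mult_ac)
  qed
  also have "((poly (pderiv p) y * u ^ m - poly p y * (of_nat m * u ^ (m - 1) * (- (2 * y)))) / (u ^ m * u ^ m)) * exp (- (1 / u))
      + poly p y / u ^ m * (exp (- (1 / u)) * (- (2 * y / (u * u))))
      = poly (bump_poly m p) y / u ^ (m + 2) * exp (- (1 / u))"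
  proof -
    have q: "poly [:1, 0, -1:] y = u" by (simp add: u_def power2_eq_square)
    have bp: "poly (bump_poly m p) y = poly (pderiv p) y * u\<^sup>2 + 2 * of_nat m * y * poly p y * u - 2 * y * poly p y"
      unfolding bump_poly_def poly_diff poly_add poly_mult poly_power q by (simp add: algebra_simps)
    have um: "of_nat m * u ^ (m - 1) = of_nat m * u ^ m / u"
      using u0 by (cases m) auto
    show ?thesis unfolding bp um using u0
      by (simp add: field_simps power2_eq_square power_add)
  qed
  finally have D: "((\<lambda>y. poly p y / (1 - y\<^sup>2) ^ m * exp (- (1 / (1 - y\<^sup>2)))) has_real_derivative
      bump (m + 2) (bump_poly m p) y) (at y)"
    using True by (simp add: bump_def u_def)
  show ?thesis
  proof (rule has_field_derivative_transform_within_open[OF D, where S = "{-1<..<1}"])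
    show "y \<in> {-1<..<1}" using True by auto
  qed (auto simp: bump_def)
next
  case False
  have "compact (poly p ` {-1..1})"
    by (intro compact_continuous_image continuous_intros) auto
  then obtain B where B: "\<And>z. z \<in> {-1..1} \<Longrightarrow> \<bar>poly p z\<bar> \<le> B"
    using compact_imp_bounded bounded_iff by (metis image_eqI real_norm_def)
  have "(bump m p has_real_derivative 0) (at y)"
  proof (rule DERIV_zero_if_quadratic)
    fix z
    have B0: "0 \<le> B" using B[of 0] by simp
    show "\<bar>bump m p z - bump m p y\<bar> \<le> (4 * B * fact (m + 2)) * (z - y)\<^sup>2"
    proof (cases "\<bar>z\<bar> < 1")
      case True
      define u where "u = 1 - z\<^sup>2"
      have u: "u > 0" using True by (simp add: abs_square_less_1 u_def)
      have "u = (1 - \<bar>z\<bar>) * (1 + \<bar>z\<bar>)" by (simp add: u_def algebra_simps power2_eq_square)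
      also have "\<dots> \<le> (1 - \<bar>z\<bar>) * 2" using True by (intro mult_left_mono) auto
      also have "\<dots> \<le> 2 * \<bar>z - y\<bar>"
        using False abs_triangle_ineq2[of y z] abs_minus_commute[of y z] by simp
      finally have "u\<^sup>2 \<le> (2 * \<bar>z - y\<bar>)\<^sup>2" using u by (intro power_mono) auto
      then have u2: "u\<^sup>2 \<le> 4 * (z - y)\<^sup>2" by (simp add: power_mult_distrib)
      have "(1 / u) ^ (m + 2) / fact (m + 2) \<le> exp (1 / u)"
        using u by (intro power_div_fact_le_exp) simp
      then have "exp (- (1 / u)) \<le> fact (m + 2) * u ^ (m + 2)"
        using u by (simp add: exp_minus field_simps power_divide del: fact_Suc)
      then have e: "1 / u ^ m * exp (- (1 / u)) \<le> fact (m + 2) * u\<^sup>2"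
        using u by (simp add: field_simps power_add power2_eq_square del: fact_Suc)
      have "\<bar>bump m p z - bump m p y\<bar> = \<bar>poly p z\<bar> * (1 / u ^ m * exp (- (1 / u)))"
        using True False u by (simp add: bump_def u_def[symmetric] abs_mult)
      also have "\<dots> \<le> B * (fact (m + 2) * u\<^sup>2)"
        using True u by (intro mult_mono[OF B e B0]) (auto simp: abs_le_iff)
      also have "\<dots> \<le> B * (fact (m + 2) * (4 * (z - y)\<^sup>2))"
        using B0 u2 by (intro mult_left_mono) auto
      finally show ?thesis by (simp add: mult_ac del: fact_Suc)
    qed (use False B0 in \<open>auto simp: bump_def\<close>)
  qed
  then show ?thesis using False by (simp add: bump_def)
qed

text \<open>The k-th derivative of the standard bump, obtained by iterating
  \<open>bump_poly\<close>. The exponent \<open>2 * k\<close> follows the rise by two at each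
  differentiation, and the initial polynomial \<open>exp 1\<close> normalises the bump to the value
  1 at 0.\<close>

fun bump_deriv :: "nat \<Rightarrow> real \<Rightarrow> real" where
  "bump_deriv k = bump (2 * k) (rec_nat [:exp 1:] (\<lambda>k p. bump_poly (2 * k) p) k)"

declare bump_deriv.simps [simp del]

lemma bump_deriv_has_derivative: "(bump_deriv k has_real_derivative bump_deriv (Suc k) y) (at y)"
  using bump_has_derivative[of "2 * k" "rec_nat [:exp 1:] (\<lambda>k p. bump_poly (2 * k) p) k" y]
  by (simp add: bump_deriv.simps)

lemma bump_deriv_support: "\<bar>y\<bar> \<ge> 1 \<Longrightarrow> bump_deriv k y = 0"
  by (simp add: bump_deriv.simps bump_def)

lemma bump_deriv_0_0: "bump_deriv 0 0 = 1"
  by (simp add: bump_deriv.simps bump_def flip: exp_add)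

lemma bump_deriv_continuous: "continuous_on S (bump_deriv k)"
  using bump_deriv_has_derivative by (intro continuous_at_imp_continuous_on ballI) (blast intro: DERIV_isCont)

lemma bump_deriv_bounded: "\<exists>B. \<forall>y. \<bar>bump_deriv k y\<bar> \<le> B"
proof -
  have "compact (bump_deriv k ` {-1..1})"
    by (intro compact_continuous_image bump_deriv_continuous) auto
  then obtain B where B: "\<And>y. y \<in> {-1..1} \<Longrightarrow> \<bar>bump_deriv k y\<bar> \<le> B"
    using compact_imp_bounded bounded_iff by (metis image_eqI real_norm_def)
  have "\<bar>bump_deriv k y\<bar> \<le> B" for y
  proof (cases "\<bar>y\<bar> \<ge> 1")
    case True then show ?thesis using B[of 0] by (simp add: bump_deriv_support)
  next
    case False then show ?thesis by (intro B) (auto simp: abs_le_iff)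
  qed
  then show ?thesis by blast
qed

text \<open>If a class of functions is closed under differentiation, all iterated derivatives stay
  in it by induction; smoothness follows without a formula for them.\<close>

lemma smooth_Cc_infI:
  fixes \<S> :: "(real \<Rightarrow> real) set"
  assumes der: "\<And>F. F \<in> \<S> \<Longrightarrow> \<exists>F'\<in>\<S>. \<forall>x. (F has_real_derivative F' x) (at x)"
    and supp: "0 < a" "\<And>x. x \<notin> {a..b} \<Longrightarrow> F x = 0" and F: "F \<in> \<S>"
  shows "(\<lambda>x. complex_of_real (F x)) \<in> Cc_inf"
proof (rule Cc_infI[OF _ supp(1)])
  fix k x
  have step: "\<exists>K'\<in>\<S>. (\<forall>x. ((\<lambda>x. complex_of_real (K x)) has_vector_derivative of_real (K' x)) (at x))"
    if K: "K \<in> \<S>" for K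
  proof -
    obtain K' where K': "K' \<in> \<S>" "\<And>x. (K has_real_derivative K' x) (at x)" using der[OF K] by blast
    then have "((\<lambda>x. complex_of_real (K x)) has_vector_derivative of_real (K' x)) (at x)" for x
      by (intro bounded_linear.has_vector_derivative[OF bounded_linear_of_real]
          has_real_derivative_iff_has_vector_derivative[THEN iffD1])
    with K'(1) show ?thesis by blast
  qed
  have "\<exists>K\<in>\<S>. (deriv1 ^^ k) (\<lambda>x. complex_of_real (F x)) = (\<lambda>x. of_real (K x))"
  proof (induction k)
    case 0 show ?case using F by auto
  next
    case (Suc k)
    then obtain K where K: "K \<in> \<S>" "(deriv1 ^^ k) (\<lambda>x. complex_of_real (F x)) = (\<lambda>x. of_real (K x))" by blast
    obtain K' where K': "K' \<in> \<S>" "\<forall>x. ((\<lambda>x. complex_of_real (K x)) has_vector_derivative of_real (K' x)) (at x)"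
      using step[OF K(1)] by blast
    then have "deriv1 (\<lambda>x. complex_of_real (K x)) = (\<lambda>x. of_real (K' x))"
      by (auto intro!: vector_derivative_at)
    then have "(deriv1 ^^ Suc k) (\<lambda>x. complex_of_real (F x)) = (\<lambda>x. of_real (K' x))"
      using K(2) by simp
    with K'(1) show ?case by blast
  qed
  then obtain K where K: "K \<in> \<S>" "(deriv1 ^^ k) (\<lambda>x. complex_of_real (F x)) = (\<lambda>x. of_real (K x))" by blast
  show "(deriv1 ^^ k) (\<lambda>x. complex_of_real (F x)) differentiable (at x)"
    unfolding K(2) using step[OF K(1)] by (auto intro: differentiableI_vector)
qed (use supp in auto)

text \<open>Cutoffs in the variable \<open>ln x\<close>: they have vanishing energy at the origin even for \<open>\<nu> = 0\<close>.\<close>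

definition log_cut :: "real \<Rightarrow> real \<Rightarrow> nat \<Rightarrow> real \<Rightarrow> real \<Rightarrow> real" where
  "log_cut t a k \<beta> x = (if x > 0 then t ^ k * bump_deriv k (t * ln x) * (x powr \<beta> * exp (- a * x\<^sup>2)) else 0)"

lemma log_cut_support:
  assumes t: "t > 0" and x: "x \<notin> {exp (- (1 / t))..exp (1 / t)}"
  shows "log_cut t a k \<beta> x = 0"
proof (cases "x > 0")
  case True
  have "1 \<le> \<bar>t * ln x\<bar>"
  proof (cases "x < exp (- (1 / t))")
    case True
    then have "ln x < ln (exp (- (1 / t)))" using \<open>x > 0\<close> by (subst ln_less_cancel_iff) auto
    then have "ln x < - (1 / t)" by simp
    then have "t * ln x < t * (- (1 / t))" using t by (intro mult_strict_left_mono)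
    then show ?thesis using t by simp
  next
    case False
    then have "x > exp (1 / t)" using x by auto
    then have "ln x > 1 / t" using \<open>x > 0\<close> by (metis exp_gt_zero exp_ln exp_less_cancel_iff)
    then have "t * ln x > t * (1 / t)" using t by (intro mult_strict_left_mono)
    then show ?thesis using t by simp
  qed
  then show ?thesis by (simp add: log_cut_def bump_deriv_support)
qed (simp add: log_cut_def)

lemma log_cut_has_derivative:
  assumes t: "t > 0"
  shows "(log_cut t a k \<beta> has_real_derivative
    (log_cut t a (Suc k) (\<beta> - 1) x + \<beta> * log_cut t a k (\<beta> - 1) x - 2 * a * log_cut t a k (\<beta> + 1) x)) (at x)"
proof (cases "x > 0")
  case True
  have D: "((\<lambda>x. t ^ k * bump_deriv k (t * ln x) * (x powr \<beta> * exp (- a * x\<^sup>2))) has_real_derivative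
     t ^ k * (bump_deriv (Suc k) (t * ln x) * (t / x)) * (x powr \<beta> * exp (- a * x\<^sup>2))
     + t ^ k * bump_deriv k (t * ln x) * ((\<beta> / x - 2 * a * x) * (x powr \<beta> * exp (- a * x\<^sup>2)))) (at x)"
  proof -
    have "((\<lambda>x. t * ln x) has_real_derivative t / x) (at x)"
      using True by (auto intro!: derivative_eq_intros)
    then have "((\<lambda>x. bump_deriv k (t * ln x)) has_real_derivative bump_deriv (Suc k) (t * ln x) * (t / x)) (at x)"
      by (rule DERIV_chain2[OF bump_deriv_has_derivative])
    then have "((\<lambda>x. t ^ k * bump_deriv k (t * ln x)) has_real_derivative t ^ k * (bump_deriv (Suc k) (t * ln x) * (t / x))) (at x)"
      by (rule DERIV_cmult)
    from DERIV_mult[OF this bessel.deriv_powr_gauss[OF _ True, of 0 \<beta> a]] show ?thesis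
      by (simp add: bessel_def mult_ac)
  qed
  have p: "x powr (\<beta> - 1) = x powr \<beta> / x" "x powr (\<beta> + 1) = x powr \<beta> * x"
    using True by (simp_all add: powr_diff powr_add)
  have eq: "t ^ k * (bump_deriv (Suc k) (t * ln x) * (t / x)) * (x powr \<beta> * exp (- a * x\<^sup>2))
     + t ^ k * bump_deriv k (t * ln x) * ((\<beta> / x - 2 * a * x) * (x powr \<beta> * exp (- a * x\<^sup>2)))
     = log_cut t a (Suc k) (\<beta> - 1) x + \<beta> * log_cut t a k (\<beta> - 1) x - 2 * a * log_cut t a k (\<beta> + 1) x"
    unfolding log_cut_def p using True by (simp add: field_simps)
  show ?thesis
    by (rule has_field_derivative_transform_within_open[OF D[unfolded eq], where S = "{0<..}"])
      (use True in \<open>auto simp: log_cut_def\<close>)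
next
  case False
  \<comment> \<open>To the left of the support, and in particular at every \<open>x \<le> 0\<close>,
    the function vanishes in a whole neighbourhood.\<close>
  define e where "e = exp (- (1 / t))"
  have z: "log_cut t a k \<beta> y = 0" if "y < e" for k \<beta> y
    using that t by (intro log_cut_support) (auto simp: e_def)
  have e: "x < e" using False exp_gt_zero[of "- (1 / t)"] unfolding e_def by linarith
  have "(log_cut t a k \<beta> has_real_derivative 0) (at x)"
    by (rule has_field_derivative_transform_within_open[where f = "\<lambda>_. 0" and S = "{..<e}"])
      (use e in \<open>auto simp: z\<close>)
  then show ?thesis using z[OF e] by simp
qed

text \<open>Differentiating the cutoff of index \<open>(k, \<beta>)\<close> gives a combination of
  those of index \<open>(k + 1, \<beta> - 1)\<close>, \<open>(k, \<beta> - 1)\<close> and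
  \<open>(k, \<beta> + 1)\<close>; the linear hull of all of them is therefore closed under
  differentiation.\<close>

inductive_set log_cut_span :: "real \<Rightarrow> real \<Rightarrow> (real \<Rightarrow> real) set" for t a where
  base: "log_cut t a k \<beta> \<in> log_cut_span t a"
| lin: "F \<in> log_cut_span t a \<Longrightarrow> K \<in> log_cut_span t a \<Longrightarrow> (\<lambda>x. F x + c * K x) \<in> log_cut_span t a"

lemma log_cut_span_deriv:
  assumes t: "t > 0" and "F \<in> log_cut_span t a"
  shows "\<exists>F'\<in>log_cut_span t a. \<forall>x. (F has_real_derivative F' x) (at x)"
  using assms(2)
proof induction
  case (base k \<beta>)
  have "(\<lambda>x. (log_cut t a (Suc k) (\<beta> - 1) x + \<beta> * log_cut t a k (\<beta> - 1) x) + (- 2 * a) * log_cut t a k (\<beta> + 1) x)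
      \<in> log_cut_span t a"
    by (intro log_cut_span.intros)
  moreover have "(log_cut t a k \<beta> has_real_derivative
     ((log_cut t a (Suc k) (\<beta> - 1) x + \<beta> * log_cut t a k (\<beta> - 1) x) + (- 2 * a) * log_cut t a k (\<beta> + 1) x)) (at x)" for x
    using log_cut_has_derivative[OF t, of a k \<beta> x] by simp
  ultimately show ?case
    by (intro bexI[of _ "\<lambda>x. (log_cut t a (Suc k) (\<beta> - 1) x + \<beta> * log_cut t a k (\<beta> - 1) x) + (- 2 * a) * log_cut t a k (\<beta> + 1) x"] allI)
next
  case (lin F K c)
  then obtain F' K' where F': "F' \<in> log_cut_span t a" "\<And>x. (F has_real_derivative F' x) (at x)"
    and K': "K' \<in> log_cut_span t a" "\<And>x. (K has_real_derivative K' x) (at x)" by blast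
  have "((\<lambda>x. F x + c * K x) has_real_derivative F' x + c * K' x) (at x)" for x
    by (intro DERIV_add DERIV_cmult F' K')
  moreover have "(\<lambda>x. F' x + c * K' x) \<in> log_cut_span t a" by (intro log_cut_span.intros F' K')
  ultimately show ?case by (intro bexI[of _ "\<lambda>x. F' x + c * K' x"] allI)
qed

lemma log_cut_Cc_inf: "t > 0 \<Longrightarrow> (\<lambda>x. complex_of_real (log_cut t a k \<beta> x)) \<in> Cc_inf"
  by (rule smooth_Cc_infI[where \<S> = "log_cut_span t a" and a = "exp (- (1 / t))" and b = "exp (1 / t)"])
    (auto intro: log_cut_span_deriv log_cut_span.base log_cut_support)

section \<open>Approximation of Gaussians in the form norm\<close>

context bessel
begin

text \<open>Subtracting \<open>(\<nu> + 1/2) / x\<close> cancels the derivative of the power, so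
  only the derivatives of the cutoff and of the Gaussian survive.\<close>

lemma ground_deriv_log_cut:
  assumes t: "t > 0" and x: "x > 0"
  shows "ground_deriv (\<lambda>x. complex_of_real (log_cut t a 0 (\<nu> + 1/2) x)) x
    = of_real (t * bump_deriv 1 (t * ln x) / x) * gs (of_real a) x
      + of_real (bump_deriv 0 (t * ln x)) * (of_real (- 2 * a) * (of_real (x ^ 1) * gs (of_real a) x))"
proof -
  define c where "c = \<nu> + 1/2"
  have gs: "gs (of_real a) x = of_real (x powr c * exp (- a * x\<^sup>2))"
    by (simp add: gs_def c_def exp_of_real[symmetric])
  have "deriv1 (\<lambda>x. complex_of_real (log_cut t a 0 c x)) x
      = of_real (log_cut t a (Suc 0) (c - 1) x + c * log_cut t a 0 (c - 1) x - 2 * a * log_cut t a 0 (c + 1) x)"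
    by (intro vector_derivative_at bounded_linear.has_vector_derivative[OF bounded_linear_of_real]
        has_real_derivative_iff_has_vector_derivative[THEN iffD1] log_cut_has_derivative t)
  then have "ground_deriv (\<lambda>x. complex_of_real (log_cut t a 0 c x)) x
      = of_real (log_cut t a (Suc 0) (c - 1) x + c * log_cut t a 0 (c - 1) x - 2 * a * log_cut t a 0 (c + 1) x
        - c / x * log_cut t a 0 c x)"
    by (simp add: ground_deriv_def c_def)
  also have "log_cut t a (Suc 0) (c - 1) x + c * log_cut t a 0 (c - 1) x - 2 * a * log_cut t a 0 (c + 1) x
        - c / x * log_cut t a 0 c x
      = t * bump_deriv 1 (t * ln x) / x * (x powr c * exp (- a * x\<^sup>2))
        + bump_deriv 0 (t * ln x) * (- 2 * a * (x * (x powr c * exp (- a * x\<^sup>2))))"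
  proof -
    have p: "x powr (c - 1) = x powr c / x" "x powr (c + 1) = x powr c * x"
      using x by (simp_all add: powr_diff powr_add)
    show ?thesis unfolding log_cut_def p using x by (simp add: field_simps)
  qed
  finally show ?thesis unfolding gs c_def by (simp only: of_real_add of_real_mult power_one_right)
qed

lemma integral_inverse_Icc:
  assumes "0 < l" "l \<le> 1"
  shows "integrable half_line (\<lambda>x. if l \<le> x \<and> x \<le> 1 then 1 / x else 0 :: real)"
    and "(LINT x|half_line. (if l \<le> x \<and> x \<le> 1 then 1 / x else 0)) = - ln l"
proof -
  let ?f = "\<lambda>x::real. if l \<le> x \<and> x \<le> 1 then 1 / x else 0"
  have supp: "x > 0 \<Longrightarrow> x \<notin> {l..1} \<Longrightarrow> ?f x = 0" for x by auto
  have "continuous_on {l..1} (\<lambda>x. 1 / x)" using assms by (intro continuous_intros) auto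
  then have "integrable (lebesgue_on {l..1}) (\<lambda>x. 1 / x)" by (rule continuous_imp_integrable_real)
  then have int: "integrable (lebesgue_on {l..1}) ?f"
    by (rule Bochner_Integration.integrable_cong[THEN iffD1, rotated -1]) auto
  show "integrable half_line ?f"
  proof (rule integrable_half_line_Icc[of l 1 ?f])
    show "x > 0 \<Longrightarrow> x \<notin> {l..1} \<Longrightarrow> ?f x = 0" for x by (rule supp)
  qed (use assms int in auto)
  have "((\<lambda>x. 1 / x) has_integral (ln 1 - ln l)) {l..1}"
    using assms by (intro fundamental_theorem_of_calculus)
      (auto intro!: derivative_eq_intros simp: has_real_derivative_iff_has_vector_derivative[symmetric])
  then have "(?f has_integral (ln 1 - ln l)) {l..1}"
    by (rule has_integral_eq[rotated]) auto
  then show "(LINT x|half_line. ?f x) = - ln l"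
    using integral_half_line_Icc[where f = ?f, OF assms(1) supp] lebesgue_integral_eq_integral[OF int] by (simp add: integral_unique)
qed

text \<open>Near the origin the energy density is at most a multiple of \<open>t^2 / x\<close>, and
  the cutoff lives on \<open>x \<ge> exp (- (1 / t))\<close>, where \<open>1 / x\<close> has
  integral \<open>1 / t\<close> up to 1. The energy is thus of order t. For \<nu> = 0 a linearly
  rescaled cutoff would keep energy of order one, which is why the scale is logarithmic.\<close>

lemma cutoff_energy:
  assumes t: "t > 0" and a: "a > 0" and B: "\<And>y. \<bar>bump_deriv 1 y\<bar> \<le> B"
  defines "C \<equiv> (LINT x|half_line. x powr (2 * \<nu> + 1) * exp (- (2 * a) * x\<^sup>2))"
    and "f \<equiv> \<lambda>x. of_real (t * bump_deriv 1 (t * ln x) / x) * gs (of_real a) x"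
  shows "f \<in> L2" "(L2_norm f)\<^sup>2 \<le> t\<^sup>2 * B\<^sup>2 * (1 / t + C)"
proof -
  define l where "l = exp (- (1 / t))"
  have l: "0 < l" "l \<le> 1" "- ln l = 1 / t" using t by (auto simp: l_def)
  \<comment> \<open>The majorant: \<open>1 / x\<close> on \<open>{l..1}\<close>, where
    \<open>x powr (2 * \<nu>) \<le> 1\<close>, and the Gaussian moment beyond 1, where dividing by
    \<open>x^2\<close> only helps. Below \<open>l\<close> the cutoff derivative is zero.\<close>
  define w where "w x = t\<^sup>2 * B\<^sup>2 * ((if l \<le> x \<and> x \<le> 1 then 1 / x else 0) + x powr (2 * \<nu> + 1) * exp (- (2 * a) * x\<^sup>2))" for x
  have B0: "0 \<le> B" using B[of 0] by linarith
  have ig: "integrable half_line (\<lambda>x. x powr (2 * \<nu> + 1) * exp (- (2 * a) * x\<^sup>2))"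
    using nu_nonneg a by (intro integrable_gaussian_moment) auto
  have w: "integrable half_line w"
    unfolding w_def by (intro integrable_mult_right Bochner_Integration.integrable_add integral_inverse_Icc l ig)
  have [measurable]: "f \<in> borel_measurable half_line"
  proof -
    have 1: "continuous_on {0<..} (\<lambda>x. t * bump_deriv 1 (t * ln x) / x)"
      by (intro continuous_intros continuous_on_compose2[OF bump_deriv_continuous[of UNIV]]) auto
    have [measurable]: "(\<lambda>x. t * bump_deriv 1 (t * ln x) / x) \<in> borel_measurable half_line"
      by (intro continuous_imp_measurable_on_sets_lebesgue 1) auto
    show ?thesis unfolding f_def by measurable
  qed
  have bd: "(cmod (f x))\<^sup>2 \<le> w x" if x: "x > 0" for x
  proof -
    have g2: "(cmod (gs (of_real a) x))\<^sup>2 = x powr (2 * \<nu> + 1) * exp (- (2 * a) * x\<^sup>2)"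
    proof -
      have "complex_of_real ((cmod (gs (of_real a) x))\<^sup>2) = of_real (x powr (2 * \<nu> + 1) * exp (- (2 * a) * x\<^sup>2))"
        unfolding complex_norm_square gs_mult_cnj by (simp add: exp_of_real[symmetric])
      then show ?thesis using of_real_eq_iff by blast
    qed
    define E where "E = exp (- (2 * a) * x\<^sup>2)"
    have E: "0 \<le> E" "E \<le> 1" using a by (auto simp: E_def)
    have f2: "(cmod (f x))\<^sup>2 = t\<^sup>2 * (bump_deriv 1 (t * ln x))\<^sup>2 * (x powr (2 * \<nu> + 1) * E / x\<^sup>2)"
      unfolding f_def norm_mult power_mult_distrib g2 E_def norm_of_real
      by (simp add: power_divide power_mult_distrib)
    show ?thesis
    proof (cases "x < l")
      case True
      then have "ln x < - (1 / t)" using x l by (metis ln_less_cancel_iff minus_equation_iff)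
      then have "t * ln x < t * (- (1 / t))" using t by (intro mult_strict_left_mono)
      then have "1 \<le> \<bar>t * ln x\<bar>" using t by simp
      then have "f x = 0" by (simp add: f_def bump_deriv_support)
      then show ?thesis using x t by (simp add: w_def)
    next
      case False
      have "x powr (2 * \<nu> + 1) * E / x\<^sup>2 \<le> (if l \<le> x \<and> x \<le> 1 then 1 / x else 0) + x powr (2 * \<nu> + 1) * E"
      proof (cases "x \<le> 1")
        case True
        have "x powr (2 * \<nu> + 1) = x powr (2 * \<nu>) * x" using x by (simp add: powr_add)
        also have "\<dots> \<le> 1 * x"
          using True x nu_nonneg by (intro mult_right_mono powr_le1) auto
        finally have "x powr (2 * \<nu> + 1) * E \<le> x * 1" using E x by (intro mult_mono) auto
        then have "x powr (2 * \<nu> + 1) * E / x\<^sup>2 \<le> x / x\<^sup>2" using x by (intro divide_right_mono) auto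
        also have "x / x\<^sup>2 = 1 / x" using x by (simp add: power2_eq_square)
        finally show ?thesis using True False E by (simp add: add_increasing2)
      next
        case False
        then have "1 \<le> x\<^sup>2" by (simp add: one_le_power)
        then have "x powr (2 * \<nu> + 1) * E / x\<^sup>2 \<le> x powr (2 * \<nu> + 1) * E / 1"
          using E by (intro divide_left_mono) auto
        then show ?thesis using False by simp
      qed
      then have "t\<^sup>2 * (bump_deriv 1 (t * ln x))\<^sup>2 * (x powr (2 * \<nu> + 1) * E / x\<^sup>2)
          \<le> t\<^sup>2 * B\<^sup>2 * ((if l \<le> x \<and> x \<le> 1 then 1 / x else 0) + x powr (2 * \<nu> + 1) * E)"
        using B[of "t * ln x"] E B0 by (intro mult_mono) (auto intro!: mult_left_mono abs_le_square_iff[THEN iffD1])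
      then show ?thesis unfolding f2 w_def E_def .
    qed
  qed
  have int: "integrable half_line (\<lambda>x. (cmod (f x))\<^sup>2)"
    by (rule Bochner_Integration.integrable_bound[OF w]) (use bd in \<open>auto intro!: AE_I2 order.trans[OF bd abs_ge_self]\<close>)
  then show "f \<in> L2" by (intro L2I) auto
  have "(L2_norm f)\<^sup>2 = (LINT x|half_line. (cmod (f x))\<^sup>2)" by (simp add: L2_norm_def)
  also have "\<dots> \<le> (LINT x|half_line. w x)"
    by (intro integral_mono int w bd) auto
  also have "\<dots> = t\<^sup>2 * B\<^sup>2 * (1 / t + C)"
    unfolding w_def C_def integral_mult_right_zero
    by (subst Bochner_Integration.integral_add[OF integral_inverse_Icc(1)[OF l(1,2)] ig])
      (simp only: integral_inverse_Icc(2)[OF l(1,2)] l(3))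
  finally show "(L2_norm f)\<^sup>2 \<le> t\<^sup>2 * B\<^sup>2 * (1 / t + C)" .
qed

text \<open>The cutoffs tend strongly to the identity, so the part of the ground derivative coming
  from the Gaussian converges to \<open>h\<close>, which is \<open>- 2 a x\<close> times the
  Gaussian; the part coming from the cutoff tends to zero by \<open>cutoff_energy\<close>.\<close>

lemma gaussian_form_approx:
  assumes a: "a > 0"
  obtains \<phi> where "\<And>n. \<phi> n \<in> Cc_inf" "(\<lambda>n. cls (\<phi> n)) \<longlonglongrightarrow> G (of_real a)"
    "Cauchy (\<lambda>n::nat. cls (ground_deriv (\<phi> n)))"
proof -
  define t where "t n = 1 / real (Suc n)" for n
  have t: "t n > 0" for n by (simp add: t_def)
  have tlim: "t \<longlonglongrightarrow> 0"
    using LIMSEQ_inverse_real_of_nat by (simp add: t_def[abs_def] inverse_eq_divide)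
  define \<phi> where "\<phi> n x = complex_of_real (log_cut (t n) a 0 (\<nu> + 1/2) x)" for n x
  have \<phi>: "\<phi> n \<in> Cc_inf" for n unfolding \<phi>_def by (rule log_cut_Cc_inf[OF t])
  define ct where "ct s x = complex_of_real (bump_deriv 0 (s * ln x))" for s x
  obtain B0 where B0: "\<And>y. \<bar>bump_deriv 0 y\<bar> \<le> B0" using bump_deriv_bounded by blast
  obtain B1 where B1: "\<And>y. \<bar>bump_deriv 1 y\<bar> \<le> B1" using bump_deriv_bounded by blast
  have ctm: "ct s \<in> borel_measurable half_line" for s
    unfolding ct_def
    by (intro continuous_imp_measurable_on_sets_lebesgue continuous_intros
        continuous_on_compose2[OF bump_deriv_continuous[of UNIV]]) auto
  have ct: "bounded_mult (ct s)" for s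
    by (rule bounded_multI[where B = B0, OF ctm]) (use B0 in \<open>simp add: ct_def\<close>)
  have ctlim: "(\<lambda>n. mult_op (ct (t n)) F) \<longlonglongrightarrow> F" for F
  proof -
    have "((\<lambda>s. mult_op (ct s) F) \<longlongrightarrow> mult_op (\<lambda>_. 1) F) (at 0)"
    proof (rule mult_op_tendsto[where B = B0])
      show "bounded_mult (\<lambda>_. 1)" by (rule bounded_multI[where B = 1]) auto
      fix x :: real
      have "isCont (bump_deriv 0) (0 * ln x)" using bump_deriv_has_derivative DERIV_isCont by blast
      then have "((\<lambda>s. bump_deriv 0 (s * ln x)) \<longlongrightarrow> bump_deriv 0 (0 * ln x)) (at 0)"
        by (rule isCont_tendsto_compose) (intro tendsto_intros)
      then have "((\<lambda>s. ct s x) \<longlongrightarrow> of_real (bump_deriv 0 (0 * ln x))) (at 0)"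
        unfolding ct_def by (intro tendsto_of_real)
      then show "((\<lambda>s. ct s x) \<longlongrightarrow> 1) (at 0)" by (simp add: bump_deriv_0_0)
    qed (use B0 ctm in \<open>auto simp: ct_def\<close>)
    then have "\<And>X. \<forall>i. X i \<in> UNIV - {0} \<Longrightarrow> X \<longlonglongrightarrow> 0 \<Longrightarrow> ((\<lambda>s. mult_op (ct s) F) \<circ> X) \<longlonglongrightarrow> mult_op (\<lambda>_. 1) F"
      unfolding tendsto_at_iff_sequentially by blast
    from this[of t] show ?thesis
      using t tlim by (auto simp: comp_def less_imp_neq[THEN not_sym])
  qed
  have za: "Re (of_real a) > 0" using a by simp
  have "cls (\<phi> n) = mult_op (ct (t n)) (G (of_real a))" for n
  proof -
    have "\<phi> n x = ct (t n) x * gs (of_real a) x" if "x > 0" for x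
      using that by (simp add: \<phi>_def log_cut_def ct_def gs_def exp_of_real[symmetric])
    then have "L2_eq (\<phi> n) (\<lambda>x. ct (t n) x * gs (of_real a) x)"
      unfolding L2_eq_def by (intro AE_I2) auto
    then show ?thesis
      unfolding mult_op_cls[OF ct gs_L2[OF za]] by (intro cls_cong Cc_inf_L2 \<phi> mult_op_L2 ct gs_L2 za)
  qed
  then have lim: "(\<lambda>n. cls (\<phi> n)) \<longlonglongrightarrow> G (of_real a)" using ctlim by simp
  define f where "f n x = of_real (t n * bump_deriv 1 (t n * ln x) / x) * gs (of_real a) x" for n x
  define h where "h x = complex_of_real (- 2 * a) * (of_real (x ^ 1) * gs (of_real a) x)" for x
  have h: "h \<in> L2" unfolding h_def by (intro L2_cmult gs_moment_L2 za)
  define C where "C = (LINT x|half_line. x powr (2 * \<nu> + 1) * exp (- (2 * a) * x\<^sup>2))"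
  note ce = cutoff_energy[OF t a B1, folded C_def]
  have f: "f n \<in> L2" "(L2_norm (f n))\<^sup>2 \<le> (t n)\<^sup>2 * B1\<^sup>2 * (1 / t n + C)" for n
    using ce[of n] by (simp_all add: f_def[abs_def])
  have gd: "cls (ground_deriv (\<phi> n)) = cls (f n) + mult_op (ct (t n)) (cls h)" for n
  proof -
    have "ground_deriv (\<phi> n) x = f n x + ct (t n) x * h x" if "x > 0" for x
      using ground_deriv_log_cut[OF t that, of n a] unfolding \<phi>_def f_def ct_def h_def .
    then have "L2_eq (ground_deriv (\<phi> n)) (\<lambda>x. f n x + ct (t n) x * h x)"
      unfolding L2_eq_def by (intro AE_I2) auto
    then have "cls (ground_deriv (\<phi> n)) = cls (\<lambda>x. f n x + ct (t n) x * h x)"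
      by (intro cls_cong ground_deriv_L2 \<phi> L2_add f mult_op_L2 ct h)
    then show ?thesis
      using cls_add[OF f(1) mult_op_L2[OF ct h], of n "t n"] by (simp add: mult_op_cls[OF ct h])
  qed
  have "(\<lambda>n. cls (f n)) \<longlonglongrightarrow> 0"
  proof (rule tendsto_norm_zero_cancel, rule Lim_null_comparison)
    have "(\<lambda>n. sqrt (t n * B1\<^sup>2 * 1 + (t n)\<^sup>2 * B1\<^sup>2 * C)) \<longlonglongrightarrow> sqrt (0 * B1\<^sup>2 * 1 + 0\<^sup>2 * B1\<^sup>2 * C)"
      by (intro tendsto_intros tlim)
    then show "(\<lambda>n. sqrt (t n * B1\<^sup>2 * 1 + (t n)\<^sup>2 * B1\<^sup>2 * C)) \<longlonglongrightarrow> 0" by simp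
    have "norm (norm (cls (f n))) \<le> sqrt (t n * B1\<^sup>2 * 1 + (t n)\<^sup>2 * B1\<^sup>2 * C)" for n
    proof -
      have "(t n)\<^sup>2 * B1\<^sup>2 * (1 / t n + C) = t n * B1\<^sup>2 * 1 + (t n)\<^sup>2 * B1\<^sup>2 * C"
        using t[of n] by (simp add: field_simps power2_eq_square)
      then show ?thesis using f[of n] norm_cls[OF f(1)[of n] f(1)[of n]] by (simp add: real_le_rsqrt)
    qed
    then show "\<forall>\<^sub>F n in sequentially. norm (norm (cls (f n))) \<le> sqrt (t n * B1\<^sup>2 * 1 + (t n)\<^sup>2 * B1\<^sup>2 * C)"
      by simp
  qed
  then have "(\<lambda>n. cls (ground_deriv (\<phi> n))) \<longlonglongrightarrow> 0 + cls h"
    unfolding gd by (intro tendsto_add ctlim)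
  then have "Cauchy (\<lambda>n. cls (ground_deriv (\<phi> n)))" by (rule LIMSEQ_imp_Cauchy)
  with that \<phi> lim show ?thesis by blast
qed

end

section \<open>The Friedrichs extension\<close>

lemma mult_rel_unique:
  assumes "mult_rel w F K" "mult_rel w F K'"
  shows "K = K'"
proof (rule hl2_eqI)
  show "AE x in half_line. rep K x = rep K' x"
    using assms unfolding mult_rel_def by eventually_elim simp
qed

lemma mult_rel_linear:
  assumes "mult_rel w F K" "mult_rel w F' K'"
  shows "mult_rel w (c *\<^sub>c F + F') (c *\<^sub>c K + K')"
  using assms AE_rep_add[of "c *\<^sub>c F" F'] AE_rep_add[of "c *\<^sub>c K" K']
    AE_rep_cscale[of c F] AE_rep_cscale[of c K]
  unfolding mult_rel_def by eventually_elim (simp add: algebra_simps)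

lemma mult_rel_diff:
  assumes "mult_rel w F K" "mult_rel w F' K'"
  shows "mult_rel w (F - F') (K - K')"
  using mult_rel_linear[OF assms(2,1), of "-1"] by (simp add: cscale_minus_one)

lemma mult_rel_exists:
  assumes "(\<lambda>x. of_real (w x) * rep F x) \<in> L2"
  shows "mult_rel w F (cls (\<lambda>x. of_real (w x) * rep F x))"
  unfolding mult_rel_def by (rule AE_rep_cls[OF assms])

context bessel
begin

text \<open>The elementary bound \<open>k \<le> 1 + k^2\<close> dominates \<open>k\<close> times the
  transform of \<open>F\<close> by the transforms of \<open>F\<close> and \<open>K\<close>: the
  domain of H is contained in the domain of its square root.\<close>

lemma H_rel_root:
  assumes "H_rel F K"
  shows "\<exists>N. mult_rel (\<lambda>k. k) (hankel F) N"
proof -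
  have n: "(\<lambda>k. of_real (cmod (rep X k))) \<in> L2" for X
    by (rule L2_bound[OF rep_L2[of X], where B = 1]) auto
  have "(\<lambda>k. of_real k * rep (hankel F) k) \<in> L2"
  proof (rule L2_bound[OF L2_add[OF n[of "hankel F"] n[of "hankel K"]], where B = 1])
    have "AE k in half_line. k > 0" by (rule AE_I2) simp
    then show "AE k in half_line. cmod (of_real k * rep (hankel F) k)
        \<le> 1 * cmod (of_real (cmod (rep (hankel F) k)) + of_real (cmod (rep (hankel K) k)))"
      using assms unfolding H_rel_def mult_rel_def
    proof eventually_elim
      case (elim k)
      have "k \<le> 1 + k\<^sup>2"
        using zero_le_power2[of "k - 1"] elim(1) by (simp add: power2_eq_square algebra_simps)
      then have "k * cmod (rep (hankel F) k) \<le> (1 + k\<^sup>2) * cmod (rep (hankel F) k)"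
        by (intro mult_right_mono) auto
      also have "\<dots> = cmod (rep (hankel F) k) + cmod (rep (hankel K) k)"
        using elim(2) by (simp add: norm_mult norm_power algebra_simps)
      also have "\<dots> = 1 * cmod (of_real (cmod (rep (hankel F) k)) + of_real (cmod (rep (hankel K) k)))"
        unfolding of_real_add[symmetric] norm_of_real by simp
      finally show ?case using elim(1) by (simp add: norm_mult)
    qed
  qed measurable
  then show ?thesis using mult_rel_exists[of "\<lambda>k. k" "hankel F"] by blast
qed

lemma H_rel_parts:
  assumes "H_rel F K" "mult_rel (\<lambda>k. k) (hankel F) N" "mult_rel (\<lambda>k. k) (hankel F') N'"
  shows "cinner K F' = cinner N N'"
proof -
  have "cinner K F' = cinner (hankel K) (hankel F')" by (simp add: cinner_hankel)
  also have "\<dots> = cinner N N'"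
    unfolding cinner_eq
  proof (rule integral_cong_AE)
    show "AE k in half_line. rep (hankel K) k * cnj (rep (hankel F') k) = rep N k * cnj (rep N' k)"
      using assms unfolding H_rel_def mult_rel_def by eventually_elim (simp add: power2_eq_square)
  qed measurable
  finally show ?thesis .
qed

text \<open>The transform of the square root of H applied to \<open>f\<close>. The quadratic form
  becomes the squared norm of this class, and form-Cauchy sequences become Cauchy sequences in
  \<open>hl2\<close>.\<close>

definition froot :: "(real \<Rightarrow> complex) \<Rightarrow> hl2" where
  "froot f = (SOME N. mult_rel (\<lambda>k. k) (hankel (cls f)) N)"

lemma froot: "f \<in> Cc_inf \<Longrightarrow> mult_rel (\<lambda>k. k) (hankel (cls f)) (froot f)"
  unfolding froot_def using H_rel_root[OF H_rel_bessel_op] by (rule someI_ex)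

lemma cls_Cc_diff: "f \<in> Cc_inf \<Longrightarrow> g \<in> Cc_inf \<Longrightarrow> cls (\<lambda>x. f x - g x) = cls f - cls g"
  by (simp add: cls_diff Cc_inf_L2)

lemma froot_diff:
  assumes f: "f \<in> Cc_inf" and g: "g \<in> Cc_inf"
  shows "froot (\<lambda>x. f x - g x) = froot f - froot g"
proof (rule mult_rel_unique)
  show "mult_rel (\<lambda>k. k) (hankel (cls f) - hankel (cls g)) (froot (\<lambda>x. f x - g x))"
    using froot[OF Cc_inf_diff[OF f g]] by (simp add: cls_Cc_diff f g hankel_diff)
  show "mult_rel (\<lambda>k. k) (hankel (cls f) - hankel (cls g)) (froot f - froot g)"
    by (intro mult_rel_diff froot f g)
qed

lemma form_eq_root:
  assumes f: "f \<in> Cc_inf"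
  shows "L2_inner (bessel_op \<nu> f) f = of_real ((norm (froot f))\<^sup>2)"
  using H_rel_parts[OF H_rel_bessel_op[OF f] froot[OF f] froot[OF f]]
  by (simp add: cinner_cls bessel_op_L2 Cc_inf_L2 f cinner_self)

text \<open>The form is computed twice, spectrally and by the ground state factorisation. This
  transfers Cauchy sequences of ground derivatives, which can be estimated explicitly, to the
  roots.\<close>

lemma norm_root:
  assumes f: "f \<in> Cc_inf"
  shows "norm (froot f) = norm (cls (ground_deriv f))"
proof -
  have "complex_of_real ((norm (froot f))\<^sup>2) = of_real ((L2_norm (ground_deriv f))\<^sup>2)"
    using form_eq_root[OF f] bessel_form[OF f] by simp
  then have "(norm (froot f))\<^sup>2 = (norm (cls (ground_deriv f)))\<^sup>2"
    unfolding of_real_eq_iff norm_cls[OF ground_deriv_L2[OF f] ground_deriv_L2[OF f]] .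
  then show ?thesis by (simp add: power2_eq_iff_nonneg)
qed

lemma form_Cauchy_iff:
  assumes \<phi>: "\<And>n. \<phi> n \<in> Cc_inf"
  shows "(\<forall>e>0. \<exists>N. \<forall>m\<ge>N. \<forall>n\<ge>N.
      cmod (L2_inner (bessel_op \<nu> (\<lambda>x. \<phi> m x - \<phi> n x)) (\<lambda>x. \<phi> m x - \<phi> n x)) < e)
    \<longleftrightarrow> Cauchy (\<lambda>n. froot (\<phi> n))"
proof -
  have eq: "cmod (L2_inner (bessel_op \<nu> (\<lambda>x. \<phi> m x - \<phi> n x)) (\<lambda>x. \<phi> m x - \<phi> n x)) = (dist (froot (\<phi> m)) (froot (\<phi> n)))\<^sup>2" for m n
    unfolding form_eq_root[OF Cc_inf_diff[OF \<phi> \<phi>]] froot_diff[OF \<phi> \<phi>] norm_of_real by (simp add: dist_norm)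
  show ?thesis
    unfolding eq
  proof
    assume *: "\<forall>e>0. \<exists>N. \<forall>m\<ge>N. \<forall>n\<ge>N. (dist (froot (\<phi> m)) (froot (\<phi> n)))\<^sup>2 < e"
    show "Cauchy (\<lambda>n. froot (\<phi> n))"
    proof (rule metric_CauchyI)
      fix e :: real assume e: "e > 0"
      then obtain N where "\<forall>m\<ge>N. \<forall>n\<ge>N. (dist (froot (\<phi> m)) (froot (\<phi> n)))\<^sup>2 < e\<^sup>2"
        using *[rule_format, of "e\<^sup>2"] by auto
      then show "\<exists>M. \<forall>m\<ge>M. \<forall>n\<ge>M. dist (froot (\<phi> m)) (froot (\<phi> n)) < e"
        using e by (intro exI[of _ N]) (auto intro: power2_less_imp_less)
    qed
  next
    assume C: "Cauchy (\<lambda>n. froot (\<phi> n))"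
    show "\<forall>e>0. \<exists>N. \<forall>m\<ge>N. \<forall>n\<ge>N. (dist (froot (\<phi> m)) (froot (\<phi> n)))\<^sup>2 < e"
    proof (intro allI impI)
      fix e :: real assume e: "e > 0"
      then obtain N where N: "\<forall>m\<ge>N. \<forall>n\<ge>N. dist (froot (\<phi> m)) (froot (\<phi> n)) < sqrt e"
        using metric_CauchyD[OF C, of "sqrt e"] by auto
      have "(dist (froot (\<phi> m)) (froot (\<phi> n)))\<^sup>2 < e" if "m \<ge> N" "n \<ge> N" for m n
      proof -
        have "(dist (froot (\<phi> m)) (froot (\<phi> n)))\<^sup>2 < (sqrt e)\<^sup>2"
          using N that by (intro power_strict_mono) auto
        then show ?thesis using e by simp
      qed
      then show "\<exists>N. \<forall>m\<ge>N. \<forall>n\<ge>N. (dist (froot (\<phi> m)) (froot (\<phi> n)))\<^sup>2 < e" by blast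
    qed
  qed
qed

lemma froot_limit:
  assumes "\<And>n. \<phi> n \<in> Cc_inf" "(\<lambda>n. cls (\<phi> n)) \<longlonglongrightarrow> F" "Cauchy (\<lambda>n. froot (\<phi> n))"
  obtains N where "(\<lambda>n. froot (\<phi> n)) \<longlonglongrightarrow> N" "mult_rel (\<lambda>k. k) (hankel F) N"
proof -
  obtain N where N: "(\<lambda>n. froot (\<phi> n)) \<longlonglongrightarrow> N"
    using assms(3) Cauchy_convergent_iff convergent_def by blast
  have "mult_rel (\<lambda>k. k) (hankel F) N"
    by (rule mult_rel_closed[OF _ froot[OF assms(1)] _ N])
      (auto intro: bounded_linear.tendsto[OF bounded_linear_hankel] assms(2))
  with N show ?thesis by (rule that)
qed

lemma gaussian_root_approx:
  assumes a: "a > 0"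
  obtains \<phi> N where "\<And>n::nat. \<phi> n \<in> Cc_inf" "(\<lambda>n. cls (\<phi> n)) \<longlonglongrightarrow> G (of_real a)"
    "(\<lambda>n. froot (\<phi> n)) \<longlonglongrightarrow> N" "mult_rel (\<lambda>k. k) (hankel (G (of_real a))) N"
proof -
  obtain \<phi> where \<phi>: "\<And>n. \<phi> n \<in> Cc_inf" "(\<lambda>n. cls (\<phi> n)) \<longlonglongrightarrow> G (of_real a)"
    "Cauchy (\<lambda>n::nat. cls (ground_deriv (\<phi> n)))"
    using gaussian_form_approx[OF a] by blast
  have "dist (froot (\<phi> m)) (froot (\<phi> n)) = dist (cls (ground_deriv (\<phi> m))) (cls (ground_deriv (\<phi> n)))" for m n
  proof -
    have "froot (\<phi> m) - froot (\<phi> n) = froot (\<lambda>x. \<phi> m x - \<phi> n x)"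
      by (simp add: froot_diff \<phi>(1))
    moreover have "cls (ground_deriv (\<phi> m)) - cls (ground_deriv (\<phi> n)) = cls (ground_deriv (\<lambda>x. \<phi> m x - \<phi> n x))"
      unfolding ground_deriv_diff[OF \<phi>(1) \<phi>(1)] by (intro cls_diff ground_deriv_L2 \<phi>(1))
    ultimately show ?thesis
      using norm_root[OF Cc_inf_diff[OF \<phi>(1) \<phi>(1)]] by (simp add: dist_norm)
  qed
  then have "Cauchy (\<lambda>n. froot (\<phi> n))" using \<phi>(3) by (simp add: Cauchy_def)
  from froot_limit[OF \<phi>(1,2) this] that \<phi>(1,2) show ?thesis by blast
qed

text \<open>The adjoint identity is available for test functions, whereas \<open>H_rel_testI\<close>
  asks for Gaussians; these are reached as limits in the form norm. Membership of \<open>u\<close>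
  in the form domain supplies the root \<open>Nu\<close> that makes the pairing continuous in that
  norm, and this is what singles out the Friedrichs extension within the adjoint.\<close>

lemma H_op_subset:
  assumes "(u, f) \<in> H_op \<nu>"
  shows "u \<in> L2" "f \<in> L2" "H_rel (cls u) (cls f)"
proof -
  show u: "u \<in> L2" and f: "f \<in> L2"
    using assms by (auto simp: H_op_def friedrichs_extension_def adjoint_graph_def)
  have adj: "L2_inner (bessel_op \<nu> \<phi>) u = L2_inner \<phi> f" if "\<phi> \<in> Cc_inf" for \<phi>
    using assms that by (auto simp: H_op_def friedrichs_extension_def adjoint_graph_def)
  have "u \<in> form_domain Cc_inf (bessel_op \<nu>)"
    using assms by (auto simp: H_op_def friedrichs_extension_def)
  then obtain \<psi> where \<psi>: "\<And>n::nat. \<psi> n \<in> Cc_inf" "(\<lambda>n. L2_norm (\<lambda>x. \<psi> n x - u x)) \<longlonglongrightarrow> 0"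
    and "\<forall>e>0. \<exists>N. \<forall>m\<ge>N. \<forall>n\<ge>N.
        cmod (L2_inner (bessel_op \<nu> (\<lambda>x. \<psi> m x - \<psi> n x)) (\<lambda>x. \<psi> m x - \<psi> n x)) < e"
    by (auto simp: form_domain_def)
  then have C: "Cauchy (\<lambda>n. froot (\<psi> n))" using form_Cauchy_iff by blast
  have "L2_norm (\<lambda>x. \<psi> n x - u x) = norm (cls (\<psi> n) - cls u)" for n
    using norm_cls[OF L2_diff[OF Cc_inf_L2[OF \<psi>(1)] u] u] by (simp add: cls_diff Cc_inf_L2[OF \<psi>(1)] u)
  then have "(\<lambda>n. cls (\<psi> n)) \<longlonglongrightarrow> cls u"
    using \<psi>(2) by (simp add: tendsto_norm_zero_iff LIM_zero_iff)
  then obtain Nu where Nu: "mult_rel (\<lambda>k. k) (hankel (cls u)) Nu"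
    using froot_limit[OF \<psi>(1) _ C] by blast
  show "H_rel (cls u) (cls f)"
  proof (rule H_rel_testI)
    fix a :: real assume a: "a > 0"
    obtain \<phi> N where \<phi>: "\<And>n::nat. \<phi> n \<in> Cc_inf" "(\<lambda>n. cls (\<phi> n)) \<longlonglongrightarrow> G (of_real a)"
      "(\<lambda>n. froot (\<phi> n)) \<longlonglongrightarrow> N" "mult_rel (\<lambda>k. k) (hankel (G (of_real a))) N"
      using gaussian_root_approx[OF a] by blast
    define X where "X = cls (\<lambda>x. of_real (4 * a * (\<nu> + 1) - 4 * a\<^sup>2 * x\<^sup>2) * gs (of_real a) x)"
    \<comment> \<open>The adjoint identity, with one root moved to each side: now both sides
      converge although the images of \<open>\<phi> n\<close> under the operator need not.\<close>
    have "cinner (froot (\<phi> n)) Nu = cinner (cls (\<phi> n)) (cls f)" for n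
      using H_rel_parts[OF H_rel_bessel_op[OF \<phi>(1)] froot[OF \<phi>(1)] Nu] adj[OF \<phi>(1)]
      by (simp add: cinner_cls bessel_op_L2[OF \<phi>(1)] Cc_inf_L2[OF \<phi>(1)] u f)
    moreover have "(\<lambda>n. cinner (froot (\<phi> n)) Nu) \<longlonglongrightarrow> cinner N Nu"
      by (intro tendsto_intros \<phi>)
    moreover have "(\<lambda>n. cinner (cls (\<phi> n)) (cls f)) \<longlonglongrightarrow> cinner (G (of_real a)) (cls f)"
      by (intro tendsto_intros \<phi>)
    ultimately have "cinner N Nu = cinner (G (of_real a)) (cls f)"
      using LIMSEQ_unique by force
    moreover have "cinner X (cls u) = cinner N Nu"
      using H_rel_parts[OF hankel_bessel_gaussian[OF a] \<phi>(4) Nu] by (simp add: X_def)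
    ultimately have "cinner (cls f) (G (of_real a)) = cinner (cls u) X"
      using cinner_commute[of "cls f"] cinner_commute[of "cls u"] by metis
    then show "cinner (cls f) (G (of_real a)) = cinner (cls u) (cls (\<lambda>x. of_real (4 * a * (\<nu> + 1) - 4 * a\<^sup>2 * x\<^sup>2) * gs (of_real a) x))"
      by (simp add: X_def)
  qed
qed

section \<open>Test functions as a form core, and the resulting description of the Friedrichs
  extension\<close>

definition form_graph :: "(hl2 \<times> hl2) set" where
  "form_graph = {(hankel (cls \<phi>), froot \<phi>) |\<phi>. \<phi> \<in> Cc_inf}"

lemma form_graph_linear:
  assumes "p \<in> form_graph" "q \<in> form_graph"
  shows "(c *\<^sub>c fst p + fst q, c *\<^sub>c snd p + snd q) \<in> form_graph"
proof -
  obtain \<phi> \<psi> where *: "\<phi> \<in> Cc_inf" "p = (hankel (cls \<phi>), froot \<phi>)" "\<psi> \<in> Cc_inf" "q = (hankel (cls \<psi>), froot \<psi>)"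
    using assms by (auto simp: form_graph_def)
  have l: "(\<lambda>x. c * \<phi> x + \<psi> x) \<in> Cc_inf" by (rule Cc_inf_linear(1)[OF *(1,3)])
  have "cls (\<lambda>x. c * \<phi> x + \<psi> x) = c *\<^sub>c cls \<phi> + cls \<psi>"
    using Cc_inf_L2[OF *(1)] Cc_inf_L2[OF *(3)] L2_cmult by (simp only: cls_cscale cls_add)
  then have h: "hankel (cls (\<lambda>x. c * \<phi> x + \<psi> x)) = c *\<^sub>c hankel (cls \<phi>) + hankel (cls \<psi>)"
    by (simp add: hankel_add hankel_cscale)
  have "froot (\<lambda>x. c * \<phi> x + \<psi> x) = c *\<^sub>c froot \<phi> + froot \<psi>"
    by (rule mult_rel_unique[OF froot[OF l, unfolded h] mult_rel_linear[OF froot[OF *(1)] froot[OF *(3)]]])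
  with h l show ?thesis
    unfolding form_graph_def * by (auto intro!: exI[of _ "\<lambda>x. c * \<phi> x + \<psi> x"])
qed

lemma zero_form_graph: "0 \<in> form_graph"
proof -
  obtain q where q: "q \<in> form_graph" using Cc_inf_zero by (auto simp: form_graph_def)
  have "((-1) *\<^sub>c fst q + fst q, (-1) *\<^sub>c snd q + snd q) \<in> form_graph" by (rule form_graph_linear[OF q q])
  then show ?thesis by (simp add: cscale_minus_one zero_prod_def)
qed

lemma form_graph_cscale: "p \<in> form_graph \<Longrightarrow> (c *\<^sub>c fst p, c *\<^sub>c snd p) \<in> form_graph"
  using form_graph_linear[OF _ zero_form_graph, of p c] by simp

lemma subspace_form_graph: "subspace form_graph"
  unfolding subspace_def
proof (intro conjI ballI allI)
  fix x y and c :: real assume "x \<in> form_graph" "y \<in> form_graph"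
  then show "x + y \<in> form_graph"
    using form_graph_linear[of x y 1] by (simp add: plus_prod_def)
  show "c *\<^sub>R x \<in> form_graph"
    using form_graph_cscale[OF \<open>x \<in> form_graph\<close>, of "of_real c"] by (simp add: scaleR_prod_def scaleR_eq_cscale)
qed (rule zero_form_graph)

lemma form_graph_closure_mult_rel:
  assumes "p \<in> closure form_graph"
  shows "mult_rel (\<lambda>k. k) (fst p) (snd p)"
proof -
  obtain q where q: "\<And>n. q n \<in> form_graph" "q \<longlonglongrightarrow> p" using assms unfolding closure_sequential by blast
  have "mult_rel (\<lambda>k. k) (fst (q n)) (snd (q n))" for n
    using q(1)[of n] by (auto simp: form_graph_def froot)
  then show ?thesis
    by (rule mult_rel_closed[rotated]) (auto intro!: tendsto_intros q)
qed

text \<open>Let \<open>(P, Q)\<close> be the part of \<open>(F, N)\<close> orthogonal to the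
  closure. It still satisfies \<open>Q = k P\<close>, and orthogonality to the Gaussians, which lie
  in the closure, gives \<open>P + k Q = 0\<close>. Hence \<open>(1 + k^2) P = 0\<close>.\<close>

lemma form_graph_dense:
  assumes "mult_rel (\<lambda>k. k) F N"
  shows "(F, N) \<in> closure form_graph"
proof -
  obtain p where p: "p \<in> closure form_graph" "\<And>s. s \<in> closure form_graph \<Longrightarrow> inner ((F, N) - p) s = 0"
    using closed_subspace_projection[OF subspace_closure[OF subspace_form_graph] closed_closure] by blast
  define P Q where "P = F - fst p" "Q = N - snd p"
  have PQ: "(F, N) - p = (P, Q)" by (simp add: P_Q_def minus_prod_def)
  have rel: "mult_rel (\<lambda>k. k) P Q"
    unfolding P_Q_def by (rule mult_rel_diff[OF assms form_graph_closure_mult_rel[OF p(1)]])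
  define D where "D k = rep P k + of_real k * rep Q k" for k
  have "AE k in half_line. D k = 0"
  proof (rule gs_total)
    fix b :: real assume b: "b > 0"
    define a where "a = 1 / (4 * b)"
    have a: "a > 0" "b = 1 / (4 * a)" using b by (auto simp: a_def)
    have HGa: "HG (of_real a) = hpow (of_real a) *\<^sub>c G (of_real b)"
      by (simp add: HG_def a(2))
    obtain \<phi> M where \<phi>: "\<And>n::nat. \<phi> n \<in> Cc_inf" "(\<lambda>n. cls (\<phi> n)) \<longlonglongrightarrow> G (of_real a)"
      "(\<lambda>n. froot (\<phi> n)) \<longlonglongrightarrow> M" "mult_rel (\<lambda>k. k) (hankel (G (of_real a))) M"
      using gaussian_root_approx[OF a(1)] by blast
    have "(c *\<^sub>c HG (of_real a), c *\<^sub>c M) \<in> closure form_graph" for c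
      unfolding closure_sequential
    proof (intro exI conjI allI)
      show "(c *\<^sub>c hankel (cls (\<phi> n)), c *\<^sub>c froot (\<phi> n)) \<in> form_graph" for n
        using form_graph_cscale[of "(hankel (cls (\<phi> n)), froot (\<phi> n))" c] \<phi>(1) by (auto simp: form_graph_def)
      show "(\<lambda>n. (c *\<^sub>c hankel (cls (\<phi> n)), c *\<^sub>c froot (\<phi> n))) \<longlonglongrightarrow> (c *\<^sub>c HG (of_real a), c *\<^sub>c M)"
        unfolding hankel_G_real[OF a(1), symmetric]
        by (intro tendsto_intros \<phi> bounded_linear.tendsto[OF bounded_linear_hankel])
    qed
    \<comment> \<open>Orthogonality is known for the real inner product only; the multiples by 1 and
      by \<i> together give the complex statement.\<close>
    then have z: "inner P (c *\<^sub>c HG (of_real a)) + inner Q (c *\<^sub>c M) = 0" for c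
      using p(2) unfolding PQ by fastforce
    have "cinner P (HG (of_real a)) + cinner Q M = 0"
      using z[of 1] z[of \<i>] by (simp add: cinner_eq_inner complex_eq_iff)
    define k1 where "k1 = cls (\<lambda>k. of_real (k ^ 1) * gs (of_real b) k)"
    have gb: "gs (of_real b) \<in> L2" "(\<lambda>k. of_real (k ^ 1) * gs (of_real b) k) \<in> L2"
      using b gs_L2 gs_moment_L2[of _ 1] by auto
    have M: "M = hpow (of_real a) *\<^sub>c k1"
    proof (rule hl2_eqI)
      show "AE x in half_line. rep M x = rep (hpow (of_real a) *\<^sub>c k1) x"
        using \<phi>(4)[unfolded hankel_G_real[OF a(1)] HGa mult_rel_def]
          AE_rep_cscale[of "hpow (of_real a)" k1] AE_rep_cscale[of "hpow (of_real a)" "G (of_real b)"]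
          AE_rep_cls[OF gb(1)] AE_rep_cls[OF gb(2), folded k1_def]
        by eventually_elim simp
    qed
    have i1: "integrable half_line (\<lambda>k. rep P k * gs (of_real b) k)"
      by (intro gs_mult_integrable rep_L2 b)
    have cq: "rep Q k * cnj (of_real (k ^ 1) * gs (of_real b) k) = (of_real k * rep Q k) * gs (of_real b) k" for k
      by (simp add: gs_real_cnj mult_ac)
    have i2: "integrable half_line (\<lambda>k. (of_real k * rep Q k) * gs (of_real b) k)"
      using L2_inner_integrable[OF rep_L2 gb(2), of Q] unfolding cq .
    show "integrable half_line (\<lambda>k. D k * gs (of_real b) k)"
      unfolding D_def distrib_right by (intro Bochner_Integration.integrable_add i1 i2)
    have k1: "cinner Q k1 = (LINT k|half_line. (of_real k * rep Q k) * gs (of_real b) k)"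
      using cinner_cls[OF rep_L2 gb(2), of Q] unfolding L2_inner_def cq by (simp add: k1_def)
    have "(LINT k|half_line. D k * gs (of_real b) k) = cinner P (G (of_real b)) + cinner Q k1"
      unfolding D_def distrib_right
      by (subst Bochner_Integration.integral_add[OF i1 i2]) (simp add: cinner_G_real[OF b] k1)
    moreover have "cnj (hpow (of_real a)) * (cinner P (G (of_real b)) + cinner Q k1) = 0"
      using \<open>cinner P (HG (of_real a)) + cinner Q M = 0\<close>
      unfolding HGa M cinner_cscale_right by (simp add: distrib_left)
    ultimately show "(LINT k|half_line. D k * gs (of_real b) k) = 0"
      using hpow_nonzero[of "of_real a"] a by simp
  qed
  then have P: "AE k in half_line. rep P k = 0"
    using rel unfolding mult_rel_def
  proof eventually_elim
    case (elim k)
    then have "of_real (1 + k * k) * rep P k = 0" by (simp add: D_def algebra_simps)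
    moreover have "1 + k * k \<noteq> 0" using zero_le_square[of k] by linarith
    ultimately show ?case by (simp only: mult_eq_0_iff of_real_eq_0_iff) simp
  qed
  then have "P = 0"
    using AE_rep_zero by (intro hl2_eqI) (auto elim: eventually_elim2)
  moreover have "Q = 0"
  proof (rule hl2_eqI)
    show "AE x in half_line. rep Q x = rep 0 x"
      using P rel AE_rep_zero unfolding mult_rel_def by eventually_elim simp
  qed
  ultimately have "(F, N) = p" using PQ by (simp add: zero_prod_def[symmetric])
  then show ?thesis using p(1) by simp
qed

lemma H_op_iff: "(u, f) \<in> H_op \<nu> \<longleftrightarrow> u \<in> L2 \<and> f \<in> L2 \<and> H_rel (cls u) (cls f)"
proof
  assume "u \<in> L2 \<and> f \<in> L2 \<and> H_rel (cls u) (cls f)"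
  then have u: "u \<in> L2" and f: "f \<in> L2" and H: "H_rel (cls u) (cls f)" by auto
  obtain N where N: "mult_rel (\<lambda>k. k) (hankel (cls u)) N" using H_rel_root[OF H] by blast
  have "L2_inner (bessel_op \<nu> \<phi>) u = L2_inner \<phi> f" if \<phi>: "\<phi> \<in> Cc_inf" for \<phi>
  proof -
    have "cinner (cls (bessel_op \<nu> \<phi>)) (cls u) = cinner (froot \<phi>) N"
      by (rule H_rel_parts[OF H_rel_bessel_op[OF \<phi>] froot[OF \<phi>] N])
    moreover have "cinner (cls f) (cls \<phi>) = cinner N (froot \<phi>)"
      by (rule H_rel_parts[OF H N froot[OF \<phi>]])
    ultimately have "cinner (cls (bessel_op \<nu> \<phi>)) (cls u) = cinner (cls \<phi>) (cls f)"
      by (metis cinner_commute)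
    then show ?thesis by (simp add: cinner_cls bessel_op_L2[OF \<phi>] Cc_inf_L2[OF \<phi>] u f)
  qed
  then have adj: "(u, f) \<in> adjoint_graph Cc_inf (bessel_op \<nu>)"
    using u f by (auto simp: adjoint_graph_def)
  obtain q where q: "\<And>n. q n \<in> form_graph" "q \<longlonglongrightarrow> (hankel (cls u), N)"
    using form_graph_dense[OF N] unfolding closure_sequential by blast
  then have "\<forall>n. \<exists>\<phi>\<in>Cc_inf. q n = (hankel (cls \<phi>), froot \<phi>)" by (auto simp: form_graph_def)
  then obtain \<phi> where \<phi>: "\<And>n. \<phi> n \<in> Cc_inf" "\<And>n. q n = (hankel (cls (\<phi> n)), froot (\<phi> n))" by metis
  have "(\<lambda>n. hankel (fst (q n))) \<longlonglongrightarrow> hankel (fst (hankel (cls u), N))"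
    by (intro bounded_linear.tendsto[OF bounded_linear_hankel] tendsto_fst q)
  then have lim: "(\<lambda>n. cls (\<phi> n)) \<longlonglongrightarrow> cls u" by (simp add: \<phi>)
  have "(\<lambda>n. snd (q n)) \<longlonglongrightarrow> snd (hankel (cls u), N)" by (intro tendsto_snd q)
  then have "Cauchy (\<lambda>n. froot (\<phi> n))" by (simp add: \<phi> LIMSEQ_imp_Cauchy)
  moreover have "(\<lambda>n. L2_norm (\<lambda>x. \<phi> n x - u x)) \<longlonglongrightarrow> 0"
  proof -
    have "L2_norm (\<lambda>x. \<phi> n x - u x) = norm (cls (\<phi> n) - cls u)" for n
      using norm_cls[OF L2_diff[OF Cc_inf_L2[OF \<phi>(1)] u] u] by (simp add: cls_diff Cc_inf_L2[OF \<phi>(1)] u)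
    then show ?thesis using lim by (simp add: tendsto_norm_zero_iff LIM_zero_iff)
  qed
  ultimately have "u \<in> form_domain Cc_inf (bessel_op \<nu>)"
    unfolding form_domain_def form_Cauchy_iff[OF \<phi>(1), symmetric]
    using u \<phi>(1) by (intro CollectI conjI exI[of _ \<phi>]) auto
  then show "(u, f) \<in> H_op \<nu>"
    using adj by (simp add: H_op_def friedrichs_extension_def)
qed (use H_op_subset in auto)

text \<open>The propagator is a witness for the choice in \<open>exp_minus_i\<close>, so the chosen
  group has the prescribed generator; \<open>unitary_group_eq_propagator\<close> then compares it
  with the propagator.\<close>

lemma exp_minus_i_H_op:
  defines "U \<equiv> exp_minus_i (H_op \<nu>)"
  shows "unitary_group U" "(f, g) \<in> generator U \<longleftrightarrow> f \<in> L2 \<and> g \<in> L2 \<and> H_rel (cls f) (\<i> *\<^sub>c cls g)"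
proof -
  let ?P = "\<lambda>U. unitary_group U \<and> (\<forall>f g. (f, g) \<in> H_op \<nu> \<longleftrightarrow> (f, \<lambda>x. - \<i> * g x) \<in> generator U)"
  have iff: "(f, g) \<in> H_op \<nu> \<longleftrightarrow> f \<in> L2 \<and> (\<lambda>x. - \<i> * g x) \<in> L2 \<and> H_rel (cls f) (\<i> *\<^sub>c cls (\<lambda>x. - \<i> * g x))" for f g
  proof -
    have 1: "(\<lambda>x. - \<i> * g x) \<in> L2 \<longleftrightarrow> g \<in> L2"
      using L2_cmult[of g "- \<i>"] L2_cmult[of "\<lambda>x. - \<i> * g x" \<i>] by (auto simp: mult.assoc[symmetric])
    have "\<i> *\<^sub>c cls (\<lambda>x. - \<i> * g x) = cls g" if "g \<in> L2"
    proof -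
      have "cls (\<lambda>x. - \<i> * g x) = (- \<i>) *\<^sub>c cls g" using cls_cscale[OF that that, of "- \<i>"] by simp
      then show ?thesis by (simp add: cscale_cscale)
    qed
    then show ?thesis unfolding H_op_iff 1 by auto
  qed
  have "?P (\<lambda>t f. rep (propagator t (cls f)))"
    using ugroup_unitary_group[OF ugroup_propagator] by (simp add: iff generator_propagator)
  then have "\<exists>U. ?P U" by blast
  then have P: "?P U" unfolding U_def exp_minus_i_def by (rule someI_ex)
  then show "unitary_group U" by blast
  have "(f, g) \<in> generator U \<longleftrightarrow> (f, \<lambda>x. \<i> * g x) \<in> H_op \<nu>"
    using P by (simp add: mult.assoc[symmetric])
  also have "\<dots> \<longleftrightarrow> f \<in> L2 \<and> g \<in> L2 \<and> H_rel (cls f) (\<i> *\<^sub>c cls g)"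
    unfolding iff by (simp add: mult.assoc[symmetric])
  finally show "(f, g) \<in> generator U \<longleftrightarrow> f \<in> L2 \<and> g \<in> L2 \<and> H_rel (cls f) (\<i> *\<^sub>c cls g)" .
qed

lemma schroedinger_solution_propagator:
  assumes "u0 \<in> Cc_inf"
  shows "AE x in half_line. schroedinger_solution \<nu> x t u0 = rep (propagator t (cls u0)) x"
  using unitary_group_eq_propagator[OF exp_minus_i_H_op Cc_inf_L2[OF assms] H_rel_bessel_op[OF assms], of t]
  by (simp add: L2_eq_def schroedinger_solution_def)

lemma schroedinger_solution_measurable:
  assumes "u0 \<in> Cc_inf"
  shows "(\<lambda>x. schroedinger_solution \<nu> x t u0) \<in> borel_measurable half_line"
  using L2_measurable[OF unitary_group_L2[OF exp_minus_i_H_op(1) Cc_inf_L2[OF assms], of t]]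
  by (simp add: schroedinger_solution_def[abs_def])

end

section \<open>The Bessel kernel\<close>

context bessel
begin

text \<open>Up to a constant, \<open>bessel_kernel 0 x\<close> is \<open>x powr (- \<nu>) J\<^sub>\<nu>(x)\<close> (Poisson's integral with
  \<open>s = sqrt t\<close>), and \<open>bessel_kernel k\<close> is its \<open>k\<close>-th derivative.\<close>

definition wt :: "real \<Rightarrow> real" where
  "wt t = t powr (1/2 - 1) * (1 - t) powr (\<nu> + 1/2 - 1)"

definition bessel_kernel :: "nat \<Rightarrow> real \<Rightarrow> real" where
  "bessel_kernel k x = (LINT t|lebesgue_on {0..1}. wt t * (sqrt t ^ k * cos (x * sqrt t + real k * (pi / 2))))"

abbreviation B0 :: real where "B0 \<equiv> Beta (1/2) (\<nu> + 1/2)"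

lemma
  shows integrable_wt_power: "integrable (lebesgue_on {0..1}) (\<lambda>t. wt t * t ^ m)"
    and integral_wt_power: "(LINT t|lebesgue_on {0..1}. wt t * t ^ m) = Beta (real m + 1/2) (\<nu> + 1/2)"
proof -
  let ?f = "\<lambda>t. t powr (real m + 1/2 - 1) * (1 - t) powr (\<nu> + 1/2 - 1)"
  have eq: "wt t * t ^ m = ?f t" if "t \<in> {0..1}" for t
  proof (cases "t = 0")
    case False
    then have "t > 0" using that by auto
    then have "t powr (real m + 1/2 - 1) = t powr (1/2 - 1) * t ^ m"
      by (simp add: powr_realpow[symmetric] powr_add[symmetric])
    then show ?thesis by (simp add: wt_def)
  qed (simp add: wt_def)
  have "set_integrable lborel {0..1} ?f"
    using nu_nonneg by (intro integrable_Beta) auto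
  then have "set_integrable lebesgue {0..1} ?f"
    unfolding set_integrable_def by (subst integrable_completion) auto
  then have "?f absolutely_integrable_on {0..1}" .
  then have int: "integrable (lebesgue_on {0..1}) ?f"
    by (rule absolutely_integrable_imp_integrable) auto
  then show "integrable (lebesgue_on {0..1}) (\<lambda>t. wt t * t ^ m)"
    by (rule Bochner_Integration.integrable_cong[THEN iffD1, rotated -1]) (auto simp: eq)
  have "(LINT t|lebesgue_on {0..1}. wt t * t ^ m) = (LINT t|lebesgue_on {0..1}. ?f t)"
    by (rule Bochner_Integration.integral_cong) (auto simp: eq)
  also have "\<dots> = integral {0..1} ?f" by (rule lebesgue_integral_eq_integral[OF int]) auto
  also have "\<dots> = Beta (real m + 1/2) (\<nu> + 1/2)"
    using has_integral_Beta_real[of "real m + 1/2" "\<nu> + 1/2"] nu_nonneg by (intro integral_unique) auto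
  finally show "(LINT t|lebesgue_on {0..1}. wt t * t ^ m) = Beta (real m + 1/2) (\<nu> + 1/2)" .
qed

lemma integrable_wt: "integrable (lebesgue_on {0..1}) wt"
  and integral_wt: "(LINT t|lebesgue_on {0..1}. wt t) = B0"
  using integrable_wt_power[of 0] integral_wt_power[of 0] by simp_all

lemma wt_nonneg: "wt t \<ge> 0" by (simp add: wt_def)

lemma B0_nonneg: "B0 \<ge> 0"
  unfolding integral_wt[symmetric] by (rule Bochner_Integration.integral_nonneg) (rule wt_nonneg)

lemma integrable_wt_mult:
  assumes "continuous_on {0..1} g" "\<And>t. t \<in> {0..1} \<Longrightarrow> \<bar>g t\<bar> \<le> C"
  shows "integrable (lebesgue_on {0..1}) (\<lambda>t. wt t * g t)"
    and "\<bar>LINT t|lebesgue_on {0..1}. wt t * g t\<bar> \<le> B0 * C"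
proof -
  have [measurable]: "g \<in> borel_measurable (lebesgue_on {0..1})" "wt \<in> borel_measurable (lebesgue_on {0..1})"
    using assms(1) integrable_wt by (auto intro: continuous_imp_measurable_on_sets_lebesgue)
  have b: "\<bar>wt t * g t\<bar> \<le> wt t * C" if "t \<in> {0..1}" for t
    using assms(2)[OF that] wt_nonneg[of t] by (simp add: abs_mult mult_left_mono)
  show int: "integrable (lebesgue_on {0..1}) (\<lambda>t. wt t * g t)"
  proof (rule Bochner_Integration.integrable_bound[of _ "\<lambda>t. wt t * C"])
    show "AE t in lebesgue_on {0..1}. norm (wt t * g t) \<le> norm (wt t * C)"
      using b by (intro AE_I2) (auto intro: order.trans[OF _ abs_ge_self])
  qed (use integrable_wt in auto)
  have "\<bar>LINT t|lebesgue_on {0..1}. wt t * g t\<bar> \<le> (LINT t|lebesgue_on {0..1}. \<bar>wt t * g t\<bar>)"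
    by (rule integral_abs_bound)
  also have "\<dots> \<le> (LINT t|lebesgue_on {0..1}. wt t * C)"
    by (rule integral_mono) (use int integrable_wt b in auto)
  finally show "\<bar>LINT t|lebesgue_on {0..1}. wt t * g t\<bar> \<le> B0 * C"
    using integral_wt by simp
qed

text \<open>Each derivative of the cosine is a shift by a quarter period, so a single Lagrange
  remainder, bounded by 1 in its trigonometric factor, covers all orders.\<close>

lemma cos_taylor:
  fixes a b :: real
  shows "\<bar>cos (a + b) - (\<Sum>i<n. cos (a + real i * (pi / 2)) / fact i * b ^ i)\<bar> \<le> \<bar>b\<bar> ^ n / fact n"
proof -
  define d where "d m t = cos (a + t + real m * (pi / 2))" for m t
  have D: "DERIV (d m) t :> d (Suc m) t" for m t
  proof -
    have "DERIV (d m) t :> - sin (a + t + real m * (pi / 2))"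
      unfolding d_def by (auto intro!: derivative_eq_intros)
    also have "- sin (a + t + real m * (pi / 2)) = d (Suc m) t"
      using cos_add[of "a + t + real m * (pi / 2)" "pi / 2"] by (simp add: d_def algebra_simps add_divide_distrib)
    finally show ?thesis .
  qed
  have "d 0 = (\<lambda>t. cos (a + t))" by (simp add: d_def fun_eq_iff)
  then obtain t where t: "cos (a + b) = (\<Sum>m<n. d m 0 / fact m * b ^ m) + d n t / fact n * b ^ n"
    using Maclaurin_all_le[of d "\<lambda>t. cos (a + t)" b n] D by blast
  have "\<bar>d n t / fact n * b ^ n\<bar> = \<bar>d n t\<bar> * (\<bar>b\<bar> ^ n / fact n)"
    by (simp add: abs_mult power_abs)
  also have "\<dots> \<le> 1 * (\<bar>b\<bar> ^ n / fact n)"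
    by (intro mult_right_mono) (auto simp: d_def)
  finally show ?thesis using t by (simp add: d_def)
qed

text \<open>Taylor's formula for the cosine is integrated against \<open>wt\<close>; as
  \<open>sqrt t \<le> 1\<close> on the unit interval, the remainder does not depend on
  \<open>x\<close>. This uniformity later gives the same radius at every centre.\<close>

lemma bessel_kernel_taylor:
  "\<bar>bessel_kernel 0 (x + h) - (\<Sum>i<n. bessel_kernel i x / fact i * h ^ i)\<bar> \<le> B0 * (\<bar>h\<bar> ^ n / fact n)"
proof -
  define g where "g i t = sqrt t ^ i * cos (x * sqrt t + real i * (pi / 2)) / fact i * h ^ i" for i t
  have gc: "continuous_on {0..1} (g i)" for i unfolding g_def by (intro continuous_intros) auto
  have gb: "\<bar>g i t\<bar> \<le> 1 / fact i * \<bar>h\<bar> ^ i" if "t \<in> {0..1}" for i t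
  proof -
    have "\<bar>g i t\<bar> = (sqrt t ^ i * \<bar>cos (x * sqrt t + real i * (pi / 2))\<bar>) * (1 / fact i * \<bar>h\<bar> ^ i)"
      using that by (simp add: g_def abs_mult power_abs)
    also have "\<dots> \<le> (1 * 1) * (1 / fact i * \<bar>h\<bar> ^ i)"
      using that by (intro mult_right_mono mult_mono power_le_one) auto
    finally show ?thesis by simp
  qed
  have cc: "continuous_on {0..1} (\<lambda>t. cos ((x + h) * sqrt t + real 0 * (pi / 2)))"
    by (intro continuous_intros) auto
  have i0: "integrable (lebesgue_on {0..1}) (\<lambda>t. wt t * cos ((x + h) * sqrt t))"
    using integrable_wt_mult(1)[OF cc, of 1] by simp
  have ii: "integrable (lebesgue_on {0..1}) (\<lambda>t. wt t * g i t)" for i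
    by (rule integrable_wt_mult(1)[OF gc gb])
  have "bessel_kernel i x / fact i * h ^ i = (LINT t|lebesgue_on {0..1}. wt t * g i t)" for i
  proof -
    have "(LINT t|lebesgue_on {0..1}. wt t * g i t)
        = (LINT t|lebesgue_on {0..1}. (1 / fact i * h ^ i) * (wt t * (sqrt t ^ i * cos (x * sqrt t + real i * (pi / 2)))))"
      by (simp add: g_def mult_ac)
    then show ?thesis by (simp add: bessel_kernel_def)
  qed
  then have "bessel_kernel 0 (x + h) - (\<Sum>i<n. bessel_kernel i x / fact i * h ^ i)
      = (LINT t|lebesgue_on {0..1}. wt t * cos ((x + h) * sqrt t) - (\<Sum>i<n. wt t * g i t))"
    using i0 ii by (simp add: bessel_kernel_def Bochner_Integration.integral_sum)
  also have "\<dots> = (LINT t|lebesgue_on {0..1}. wt t * (cos ((x + h) * sqrt t) - (\<Sum>i<n. g i t)))"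
    by (simp add: right_diff_distrib sum_distrib_left)
  finally have eq: "bessel_kernel 0 (x + h) - (\<Sum>i<n. bessel_kernel i x / fact i * h ^ i)
    = (LINT t|lebesgue_on {0..1}. wt t * (cos ((x + h) * sqrt t) - (\<Sum>i<n. g i t)))" .
  show ?thesis
    unfolding eq
  proof (rule integrable_wt_mult(2))
    show "continuous_on {0..1} (\<lambda>t. cos ((x + h) * sqrt t) - (\<Sum>i<n. g i t))"
      by (intro continuous_intros gc)
    fix t :: real assume t: "t \<in> {0..1}"
    have "\<bar>cos (x * sqrt t + h * sqrt t) - (\<Sum>i<n. cos (x * sqrt t + real i * (pi / 2)) / fact i * (h * sqrt t) ^ i)\<bar>
        \<le> \<bar>h * sqrt t\<bar> ^ n / fact n" by (rule cos_taylor)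
    also have "\<dots> \<le> \<bar>h\<bar> ^ n / fact n"
      using t by (intro divide_right_mono power_mono) (auto simp: abs_mult intro: mult_left_le)
    finally show "\<bar>cos ((x + h) * sqrt t) - (\<Sum>i<n. g i t)\<bar> \<le> \<bar>h\<bar> ^ n / fact n"
      unfolding distrib_right[of x h "sqrt t"] by (simp add: g_def power_mult_distrib mult_ac)
  qed
qed

lemma bessel_kernel_bounded: "\<bar>bessel_kernel k x\<bar> \<le> B0"
proof -
  have "\<bar>LINT t|lebesgue_on {0..1}. wt t * (sqrt t ^ k * cos (x * sqrt t + real k * (pi / 2)))\<bar> \<le> B0 * 1"
  proof (rule integrable_wt_mult(2))
    show "continuous_on {0..1} (\<lambda>t. sqrt t ^ k * cos (x * sqrt t + real k * (pi / 2)))"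
      by (intro continuous_intros) auto
    fix t :: real assume "t \<in> {0..1}"
    then show "\<bar>sqrt t ^ k * cos (x * sqrt t + real k * (pi / 2))\<bar> \<le> 1"
      unfolding abs_mult power_abs by (intro mult_le_one power_le_one) auto
  qed
  then show ?thesis by (simp add: bessel_kernel_def)
qed

lemma cos_lipschitz: "\<bar>cos a - cos b\<bar> \<le> \<bar>a - (b::real)\<bar>"
  using cos_taylor[of b "a - b" 1] by simp

lemma bessel_kernel_lipschitz: "\<bar>bessel_kernel k x - bessel_kernel k y\<bar> \<le> B0 * \<bar>x - y\<bar>"
proof -
  let ?g = "\<lambda>x t. sqrt t ^ k * cos (x * sqrt t + real k * (pi / 2))"
  have c: "continuous_on {0..1} (?g x)" for x by (intro continuous_intros) auto
  have b: "\<bar>?g x t\<bar> \<le> 1" if "t \<in> {0..1}" for x t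
    unfolding abs_mult power_abs using that by (intro mult_le_one power_le_one) auto
  have "bessel_kernel k x - bessel_kernel k y = (LINT t|lebesgue_on {0..1}. wt t * (?g x t - ?g y t))"
    unfolding bessel_kernel_def right_diff_distrib
    by (rule Bochner_Integration.integral_diff[OF integrable_wt_mult(1)[OF c b] integrable_wt_mult(1)[OF c b], symmetric])
  also have "\<bar>\<dots>\<bar> \<le> B0 * \<bar>x - y\<bar>"
  proof (rule integrable_wt_mult(2))
    show "continuous_on {0..1} (\<lambda>t. ?g x t - ?g y t)" by (intro continuous_intros c)
    fix t :: real assume t: "t \<in> {0..1}"
    have "\<bar>?g x t - ?g y t\<bar> = sqrt t ^ k * \<bar>cos (x * sqrt t + real k * (pi / 2)) - cos (y * sqrt t + real k * (pi / 2))\<bar>"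
      using t by (simp add: abs_mult power_abs flip: right_diff_distrib)
    also have "\<dots> \<le> 1 * \<bar>(x * sqrt t + real k * (pi / 2)) - (y * sqrt t + real k * (pi / 2))\<bar>"
      using t by (intro mult_mono cos_lipschitz power_le_one) auto
    also have "\<dots> = \<bar>x - y\<bar> * sqrt t" using t by (simp add: abs_mult flip: left_diff_distrib)
    also have "\<dots> \<le> \<bar>x - y\<bar> * 1" using t by (intro mult_left_mono) auto
    finally show "\<bar>?g x t - ?g y t\<bar> \<le> \<bar>x - y\<bar>" by simp
  qed
  finally show ?thesis .
qed

lemma bessel_kernel_continuous: "continuous_on S (bessel_kernel k)"
proof -
  have "B0-lipschitz_on S (bessel_kernel k)"
    using bessel_kernel_lipschitz B0_nonneg by (intro lipschitz_onI) (auto simp: dist_real_def)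
  then show ?thesis by (rule lipschitz_on_continuous_on)
qed

lemma bessel_kernel_measurable [measurable]: "bessel_kernel k \<in> borel_measurable borel"
  by (intro borel_measurable_continuous_onI bessel_kernel_continuous)

lemma summable_even_exp: "summable (\<lambda>m. \<bar>x\<bar> ^ (2 * m) / fact (2 * m))" for x :: real
proof (rule summable_comparison_test')
  show "summable (\<lambda>m. (x\<^sup>2) ^ m / fact m)"
    using summable_exp[of "x\<^sup>2"] by (simp add: divide_inverse mult.commute)
  fix m :: nat
  have "(x\<^sup>2) ^ m / fact (2 * m) \<le> (x\<^sup>2) ^ m / fact m"
    by (intro divide_left_mono fact_mono) auto
  then show "norm (\<bar>x\<bar> ^ (2 * m) / fact (2 * m)) \<le> (x\<^sup>2) ^ m / fact m"
    by (simp add: power_mult)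
qed

lemma bessel_kernel_series:
  "(\<lambda>m. (-1) ^ m / fact (2 * m) * x ^ (2 * m) * Beta (real m + 1/2) (\<nu> + 1/2)) sums bessel_kernel 0 x"
proof -
  define f where "f m t = ((-1) ^ m / fact (2 * m) * x ^ (2 * m)) * (wt t * t ^ m)" for m t
  have int: "integrable (lebesgue_on {0..1}) (f m)" for m
    unfolding f_def by (intro integrable_mult_right integrable_wt_power)
  have n: "norm (f m t) = (\<bar>x\<bar> ^ (2 * m) / fact (2 * m)) * (wt t * t ^ m)" if "t \<in> {0..1}" for m t
    using that wt_nonneg[of t] by (simp add: f_def abs_mult power_abs)
  have s: "summable (\<lambda>m. \<bar>x\<bar> ^ (2 * m) / fact (2 * m))"
    by (rule summable_even_exp)
  have "(\<lambda>m. integral\<^sup>L (lebesgue_on {0..1}) (f m)) sums (LINT t|lebesgue_on {0..1}. (\<Sum>m. f m t))"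
  proof (rule sums_integral[OF int])
    show "AE t in lebesgue_on {0..1}. summable (\<lambda>m. norm (f m t))"
    proof (rule AE_I2)
      fix t :: real assume t: "t \<in> space (lebesgue_on {0..1})"
      show "summable (\<lambda>m. norm (f m t))"
      proof (rule summable_comparison_test'[OF summable_mult2[OF s, of "wt t"]])
        fix m :: nat
        have "(\<bar>x\<bar> ^ (2 * m) / fact (2 * m)) * (wt t * t ^ m) \<le> (\<bar>x\<bar> ^ (2 * m) / fact (2 * m)) * (wt t * 1)"
          using t wt_nonneg[of t] by (intro mult_left_mono power_le_one) auto
        moreover have "norm (norm (f m t)) = (\<bar>x\<bar> ^ (2 * m) / fact (2 * m)) * (wt t * t ^ m)"
          using n[of t m] t unfolding real_norm_def abs_idempotent by simp
        ultimately show "norm (norm (f m t)) \<le> \<bar>x\<bar> ^ (2 * m) / fact (2 * m) * wt t"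
          by simp
      qed
    qed
    show "summable (\<lambda>m. LINT t|lebesgue_on {0..1}. norm (f m t))"
    proof (rule summable_comparison_test'[OF summable_mult2[OF s, of B0]])
      fix m :: nat
      have "(LINT t|lebesgue_on {0..1}. norm (f m t)) = (LINT t|lebesgue_on {0..1}. (\<bar>x\<bar> ^ (2 * m) / fact (2 * m)) * (wt t * t ^ m))"
        by (rule Bochner_Integration.integral_cong[OF refl]) (rule n, simp)
      also have "\<dots> = (\<bar>x\<bar> ^ (2 * m) / fact (2 * m)) * (LINT t|lebesgue_on {0..1}. wt t * t ^ m)" by simp
      also have "\<dots> \<le> (\<bar>x\<bar> ^ (2 * m) / fact (2 * m)) * B0"
        unfolding integral_wt[symmetric]
        by (intro mult_left_mono integral_mono integrable_wt_power integrable_wt)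
          (auto intro!: mult_left_le power_le_one wt_nonneg)
      finally show "norm (LINT t|lebesgue_on {0..1}. norm (f m t)) \<le> \<bar>x\<bar> ^ (2 * m) / fact (2 * m) * B0"
        by simp
    qed
  qed
  moreover have "(\<Sum>m. f m t) = wt t * cos (x * sqrt t)" if "t \<in> {0..1}" for t
  proof -
    have "(\<lambda>m. wt t * ((- 1) ^ m / fact (2 * m) * (x * sqrt t) ^ (2 * m))) sums (wt t * cos (x * sqrt t))"
      by (intro sums_mult cos_paired)
    moreover have "wt t * ((- 1) ^ m / fact (2 * m) * (x * sqrt t) ^ (2 * m)) = f m t" for m
      using that by (simp add: f_def power_mult_distrib power_mult)
    ultimately show ?thesis by (simp add: sums_iff)
  qed
  then have "(LINT t|lebesgue_on {0..1}. (\<Sum>m. f m t)) = bessel_kernel 0 x"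
    unfolding bessel_kernel_def by (intro Bochner_Integration.integral_cong) auto
  moreover have "integral\<^sup>L (lebesgue_on {0..1}) (f m) = (-1) ^ m / fact (2 * m) * x ^ (2 * m) * Beta (real m + 1/2) (\<nu> + 1/2)" for m
    unfolding f_def integral_mult_right_zero integral_wt_power ..
  ultimately show ?thesis by simp
qed

lemma Gamma_half_nat: "Gamma (real m + 1/2) = fact (2 * m) * sqrt pi / (4 ^ m * fact m)"
proof (induction m)
  case 0 show ?case by (simp add: Gamma_one_half_real)
next
  case (Suc m)
  have "real m + 1/2 \<notin> \<int>\<^sub>\<le>\<^sub>0" by (auto dest: nonpos_Ints_nonpos)
  then have "Gamma (real m + 1/2 + 1) = (real m + 1/2) * Gamma (real m + 1/2)" by (rule Gamma_plus1)
  then have "Gamma (real (Suc m) + 1/2) = (real m + 1/2) * (fact (2 * m) * sqrt pi / (4 ^ m * fact m))"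
    using Suc by (simp add: add_ac)
  also have "\<dots> = fact (2 * Suc m) * sqrt pi / (4 ^ Suc m * fact (Suc m))"
  proof -
    have f: "fact (2 * Suc m) = (2 * real m + 2) * (2 * real m + 1) * fact (2 * m)"
      by (simp add: algebra_simps)
    have "real m + 1/2 = (2 * real m + 2) * (2 * real m + 1) / (4 * (1 + real m))"
      by (simp add: divide_simps) (simp add: algebra_simps)
    then show ?thesis unfolding f by (simp add: mult_ac)
  qed
  finally show ?case .
qed

definition kernel_const :: real where
  "kernel_const = sqrt pi * Gamma (\<nu> + 1/2) / 2"

lemma kernel_const_pos: "kernel_const > 0"
  using nu_nonneg by (simp add: kernel_const_def Gamma_real_pos)

text \<open>The Gamma value in the denominator of the Beta function cancels the one in the Gaussian
  moment, and the half-integer Gamma value cancels \<open>fact (2 * m)\<close>. What is left are the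
  coefficients of an exponential series.\<close>

lemma kernel_coeff:
  "Beta (real m + 1/2) (\<nu> + 1/2) / fact (2 * m) * (Gamma (\<nu> + real m + 1) / 2) = kernel_const / (4 ^ m * fact m)"
proof -
  have "Gamma (\<nu> + real m + 1) > 0" using nu_nonneg by (intro Gamma_real_pos) auto
  moreover have "Beta (real m + 1/2) (\<nu> + 1/2) = Gamma (real m + 1/2) * Gamma (\<nu> + 1/2) / Gamma (\<nu> + real m + 1)"
    by (simp add: Beta_def add_ac)
  ultimately show ?thesis unfolding Gamma_half_nat by (simp add: kernel_const_def field_simps)
qed

text \<open>Weber's integral; expanding the kernel in its power series gives an exponential series.\<close>

lemma gaussian_bessel_integral:
  fixes z :: complex and k :: real
  assumes z: "Re z > 0"
  shows "(LINT x|half_line. of_real (x powr (2 * \<nu> + 1)) * exp (- z * of_real (x\<^sup>2)) * of_real (bessel_kernel 0 (k * x)))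
    = kernel_const * z powr (- of_real (\<nu> + 1)) * exp (- of_real (k\<^sup>2) / (4 * z))"
proof -
  define b where "b m = (-1) ^ m / fact (2 * m) * k ^ (2 * m) * Beta (real m + 1/2) (\<nu> + 1/2)" for m
  define F where "F m x = of_real (b m) * (of_real (x powr (2 * (\<nu> + real m) + 1)) * exp (- z * of_real (x\<^sup>2)))" for m x
  have pw: "x powr (2 * (\<nu> + real m) + 1) = x powr (2 * \<nu> + 1) * x ^ (2 * m)" if "x > 0" for x m
  proof -
    have "x powr (2 * (\<nu> + real m) + 1) = x powr (2 * \<nu> + 1) * x powr (real (2 * m))"
      by (simp add: powr_add[symmetric] algebra_simps)
    then show ?thesis using that by (simp only: powr_realpow)
  qed
  have int: "integrable half_line (F m)" for m
    unfolding F_def using nu_nonneg z by (intro integrable_mult_right integrable_gaussian_moment_complex) auto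
  have sumF: "(\<lambda>m. F m x) sums (of_real (x powr (2 * \<nu> + 1)) * exp (- z * of_real (x\<^sup>2)) * of_real (bessel_kernel 0 (k * x)))"
    if x: "x > 0" for x
  proof -
    have "(\<lambda>m. of_real (x powr (2 * \<nu> + 1)) * exp (- z * of_real (x\<^sup>2)) *
        complex_of_real ((-1) ^ m / fact (2 * m) * (k * x) ^ (2 * m) * Beta (real m + 1/2) (\<nu> + 1/2)))
        sums (of_real (x powr (2 * \<nu> + 1)) * exp (- z * of_real (x\<^sup>2)) * of_real (bessel_kernel 0 (k * x)))"
      by (intro sums_mult sums_of_real bessel_kernel_series)
    moreover have "of_real (x powr (2 * \<nu> + 1)) * exp (- z * of_real (x\<^sup>2)) *
        complex_of_real ((-1) ^ m / fact (2 * m) * (k * x) ^ (2 * m) * Beta (real m + 1/2) (\<nu> + 1/2)) = F m x" for m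
      unfolding F_def b_def pw[OF x] power_mult_distrib by simp
    ultimately show ?thesis by simp
  qed
  have Bp: "Beta (real m + 1/2) (\<nu> + 1/2) \<ge> 0" for m
    using nu_nonneg by (simp add: Beta_def Gamma_real_pos less_imp_le)
  have cb: "\<bar>b m\<bar> * (Gamma (\<nu> + real m + 1) / 2) = kernel_const * ((k\<^sup>2 / 4) ^ m / fact m)" for m
  proof -
    have "\<bar>b m\<bar> = k ^ (2 * m) * (Beta (real m + 1/2) (\<nu> + 1/2) / fact (2 * m))"
      using Bp[of m] by (simp add: b_def abs_mult)
    then have "\<bar>b m\<bar> * (Gamma (\<nu> + real m + 1) / 2)
        = k ^ (2 * m) * (Beta (real m + 1/2) (\<nu> + 1/2) / fact (2 * m) * (Gamma (\<nu> + real m + 1) / 2))"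
      by (simp only: mult.assoc)
    also have "\<dots> = kernel_const * ((k\<^sup>2 / 4) ^ m / fact m)"
      unfolding kernel_coeff by (simp add: power_mult power_divide)
    finally show ?thesis .
  qed
  have nF: "(LINT x|half_line. norm (F m x)) = kernel_const * Re z powr (- (\<nu> + 1)) * ((k\<^sup>2 / (4 * Re z)) ^ m / fact m)" for m
  proof -
    have "(LINT x|half_line. norm (F m x)) = (LINT x|half_line. \<bar>b m\<bar> * (x powr (2 * (\<nu> + real m) + 1) * exp (- Re z * x\<^sup>2)))"
      by (intro Bochner_Integration.integral_cong) (auto simp: F_def norm_mult)
    also have "\<dots> = \<bar>b m\<bar> * (Gamma (\<nu> + real m + 1) / 2) * Re z powr (- (\<nu> + real m + 1))"
      unfolding integral_mult_right_zero using nu_nonneg z by (subst gaussian_moment) auto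
    also have "Re z powr (- (\<nu> + real m + 1)) = Re z powr (- (\<nu> + 1)) / Re z ^ m"
      using z by (simp add: powr_diff powr_minus powr_add powr_realpow field_simps)
    finally show ?thesis unfolding cb by (simp add: power_divide power_mult_distrib mult_ac)
  qed
  have sums: "(\<lambda>m. integral\<^sup>L half_line (F m)) sums (LINT x|half_line. (\<Sum>m. F m x))"
  proof (rule sums_integral[OF int])
    have "summable (\<lambda>m. (k\<^sup>2 / (4 * Re z)) ^ m / fact m)"
      using summable_exp[of "k\<^sup>2 / (4 * Re z)"] by (simp only: divide_inverse mult.commute[of _ "inverse (fact _)"])
    then show "summable (\<lambda>m. LINT x|half_line. norm (F m x))"
      unfolding nF by (rule summable_mult)
    show "AE x in half_line. summable (\<lambda>m. norm (F m x))"
    proof (rule AE_I2)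
      fix x assume "x \<in> space half_line"
      then have x: "x > 0" by simp
      have "summable (\<lambda>m. norm ((k * x) ^ (2 * m) / fact (2 * m)))"
        using summable_even_exp[of "k * x"] by (simp add: power_abs)
      then have s: "summable (\<lambda>m. norm ((k * x) ^ (2 * m) / fact (2 * m)) * (B0 * (x powr (2 * \<nu> + 1) * exp (- Re z * x\<^sup>2))))"
        by (rule summable_mult2)
      show "summable (\<lambda>m. norm (F m x))"
      proof (rule summable_comparison_test'[OF s])
        fix m
        have Ble: "Beta (real m + 1/2) (\<nu> + 1/2) \<le> B0"
          unfolding integral_wt[symmetric] integral_wt_power[symmetric]
          by (intro integral_mono integrable_wt_power integrable_wt) (auto intro!: mult_left_le power_le_one wt_nonneg)
        have "norm (F m x) = norm ((k * x) ^ (2 * m) / fact (2 * m)) * (Beta (real m + 1/2) (\<nu> + 1/2) * (x powr (2 * \<nu> + 1) * exp (- Re z * x\<^sup>2)))"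
          using x Bp[of m] unfolding F_def b_def pw[OF x]
          by (simp add: norm_mult norm_power norm_divide abs_mult power_mult_distrib power_abs mult_ac)
        also have "\<dots> \<le> norm ((k * x) ^ (2 * m) / fact (2 * m)) * (B0 * (x powr (2 * \<nu> + 1) * exp (- Re z * x\<^sup>2)))"
          using Ble by (intro mult_left_mono mult_right_mono) auto
        finally show "norm (norm (F m x)) \<le> \<dots>" by simp
      qed
    qed
  qed
  have "(LINT x|half_line. (\<Sum>m. F m x)) = (LINT x|half_line. of_real (x powr (2 * \<nu> + 1)) * exp (- z * of_real (x\<^sup>2)) * of_real (bessel_kernel 0 (k * x)))"
    using sumF by (intro Bochner_Integration.integral_cong) (auto simp: sums_iff)
  moreover have "(\<lambda>m. integral\<^sup>L half_line (F m)) sums (kernel_const * z powr (- of_real (\<nu> + 1)) * exp (- of_real (k\<^sup>2) / (4 * z)))"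
  proof -
    have z0: "z \<noteq> 0" using z by auto
    have "integral\<^sup>L half_line (F m) = kernel_const * z powr (- of_real (\<nu> + 1)) * ((- of_real (k\<^sup>2) / (4 * z)) ^ m /\<^sub>R fact m)" for m
    proof -
      have "integral\<^sup>L half_line (F m) = of_real (b m) * (of_real (Gamma (\<nu> + real m + 1) / 2) * z powr (- of_real (\<nu> + real m + 1)))"
        unfolding F_def integral_mult_right_zero using nu_nonneg z by (subst gaussian_moment_complex) auto
      also have "z powr (- of_real (\<nu> + real m + 1)) = z powr (- of_real (\<nu> + 1)) / z ^ m"
      proof -
        have "z powr (- of_real (\<nu> + 1)) = z powr (- of_real (\<nu> + real m + 1) + of_nat m)" by simp
        also have "\<dots> = z powr (- of_real (\<nu> + real m + 1)) * z ^ m"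
          using z0 by (simp only: powr_add powr_nat) simp
        finally show ?thesis using z0 by simp
      qed
      also have "of_real (b m) * (of_real (Gamma (\<nu> + real m + 1) / 2) * (z powr (- of_real (\<nu> + 1)) / z ^ m))
          = of_real (b m * (Gamma (\<nu> + real m + 1) / 2)) * (z powr (- of_real (\<nu> + 1)) / z ^ m)"
        by simp
      also have "b m * (Gamma (\<nu> + real m + 1) / 2) = kernel_const * ((- 1) ^ m * (k\<^sup>2 / 4) ^ m / fact m)"
      proof -
        have "b m = (-1) ^ m * \<bar>b m\<bar>" using Bp[of m] by (simp add: b_def abs_mult)
        then have "b m * (Gamma (\<nu> + real m + 1) / 2) = (-1) ^ m * (\<bar>b m\<bar> * (Gamma (\<nu> + real m + 1) / 2))"
          by (metis mult.assoc)
        then show ?thesis unfolding cb by simp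
      qed
      also have "of_real (kernel_const * ((- 1) ^ m * (k\<^sup>2 / 4) ^ m / fact m)) * (z powr (- of_real (\<nu> + 1)) / z ^ m)
          = kernel_const * z powr (- of_real (\<nu> + 1)) * (((- 1) ^ m * (of_real (k\<^sup>2) / 4) ^ m / z ^ m) /\<^sub>R fact m)"
        by (simp add: scaleR_conv_of_real field_simps)
      also have "(- 1) ^ m * (of_real (k\<^sup>2) / 4) ^ m / z ^ m = (- of_real (k\<^sup>2) / (4 * z)) ^ m"
        by (simp only: power_mult_distrib[symmetric] power_divide[symmetric]) simp
      finally show ?thesis .
    qed
    then show ?thesis by (simp only:) (intro sums_mult exp_converges)
  qed
  ultimately show ?thesis using sums sums_unique2 by metis
qed

end

section \<open>The integral kernel of the propagator\<close>

context bessel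
begin

text \<open>The data together with those factors of the propagator kernel that depend on
  \<open>y\<close> alone. The phase is unimodular, so only the power of \<open>y\<close> affects the
  modulus.\<close>

definition modulated :: "real \<Rightarrow> (real \<Rightarrow> complex) \<Rightarrow> real \<Rightarrow> complex" where
  "modulated T u y = of_real (y powr (\<nu> + 1/2)) * (exp (\<i> * of_real (y\<^sup>2 / (4 * T))) * u y)"

definition amplitude :: "real \<Rightarrow> (real \<Rightarrow> complex) \<Rightarrow> real \<Rightarrow> complex" where
  "amplitude T u x = (LINT y|half_line. of_real (bessel_kernel 0 (x * (y / (2 * T)))) * modulated T u y)"

lemma cmod_modulated: "y > 0 \<Longrightarrow> cmod (modulated T u y) = y powr (\<nu> + 1/2) * cmod (u y)"
  by (simp add: modulated_def norm_mult)

lemma integrable_times_modulated: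
  fixes g :: "real \<Rightarrow> complex"
  assumes u: "u \<in> Cc_inf" and g: "continuous_on {0<..} g"
  shows "integrable half_line (\<lambda>y. g y * modulated T u y)"
proof -
  obtain a b where ab: "0 < a" "a < b" "\<And>x. x \<notin> {a<..<b} \<Longrightarrow> u x = 0"
    using Cc_inf_support[OF u] by blast
  have "continuous_on {0<..} (\<lambda>y. complex_of_real (y powr (\<nu> + 1/2)))"
    by (intro continuous_intros) auto
  moreover have "continuous_on {0<..} (\<lambda>y. y\<^sup>2 / (4 * T))"
    by (cases "T = 0") (auto intro!: continuous_intros)
  then have "continuous_on {0<..} (\<lambda>y. exp (\<i> * complex_of_real (y\<^sup>2 / (4 * T))))"
    by (intro continuous_on_exp continuous_on_mult continuous_on_const continuous_on_of_real)
  ultimately have "continuous_on {0<..} (\<lambda>y. g y * modulated T u y)"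
    unfolding modulated_def by (intro continuous_on_mult g Cc_inf_continuous[OF u])
  then have "continuous_on {a..b} (\<lambda>y. g y * modulated T u y)"
    by (rule continuous_on_subset) (use ab in auto)
  then show ?thesis
    using ab by (intro integrable_half_line_Icc[of a b] continuous_imp_integrable_real) (auto simp: modulated_def)
qed

lemma integrable_times_cmod_modulated:
  fixes g :: "real \<Rightarrow> real"
  assumes u: "u \<in> Cc_inf" and g: "continuous_on {0<..} g" "\<And>y. y > 0 \<Longrightarrow> g y \<ge> 0"
  shows "integrable half_line (\<lambda>y. g y * cmod (modulated T u y))"
proof -
  have "integrable half_line (\<lambda>y. norm (of_real (g y) * modulated T u y))"
    by (intro integrable_norm integrable_times_modulated u continuous_intros g)
  then show ?thesis
    by (rule Bochner_Integration.integrable_cong[THEN iffD1, rotated -1]) (auto simp: norm_mult g)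
qed

lemma integrable_cmod_modulated: "u \<in> Cc_inf \<Longrightarrow> integrable half_line (\<lambda>y. cmod (modulated T u y))"
  using integrable_times_cmod_modulated[of u "\<lambda>_. 1"] by simp

lemma continuous_kernel_line: "continuous_on S (\<lambda>y. bessel_kernel k (x * (y / c)))"
proof (cases "c = 0")
  case False
  then show ?thesis
    by (intro continuous_on_compose2[OF bessel_kernel_continuous[of UNIV]] continuous_intros) auto
qed simp

lemma integrable_kernel_modulated:
  "u \<in> Cc_inf \<Longrightarrow> integrable half_line (\<lambda>y. of_real (bessel_kernel 0 (x * (y / (2 * T)))) * modulated T u y)"
  by (intro integrable_times_modulated continuous_intros continuous_kernel_line)

text \<open>The weighted L1 norm that bounds all Taylor coefficients of the amplitude at radius
  \<open>R\<close>; \<open>y / (2 * T)\<close> is the frequency belonging to the point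
  \<open>y\<close>.\<close>

definition exp_mass :: "real \<Rightarrow> real \<Rightarrow> (real \<Rightarrow> complex) \<Rightarrow> real" where
  "exp_mass T R u = (LINT y|half_line. exp (R * (y / (2 * T))) * cmod (modulated T u y))"

lemma exp_mass_nonneg: "exp_mass T R u \<ge> 0"
  unfolding exp_mass_def by (intro Bochner_Integration.integral_nonneg) auto

text \<open>With the frequency \<open>s = y / (2 T)\<close>, the kernel remainder
  \<open>\<bar>h * s\<bar> ^ n / fact n\<close> is at most
  \<open>(\<bar>h\<bar> / R) ^ n * exp (R * s)\<close>. The coefficients \<open>c\<close> depend on
  the centre, but serve all \<open>n\<close> and \<open>h\<close>, and the bound is independent of
  the centre.\<close>

lemma amplitude_taylor:
  assumes u: "u \<in> Cc_inf" and T: "T > 0" and R: "R > 0"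
  obtains c where "\<And>n h. cmod (amplitude T u (x + h) - (\<Sum>i<n. c i * of_real (h ^ i)))
    \<le> (\<bar>h\<bar> / R) ^ n * (B0 * exp_mass T R u)"
proof
  define K where "K i y = bessel_kernel i (x * (y / (2 * T))) / fact i * (y / (2 * T)) ^ i" for i y
  define c where "c i = (LINT y|half_line. of_real (K i y) * modulated T u y)" for i
  fix n :: nat and h :: real
  have Kc: "continuous_on {0<..} (K i)" for i
    unfolding K_def using T by (intro continuous_intros continuous_kernel_line) auto
  have Ki: "integrable half_line (\<lambda>y. of_real (K i y) * modulated T u y)" for i
    by (intro integrable_times_modulated[OF u] continuous_intros Kc)
  have remainder: "amplitude T u (x + h) - (\<Sum>i<n. c i * of_real (h ^ i))
      = (LINT y|half_line. of_real (bessel_kernel 0 ((x + h) * (y / (2 * T)))) * modulated T u y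
          - (\<Sum>i<n. of_real (K i y) * modulated T u y * of_real (h ^ i)))"
  proof -
    have "integrable half_line (\<lambda>y. \<Sum>i<n. of_real (K i y) * modulated T u y * of_real (h ^ i))"
      by (intro Bochner_Integration.integrable_sum integrable_mult_left Ki)
    moreover have "(LINT y|half_line. (\<Sum>i<n. of_real (K i y) * modulated T u y * of_real (h ^ i))) = (\<Sum>i<n. c i * of_real (h ^ i))"
      unfolding c_def by (subst Bochner_Integration.integral_sum)
        (intro integrable_mult_left Ki, intro sum.cong refl integral_mult_left_zero)
    ultimately show ?thesis
      unfolding amplitude_def by (simp only: Bochner_Integration.integral_diff[OF integrable_kernel_modulated[OF u]])
  qed
  have "cmod (amplitude T u (x + h) - (\<Sum>i<n. c i * of_real (h ^ i)))
      \<le> (LINT y|half_line. ((\<bar>h\<bar> / R) ^ n * B0) * (exp (R * (y / (2 * T))) * cmod (modulated T u y)))"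
    unfolding remainder
  proof (rule order.trans[OF integral_norm_bound integral_mono])
    show "integrable half_line (\<lambda>y. cmod (of_real (bessel_kernel 0 ((x + h) * (y / (2 * T)))) * modulated T u y
          - (\<Sum>i<n. of_real (K i y) * modulated T u y * of_real (h ^ i))))"
      by (intro integrable_norm Bochner_Integration.integrable_diff integrable_kernel_modulated u
          Bochner_Integration.integrable_sum integrable_mult_left Ki)
    show "integrable half_line (\<lambda>y. ((\<bar>h\<bar> / R) ^ n * B0) * (exp (R * (y / (2 * T))) * cmod (modulated T u y)))"
      using T by (intro integrable_mult_right integrable_times_cmod_modulated u continuous_intros) auto
    fix y assume "y \<in> space half_line"
    then have y: "y > 0" by simp
    define s where "s = y / (2 * T)"
    have s: "s > 0" using y T by (simp add: s_def)
    have summand: "of_real (K i y) * modulated T u y * of_real (h ^ i)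
        = of_real (bessel_kernel i (x * s) / fact i * (h * s) ^ i) * modulated T u y" for i
    proof -
      have "K i y * h ^ i = bessel_kernel i (x * s) / fact i * (h * s) ^ i"
        unfolding K_def s_def[symmetric] power_mult_distrib by simp
      then have "of_real (K i y) * of_real (h ^ i) = complex_of_real (bessel_kernel i (x * s) / fact i * (h * s) ^ i)"
        by (metis of_real_mult)
      then show ?thesis by (metis mult.assoc mult.commute)
    qed
    have "of_real (bessel_kernel 0 ((x + h) * (y / (2 * T)))) * modulated T u y
          - (\<Sum>i<n. of_real (K i y) * modulated T u y * of_real (h ^ i))
        = of_real (bessel_kernel 0 (x * s + h * s) - (\<Sum>i<n. bessel_kernel i (x * s) / fact i * (h * s) ^ i)) * modulated T u y"
      unfolding summand s_def[symmetric] distrib_right[of x h s] of_real_diff of_real_sum left_diff_distrib sum_distrib_right ..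
    also have "cmod \<dots> \<le> (B0 * (\<bar>h * s\<bar> ^ n / fact n)) * cmod (modulated T u y)"
      unfolding norm_mult norm_of_real by (intro mult_right_mono bessel_kernel_taylor) auto
    also have "\<dots> \<le> (((\<bar>h\<bar> / R) ^ n * B0) * exp (R * s)) * cmod (modulated T u y)"
    proof (rule mult_right_mono)
      have "\<bar>h * s\<bar> ^ n / fact n = (\<bar>h\<bar> / R) ^ n * ((R * s) ^ n / fact n)"
        using R s by (simp add: abs_mult power_mult_distrib power_divide)
      also have "\<dots> \<le> (\<bar>h\<bar> / R) ^ n * exp (R * s)"
        using R s by (intro mult_left_mono power_div_fact_le_exp) auto
      finally have "B0 * (\<bar>h * s\<bar> ^ n / fact n) \<le> B0 * ((\<bar>h\<bar> / R) ^ n * exp (R * s))"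
        by (intro mult_left_mono B0_nonneg)
      then show "B0 * (\<bar>h * s\<bar> ^ n / fact n) \<le> ((\<bar>h\<bar> / R) ^ n * B0) * exp (R * s)"
        by (simp add: mult_ac)
    qed simp
    finally show "cmod (of_real (bessel_kernel 0 ((x + h) * (y / (2 * T)))) * modulated T u y
          - (\<Sum>i<n. of_real (K i y) * modulated T u y * of_real (h ^ i)))
        \<le> ((\<bar>h\<bar> / R) ^ n * B0) * (exp (R * (y / (2 * T))) * cmod (modulated T u y))"
      by (simp add: s_def mult.assoc)
  qed
  then show "cmod (amplitude T u (x + h) - (\<Sum>i<n. c i * of_real (h ^ i)))
    \<le> (\<bar>h\<bar> / R) ^ n * (B0 * exp_mass T R u)"
    unfolding integral_mult_right_zero exp_mass_def[symmetric] mult.assoc .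
qed

lemma amplitude_continuous:
  assumes u: "u \<in> Cc_inf" and T: "T > 0"
  shows "continuous_on S (amplitude T u)"
proof (rule continuous_at_imp_continuous_on, rule ballI)
  fix x
  obtain c where c: "\<And>n h. cmod (amplitude T u (x + h) - (\<Sum>i<n. c i * of_real (h ^ i)))
    \<le> (\<bar>h\<bar> / 1) ^ n * (B0 * exp_mass T 1 u)"
    using amplitude_taylor[OF u T, of 1 x] by auto
  have c0: "c 0 = amplitude T u x" using c[where n = 1 and h = 0] by simp
  have "((\<lambda>h. amplitude T u (x + h)) \<longlongrightarrow> amplitude T u x) (at 0)"
  proof (rule Lim_null[THEN iffD2], rule Lim_null_comparison)
    show "\<forall>\<^sub>F h in at 0. norm (amplitude T u (x + h) - amplitude T u x) \<le> \<bar>h\<bar> * (B0 * exp_mass T 1 u)"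
      using c[where n = 1] by (simp add: c0)
    have "((\<lambda>h. \<bar>h\<bar> * (B0 * exp_mass T 1 u)) \<longlongrightarrow> \<bar>0\<bar> * (B0 * exp_mass T 1 u)) (at 0)"
      by (intro tendsto_intros)
    then show "((\<lambda>h. \<bar>h\<bar> * (B0 * exp_mass T 1 u)) \<longlongrightarrow> 0) (at 0)" by simp
  qed
  then show "isCont (amplitude T u) x" by (simp add: isCont_iff)
qed

text \<open>The principal power is the one that combines with a power of
  \<open>z = a - \<i> / (4 T)\<close> to the power of \<open>1 + 4 \<i> a T\<close>; dividing by
  \<open>kernel_const\<close> undoes the factor of Weber's integral.\<close>

definition kernel_factor :: "real \<Rightarrow> complex" where
  "kernel_factor T = (4 * \<i> * of_real T) powr (- of_real (\<nu> + 1)) / kernel_const"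

definition represented :: "real \<Rightarrow> (real \<Rightarrow> complex) \<Rightarrow> real \<Rightarrow> complex" where
  "represented T u x = kernel_factor T * (of_real (x powr (\<nu> + 1/2)) * (exp (\<i> * of_real (x\<^sup>2 / (4 * T))) * amplitude T u x))"

text \<open>The Bessel kernel is bounded by \<open>B0\<close>, so the double integrand is dominated
  by a product of integrable functions. After the interchange the integral over \<open>x\<close> is
  Weber's integral.\<close>

lemma kernel_fubini:
  fixes z :: complex
  assumes u: "u \<in> Cc_inf" and T: "T > 0" and z: "Re z > 0"
  defines "P \<equiv> \<lambda>x. of_real (x powr (2 * \<nu> + 1)) * exp (- z * of_real (x\<^sup>2))"
  shows "integrable half_line (\<lambda>x. P x * amplitude T u x)"
    and "(LINT x|half_line. P x * amplitude T u x)
      = kernel_const * z powr (- of_real (\<nu> + 1)) *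
        (LINT y|half_line. exp (- of_real ((y / (2 * T))\<^sup>2) / (4 * z)) * modulated T u y)"
proof -
  interpret s: sigma_finite_measure half_line by (rule sigma_finite_half_line)
  interpret p: pair_sigma_finite half_line half_line by unfold_locales
  have P: "integrable half_line P"
    unfolding P_def using nu_nonneg z by (intro integrable_gaussian_moment_complex) auto
  have [measurable]: "P \<in> borel_measurable half_line" using P by auto
  have [measurable]: "modulated T u \<in> borel_measurable half_line"
    using integrable_times_modulated[OF u, of "\<lambda>_. 1" T] by auto
  have [measurable]: "(\<lambda>p. bessel_kernel 0 (fst p * (snd p / (2 * T)))) \<in> borel_measurable (half_line \<Otimes>\<^sub>M half_line)"
  proof -
    have [measurable]: "fst \<in> borel_measurable (half_line \<Otimes>\<^sub>M half_line)" "snd \<in> borel_measurable (half_line \<Otimes>\<^sub>M half_line)"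
      using measurable_compose[OF measurable_fst borel_measurable_half_line]
        measurable_compose[OF measurable_snd borel_measurable_half_line] by auto
    show ?thesis by measurable
  qed
  define F where "F = (\<lambda>p. P (fst p) * (of_real (bessel_kernel 0 (fst p * (snd p / (2 * T)))) * modulated T u (snd p)))"
  have Fm [measurable]: "F \<in> borel_measurable (half_line \<Otimes>\<^sub>M half_line)"
    unfolding F_def by measurable
  have i2: "integrable half_line (\<lambda>y. F (x, y))" for x
    unfolding F_def fst_conv snd_conv by (intro integrable_mult_right integrable_kernel_modulated u)
  define I where "I = (LINT y|half_line. cmod (modulated T u y))"
  have nF: "cmod (F (x, y)) \<le> cmod (P x) * (B0 * cmod (modulated T u y))" for x y
    unfolding F_def by (auto simp: norm_mult intro!: mult_left_mono mult_right_mono bessel_kernel_bounded)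
  have Fint: "integrable (half_line \<Otimes>\<^sub>M half_line) F"
  proof (rule p.Fubini_integrable[OF Fm])
    show "integrable half_line (\<lambda>x. LINT y|half_line. norm (F (x, y)))"
    proof (rule Bochner_Integration.integrable_bound)
      show "integrable half_line (\<lambda>x. cmod (P x) * (B0 * I))" using P by simp
      show "AE x in half_line. norm (LINT y|half_line. norm (F (x, y))) \<le> norm (cmod (P x) * (B0 * I))"
      proof (rule AE_I2)
        fix x
        have "(LINT y|half_line. norm (F (x, y))) \<le> (LINT y|half_line. cmod (P x) * (B0 * cmod (modulated T u y)))"
          using i2 nF integrable_cmod_modulated[OF u] by (intro integral_mono) auto
        also have "\<dots> = cmod (P x) * (B0 * I)" by (simp add: I_def)
        finally show "norm (LINT y|half_line. norm (F (x, y))) \<le> norm (cmod (P x) * (B0 * I))"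
          by (simp add: order.trans[OF _ abs_ge_self])
      qed
    qed measurable
  qed (use i2 in auto)
  have Fx: "(LINT y|half_line. F (x, y)) = P x * amplitude T u x" for x
    unfolding F_def amplitude_def by simp
  show "integrable half_line (\<lambda>x. P x * amplitude T u x)"
    using p.integrable_fst'[OF Fint] unfolding Fx .
  have "(LINT x|half_line. P x * amplitude T u x) = (LINT y|half_line. LINT x|half_line. F (x, y))"
    using p.Fubini_integral[of "\<lambda>x y. F (x, y)"] Fint unfolding Fx by simp
  also have "\<dots> = (LINT y|half_line. (kernel_const * z powr (- of_real (\<nu> + 1)) * exp (- of_real ((y / (2 * T))\<^sup>2) / (4 * z))) * modulated T u y)"
  proof (rule Bochner_Integration.integral_cong)
    fix y
    have "(LINT x|half_line. F (x, y)) = (LINT x|half_line. (P x * of_real (bessel_kernel 0 (y / (2 * T) * x))) * modulated T u y)"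
      by (simp add: F_def mult_ac)
    also have "\<dots> = (LINT x|half_line. P x * of_real (bessel_kernel 0 (y / (2 * T) * x))) * modulated T u y"
      by (rule integral_mult_left_zero)
    also have "(LINT x|half_line. P x * of_real (bessel_kernel 0 (y / (2 * T) * x)))
        = kernel_const * z powr (- of_real (\<nu> + 1)) * exp (- of_real ((y / (2 * T))\<^sup>2) / (4 * z))"
      unfolding P_def by (rule gaussian_bessel_integral[OF z])
    finally show "(LINT x|half_line. F (x, y))
        = (kernel_const * z powr (- of_real (\<nu> + 1)) * exp (- of_real ((y / (2 * T))\<^sup>2) / (4 * z))) * modulated T u y" .
  qed simp
  also have "\<dots> = kernel_const * z powr (- of_real (\<nu> + 1)) *
        (LINT y|half_line. exp (- of_real ((y / (2 * T))\<^sup>2) / (4 * z)) * modulated T u y)"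
    by (simp add: mult.assoc)
  finally show "(LINT x|half_line. P x * amplitude T u x) = \<dots>" .
qed

text \<open>The evolution is moved to the Gaussian, where it is explicit: transform, multiply by the
  conjugate phase, transform back. The outcome is again a Gaussian, whose conjugated parameter is
  \<open>a / (1 + 4 \<i> a T)\<close>.\<close>

lemma cinner_propagator_G:
  assumes u: "u \<in> L2" and a: "a > 0"
  shows "cinner (propagator T (cls u)) (G (of_real a))
    = (1 + 4 * \<i> * of_real (a * T)) powr (- of_real (\<nu> + 1)) *
      (LINT y|half_line. u y * (of_real (y powr (\<nu> + 1/2)) * exp (- (of_real a / (1 + 4 * \<i> * of_real (a * T))) * of_real (y\<^sup>2))))"
proof -
  define e where "e = - complex_of_real (\<nu> + 1)"
  define w where "w = 1 + 4 * \<i> * of_real (a * T)"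
  \<comment> \<open>The parameter after transforming the Gaussian of parameter \<open>a\<close> and
    applying the conjugate phase; its real part stays positive.\<close>
  define \<beta> where "\<beta> = of_real (1 / (4 * a)) - \<i> * of_real T"
  have \<beta>: "Re \<beta> > 0" using a by (simp add: \<beta>_def)
  have \<beta>0: "\<beta> \<noteq> 0" using \<beta> by auto
  have b4: "4 * of_real a * \<beta> = cnj w" using a by (simp add: \<beta>_def w_def field_simps)
  have w0: "w \<noteq> 0" "Re w > 0" by (auto simp: w_def complex_eq_iff)
  have inv: "cnj (1 / (4 * \<beta>)) = of_real a / w"
  proof -
    have "4 * of_real a * cnj \<beta> = w" using b4 by (metis complex_cnj_cnj complex_cnj_mult complex_cnj_complex_of_real complex_cnj_numeral)
    then show ?thesis using \<beta>0 w0 a by (simp add: field_simps)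
  qed
  have ph: "cnj (phase T k) * gs (of_real (1 / (4 * a))) k = gs \<beta> k" for k
    by (simp add: phase_def gs_def \<beta>_def exp_cnj exp_add[symmetric] algebra_simps flip: exp_of_real)
  have bm: "bounded_mult (\<lambda>k. cnj (phase T k))"
    by (rule bounded_multI[where B = 1]) auto
  have Ga: "Re (of_real (1 / (4 * a))) > 0" using a by simp
  have "cinner (propagator T (cls u)) (G (of_real a)) = cinner (mult_op (phase T) (hankel (cls u))) (HG (of_real a))"
    unfolding propagator_def cinner_hankel_left hankel_G_real[OF a] ..
  also have "\<dots> = cinner (hankel (cls u)) (mult_op (\<lambda>k. cnj (phase T k)) (HG (of_real a)))"
    by (rule cinner_mult_op[OF bounded_mult_phase])
  also have "mult_op (\<lambda>k. cnj (phase T k)) (HG (of_real a)) = hpow (of_real a) *\<^sub>c G \<beta>"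
  proof -
    have "mult_op (\<lambda>k. cnj (phase T k)) (G (of_real (1 / (4 * a)))) = G \<beta>"
      unfolding mult_op_cls[OF bm gs_L2[OF Ga]] ph ..
    then show ?thesis by (simp add: HG_def mult_op_cscale[OF bm])
  qed
  also have "cinner (hankel (cls u)) (hpow (of_real a) *\<^sub>c G \<beta>) = cinner (cls u) ((hpow (of_real a) * hpow \<beta>) *\<^sub>c G (1 / (4 * \<beta>)))"
    by (simp add: cinner_hankel_left hankel_cscale hankel_G[OF \<beta>] HG_def cscale_cscale)
  also have "\<dots> = cnj (hpow (of_real a) * hpow \<beta>) * L2_inner u (gs (1 / (4 * \<beta>)))"
    unfolding cinner_cscale_right cinner_cls[OF u gs_L2[OF Re_inverse_pos[OF \<beta>]]] ..
  also have "cnj (hpow (of_real a) * hpow \<beta>) = w powr e"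
  proof -
    have "hpow (of_real a) * hpow \<beta> = (of_real (2 * a) * (2 * \<beta>)) powr e"
      unfolding hpow_def e_def using a by (subst powr_of_real_mult_complex) auto
    also have "of_real (2 * a) * (2 * \<beta>) = cnj w" using b4 by (simp add: mult.assoc)
    also have "cnj w powr e = cnj (w powr e)"
      using w0 by (subst cnj_powr) (auto simp: e_def)
    finally show ?thesis by simp
  qed
  also have "L2_inner u (gs (1 / (4 * \<beta>))) = (LINT y|half_line. u y * (of_real (y powr (\<nu> + 1/2)) * exp (- (of_real a / w) * of_real (y\<^sup>2))))"
    unfolding L2_inner_def inv[symmetric] by (simp add: gs_def exp_cnj)
  finally show ?thesis by (simp only: w_def e_def)
qed

lemma mult_rearrange: "a * b = c \<Longrightarrow> a * (p * (b * v)) = v * (p * (c::complex))"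
  by (auto simp: mult_ac)

text \<open>Weber's integral reduces the pairing to an integral over \<open>y\<close>; combining its
  exponent with the phase of \<open>modulated\<close> gives \<open>- (a / w) y^2\<close> with
  \<open>w = 1 + 4 \<i> a T\<close>, exactly as for the propagator.\<close>

lemma cinner_represented_G:
  assumes u: "u \<in> Cc_inf" and T: "T > 0" and a: "a > 0"
  shows "integrable half_line (\<lambda>x. represented T u x * gs (of_real a) x)"
    and "(LINT x|half_line. represented T u x * gs (of_real a) x) = cinner (propagator T (cls u)) (G (of_real a))"
proof -
  define e where "e = - complex_of_real (\<nu> + 1)"
  define w where "w = 1 + 4 * \<i> * of_real (a * T)"
  \<comment> \<open>The phase of the propagator kernel in \<open>x\<close> is absorbed into the test
    Gaussian as an imaginary part of its parameter; the key relation is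
    \<open>z * (4 \<i> T) = w\<close>.\<close>
  define z where "z = of_real a - \<i> / (4 * of_real T)"
  have z: "Re z > 0" using a by (simp add: z_def)
  have z0: "z \<noteq> 0" using z by auto
  have zT: "z * (4 * \<i> * of_real T) = w" using T by (simp add: z_def w_def field_simps)
  have w0: "w \<noteq> 0" by (auto simp: w_def complex_eq_iff)
  have eq: "represented T u x * gs (of_real a) x
      = kernel_factor T * ((of_real (x powr (2 * \<nu> + 1)) * exp (- z * of_real (x\<^sup>2))) * amplitude T u x)" for x
  proof -
    have "x powr (2 * \<nu> + 1) = x powr (\<nu> + 1/2) * x powr (\<nu> + 1/2)" by (simp flip: powr_add)
    moreover have "exp (- z * of_real (x\<^sup>2)) = exp (\<i> * of_real (x\<^sup>2 / (4 * T))) * exp (- of_real a * of_real (x\<^sup>2))"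
      by (simp add: z_def exp_add[symmetric] algebra_simps)
    ultimately show ?thesis by (simp add: represented_def gs_def mult_ac)
  qed
  show "integrable half_line (\<lambda>x. represented T u x * gs (of_real a) x)"
    unfolding eq by (intro integrable_mult_right kernel_fubini u T z)
  have kc: "complex_of_real kernel_const \<noteq> 0" using kernel_const_pos by simp
  have "(LINT x|half_line. represented T u x * gs (of_real a) x)
      = kernel_factor T * (kernel_const * z powr e *
        (LINT y|half_line. exp (- of_real ((y / (2 * T))\<^sup>2) / (4 * z)) * modulated T u y))"
    unfolding eq integral_mult_right_zero kernel_fubini(2)[OF u T z] e_def ..
  also have "\<dots> = (z powr e * (4 * \<i> * of_real T) powr e) *
        (LINT y|half_line. exp (- of_real ((y / (2 * T))\<^sup>2) / (4 * z)) * modulated T u y)"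
    using kc by (simp add: kernel_factor_def e_def)
  also have "z powr e * (4 * \<i> * of_real T) powr e = w powr e"
    using z T by (subst powr_mult_right_half_plane[symmetric]) (auto simp: zT)
  also have "(LINT y|half_line. exp (- of_real ((y / (2 * T))\<^sup>2) / (4 * z)) * modulated T u y)
     = (LINT y|half_line. u y * (of_real (y powr (\<nu> + 1/2)) * exp (- (of_real a / w) * of_real (y\<^sup>2))))"
  proof (rule Bochner_Integration.integral_cong)
    fix y
    have "- of_real ((y / (2 * T))\<^sup>2) / (4 * z) + \<i> * of_real (y\<^sup>2 / (4 * T)) = - (of_real a / w) * of_real (y\<^sup>2)"
    proof -
      have zz: "z = w / (4 * \<i> * of_real T)" using zT T by (simp add: field_simps)
      have "- of_real ((y / (2 * T))\<^sup>2) / (4 * z) = - (\<i> / (4 * of_real T * w)) * of_real (y\<^sup>2)"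
        unfolding zz using T w0 by (simp add: field_simps power2_eq_square)
      moreover have "- (\<i> / (4 * of_real T * w)) + \<i> / (4 * of_real T) = - (of_real a / w)"
      proof -
        have "- (\<i> / (4 * of_real T * w)) + \<i> / (4 * of_real T) = \<i> * (w - 1) / (4 * of_real T * w)"
          using T w0 by (simp add: field_simps)
        also have "\<i> * (w - 1) = - (4 * of_real T * of_real a)" by (simp add: w_def)
        finally show ?thesis using T w0 by simp
      qed
      moreover have "\<i> * of_real (y\<^sup>2 / (4 * T)) = (\<i> / (4 * of_real T)) * of_real (y\<^sup>2)" by simp
      ultimately show ?thesis by (metis distrib_right)
    qed
    then have "exp (- of_real ((y / (2 * T))\<^sup>2) / (4 * z)) * exp (\<i> * of_real (y\<^sup>2 / (4 * T)))
        = exp (- (of_real a / w) * of_real (y\<^sup>2))" by (simp only: exp_add[symmetric])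
    then show "exp (- of_real ((y / (2 * T))\<^sup>2) / (4 * z)) * modulated T u y
        = u y * (of_real (y powr (\<nu> + 1/2)) * exp (- (of_real a / w) * of_real (y\<^sup>2)))"
      unfolding modulated_def by (rule mult_rearrange)
  qed simp
  also have "w powr e * \<dots> = cinner (propagator T (cls u)) (G (of_real a))"
    unfolding cinner_propagator_G[OF Cc_inf_L2[OF u] a] w_def e_def ..
  finally show "(LINT x|half_line. represented T u x * gs (of_real a) x) = cinner (propagator T (cls u)) (G (of_real a))" .
qed

lemma schroedinger_solution_represented:
  assumes u: "u \<in> Cc_inf" and T: "T > 0"
  shows "AE x in half_line. schroedinger_solution \<nu> x T u = represented T u x"
proof -
  define D where "D x = rep (propagator T (cls u)) x - represented T u x" for x
  have "AE x in half_line. D x = 0"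
  proof (rule gs_total)
    fix a :: real assume a: "a > 0"
    have i: "integrable half_line (\<lambda>x. rep (propagator T (cls u)) x * gs (of_real a) x)"
      by (intro gs_mult_integrable rep_L2 a)
    note r = cinner_represented_G[OF u T a]
    show "integrable half_line (\<lambda>x. D x * gs (of_real a) x)"
      unfolding D_def left_diff_distrib by (intro Bochner_Integration.integrable_diff i r)
    show "(LINT x|half_line. D x * gs (of_real a) x) = 0"
      unfolding D_def left_diff_distrib Bochner_Integration.integral_diff[OF i r(1)] r(2) cinner_G_real[OF a]
      by simp
  qed
  then show ?thesis
    using schroedinger_solution_propagator[OF u, of T] by eventually_elim (simp add: D_def)
qed

lemma cmod_kernel_factor: "T > 0 \<Longrightarrow> cmod (kernel_factor T) = (4 * T) powr (- (\<nu> + 1)) / kernel_const"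
proof -
  assume T: "T > 0"
  define w where "w = 4 * \<i> * complex_of_real T"
  have w: "w \<noteq> 0" "cmod w = 4 * T" using T by (auto simp: w_def norm_mult)
  have "cmod (w powr (- of_real (\<nu> + 1))) = exp (Re (- of_real (\<nu> + 1) * Ln w))"
    using w by (simp add: powr_def)
  also have "Re (- of_real (\<nu> + 1) * Ln w) = - (\<nu> + 1) * ln (4 * T)"
    using w by simp
  finally have "cmod (w powr (- of_real (\<nu> + 1))) = (4 * T) powr (- (\<nu> + 1))"
    using T by (simp add: powr_def)
  then show ?thesis using kernel_const_pos unfolding kernel_factor_def w_def[symmetric] by (simp add: norm_divide)
qed

lemma
  assumes l: "l > 0"
  shows integrable_exponential_moment: "integrable half_line (\<lambda>y. y powr (2 * \<nu> + 1) * exp (- l * y))"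
    and exponential_moment: "(LINT y|half_line. y powr (2 * \<nu> + 1) * exp (- l * y)) = Gamma (2 * \<nu> + 2) * l powr (- (2 * \<nu> + 2))"
proof -
  define f :: "real \<Rightarrow> real" where "f t = t powr (2 * \<nu> + 1) / exp t" for t
  have "(f has_integral Gamma (2 * \<nu> + 2)) {0..}"
  proof -
    have "2 * \<nu> + 2 - 1 = 2 * \<nu> + 1" by simp
    then show ?thesis
      using Gamma_integral_real[of "2 * \<nu> + 2"] nu_nonneg unfolding f_def[abs_def] by (simp only:)
  qed
  moreover have "(f has_integral Gamma (2 * \<nu> + 2)) {0..} \<longleftrightarrow> (f has_integral Gamma (2 * \<nu> + 2)) {0<..}"
    by (intro has_integral_spike_set_eq; rule negligible_subset[of "{0}"]) auto
  ultimately have hi: "(f has_integral Gamma (2 * \<nu> + 2)) {0<..}" by simp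
  have "(f absolutely_integrable_on {0<..})"
    by (rule nonnegative_absolutely_integrable_1) (use hi in \<open>auto simp: f_def has_integral_iff\<close>)
  moreover have "(\<lambda>x. l * x) ` {0<..} = {0<..}"
  proof (intro equalityI subsetI)
    fix y :: real assume "y \<in> {0<..}"
    then show "y \<in> (\<lambda>x. l * x) ` {0<..}"
      using l by (intro image_eqI[of _ _ "y / l"]) auto
  qed (use l in auto)
  ultimately have fint: "f absolutely_integrable_on (\<lambda>x. l * x) ` {0<..} \<and>
      integral ((\<lambda>x. l * x) ` {0<..}) f = Gamma (2 * \<nu> + 2)"
    using hi by (simp add: integral_unique)
  have "(\<lambda>x. \<bar>l\<bar> * f (l * x)) absolutely_integrable_on {0<..} \<and>
      integral {0<..} (\<lambda>x. \<bar>l\<bar> * f (l * x)) = Gamma (2 * \<nu> + 2)"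
  proof (subst has_absolute_integral_change_of_variables_1'[where g = "\<lambda>x. l * x"])
    show "((\<lambda>x. l * x) has_real_derivative l) (at x within {0<..})" for x
      by (auto intro!: derivative_eq_intros)
    show "inj_on (\<lambda>x. l * x) {0<..}" using l by (auto intro!: inj_onI)
  qed (use fint in auto)
  then have 1: "integrable half_line (\<lambda>x. \<bar>l\<bar> * f (l * x))"
      and 2: "(LINT x|half_line. \<bar>l\<bar> * f (l * x)) = Gamma (2 * \<nu> + 2)"
    using lebesgue_integral_eq_integral[OF absolutely_integrable_imp_integrable, of "{0<..}" "\<lambda>x. \<bar>l\<bar> * f (l * x)"]
    by (auto intro: absolutely_integrable_imp_integrable)
  have eq: "\<bar>l\<bar> * f (l * x) = l powr (2 * \<nu> + 2) * (x powr (2 * \<nu> + 1) * exp (- l * x))" if "x > 0" for x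
  proof -
    have "l powr (2 * \<nu> + 2) = l * l powr (2 * \<nu> + 1)"
      using l powr_add[of l 1 "2 * \<nu> + 1"] by (simp add: add.commute)
    then show ?thesis using that l by (simp add: f_def powr_mult exp_minus divide_inverse)
  qed
  have "integrable half_line (\<lambda>x. l powr (2 * \<nu> + 2) * (x powr (2 * \<nu> + 1) * exp (- l * x)))"
    using 1 by (rule Bochner_Integration.integrable_cong[THEN iffD1, rotated -1]) (auto simp: eq)
  then show "integrable half_line (\<lambda>y. y powr (2 * \<nu> + 1) * exp (- l * y))" using l by simp
  have "l powr (2 * \<nu> + 2) * (LINT x|half_line. x powr (2 * \<nu> + 1) * exp (- l * x)) = Gamma (2 * \<nu> + 2)"
    unfolding 2[symmetric] integral_mult_right_zero[symmetric]
    by (rule Bochner_Integration.integral_cong) (auto simp: eq)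
  then show "(LINT y|half_line. y powr (2 * \<nu> + 1) * exp (- l * y)) = Gamma (2 * \<nu> + 2) * l powr (- (2 * \<nu> + 2))"
    using l unfolding powr_minus_divide[of l "2 * \<nu> + 2"] by (simp add: field_simps)
qed

text \<open>For \<open>R \<le> l * T / 2\<close> the weight is at most
  \<open>exp (l / 4 * y)\<close>, which is written as
  \<open>exp (- (l / 4) * y) * exp (l / 2 * y)\<close>. By Cauchy-Schwarz the growing factor goes to
  the data, and the decaying one keeps \<open>y powr (\<nu> + 1/2)\<close> square
  integrable.\<close>

lemma exp_mass_le:
  assumes u: "u \<in> Cc_inf" and T: "T > 0" and l: "l > 0" and R: "R \<le> l * T / 2"
  shows "(exp_mass T R u)\<^sup>2 \<le> Gamma (2 * \<nu> + 2) * (l / 2) powr (- (2 * \<nu> + 2)) *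
    (LINT y|half_line. exp (l * y) * (cmod (u y))\<^sup>2)"
proof -
  define f g where "f y = complex_of_real (y powr (\<nu> + 1/2) * exp (- (l / 4) * y))"
    and "g y = complex_of_real (exp (l / 2 * y) * cmod (u y))" for y
  have ff: "(cmod (f y))\<^sup>2 = y powr (2 * \<nu> + 1) * exp (- (l / 2) * y)" for y
  proof -
    have "y powr (2 * \<nu> + 1) = (y powr (\<nu> + 1/2))\<^sup>2" by (simp add: power2_eq_square flip: powr_add)
    moreover have "exp (- (l / 2) * y) = (exp (- (l / 4) * y))\<^sup>2"
      by (simp add: power2_eq_square flip: exp_add)
    ultimately show ?thesis unfolding f_def norm_of_real power2_abs by (simp add: power_mult_distrib)
  qed
  have gg: "(cmod (g y))\<^sup>2 = exp (l * y) * (cmod (u y))\<^sup>2" for y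
  proof -
    have "exp (l * y) = (exp (l / 2 * y))\<^sup>2" by (simp add: power2_eq_square flip: exp_add)
    then show ?thesis unfolding g_def norm_of_real power2_abs by (simp add: power_mult_distrib)
  qed
  have f: "f \<in> L2"
  proof (rule L2I)
    have "continuous_on {0<..} f" unfolding f_def by (intro continuous_intros) auto
    then show "f \<in> borel_measurable half_line" by (intro continuous_imp_measurable_on_sets_lebesgue) auto
    show "integrable half_line (\<lambda>x. (cmod (f x))\<^sup>2)" unfolding ff using l by (intro integrable_exponential_moment) simp
  qed
  have g: "g \<in> L2"
  proof -
    obtain a b where ab: "0 < a" "a < b" "\<And>x. x \<notin> {a<..<b} \<Longrightarrow> u x = 0"
      using Cc_inf_support[OF u] by blast
    show ?thesis
      unfolding g_def using ab by (intro L2_compact_support[of a _ b] continuous_intros Cc_inf_continuous u) auto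
  qed
  have lf: "(norm (cls f))\<^sup>2 = Gamma (2 * \<nu> + 2) * (l / 2) powr (- (2 * \<nu> + 2))"
    unfolding norm_cls[OF f f] L2_norm_def ff using exponential_moment[of "l / 2"] l nu_nonneg
    by (simp add: Gamma_real_pos less_imp_le)
  have lg: "(norm (cls g))\<^sup>2 = (LINT y|half_line. exp (l * y) * (cmod (u y))\<^sup>2)"
    unfolding norm_cls[OF g g] L2_norm_def gg by (simp add: Bochner_Integration.integral_nonneg)
  have fg: "f y * cnj (g y) = of_real (exp (l / 4 * y) * (y powr (\<nu> + 1/2) * cmod (u y)))" for y
  proof -
    have "exp (l / 4 * y) = exp (- (l / 4) * y) * exp (l / 2 * y)" by (simp flip: exp_add)
    then show ?thesis by (simp add: f_def g_def mult_ac)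
  qed
  have "exp_mass T R u \<le> (LINT y|half_line. exp (l / 4 * y) * (y powr (\<nu> + 1/2) * cmod (u y)))"
    unfolding exp_mass_def
  proof (rule integral_mono)
    show "integrable half_line (\<lambda>y. exp (R * (y / (2 * T))) * cmod (modulated T u y))"
      using T by (intro integrable_times_cmod_modulated u continuous_intros) auto
    have "integrable half_line (\<lambda>y. norm (f y * cnj (g y)))" by (intro integrable_norm L2_inner_integrable f g)
    then show "integrable half_line (\<lambda>y. exp (l / 4 * y) * (y powr (\<nu> + 1/2) * cmod (u y)))"
      unfolding fg norm_of_real by (simp add: abs_mult)
    fix y assume "y \<in> space half_line"
    then have y: "y > 0" by simp
    have "R * (y / (2 * T)) \<le> l * T / 2 * (y / (2 * T))" using R y T by (intro mult_right_mono) auto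
    also have "\<dots> = l / 4 * y" using T by simp
    finally show "exp (R * (y / (2 * T))) * cmod (modulated T u y) \<le> exp (l / 4 * y) * (y powr (\<nu> + 1/2) * cmod (u y))"
      unfolding cmod_modulated[OF y] by (intro mult_right_mono) auto
  qed
  also have "\<dots> = cmod (cinner (cls f) (cls g))"
    unfolding cinner_cls[OF f g] L2_inner_def fg integral_complex_of_real norm_of_real
    by (intro abs_of_nonneg[symmetric] Bochner_Integration.integral_nonneg) auto
  also have "\<dots> \<le> norm (cls f) * norm (cls g)" by (rule norm_cinner_le)
  finally have "(exp_mass T R u)\<^sup>2 \<le> (norm (cls f) * norm (cls g))\<^sup>2"
    by (intro power_mono exp_mass_nonneg)
  then show ?thesis unfolding power_mult_distrib lf lg .
qed

end

section \<open>Propagation of smallness\<close>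

lemma lagrange_interpolation:
  fixes P :: "'a::field poly"
  assumes deg: "degree P \<le> m" and inj: "inj_on t {..m}"
  shows "poly P x = (\<Sum>j\<le>m. poly P (t j) * (\<Prod>k\<in>{..m} - {j}. (x - t k) / (t j - t k)))"
proof -
  define L where "L j = (\<Prod>k\<in>{..m} - {j}. smult (1 / (t j - t k)) [:- t k, 1:])" for j
  define Q where "Q = (\<Sum>j\<le>m. smult (poly P (t j)) (L j))"
  have L: "poly (L j) y = (\<Prod>k\<in>{..m} - {j}. (y - t k) / (t j - t k))" for j y
    by (simp add: L_def poly_prod diff_divide_distrib)
  have degL: "degree (L j) \<le> m" if "j \<le> m" for j
  proof -
    have "degree (L j) \<le> (\<Sum>k\<in>{..m} - {j}. 1)"
      unfolding L_def
      by (rule order.trans[OF degree_prod_sum_le sum_mono]) (auto simp: degree_pCons_eq_if intro: order.trans[OF degree_smult_le])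
    also have "\<dots> = m" using that by simp
    finally show ?thesis .
  qed
  have delta: "poly (L j) (t i) = (if i = j then 1 else 0)" if "i \<le> m" "j \<le> m" for i j
  proof (cases "i = j")
    case True
    have "t j \<noteq> t k" if "k \<in> {..m} - {j}" for k
      using inj that \<open>j \<le> m\<close> by (auto simp: inj_on_def)
    then show ?thesis unfolding L using True by (intro trans[OF prod.neutral]) auto
  next
    case False
    then show ?thesis unfolding L using that by (auto intro!: prod_zero)
  qed
  have "P = Q"
  proof (rule poly_eqI_degree)
    show "poly P y = poly Q y" if "y \<in> t ` {..m}" for y
      using that by (auto simp: Q_def poly_sum delta if_distrib cong: if_cong)
    show "degree P < card (t ` {..m})" using deg by (simp add: card_image inj)
    have "degree Q \<le> m"
      unfolding Q_def by (rule degree_sum_le) (auto intro: order.trans[OF degree_smult_le] degL)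
    then show "degree Q < card (t ` {..m})" by (simp add: card_image inj)
  qed
  then have "poly P x = poly Q x" by simp
  also have "\<dots> = (\<Sum>j\<le>m. poly P (t j) * (\<Prod>k\<in>{..m} - {j}. (x - t k) / (t j - t k)))"
    by (simp add: Q_def poly_sum L)
  finally show ?thesis .
qed

lemma prod_dist_nat:
  assumes "j \<le> m"
  shows "(\<Prod>k\<in>{..m} - {j}. \<bar>real j - real k\<bar>) = fact j * fact (m - j)"
proof -
  have "(\<Prod>k\<in>{..m} - {j}. \<bar>real j - real k\<bar>) = (\<Prod>k\<in>{..<j} \<union> {j<..m}. \<bar>real j - real k\<bar>)"
    using assms by (intro prod.cong) auto
  also have "\<dots> = (\<Prod>k<j. \<bar>real j - real k\<bar>) * (\<Prod>k\<in>{j<..m}. \<bar>real j - real k\<bar>)"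
    by (intro prod.union_disjoint) auto
  also have "(\<Prod>k<j. \<bar>real j - real k\<bar>) = fact j"
    unfolding fact_prod_rev of_nat_prod atLeast0LessThan by (intro prod.cong) (auto simp: of_nat_diff)
  also have "(\<Prod>k\<in>{j<..m}. \<bar>real j - real k\<bar>) = fact (m - j)"
    using assms
  proof (induction m rule: dec_induct)
    case (step m)
    have "{j<..Suc m} = insert (Suc m) {j<..m}" using step.hyps by auto
    then show ?case using step by (simp add: Suc_diff_le)
  qed simp
  finally show ?thesis .
qed

text \<open>Separation bounds the denominators by those of the equidistant nodes, whose products are
  \<open>fact j * fact (m - j)\<close>; summing their reciprocals over j gives
  \<open>2 ^ m / fact m\<close> by the binomial theorem.\<close>

lemma lebesgue_constant_separated:
  fixes t :: "nat \<Rightarrow> real"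
  assumes sep: "\<And>j k. j \<le> m \<Longrightarrow> k \<le> m \<Longrightarrow> \<bar>real j - real k\<bar> * \<delta> \<le> \<bar>t j - t k\<bar>" and \<delta>: "\<delta> > 0"
    and x: "\<And>k. k \<le> m \<Longrightarrow> \<bar>x - t k\<bar> \<le> L"
  shows "(\<Sum>j\<le>m. \<Prod>k\<in>{..m} - {j}. \<bar>x - t k\<bar> / \<bar>t j - t k\<bar>) \<le> (2 * L / \<delta>) ^ m / fact m"
proof -
  have L: "L \<ge> 0" using x[of 0] by simp
  have "(\<Prod>k\<in>{..m} - {j}. \<bar>x - t k\<bar> / \<bar>t j - t k\<bar>) \<le> (L / \<delta>) ^ m / fact m * real (m choose j)" if j: "j \<le> m" for j
  proof -
    have "(\<Prod>k\<in>{..m} - {j}. \<bar>x - t k\<bar> / \<bar>t j - t k\<bar>) \<le> (\<Prod>k\<in>{..m} - {j}. L / (\<bar>real j - real k\<bar> * \<delta>))"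
      using sep \<delta> j x L by (intro prod_mono conjI frac_le) auto
    also have "\<dots> = (\<Prod>k\<in>{..m} - {j}. (L / \<delta>) / \<bar>real j - real k\<bar>)"
      by (simp add: mult.commute)
    also have "\<dots> = (L / \<delta>) ^ m / (fact j * fact (m - j))"
      unfolding prod_dividef prod_dist_nat[OF j] using j by (simp add: power_divide)
    also have "\<dots> = (L / \<delta>) ^ m / fact m * real (m choose j)"
      by (simp add: binomial_fact[OF j])
    finally show ?thesis .
  qed
  then have "(\<Sum>j\<le>m. \<Prod>k\<in>{..m} - {j}. \<bar>x - t k\<bar> / \<bar>t j - t k\<bar>) \<le> (\<Sum>j\<le>m. (L / \<delta>) ^ m / fact m * real (m choose j))"
    by (intro sum_mono) auto
  also have "\<dots> = (L / \<delta>) ^ m / fact m * real (\<Sum>j\<le>m. m choose j)"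
    by (simp add: sum_distrib_left)
  also have "\<dots> = (2 * L / \<delta>) ^ m / fact m"
    unfolding choose_row_sum by (simp add: power_mult_distrib power_divide)
  finally show ?thesis .
qed

text \<open>Quantitative real analyticity with radius and bound uniform in the centre. The
  coefficients are fixed before \<open>n\<close> and \<open>h\<close>; the case \<open>n = 0\<close>
  is the bound of \<open>f\<close> by \<open>M\<close>.\<close>

definition taylor_bound :: "(real \<Rightarrow> complex) \<Rightarrow> real \<Rightarrow> real \<Rightarrow> bool" where
  "taylor_bound f R M \<longleftrightarrow>
    (\<forall>x. \<exists>c. \<forall>n h. cmod (f (x + h) - (\<Sum>i<n. c i * of_real (h ^ i))) \<le> (\<bar>h\<bar> / R) ^ n * M)"

lemma taylor_bound_le: "taylor_bound f R M \<Longrightarrow> cmod (f x) \<le> M"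
proof -
  assume "taylor_bound f R M"
  then obtain c where "\<forall>n h. cmod (f (x + h) - (\<Sum>i<n. c i * of_real (h ^ i))) \<le> (\<bar>h\<bar> / R) ^ n * M"
    unfolding taylor_bound_def by blast
  from spec[OF spec[OF this, of 0], of 0] show ?thesis by simp
qed

lemma exists_le_mean:
  fixes g :: "real \<Rightarrow> real"
  assumes g: "continuous_on UNIV g" "\<And>x. g x \<ge> 0" and ab: "s \<le> \<alpha>" "\<alpha> < \<beta>" "\<beta> \<le> r"
  obtains y where "y \<in> {\<alpha>..\<beta>}" "g y * (\<beta> - \<alpha>) \<le> integral {s..r} g"
proof -
  have gi: "g integrable_on {a..b}" for a b
    by (intro integrable_continuous_real continuous_on_subset[OF g(1)]) auto
  obtain y where y: "y \<in> {\<alpha>..\<beta>}" "\<And>x. x \<in> {\<alpha>..\<beta>} \<Longrightarrow> g y \<le> g x"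
    using continuous_attains_inf[of "{\<alpha>..\<beta>}" g] continuous_on_subset[OF g(1)] ab by force
  have "g y * (\<beta> - \<alpha>) = integral {\<alpha>..\<beta>} (\<lambda>_. g y)"
    using ab by simp
  also have "\<dots> \<le> integral {\<alpha>..\<beta>} g"
    by (intro integral_le gi) (auto simp: y)
  also have "\<dots> \<le> integral {s..r} g"
    using ab g(2) by (intro integral_subset_le gi) auto
  finally show thesis using that y(1) by blast
qed

text \<open>The nodes of the interpolation are points of the even ones among \<open>2 * n\<close> equal pieces of the interval.\<close>

lemma taylor_bound_remez:
  assumes f: "taylor_bound f R M" "continuous_on UNIV f" and R: "R > 0" and l: "l > 0" and e: "\<epsilon> \<ge> 0"
    and int: "integral {s..s + l} (\<lambda>x. (cmod (f x))\<^sup>2) \<le> \<epsilon>\<^sup>2 * l"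
    and x: "x \<in> {s - l..s + 2 * l}"
  shows "cmod (f x) \<le> 48 ^ n * \<epsilon> + (24 ^ n + 1) * ((2 * l / R) ^ n * M)"
proof (cases n)
  case 0
  moreover have "M \<ge> 0" using order.trans[OF norm_ge_zero taylor_bound_le[OF f(1)]] .
  ultimately show ?thesis using taylor_bound_le[OF f(1), of x] e by simp
next
  case (Suc m)
  define \<delta> where "\<delta> = l / (2 * real n)"
  have n: "real n \<ge> 1" using Suc by simp
  have \<delta>: "\<delta> > 0" and l\<delta>: "l = 2 * real n * \<delta>" using l n by (auto simp: \<delta>_def)
  define q where "q = (2 * l / R) ^ n * M"
  have M: "M \<ge> 0" using order.trans[OF norm_ge_zero taylor_bound_le[OF f(1)]] .
  have "\<exists>y. y \<in> {s + 2 * real j * \<delta>..s + (2 * real j + 1) * \<delta>} \<and> cmod (f y) \<le> 2 ^ n * \<epsilon>" if j: "j \<le> m" for j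
  proof -
    have jn: "(2 * real j + 1) * \<delta> \<le> 2 * real n * \<delta>"
      using j Suc \<delta> by (intro mult_right_mono) auto
    obtain y where y: "y \<in> {s + 2 * real j * \<delta>..s + (2 * real j + 1) * \<delta>}"
      "(cmod (f y))\<^sup>2 * (s + (2 * real j + 1) * \<delta> - (s + 2 * real j * \<delta>)) \<le> integral {s..s + l} (\<lambda>x. (cmod (f x))\<^sup>2)"
    proof (rule exists_le_mean[of "\<lambda>x. (cmod (f x))\<^sup>2" s "s + 2 * real j * \<delta>" "s + (2 * real j + 1) * \<delta>" "s + l"])
      show "continuous_on UNIV (\<lambda>x. (cmod (f x))\<^sup>2)" by (intro continuous_intros f)
      show "s \<le> s + 2 * real j * \<delta>" "s + 2 * real j * \<delta> < s + (2 * real j + 1) * \<delta>"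
        using \<delta> by (auto simp: distrib_right)
      show "s + (2 * real j + 1) * \<delta> \<le> s + l" using jn l\<delta> by simp
    qed auto
    have "(cmod (f y))\<^sup>2 * \<delta> = (cmod (f y))\<^sup>2 * (s + (2 * real j + 1) * \<delta> - (s + 2 * real j * \<delta>))"
      by (simp add: distrib_right)
    also have "\<dots> \<le> (\<epsilon>\<^sup>2 * (2 * real n)) * \<delta>"
      using order.trans[OF y(2) int] by (subst (asm) l\<delta>) (simp add: mult.assoc)
    finally have "(cmod (f y))\<^sup>2 \<le> \<epsilon>\<^sup>2 * (2 * real n)" using \<delta> by simp
    \<comment> \<open>Restricting the mean to a piece of length \<open>\<delta>\<close> costs the
      factor \<open>2 n\<close>, which is absorbed into \<open>4 ^ n\<close>.\<close>
    also have "\<dots> \<le> \<epsilon>\<^sup>2 * (2 ^ n * 2 ^ n)"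
    proof (intro mult_left_mono mult_mono)
      show "(2::real) \<le> 2 ^ n" using Suc by simp
      show "real n \<le> 2 ^ n" using of_nat_less_two_power[of n, where ?'a = real] by simp
    qed auto
    also have "\<dots> = (2 ^ n * \<epsilon>)\<^sup>2" by (simp add: power2_eq_square mult_ac)
    finally have "cmod (f y) \<le> 2 ^ n * \<epsilon>" using e by (simp add: power2_le_iff_abs_le abs_mult)
    with y(1) show ?thesis by blast
  qed
  then obtain y where y: "\<And>j. j \<le> m \<Longrightarrow> y j \<in> {s + 2 * real j * \<delta>..s + (2 * real j + 1) * \<delta>} \<and> cmod (f (y j)) \<le> 2 ^ n * \<epsilon>"
    by metis
  define t where "t j = y j - s" for j
  have sep': "(real j - real k) * \<delta> \<le> t j - t k" if "k \<le> m" "j \<le> m" "k < j" for j k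
  proof -
    have "(2 * real j) * \<delta> \<le> t j" "t k \<le> (2 * real k + 1) * \<delta>"
      using y[OF that(2)] y[OF that(1)] by (auto simp: t_def)
    moreover have "(real j - real k) * \<delta> \<le> (2 * real j - (2 * real k + 1)) * \<delta>"
      using that \<delta> by (intro mult_right_mono) auto
    moreover have "(2 * real j - (2 * real k + 1)) * \<delta> = (2 * real j) * \<delta> - (2 * real k + 1) * \<delta>"
      by (rule left_diff_distrib)
    ultimately show ?thesis by linarith
  qed
  have sep: "\<bar>real j - real k\<bar> * \<delta> \<le> \<bar>t j - t k\<bar>" if "j \<le> m" "k \<le> m" for j k
    using sep'[of k j] sep'[of j k] that \<delta> by (cases j k rule: linorder_cases) auto
  have tl: "0 \<le> t j" "t j \<le> l" if "j \<le> m" for j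
  proof -
    have "0 \<le> 2 * real j * \<delta>" using \<delta> by simp
    then show "0 \<le> t j" using y[OF that] unfolding t_def atLeastAtMost_iff by linarith
    have "(2 * real j + 1) * \<delta> \<le> l" unfolding l\<delta> using that Suc \<delta> by (intro mult_right_mono) auto
    then show "t j \<le> l" using y[OF that] unfolding t_def atLeastAtMost_iff by linarith
  qed
  obtain c where c: "\<And>n h. cmod (f (s + h) - (\<Sum>i<n. c i * of_real (h ^ i))) \<le> (\<bar>h\<bar> / R) ^ n * M"
    using f(1) unfolding taylor_bound_def by blast
  define P where "P = (\<Sum>i<n. monom (c i) i)"
  have P: "poly P (of_real h) = (\<Sum>i<n. c i * of_real (h ^ i))" for h
    by (simp add: P_def poly_sum poly_monom)
  have degP: "degree P \<le> m"
    unfolding P_def using Suc by (intro degree_sum_le) (auto intro: order.trans[OF degree_monom_le])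
  have q: "cmod (f (s + h) - poly P (of_real h)) \<le> q" if "\<bar>h\<bar> \<le> 2 * l" for h
  proof -
    have "(\<bar>h\<bar> / R) ^ n * M \<le> q"
      unfolding q_def using that R M l by (intro mult_right_mono power_mono divide_right_mono) auto
    then show ?thesis unfolding P using c[of h n] by linarith
  qed
  define D where "D = 2 ^ n * \<epsilon> + q"
  have D: "cmod (poly P (of_real (t j))) \<le> D" if "j \<le> m" for j
  proof -
    have "cmod (f (s + t j) - poly P (of_real (t j))) \<le> q" using tl[OF that] by (intro q) auto
    moreover have "cmod (f (s + t j)) \<le> 2 ^ n * \<epsilon>" using y[OF that] by (simp add: t_def)
    ultimately show ?thesis
      unfolding D_def using norm_triangle_sub[of "poly P (of_real (t j))" "f (s + t j)"]
      by (simp add: norm_minus_commute)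
  qed
  have D0: "D \<ge> 0" using order.trans[OF norm_ge_zero D[of 0]] by simp
  define h where "h = x - s"
  have h: "\<bar>h\<bar> \<le> 2 * l" using x l by (auto simp: h_def)
  have inj: "inj_on (\<lambda>j. complex_of_real (t j)) {..m}"
  proof (rule inj_onI)
    fix j k assume "j \<in> {..m}" "k \<in> {..m}" "complex_of_real (t j) = of_real (t k)"
    then have "\<bar>real j - real k\<bar> * \<delta> \<le> 0" using sep[of j k] by simp
    then show "j = k" using \<delta> by (simp add: mult_le_0_iff)
  qed
  have "cmod (poly P (of_real h)) = cmod (\<Sum>j\<le>m. poly P (of_real (t j)) * (\<Prod>k\<in>{..m} - {j}. (of_real h - of_real (t k)) / (of_real (t j) - of_real (t k))))"
    by (rule arg_cong[OF lagrange_interpolation[OF degP inj]])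
  also have "\<dots> \<le> (\<Sum>j\<le>m. D * (\<Prod>k\<in>{..m} - {j}. \<bar>h - t k\<bar> / \<bar>t j - t k\<bar>))"
  proof (rule order.trans[OF norm_sum sum_mono])
    fix j assume j: "j \<in> {..m}"
    have "cmod (\<Prod>k\<in>{..m} - {j}. (of_real h - of_real (t k)) / (of_real (t j) - of_real (t k))) = (\<Prod>k\<in>{..m} - {j}. \<bar>h - t k\<bar> / \<bar>t j - t k\<bar>)"
      unfolding prod_norm[symmetric] by (intro prod.cong) (auto simp: norm_divide simp flip: of_real_diff)
    then show "cmod (poly P (of_real (t j)) * (\<Prod>k\<in>{..m} - {j}. (of_real h - of_real (t k)) / (of_real (t j) - of_real (t k))))
        \<le> D * (\<Prod>k\<in>{..m} - {j}. \<bar>h - t k\<bar> / \<bar>t j - t k\<bar>)"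
      using D[of j] j by (auto simp: norm_mult intro!: mult_right_mono prod_nonneg)
  qed
  also have "\<dots> = D * (\<Sum>j\<le>m. \<Prod>k\<in>{..m} - {j}. \<bar>h - t k\<bar> / \<bar>t j - t k\<bar>)"
    by (simp add: sum_distrib_left)
  also have "\<dots> \<le> D * ((2 * (2 * l) / \<delta>) ^ m / fact m)"
  proof (intro mult_left_mono D0 lebesgue_constant_separated sep \<delta>)
    fix k assume "k \<le> m"
    with tl[of k] x l show "\<bar>h - t k\<bar> \<le> 2 * l" by (auto simp: h_def)
  qed
  also have "\<dots> \<le> D * 24 ^ n"
  proof (intro mult_left_mono D0)
    \<comment> \<open>With \<open>2 * l\<close> as bound for the distance to the nodes, the
      interpolation constant is \<open>(8 n) ^ m / fact m\<close>, at most
      \<open>8 ^ n * exp n\<close> and so at most \<open>24 ^ n\<close>. The node values contribute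
      another \<open>2 ^ n\<close>, in total 48.\<close>
    have e: "2 * (2 * l) / \<delta> = 8 * real n" unfolding l\<delta> using \<delta> by simp
    have "(2 * (2 * l) / \<delta>) ^ m / fact m = 8 ^ m * (real n ^ m / fact m)"
      unfolding e power_mult_distrib by simp
    also have "\<dots> \<le> 8 ^ n * exp (real n)"
      using Suc by (intro mult_mono power_increasing power_div_fact_le_exp) auto
    also have "exp (real n) = exp 1 ^ n" using exp_of_nat_mult[of n "1 :: real"] by simp
    also have "8 ^ n * exp 1 ^ n \<le> (8 :: real) ^ n * 3 ^ n"
      using exp_le by (intro mult_left_mono power_mono) auto
    also have "\<dots> = 24 ^ n" unfolding power_mult_distrib[symmetric] by simp
    finally show "(2 * (2 * l) / \<delta>) ^ m / fact m \<le> 24 ^ n" .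
  qed
  finally have "cmod (poly P (of_real h)) \<le> D * 24 ^ n" .
  moreover have "cmod (f x - poly P (of_real h)) \<le> q" using q[OF h] by (simp add: h_def)
  ultimately have "cmod (f x) \<le> D * 24 ^ n + q"
    using norm_triangle_sub[of "f x" "poly P (of_real h)"] by linarith
  also have "\<dots> = 48 ^ n * \<epsilon> + (24 ^ n + 1) * q"
    by (simp add: D_def algebra_simps flip: power_mult_distrib)
  finally show ?thesis unfolding q_def .
qed

text \<open>The radius is chosen so that \<open>2 * l / R = 1 / 48\<^sup>2\<close>: the two error terms become \<open>48 ^ n * \<epsilon>\<close>
  and \<open>M / 48 ^ n\<close>, which are balanced by the choice of \<open>n\<close>.\<close>

lemma taylor_bound_step:
  assumes f: "taylor_bound f R M" "continuous_on UNIV f" and R: "R > 0" and l: "l = R / 4608" and e: "\<epsilon> \<ge> 0"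
    and int: "integral {s..s + l} (\<lambda>x. (cmod (f x))\<^sup>2) \<le> \<epsilon>\<^sup>2 * l"
    and x: "x \<in> {s - l..s + 2 * l}"
  shows "cmod (f x) \<le> sqrt ((2401 * M) * \<epsilon>)"
proof -
  have M: "M \<ge> 0" using order.trans[OF norm_ge_zero taylor_bound_le[OF f(1)]] .
  have b: "cmod (f x) \<le> 48 ^ n * \<epsilon> + M / 48 ^ n" for n
  proof (cases "n = 0")
    case True
    then show ?thesis using taylor_bound_le[OF f(1), of x] e by simp
  next
    case False
    then have "(2::real) ^ 1 \<le> 2 ^ n" by (intro power_increasing) auto
    then have "(24::real) ^ n * 2 \<le> 24 ^ n * 2 ^ n" by simp
    moreover have "(24::real) ^ n * 2 ^ n = 48 ^ n" by (simp flip: power_mult_distrib)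
    moreover have "(1::real) \<le> 24 ^ n" by simp
    ultimately have 24: "(24::real) ^ n + 1 \<le> 48 ^ n" by linarith
    have "2 * l / R = 1 / (48 * 48)" using R by (simp add: l)
    then have "(2 * l / R) ^ n * M = M / (48 ^ n * 48 ^ n)"
      by (simp add: power_divide flip: power_mult_distrib)
    then have "(24 ^ n + 1) * ((2 * l / R) ^ n * M) \<le> 48 ^ n * (M / (48 ^ n * 48 ^ n))"
      using M 24 by (simp only:) (intro mult_right_mono, auto)
    then show ?thesis using taylor_bound_remez[OF f R _ e int x, of n] R l by simp
  qed
  \<comment> \<open>For vanishing \<epsilon> one lets n grow; for \<epsilon> above \<open>M\<close>
    the trivial bound is already good enough; only in the remaining range can the two terms be
    balanced.\<close>
  consider "\<epsilon> = 0" | "\<epsilon> > M" | "0 < \<epsilon>" "\<epsilon> \<le> M" using e by linarith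
  then show ?thesis
  proof cases
    case 1
    have "cmod (f x) \<le> 0"
    proof (rule ccontr)
      assume "\<not> cmod (f x) \<le> 0"
      then obtain n where "M / cmod (f x) < 48 ^ n"
        using real_arch_pow[of 48 "M / cmod (f x)"] by auto
      then have "M / 48 ^ n < cmod (f x)"
        using \<open>\<not> cmod (f x) \<le> 0\<close> by (simp add: field_simps)
      then show False using b[of n] 1 by simp
    qed
    then show ?thesis using 1 by simp
  next
    case 2
    have "cmod (f x) \<le> sqrt (M * M)" using taylor_bound_le[OF f(1), of x] M by simp
    also have "\<dots> \<le> sqrt ((2401 * M) * \<epsilon>)" using 2 M by (intro real_sqrt_le_mono mult_mono) auto
    finally show ?thesis .
  next
    case 3
    have "\<exists>n. M < (48 ^ n * 48 ^ n) * \<epsilon>"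
    proof -
      obtain n where "M / \<epsilon> < 2304 ^ n" using real_arch_pow[of 2304 "M / \<epsilon>"] by auto
      then show ?thesis using 3 by (auto simp: field_simps simp flip: power_mult_distrib)
    qed
    \<comment> \<open>The least such \<open>k\<close> is positive because
      \<open>\<epsilon> \<le> M\<close>. For its predecessor n, the terms are at most
      \<open>sqrt (M * \<epsilon>)\<close> and \<open>48 * sqrt (M * \<epsilon>)\<close>; their sum
      explains 49^2 = 2401.\<close>
    then obtain k where k: "M < (48 ^ k * 48 ^ k) * \<epsilon>" "\<And>j. j < k \<Longrightarrow> \<not> M < (48 ^ j * 48 ^ j) * \<epsilon>"
      using exists_least_iff[of "\<lambda>n. M < (48 ^ n * 48 ^ n) * \<epsilon>"] by blast
    then obtain n where n: "k = Suc n" using 3 by (cases k) auto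
    define A :: real where "A = 48 ^ n"
    have A: "A > 0" "A * A * \<epsilon> \<le> M" "M \<le> 2304 * (A * A * \<epsilon>)"
      using k(1) k(2)[of n] by (auto simp: n A_def)
    have "A * \<epsilon> \<le> sqrt (M * \<epsilon>)"
      using mult_right_mono[OF A(2), of \<epsilon>] 3 by (intro real_le_rsqrt) (simp add: power2_eq_square mult_ac)
    moreover have "M / A \<le> sqrt (2304 * (M * \<epsilon>))"
    proof (rule real_le_rsqrt)
      have "(M / A)\<^sup>2 = M * M / (A * A)" by (simp add: power2_eq_square)
      also have "\<dots> \<le> M * (2304 * (A * A * \<epsilon>)) / (A * A)"
        using A M by (intro divide_right_mono mult_left_mono) auto
      also have "\<dots> = 2304 * (M * \<epsilon>)" using A(1) by simp
      finally show "(M / A)\<^sup>2 \<le> 2304 * (M * \<epsilon>)" .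
    qed
    moreover have "sqrt (2304 * (M * \<epsilon>)) = 48 * sqrt (M * \<epsilon>)"
      unfolding real_sqrt_mult using real_sqrt_unique[of 48 2304] by simp
    moreover have "sqrt ((2401 * M) * \<epsilon>) = 49 * sqrt (M * \<epsilon>)"
      unfolding mult.assoc real_sqrt_mult using real_sqrt_unique[of 49 2401] by simp
    ultimately show ?thesis using b[of n] unfolding A_def by linarith
  qed
qed

text \<open>Each application takes the sup bound just obtained as the new \<epsilon> and reaches one
  length further on both sides; the geometric mean with the fixed bound halves the exponent of the
  original \<epsilon>.\<close>

lemma taylor_bound_chain:
  assumes f: "taylor_bound f R M" "continuous_on UNIV f" and R: "R > 0" and l: "l = R / 4608" and e: "\<epsilon> \<ge> 0"
    and int: "integral {s..s + l} (\<lambda>x. (cmod (f x))\<^sup>2) \<le> \<epsilon>\<^sup>2 * l"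
    and x: "x \<in> {s - real (Suc k) * l..s + (real (Suc k) + 1) * l}"
  shows "cmod (f x) \<le> (2401 * M) powr (1 - (1/2) ^ Suc k) * \<epsilon> powr ((1/2) ^ Suc k)"
  using x
proof (induction k arbitrary: x)
  case 0
  have M: "M \<ge> 0" using order.trans[OF norm_ge_zero taylor_bound_le[OF f(1)]] .
  have "cmod (f x) \<le> sqrt ((2401 * M) * \<epsilon>)"
    using taylor_bound_step[OF f R l e int, of x] 0 by simp
  also have "\<dots> = (2401 * M) powr (1/2) * \<epsilon> powr (1/2)"
    using M e by (simp add: powr_half_sqrt real_sqrt_mult)
  finally show ?case by simp
next
  case (Suc k)
  have M: "M \<ge> 0" using order.trans[OF norm_ge_zero taylor_bound_le[OF f(1)]] .
  define N where "N = 2401 * M"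
  have N: "N \<ge> 0" using M by (simp add: N_def)
  define \<tau> :: real where "\<tau> = (1/2) ^ Suc k"
  define E where "E = N powr (1 - \<tau>) * \<epsilon> powr \<tau>"
  have l0: "l > 0" using R l by simp
  \<comment> \<open>The point \<open>x\<close> clipped so that \<open>{r..r + l}\<close> stays where
    the induction hypothesis holds, while \<open>x\<close> remains within distance \<open>l\<close>
    of that interval.\<close>
  define r where "r = max (s - real (Suc k) * l) (min (s + real (Suc k) * l) x)"
  have kl: "real (Suc k) * l \<ge> 0" using l0 by simp
  have S: "real (Suc (Suc k)) * l = real (Suc k) * l + l" "(real (Suc k) + 1) * l = real (Suc k) * l + l"
    "(real (Suc (Suc k)) + 1) * l = real (Suc k) * l + 2 * l" by (simp_all add: algebra_simps)
  have r: "x \<in> {r - l..r + 2 * l}" "s - real (Suc k) * l \<le> r" "r + l \<le> s + (real (Suc k) + 1) * l"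
    using Suc.prems l0 kl unfolding r_def S by auto
  have "integral {r..r + l} (\<lambda>x. (cmod (f x))\<^sup>2) \<le> integral {r..r + l} (\<lambda>x. E\<^sup>2)"
  proof (rule integral_le)
    show "(\<lambda>x. (cmod (f x))\<^sup>2) integrable_on {r..r + l}"
      by (intro integrable_continuous_real continuous_intros continuous_on_subset[OF f(2)]) auto
    fix y assume "y \<in> {r..r + l}"
    then have "cmod (f y) \<le> E" unfolding E_def \<tau>_def N_def using r by (intro Suc.IH) auto
    then show "(cmod (f y))\<^sup>2 \<le> E\<^sup>2" by (intro power_mono) auto
  qed auto
  also have "\<dots> = E\<^sup>2 * l" using l0 by simp
  finally have "cmod (f x) \<le> sqrt (N * E)"
    unfolding N_def using r(1) by (intro taylor_bound_step[OF f R l _ _, of E r]) (auto simp: E_def)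
  also have "\<dots> = N powr (1/2) * E powr (1/2)"
    using N by (simp add: powr_half_sqrt real_sqrt_mult E_def)
  also have "E powr (1/2) = N powr ((1 - \<tau>) * (1/2)) * \<epsilon> powr (\<tau> * (1/2))"
    unfolding E_def by (simp only: powr_mult powr_powr powr_ge_zero)
  also have "N powr (1/2) * (N powr ((1 - \<tau>) * (1/2)) * \<epsilon> powr (\<tau> * (1/2))) = N powr (1/2 + (1 - \<tau>) * (1/2)) * \<epsilon> powr (\<tau> * (1/2))"
    by (simp only: powr_add mult.assoc)
  also have "1/2 + (1 - \<tau>) * (1/2) = 1 - (1/2) ^ Suc (Suc k)" by (simp add: \<tau>_def algebra_simps)
  also have "\<tau> * (1/2) = (1/2) ^ Suc (Suc k)" by (simp add: \<tau>_def)
  finally show ?case unfolding N_def .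
qed

text \<open>Since the mean value never exceeds the sup bound, lowering the exponent from
  \<open>(1/2) ^ k\<close> to any smaller \<tau> is harmless. This lets the integer number of steps
  be replaced by a real quantity. Distances are measured from the right end
  \<open>s + l\<close>.\<close>

lemma propagation_of_smallness:
  assumes f: "taylor_bound f R M" "continuous_on UNIV f" and R: "R > 0" and l: "l = R / 4608"
    and k: "k > 0" and \<tau>: "0 < \<tau>" "\<tau> \<le> (1/2) ^ k"
    and x: "\<bar>x - (s + l)\<bar> \<le> real k * l"
  shows "(cmod (f x))\<^sup>2 \<le> ((2401 * M)\<^sup>2) powr (1 - \<tau>) * (integral {s..s + l} (\<lambda>x. (cmod (f x))\<^sup>2) / l) powr \<tau>"
proof -
  have M: "M \<ge> 0" using order.trans[OF norm_ge_zero taylor_bound_le[OF f(1)]] .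
  define N where "N = 2401 * M"
  have N: "N \<ge> 0" using M by (simp add: N_def)
  have l0: "l > 0" using R l by simp
  define I where "I = integral {s..s + l} (\<lambda>x. (cmod (f x))\<^sup>2) / l"
  have fi: "(\<lambda>x. (cmod (f x))\<^sup>2) integrable_on {s..s + l}"
    by (intro integrable_continuous_real continuous_intros continuous_on_subset[OF f(2)]) auto
  have I: "I \<ge> 0" unfolding I_def using l0 by (intro divide_nonneg_pos integral_nonneg fi) auto
  define \<epsilon> where "\<epsilon> = sqrt I"
  have e: "\<epsilon> \<ge> 0" "\<epsilon>\<^sup>2 = I" using I by (auto simp: \<epsilon>_def)
  have "integral {s..s + l} (\<lambda>x. (cmod (f x))\<^sup>2) \<le> integral {s..s + l} (\<lambda>x. M\<^sup>2)"
    by (intro integral_le fi power_mono taylor_bound_le[OF f(1)]) auto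
  then have "I \<le> M\<^sup>2" using l0 unfolding I_def by (simp add: pos_divide_le_eq mult.commute)
  then have eM: "\<epsilon> \<le> N" using M real_le_lsqrt[of M I] by (simp add: \<epsilon>_def N_def)
  have int: "integral {s..s + l} (\<lambda>x. (cmod (f x))\<^sup>2) \<le> \<epsilon>\<^sup>2 * l"
    unfolding e(2) I_def using l0 by simp
  define \<sigma> :: real where "\<sigma> = (1/2) ^ k"
  obtain j where j: "k = Suc j" using k by (cases k) auto
  have "x \<in> {s - real (Suc j) * l..s + (real (Suc j) + 1) * l}"
    using x l0 by (auto simp: j algebra_simps abs_le_iff)
  then have "cmod (f x) \<le> N powr (1 - \<sigma>) * \<epsilon> powr \<sigma>"
    unfolding N_def \<sigma>_def j by (rule taylor_bound_chain[OF f R l e(1) int])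
  also have "\<epsilon> powr \<sigma> = \<epsilon> powr \<tau> * \<epsilon> powr (\<sigma> - \<tau>)" by (simp flip: powr_add)
  \<comment> \<open>The surplus \<open>\<sigma> - \<tau>\<close> of the exponent is moved from
    \<epsilon> to the larger \<open>N\<close>.\<close>
  also have "N powr (1 - \<sigma>) * (\<epsilon> powr \<tau> * \<epsilon> powr (\<sigma> - \<tau>)) \<le> N powr (1 - \<sigma>) * (\<epsilon> powr \<tau> * N powr (\<sigma> - \<tau>))"
    using e eM \<tau> unfolding \<sigma>_def by (intro mult_left_mono powr_mono2) auto
  also have "\<dots> = N powr (1 - \<sigma> + (\<sigma> - \<tau>)) * \<epsilon> powr \<tau>" by (simp only: powr_add mult_ac)
  also have "1 - \<sigma> + (\<sigma> - \<tau>) = 1 - \<tau>" by simp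
  finally have "(cmod (f x))\<^sup>2 \<le> (N powr (1 - \<tau>) * \<epsilon> powr \<tau>)\<^sup>2" by (intro power_mono) auto
  also have "\<dots> = (N\<^sup>2) powr (1 - \<tau>) * (\<epsilon>\<^sup>2) powr \<tau>"
    using N e(1) by (simp add: power2_eq_square powr_mult mult_ac)
  finally show ?thesis unfolding e(2) I_def N_def .
qed

section \<open>Comparison of the masses on two intervals\<close>

context bessel
begin

lemma taylor_bound_amplitude:
  assumes "u \<in> Cc_inf" "T > 0" "R > 0"
  shows "taylor_bound (amplitude T u) R (B0 * exp_mass T R u)"
  unfolding taylor_bound_def using amplitude_taylor[OF assms] by metis

lemma
  assumes ab: "0 \<le> a" "a \<le> b"
  shows powr_integrable_Icc: "(\<lambda>x. x powr (2 * \<nu> + 1)) integrable_on {a..b}"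
    and integral_powr_Icc: "integral {a..b} (\<lambda>x. x powr (2 * \<nu> + 1)) = (b powr (2 * \<nu> + 2) - a powr (2 * \<nu> + 2)) / (2 * \<nu> + 2)"
proof -
  have "((\<lambda>x. x powr (2 * \<nu> + 1)) has_integral (b powr (2 * \<nu> + 2) / (2 * \<nu> + 2) - a powr (2 * \<nu> + 2) / (2 * \<nu> + 2))) {a..b}"
  proof (rule fundamental_theorem_of_calculus_interior[OF ab(2)])
    have nz: "2 * \<nu> + 2 \<noteq> 0" using nu_nonneg by simp
    have e: "2 * \<nu> + 2 - 1 = 2 * \<nu> + 1" by simp
    show "continuous_on {a..b} (\<lambda>x. x powr (2 * \<nu> + 2) / (2 * \<nu> + 2))"
      using ab nu_nonneg by (intro continuous_on_divide continuous_on_powr' continuous_intros) auto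
    fix x assume "x \<in> {a<..<b}"
    then have "x > 0" using ab by auto
    then have "((\<lambda>x. x powr (2 * \<nu> + 2) / (2 * \<nu> + 2)) has_real_derivative ((2 * \<nu> + 2) * x powr (2 * \<nu> + 2 - 1)) / (2 * \<nu> + 2)) (at x)"
      by (intro DERIV_cdivide has_real_derivative_powr)
    then show "((\<lambda>x. x powr (2 * \<nu> + 2) / (2 * \<nu> + 2)) has_vector_derivative x powr (2 * \<nu> + 1)) (at x)"
      unfolding e nonzero_mult_div_cancel_left[OF nz] has_real_derivative_iff_has_vector_derivative .
  qed
  then show "(\<lambda>x. x powr (2 * \<nu> + 1)) integrable_on {a..b}"
    "integral {a..b} (\<lambda>x. x powr (2 * \<nu> + 1)) = (b powr (2 * \<nu> + 2) - a powr (2 * \<nu> + 2)) / (2 * \<nu> + 2)"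
    by (auto simp: integral_unique diff_divide_distrib)
qed

text \<open>A continuous representative of the squared modulus of the solution, so that masses on
  compact intervals become ordinary integrals.\<close>

definition density :: "real \<Rightarrow> (real \<Rightarrow> complex) \<Rightarrow> real \<Rightarrow> real" where
  "density T u x = (cmod (kernel_factor T))\<^sup>2 * (x powr (2 * \<nu> + 1) * (cmod (amplitude T u x))\<^sup>2)"

lemma density_nonneg: "density T u x \<ge> 0"
  by (simp add: density_def)

lemma density_continuous:
  assumes "u \<in> Cc_inf" "T > 0"
  shows "continuous_on {0..} (density T u)"
  unfolding density_def using nu_nonneg
  by (intro continuous_on_mult continuous_on_powr' continuous_intros amplitude_continuous assms) auto

lemma density_integrable_Icc:
  assumes "u \<in> Cc_inf" "T > 0" "0 \<le> a"
  shows "density T u integrable_on {a..b}"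
  using assms by (intro integrable_continuous_real continuous_on_subset[OF density_continuous]) auto

lemma cmod_represented: "(cmod (represented T u x))\<^sup>2 = density T u x"
proof -
  have "(x powr (\<nu> + 1/2))\<^sup>2 = x powr (2 * \<nu> + 1)" by (simp add: power2_eq_square flip: powr_add)
  moreover have "cmod (exp (\<i> * of_real (x\<^sup>2 / (4 * T)))) = 1" by (rule norm_exp_i_times)
  ultimately show ?thesis
    unfolding density_def represented_def norm_mult norm_of_real by (simp add: power_mult_distrib)
qed

lemma mass_Icc:
  assumes u: "u \<in> Cc_inf" and T: "T > 0" and ab: "0 \<le> a" "a \<le> b"
  shows "(LINT x:{a..b}|half_line. (cmod (schroedinger_solution \<nu> x T u))\<^sup>2) = integral {a..b} (density T u)"
proof -
  have [measurable]: "(\<lambda>x. schroedinger_solution \<nu> x T u) \<in> borel_measurable half_line"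
    by (rule schroedinger_solution_measurable[OF u])
  have [measurable]: "indicat_real {a..b} \<in> borel_measurable half_line"
    by (rule measurable_half_line_comp) simp
  have "continuous_on {0<..} (density T u)"
    by (rule continuous_on_subset[OF density_continuous[OF u T]]) auto
  then have [measurable]: "density T u \<in> borel_measurable half_line"
    by (intro continuous_imp_measurable_on_sets_lebesgue) auto
  have "(LINT x:{a..b}|half_line. (cmod (schroedinger_solution \<nu> x T u))\<^sup>2)
      = (LINT x|half_line. indicat_real {a..b} x *\<^sub>R density T u x)"
    unfolding set_lebesgue_integral_def
  proof (rule integral_cong_AE)
    show "AE x in half_line. indicat_real {a..b} x *\<^sub>R (cmod (schroedinger_solution \<nu> x T u))\<^sup>2 = indicat_real {a..b} x *\<^sub>R density T u x"
      using schroedinger_solution_represented[OF u T] by eventually_elim (simp add: cmod_represented)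
  qed measurable
  also have "\<dots> = (LINT x|lebesgue. (if x \<in> {0<..} then indicat_real {a..b} x *\<^sub>R density T u x else 0))"
    by (rule Lebesgue_Measure.integral_restrict_UNIV[symmetric]) simp
  also have "\<dots> = (LINT x|lebesgue. (if x \<in> {a..b} then density T u x else 0))"
  proof (rule Bochner_Integration.integral_cong)
    fix x
    \<comment> \<open>The half-line omits 0, which may be an end point of the interval; the value
      there is zero by the convention for \<open>powr\<close> at 0.\<close>
    have "density T u 0 = 0" by (simp add: density_def)
    then show "(if x \<in> {0<..} then indicat_real {a..b} x *\<^sub>R density T u x else 0) = (if x \<in> {a..b} then density T u x else 0)"
      using ab by (cases "x = 0") (auto simp: indicator_def)
  qed simp
  also have "\<dots> = (LINT x|lebesgue_on {a..b}. density T u x)"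
    by (rule Lebesgue_Measure.integral_restrict_UNIV) simp
  also have "\<dots> = integral {a..b} (density T u)"
    using ab by (intro lebesgue_integral_eq_integral continuous_imp_integrable_real continuous_on_subset[OF density_continuous[OF u T]]) auto
  finally show ?thesis .
qed

text \<open>The sum dominates both constants at once: the one relating the sup bound to the weighted
  norm, and the factor 9216 from averaging over an interval of length m/9216.\<close>

definition smallness_const :: real where
  "smallness_const = (2401 * B0)\<^sup>2 * Gamma (2 * \<nu> + 2) / kernel_const\<^sup>2 + 9216"

lemma smallness_const_ge: "(2401 * B0)\<^sup>2 * Gamma (2 * \<nu> + 2) / kernel_const\<^sup>2 \<le> smallness_const" "9216 \<le> smallness_const"
  using nu_nonneg by (auto simp: smallness_const_def Gamma_real_pos less_imp_le)

text \<open>Smallness is propagated from a short interval at the right end of B to every point of A,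
  and the pointwise bound is integrated against the weight over A. The prefactor is shared between
  the small and the large quantity with exponents \<tau> and 1 - \<tau>; both come with the same
  power of \<open>m\<close>.\<close>

lemma mass_estimate:
  fixes a1 a2 b1 b2 l T p \<tau> :: real
  assumes a: "0 \<le> a1" "a1 < a2" and b: "0 \<le> b1" "b1 < b2" and l: "l > 0" and T: "T > 0" and u: "u \<in> Cc_inf"
  defines "m \<equiv> min (l * T) ((b2 - b1) / 2)"
  assumes p: "p = 1 + (\<bar>(a1 + a2) / 2 - (b1 + b2) / 2\<bar> + (a2 - a1) / 2 + (b2 - b1) / 2) / m"
    and \<tau>: "\<tau> = (1/2) powr (9216 * p)"
  defines "X \<equiv> (LINT x|half_line. exp (l * x) * (cmod (u x))\<^sup>2)"
  shows "integral {a1..a2} (density T u) \<le> (a2 powr (2 * \<nu> + 2) - a1 powr (2 * \<nu> + 2)) / (2 * \<nu> + 2) *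
    ((smallness_const * m powr (- (2 * \<nu> + 2))) * (integral {b1..b2} (density T u) powr \<tau> * X powr (1 - \<tau>)))"
proof -
  define q where "q = 2 * \<nu> + 2"
  have q: "q > 0" using nu_nonneg by (simp add: q_def)
  have m: "m > 0" "m \<le> l * T" "m \<le> (b2 - b1) / 2"
    unfolding m_def using l T b by simp (rule min.cobounded1, rule min.cobounded2)
  define d where "d = \<bar>(a1 + a2) / 2 - (b1 + b2) / 2\<bar> + (a2 - a1) / 2 + (b2 - b1) / 2"
  have d: "d > 0" unfolding d_def using a b by (intro add_nonneg_pos add_nonneg_nonneg) auto
  \<comment> \<open>Since \<open>m \<le> l * T\<close>, this radius meets the requirement
    \<open>R \<le> l * T / 2\<close> of \<open>exp_mass_le\<close>.\<close>
  define R where "R = m / 2"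
  define r where "r = R / 4608"
  have R: "R > 0" using m by (simp add: R_def)
  have rm: "r = m / 9216" by (simp add: r_def R_def)
  have r: "r > 0" using m by (simp add: rm)
  have rb: "r \<le> (b2 - b1) / 2" using m by (simp add: rm)
  \<comment> \<open>The right end of B is used: as \<open>r\<close> and \<open>m\<close> are at most
    half its length and \<open>b1 \<ge> 0\<close>, the interval \<open>{s..s + r}\<close> lies in B
    and in \<open>x \<ge> m\<close>.\<close>
  define s where "s = b2 - r"
  have s: "s + r = b2" "b1 \<le> s" "m \<le> s" using rb m b by (auto simp: s_def)
  define k where "k = nat \<lceil>d / r\<rceil>"
  have k: "real k = of_int \<lceil>d / r\<rceil>" using d r by (simp add: k_def)
  have k0: "k > 0" using d r by (simp add: k_def)
  have kr: "d \<le> real k * r" unfolding k pos_divide_le_eq[OF r, symmetric] by (rule le_of_int_ceiling)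
  \<comment> \<open>The one lost in rounding up is covered by the summand 1 in
    \<open>p\<close>.\<close>
  have kp: "real k \<le> 9216 * p"
  proof -
    have "real k \<le> d / r + 1" unfolding k by (rule of_int_ceiling_le_add_one)
    also have "d / r = 9216 * (d / m)" by (simp add: rm)
    finally show ?thesis unfolding p d_def by simp
  qed
  have \<tau>0: "0 < \<tau>" by (simp add: \<tau>)
  have \<tau>k: "\<tau> \<le> (1/2) ^ k"
  proof -
    have "\<tau> \<le> (1/2) powr real k" unfolding \<tau> using kp by (intro powr_mono') auto
    then show ?thesis by (simp add: powr_realpow)
  qed
  have \<tau>1: "\<tau> \<le> 1" using \<tau>k power_le_one[of "1/2 :: real" k] by linarith
  define M where "M = B0 * exp_mass T R u"
  define I where "I = integral {s..s + r} (\<lambda>x. (cmod (amplitude T u x))\<^sup>2)"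
  define K where "K = (cmod (kernel_factor T))\<^sup>2"
  define D where "D = smallness_const * m powr (- q)"
  define UB where "UB = integral {b1..b2} (density T u)"
  define S where "S = ((2401 * M)\<^sup>2) powr (1 - \<tau>) * (I / r) powr \<tau>"
  have K: "K \<ge> 0" by (simp add: K_def)
  have D: "D > 0" unfolding D_def using smallness_const_ge(2) m(1) by simp
  have ai: "(\<lambda>x. (cmod (amplitude T u x))\<^sup>2) integrable_on {c..e}" for c e
    by (intro integrable_continuous_real continuous_intros amplitude_continuous u T)
  have I: "I \<ge> 0" unfolding I_def by (intro integral_nonneg ai) auto
  have UB: "UB \<ge> 0" unfolding UB_def using b by (intro integral_nonneg density_integrable_Icc u T density_nonneg)
  have X: "X \<ge> 0" unfolding X_def by (intro Bochner_Integration.integral_nonneg) auto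
  have point: "(cmod (amplitude T u x))\<^sup>2 \<le> S" if "x \<in> {a1..a2}" for x
    unfolding S_def I_def M_def
  proof (rule propagation_of_smallness[OF taylor_bound_amplitude[OF u T R] amplitude_continuous[OF u T] R r_def k0 \<tau>0 \<tau>k])
    have "\<bar>x - b2\<bar> \<le> d" using that b unfolding d_def by (auto simp: abs_if field_simps)
    then show "\<bar>x - (s + r)\<bar> \<le> real k * r" using kr s by simp
  qed
  have K_eq: "K = (4 * T) powr (- q) / kernel_const\<^sup>2"
  proof -
    have "((4 * T) powr (- (\<nu> + 1)))\<^sup>2 = (4 * T) powr (- q)" by (simp add: power2_eq_square q_def flip: powr_add)
    then show ?thesis unfolding K_def cmod_kernel_factor[OF T] power_divide by simp
  qed
  have KM: "K * (2401 * M)\<^sup>2 \<le> D * X"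
  proof -
    have "K * (2401 * M)\<^sup>2 = ((2401 * B0)\<^sup>2 / kernel_const\<^sup>2) * ((4 * T) powr (- q) * (exp_mass T R u)\<^sup>2)"
      unfolding K_eq M_def by (simp add: power_mult_distrib)
    also have "\<dots> \<le> ((2401 * B0)\<^sup>2 / kernel_const\<^sup>2) * ((4 * T) powr (- q) * (Gamma q * (l / 2) powr (- q) * X))"
    proof (intro mult_left_mono)
      show "(exp_mass T R u)\<^sup>2 \<le> Gamma q * (l / 2) powr (- q) * X"
        unfolding q_def X_def using m by (intro exp_mass_le u T l) (simp add: R_def)
    qed auto
    also have "\<dots> = ((2401 * B0)\<^sup>2 * Gamma q / kernel_const\<^sup>2) * ((4 * T) * (l / 2)) powr (- q) * X"
      unfolding powr_mult by (simp add: mult_ac)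
    also have "\<dots> \<le> smallness_const * m powr (- q) * X"
    proof (intro mult_right_mono mult_mono X)
      show "((2401 * B0)\<^sup>2 * Gamma q / kernel_const\<^sup>2) \<le> smallness_const"
        unfolding q_def by (rule smallness_const_ge)
      \<comment> \<open>The power of \<open>T\<close> from the propagator and the power of
        \<open>l\<close> from the exponential moment have equal exponents and combine to a power of
        \<open>2 l T\<close>.\<close>
      have "m \<le> (4 * T) * (l / 2)" using m by (simp add: mult.commute)
      then show "((4 * T) * (l / 2)) powr (- q) \<le> m powr (- q)" using m q by (intro powr_mono2') auto
      show "smallness_const \<ge> 0" using smallness_const_ge(2) by linarith
    qed auto
    finally show ?thesis unfolding D_def .
  qed
  have KI: "K * (I / r) \<le> D * UB"
  proof -
    \<comment> \<open>On the starting interval \<open>x \<ge> m\<close>, so the weight is divided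
      out at the price of \<open>m powr (- (2 * \<nu> + 1))\<close>. Dividing by the length
      \<open>r = m / 9216\<close> supplies the remaining power of \<open>m\<close>.\<close>
    have le: "K * (cmod (amplitude T u x))\<^sup>2 \<le> m powr (- (2 * \<nu> + 1)) * density T u x" if "x \<in> {s..s + r}" for x
    proof -
      have "m powr (2 * \<nu> + 1) \<le> x powr (2 * \<nu> + 1)" using that s m nu_nonneg by (intro powr_mono2) auto
      then have "m powr (- (2 * \<nu> + 1)) * m powr (2 * \<nu> + 1) \<le> m powr (- (2 * \<nu> + 1)) * x powr (2 * \<nu> + 1)"
        by (intro mult_left_mono) auto
      moreover have "m powr (- (2 * \<nu> + 1)) * m powr (2 * \<nu> + 1) = 1" using m by (simp flip: powr_add)
      ultimately have "1 * (K * (cmod (amplitude T u x))\<^sup>2) \<le> m powr (- (2 * \<nu> + 1)) * x powr (2 * \<nu> + 1) * (K * (cmod (amplitude T u x))\<^sup>2)"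
        using K by (intro mult_right_mono) auto
      then show ?thesis by (simp add: density_def K_def mult_ac)
    qed
    have si: "density T u integrable_on {s..s + r}" using s m by (intro density_integrable_Icc u T) auto
    have "K * I = integral {s..s + r} (\<lambda>x. K * (cmod (amplitude T u x))\<^sup>2)" by (simp add: I_def)
    also have "\<dots> \<le> integral {s..s + r} (\<lambda>x. m powr (- (2 * \<nu> + 1)) * density T u x)"
      by (intro integral_le integrable_on_mult_right ai si le)
    also have "\<dots> = m powr (- (2 * \<nu> + 1)) * integral {s..s + r} (density T u)" by simp
    also have "\<dots> \<le> m powr (- (2 * \<nu> + 1)) * UB"
      unfolding UB_def using s b density_nonneg
      by (intro mult_left_mono integral_subset_le si density_integrable_Icc u T) auto
    finally have "K * I / r \<le> m powr (- (2 * \<nu> + 1)) * UB / r"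
      using r by (intro divide_right_mono) auto
    also have "\<dots> = 9216 * (m powr (- (2 * \<nu> + 1)) * m powr (- 1)) * UB"
    proof -
      have "m powr (- 1) = 1 / m" using m by (simp add: powr_minus_divide)
      then show ?thesis by (simp add: rm)
    qed
    also have "m powr (- (2 * \<nu> + 1)) * m powr (- 1) = m powr (- q)"
      unfolding powr_add[symmetric] q_def by (rule arg_cong[of _ _ "\<lambda>c. m powr c"]) simp
    also have "9216 * m powr (- q) * UB \<le> D * UB"
      unfolding D_def using smallness_const_ge(2) UB by (intro mult_right_mono) auto
    finally show ?thesis by simp
  qed
  have KS: "K * S \<le> D * (UB powr \<tau> * X powr (1 - \<tau>))"
  proof -
    have split: "c = c powr (1 - \<tau>) * c powr \<tau>" if "c \<ge> 0" for c :: real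
      using that by (simp flip: powr_add)
    \<comment> \<open>\<open>K\<close> is split to turn both factors of \<open>S\<close> into the
      quantities estimated in \<open>KM\<close> and \<open>KI\<close>; the two powers of
      \<open>D\<close> then recombine.\<close>
    have "K * S = (K powr (1 - \<tau>) * K powr \<tau>) * S" using split[OF K] by simp
    also have "\<dots> = (K * (2401 * M)\<^sup>2) powr (1 - \<tau>) * (K * (I / r)) powr \<tau>"
      unfolding S_def powr_mult by (simp only: mult_ac)
    also have "\<dots> \<le> (D * X) powr (1 - \<tau>) * (D * UB) powr \<tau>"
      using \<tau>0 \<tau>1 K I r by (intro mult_mono powr_mono2 KM KI) auto
    also have "\<dots> = (D powr (1 - \<tau>) * D powr \<tau>) * (UB powr \<tau> * X powr (1 - \<tau>))"
      unfolding powr_mult by (simp only: mult_ac)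
    also have "D powr (1 - \<tau>) * D powr \<tau> = D" using split[of D] D by simp
    finally show ?thesis .
  qed
  have "integral {a1..a2} (density T u) \<le> integral {a1..a2} (\<lambda>x. (K * S) * x powr (2 * \<nu> + 1))"
  proof (rule integral_le)
    show "density T u integrable_on {a1..a2}" by (intro density_integrable_Icc u T a)
    show "(\<lambda>x. (K * S) * x powr (2 * \<nu> + 1)) integrable_on {a1..a2}"
      using a by (intro integrable_on_mult_right powr_integrable_Icc) auto
    fix x assume "x \<in> {a1..a2}"
    then have "K * (x powr (2 * \<nu> + 1) * (cmod (amplitude T u x))\<^sup>2) \<le> K * (x powr (2 * \<nu> + 1) * S)"
      by (intro mult_left_mono point K) auto
    then show "density T u x \<le> (K * S) * x powr (2 * \<nu> + 1)"
      by (simp add: density_def K_def mult_ac)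
  qed
  also have "\<dots> = (K * S) * ((a2 powr q - a1 powr q) / q)"
    using a integral_powr_Icc[of a1 a2] by (simp add: q_def)
  also have "\<dots> \<le> (D * (UB powr \<tau> * X powr (1 - \<tau>))) * ((a2 powr q - a1 powr q) / q)"
    using a q by (intro mult_right_mono KS divide_nonneg_pos) (auto intro: powr_mono2)
  also have "\<dots> = (a2 powr q - a1 powr q) / q * (D * (UB powr \<tau> * X powr (1 - \<tau>)))"
    by (rule mult.commute)
  finally show ?thesis unfolding q_def D_def UB_def .
qed

end

theorem theorem1p3:
  fixes \<nu> :: real
  assumes "\<nu> \<ge> 0"
  shows "\<exists>C \<theta> :: real. C > 0 \<and> 0 < \<theta> \<and> \<theta> < 1 \<and>
    (\<forall>(a\<^sub>1::real) (a\<^sub>2::real) (b\<^sub>1::real) (b\<^sub>2::real) (lam::real) (T::real) (u\<^sub>0 :: real \<Rightarrow> complex).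
      0 \<le> a\<^sub>1 \<and> a\<^sub>1 < a\<^sub>2 \<and> 0 \<le> b\<^sub>1 \<and> b\<^sub>1 < b\<^sub>2 \<and> lam > 0 \<and> T > 0 \<and> u\<^sub>0 \<in> Cc_inf \<longrightarrow>
      (let a = a\<^sub>2 - a\<^sub>1; b = b\<^sub>2 - b\<^sub>1;
           x\<^sub>0 = (a\<^sub>1 + a\<^sub>2) / 2; x\<^sub>1 = (b\<^sub>1 + b\<^sub>2) / 2;
           p = 1 + (\<bar>x\<^sub>0 - x\<^sub>1\<bar> + a / 2 + b / 2) / min (lam * T) (b / 2)
       in (LINT x:{a\<^sub>1..a\<^sub>2}|half_line. (cmod (schroedinger_solution \<nu> x T u\<^sub>0))\<^sup>2)
          \<le> C * (a\<^sub>2 powr (2 * \<nu> + 2) - a\<^sub>1 powr (2 * \<nu> + 2))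
              * (min (lam * T) b) powr (- (2 * \<nu> + 2))
              * (LINT x:{b\<^sub>1..b\<^sub>2}|half_line. (cmod (schroedinger_solution \<nu> x T u\<^sub>0))\<^sup>2) powr (\<theta> powr p)
              * (LINT x|half_line. exp (lam * x) * (cmod (u\<^sub>0 x))\<^sup>2) powr (1 - \<theta> powr p)))"
proof -
  interpret bessel \<nu> by unfold_locales (rule assms)
  define q where "q = 2 * \<nu> + 2"
  have q: "q > 0" using assms by (simp add: q_def)
  \<comment> \<open>The factor \<open>1 / q\<close> comes from integrating the weight over A, and
    \<open>2 powr q\<close> from replacing min(\<lambda> T, b/2) by the smaller min(\<lambda> T,
    b)/2.\<close>
  define C where "C = smallness_const * 2 powr q / q"
  \<comment> \<open>At most \<open>9216 * p\<close> halvings are made, and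
    \<open>\<theta> powr p = (1/2) powr (9216 * p)\<close>.\<close>
  define \<theta> :: real where "\<theta> = (1/2) powr 9216"
  have sc: "smallness_const > 0" using smallness_const_ge(2) by linarith
  have \<theta>0: "0 < \<theta>" unfolding \<theta>_def by (rule powr_gt_zero[THEN iffD2]) simp
  have \<theta>1: "\<theta> < 1" unfolding \<theta>_def by (rule powr01_less_one[THEN iffD2]) simp_all
  have C: "C > 0" unfolding C_def using q sc by simp
  show ?thesis
  proof (rule exI[of _ C], rule exI[of _ \<theta>], intro conjI allI impI C \<theta>0 \<theta>1)
    fix a1 a2 b1 b2 l T :: real and u
    assume "0 \<le> a1 \<and> a1 < a2 \<and> 0 \<le> b1 \<and> b1 < b2 \<and> l > 0 \<and> T > 0 \<and> u \<in> Cc_inf"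
    then have a: "0 \<le> a1" "a1 < a2" and b: "0 \<le> b1" "b1 < b2" and l: "l > 0" and T: "T > 0" and u: "u \<in> Cc_inf"
      by auto
    define m where "m = min (l * T) ((b2 - b1) / 2)"
    define p where "p = 1 + (\<bar>(a1 + a2) / 2 - (b1 + b2) / 2\<bar> + (a2 - a1) / 2 + (b2 - b1) / 2) / m"
    define Y where "Y = integral {b1..b2} (density T u) powr (\<theta> powr p) * (LINT x|half_line. exp (l * x) * (cmod (u x))\<^sup>2) powr (1 - \<theta> powr p)"
    define A where "A = a2 powr q - a1 powr q"
    have A: "A \<ge> 0" unfolding A_def using a q by (simp add: powr_mono2)
    have \<theta>p: "\<theta> powr p = (1/2) powr (9216 * p)" unfolding \<theta>_def by (rule powr_powr)
    have "integral {a1..a2} (density T u) \<le> A / q * ((smallness_const * m powr (- q)) * Y)"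
      using mass_estimate[OF a b l T u p_def[unfolded m_def] \<theta>p] unfolding A_def q_def Y_def m_def .
    also have "\<dots> \<le> A / q * ((smallness_const * (2 powr q * (min (l * T) (b2 - b1)) powr (- q))) * Y)"
    proof (intro mult_left_mono mult_right_mono)
      have "m powr (- q) \<le> (min (l * T) (b2 - b1) / 2) powr (- q)"
      proof (rule powr_mono2')
        have "min c e / 2 \<le> min c (e / 2)" if "c > 0" "e > 0" for c e :: real
          using that by (auto simp: min_def)
        then show "min (l * T) (b2 - b1) / 2 \<le> m" unfolding m_def using l T b by simp
        show "0 < min (l * T) (b2 - b1) / 2" using l T b by simp
      qed (use q in auto)
      also have "\<dots> = 2 powr q * (min (l * T) (b2 - b1)) powr (- q)"
        by (simp add: powr_divide powr_minus field_simps)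
      finally show "m powr (- q) \<le> 2 powr q * (min (l * T) (b2 - b1)) powr (- q)" .
    qed (use A q sc in \<open>auto simp: Y_def\<close>)
    also have "\<dots> = C * A * (min (l * T) (b2 - b1)) powr (- q) * Y"
      by (simp add: C_def)
    finally show "let a = a2 - a1; b = b2 - b1; x\<^sub>0 = (a1 + a2) / 2; x\<^sub>1 = (b1 + b2) / 2;
           p = 1 + (\<bar>x\<^sub>0 - x\<^sub>1\<bar> + a / 2 + b / 2) / min (l * T) (b / 2)
       in (LINT x:{a1..a2}|half_line. (cmod (schroedinger_solution \<nu> x T u))\<^sup>2)
          \<le> C * (a2 powr (2 * \<nu> + 2) - a1 powr (2 * \<nu> + 2))
              * (min (l * T) b) powr (- (2 * \<nu> + 2))
              * (LINT x:{b1..b2}|half_line. (cmod (schroedinger_solution \<nu> x T u))\<^sup>2) powr (\<theta> powr p)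
              * (LINT x|half_line. exp (l * x) * (cmod (u x))\<^sup>2) powr (1 - \<theta> powr p)"
      unfolding Let_def mass_Icc[OF u T a(1) less_imp_le[OF a(2)]] mass_Icc[OF u T b(1) less_imp_le[OF b(2)]]
        A_def q_def Y_def p_def m_def by (simp only: mult.assoc)
  qed
qed

end
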